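(* Suppose $S\in C\left([0,T_{max});L^2_{st}\right)$ is a mild solution to the strain self-amplification model equation $\partial_tS-\Delta S+\frac23P_{st}\left(S^2\right)=0$ on $\mathbb{R}^3$. Then for all $0<t<T_{max}$, $$\frac{d}{dt}\|S(\cdot,t)\|_{L^2}^2=-2\|S\|_{\dot H^1}^2-\frac43\int_{\mathbb{R}^3}\operatorname{tr}\left(S^3\right)=-2\|S\|_{\dot H^1}^2-4\int_{\mathbb{R}^3}\det(S),$$ where the right-hand sides are evaluated at time $t$.
   Context: All function spaces are over $\mathbb{R}^3$. $\mathbb{S}^{3\times3}$ is the space of real symmetric $3\times3$ matrices with the Frobenius inner product; $L^2$ norms of matrix fields use it. $\|f\|_{\dot H^s}=\|(2\pi|\xi|)^s\hat f\|_{L^2}$. $(\nabla_{sym}u)_{ij}=\frac12(\partial_iu_j+\partial_ju_i)$. $L^2_{st}=\{\nabla_{sym}u:u\in\dot H^1(\mathbb{R}^3;\mathbb{R}^3),\ \nabla\cdot u=0\}$. $P_{st}$ is the orthogonal projection of $L^2(\mathbb{R}^3;\mathbb{S}^{3\times3})$ onto $L^2_{st}$ (a Fourier multiplier operator, commuting with $e^{\tau\Delta}$; $e^{\tau\Delta}P_{st}F$ is understood as $P_{st}e^{\tau\Delta}F$ when $F\in L^1$). $S\in C([0,T_{max});L^2_{st})$ is a mild solution of the strain self-amplification model equation if for all $0<t<T_{max}$, $S(t)=e^{t\Delta}S^0-\frac23\int_0^te^{\tau\Delta}P_{st}\left(S^2\right)(t-\tau)\,d\tau$, where $S^0=S(\cdot,0)$,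 $S^2$ is the matrix square and $e^{t\Delta}$ is convolution with the heat kernel $G(x,t)=(4\pi t)^{-3/2}e^{-|x|^2/(4t)}$. $T_{max}\in(0,+\infty]$ is the maximal time of existence of the mild solution. *)

theory Defs
  imports "HOL-Analysis.Analysis"
begin

section \<open>Square-integrable fields on three-dimensional space\<close>

text \<open>
  Only Borel measurable representatives are used; every Lebesgue class contains one.
\<close>

definition square_integrable :: "(real^3 \<Rightarrow> 'a::euclidean_space) \<Rightarrow> bool" where
  "square_integrable f \<longleftrightarrow>
     f \<in> borel_measurable lborel \<and> integrable lborel (\<lambda>x. (norm (f x))\<^sup>2)"

definition L2_rel :: "(real^3 \<Rightarrow> 'a::euclidean_space) \<Rightarrow> (real^3 \<Rightarrow> 'a) \<Rightarrow> bool" where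
  "L2_rel f g \<longleftrightarrow> square_integrable f \<and> square_integrable g \<and> (AE x in lborel. f x = g x)"

lemma square_integrable_zero: "square_integrable (\<lambda>x. 0)"
  by (simp add: square_integrable_def)

lemma square_integrable_add:
  assumes "square_integrable f" "square_integrable g"
  shows "square_integrable (\<lambda>x. f x + g x)"
proof -
  have [measurable]: "f \<in> borel_measurable lborel" "g \<in> borel_measurable lborel"
    using assms by (auto simp: square_integrable_def)
  have "integrable lborel (\<lambda>x. 2 * (norm (f x))\<^sup>2 + 2 * (norm (g x))\<^sup>2)"
    using assms by (auto simp: square_integrable_def)
  then have "integrable lborel (\<lambda>x. (norm (f x + g x))\<^sup>2)"
  proof (rule Bochner_Integration.integrable_bound)
    show "AE x in lborel. norm ((norm (f x + g x))\<^sup>2)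
        \<le> norm (2 * (norm (f x))\<^sup>2 + 2 * (norm (g x))\<^sup>2)"
    proof (rule AE_I2)
      fix x
      have "(norm (f x + g x))\<^sup>2 \<le> (norm (f x) + norm (g x))\<^sup>2"
        by (intro power_mono norm_triangle_ineq norm_ge_zero)
      also have "\<dots> \<le> 2 * (norm (f x))\<^sup>2 + 2 * (norm (g x))\<^sup>2"
        using sum_squares_bound[of "norm (f x)" "norm (g x)"] by (simp add: power2_sum)
      finally show "norm ((norm (f x + g x))\<^sup>2)
        \<le> norm (2 * (norm (f x))\<^sup>2 + 2 * (norm (g x))\<^sup>2)" by simp
    qed
  qed measurable
  then show ?thesis by (simp add: square_integrable_def)
qed

lemma square_integrable_scaleR:
  assumes "square_integrable f"
  shows "square_integrable (\<lambda>x. c *\<^sub>R f x)"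
  using assms by (auto simp: square_integrable_def power_mult_distrib)

lemma square_integrable_uminus:
  "square_integrable f \<Longrightarrow> square_integrable (\<lambda>x. - f x)"
  by (auto simp: square_integrable_def)

lemma square_integrable_inner:
  assumes "square_integrable f" "square_integrable g"
  shows "integrable lborel (\<lambda>x. f x \<bullet> g x)"
proof -
  have [measurable]: "f \<in> borel_measurable lborel" "g \<in> borel_measurable lborel"
    using assms by (auto simp: square_integrable_def)
  have "integrable lborel (\<lambda>x. (norm (f x))\<^sup>2 + (norm (g x))\<^sup>2)"
    using assms by (auto simp: square_integrable_def)
  then show ?thesis
  proof (rule Bochner_Integration.integrable_bound)
    show "AE x in lborel. norm (f x \<bullet> g x) \<le> norm ((norm (f x))\<^sup>2 + (norm (g x))\<^sup>2)"
    proof (rule AE_I2)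
      fix x
      have "\<bar>f x \<bullet> g x\<bar> \<le> norm (f x) * norm (g x)"
        by (rule Cauchy_Schwarz_ineq2)
      moreover have "2 * norm (f x) * norm (g x) \<le> (norm (f x))\<^sup>2 + (norm (g x))\<^sup>2"
        by (rule sum_squares_bound)
      moreover have "0 \<le> norm (f x) * norm (g x)" by simp
      ultimately show "norm (f x \<bullet> g x) \<le> norm ((norm (f x))\<^sup>2 + (norm (g x))\<^sup>2)"
        by simp
    qed
  qed measurable
qed

quotient_type (overloaded) 'a L2 = "real^3 \<Rightarrow> 'a::euclidean_space" / partial: L2_rel
proof (rule part_equivpI)
  show "\<exists>f::real^3 \<Rightarrow> 'a. L2_rel f f"
    using square_integrable_zero by (auto simp: L2_rel_def)
  show "symp (L2_rel :: (real^3 \<Rightarrow> 'a) \<Rightarrow> _)"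
    by (auto simp: symp_def L2_rel_def elim: AE_mp)
  show "transp (L2_rel :: (real^3 \<Rightarrow> 'a) \<Rightarrow> _)"
    unfolding transp_def L2_rel_def by (auto elim: AE_mp)
qed

instantiation L2 :: (euclidean_space) real_inner
begin

lift_definition zero_L2 :: "'a L2" is "\<lambda>x. 0"
  by (simp add: L2_rel_def square_integrable_zero)

lift_definition plus_L2 :: "'a L2 \<Rightarrow> 'a L2 \<Rightarrow> 'a L2" is "\<lambda>f g x. f x + g x"
  by (auto simp: L2_rel_def intro: square_integrable_add)

lift_definition uminus_L2 :: "'a L2 \<Rightarrow> 'a L2" is "\<lambda>f x. - f x"
  by (auto simp: L2_rel_def intro: square_integrable_uminus)

definition minus_L2 :: "'a L2 \<Rightarrow> 'a L2 \<Rightarrow> 'a L2" where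
  "minus_L2 F G = F + (- G)"

lift_definition scaleR_L2 :: "real \<Rightarrow> 'a L2 \<Rightarrow> 'a L2" is "\<lambda>c f x. c *\<^sub>R f x"
  by (auto simp: L2_rel_def intro: square_integrable_scaleR)

lift_definition inner_L2 :: "'a L2 \<Rightarrow> 'a L2 \<Rightarrow> real" is "\<lambda>f g. \<integral>x. f x \<bullet> g x \<partial>lborel"
  unfolding L2_rel_def square_integrable_def
  by (rule integral_cong_AE) auto

definition norm_L2 :: "'a L2 \<Rightarrow> real" where
  "norm_L2 F = sqrt (F \<bullet> F)"

definition dist_L2 :: "'a L2 \<Rightarrow> 'a L2 \<Rightarrow> real" where
  "dist_L2 F G = norm (F - G)"

definition sgn_L2 :: "'a L2 \<Rightarrow> 'a L2" where
  "sgn_L2 F = inverse (norm F) *\<^sub>R F"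

definition uniformity_L2 :: "('a L2 \<times> 'a L2) filter" where
  "uniformity_L2 = (INF e\<in>{0 <..}. principal {(x, y). dist x y < e})"

definition open_L2 :: "'a L2 set \<Rightarrow> bool" where
  "open_L2 U \<longleftrightarrow> (\<forall>x\<in>U. eventually (\<lambda>(x', y). x' = x \<longrightarrow> y \<in> U) uniformity)"

instance
proof
  fix F G H :: "'a L2" and a b :: real and U :: "'a L2 set"
  show "F + G + H = F + (G + H)"
    by transfer (auto simp: L2_rel_def add.assoc intro!: square_integrable_add)
  show "F + G = G + F"
    by transfer (auto simp: L2_rel_def add.commute intro!: square_integrable_add)
  show "0 + F = F" by transfer (auto simp: L2_rel_def)
  show "- F + F = 0"
    by transfer (auto simp: L2_rel_def square_integrable_zero)
  show "F - G = F + - G" by (rule minus_L2_def)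
  show "a *\<^sub>R (F + G) = a *\<^sub>R F + a *\<^sub>R G"
    by transfer (auto simp: L2_rel_def scaleR_add_right
        intro!: square_integrable_add square_integrable_scaleR)
  show "(a + b) *\<^sub>R F = a *\<^sub>R F + b *\<^sub>R F"
    by transfer (auto simp: L2_rel_def scaleR_add_left
        intro!: square_integrable_add square_integrable_scaleR)
  show "a *\<^sub>R b *\<^sub>R F = (a * b) *\<^sub>R F"
    by transfer (auto simp: L2_rel_def intro!: square_integrable_scaleR)
  show "1 *\<^sub>R F = F" by transfer (auto simp: L2_rel_def)
  show "dist F G = norm (F - G)" by (rule dist_L2_def)
  show "sgn F = inverse (norm F) *\<^sub>R F" by (rule sgn_L2_def)
  show "uniformity = (INF e\<in>{0 <..}. principal {(x, y :: 'a L2). dist x y < e})"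
    by (rule uniformity_L2_def)
  show "open U \<longleftrightarrow> (\<forall>x\<in>U. \<forall>\<^sub>F (x', y) in uniformity. x' = x \<longrightarrow> y \<in> U)"
    by (rule open_L2_def)
  show "F \<bullet> G = G \<bullet> F" by transfer (simp add: inner_commute)
  show "(F + G) \<bullet> H = F \<bullet> H + G \<bullet> H"
    by transfer (simp add: L2_rel_def inner_add_left square_integrable_inner)
  show "a *\<^sub>R F \<bullet> G = a * (F \<bullet> G)" by transfer simp
  show "0 \<le> F \<bullet> F" by transfer simp
  show "F \<bullet> F = 0 \<longleftrightarrow> F = 0"
  proof transfer
    fix f :: "real^3 \<Rightarrow> 'a"
    assume "L2_rel f f"
    then have f: "square_integrable f" by (simp add: L2_rel_def)
    have "(\<integral>x. f x \<bullet> f x \<partial>lborel) = 0 \<longleftrightarrow> (AE x in lborel. f x \<bullet> f x = 0)"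
      by (rule integral_nonneg_eq_0_iff_AE[OF square_integrable_inner[OF f f]]) simp
    then show "(\<integral>x. f x \<bullet> f x \<partial>lborel) = 0 \<longleftrightarrow> L2_rel f (\<lambda>x. 0)"
      using f by (simp add: L2_rel_def square_integrable_zero)
  qed
  show "norm F = sqrt (F \<bullet> F)" by (rule norm_L2_def)
qed

end


section \<open>Tempered functions and their Fourier transforms\<close>

definition partial_deriv :: "3 \<Rightarrow> (real^3 \<Rightarrow> complex) \<Rightarrow> real^3 \<Rightarrow> complex" where
  "partial_deriv i f x = frechet_derivative f (at x) (axis i 1)"

definition schwartz :: "(real^3 \<Rightarrow> complex) set" where
  "schwartz = {\<phi>. \<forall>is. (\<forall>x. foldr partial_deriv is \<phi> differentiable at x) \<and>
     (\<forall>k::nat. \<exists>C. \<forall>x. (1 + norm x) ^ k * norm (foldr partial_deriv is \<phi> x) \<le> C)}"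

definition fourier_integral :: "(real^3 \<Rightarrow> complex) \<Rightarrow> real^3 \<Rightarrow> complex" where
  "fourier_integral \<phi> \<xi> = (\<integral>x. cis (- 2 * pi * (x \<bullet> \<xi>)) * \<phi> x \<partial>lborel)"

text \<open>Functions that act on Schwartz functions by integration, as tempered distributions.\<close>

definition tempered :: "(real^3 \<Rightarrow> complex) \<Rightarrow> bool" where
  "tempered f \<longleftrightarrow> f \<in> borel_measurable lborel \<and>
     (\<forall>\<phi>\<in>schwartz. integrable lborel (\<lambda>x. f x * \<phi> x))"

text \<open>
  \<open>g\<close> is the Fourier transform of \<open>f\<close> in the sense of tempered distributions; for
  integrable or square-integrable \<open>f\<close> this is the classical, respectively the Plancherel,
  transform.
\<close>

definition has_fourier_transform :: "(real^3 \<Rightarrow> complex) \<Rightarrow> (real^3 \<Rightarrow> complex) \<Rightarrow> bool" where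
  "has_fourier_transform f g \<longleftrightarrow> tempered f \<and> tempered g \<and>
     (\<forall>\<phi>\<in>schwartz. (\<integral>x. f x * fourier_integral \<phi> x \<partial>lborel) = (\<integral>\<xi>. g \<xi> * \<phi> \<xi> \<partial>lborel))"

definition fourier :: "(real^3 \<Rightarrow> complex) \<Rightarrow> real^3 \<Rightarrow> complex" where
  "fourier f = (SOME g. has_fourier_transform f g)"

definition component :: "'a::euclidean_space \<Rightarrow> (real^3 \<Rightarrow> 'a) \<Rightarrow> real^3 \<Rightarrow> complex" where
  "component b f x = complex_of_real (f x \<bullet> b)"

text \<open>
  The homogeneous Sobolev space consists of tempered distributions whose Fourier transform is
  a function, with finite seminorm. For \<open>0 \<le> s < 3/2\<close> (below: \<open>s = 1\<close>) all of these
  distributions are functions, so nothing is lost by taking functions as its elements.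
\<close>

definition Hdot :: "real \<Rightarrow> (real^3 \<Rightarrow> 'a::euclidean_space) set" where
  "Hdot s = {f. \<forall>b\<in>Basis. (\<exists>g. has_fourier_transform (component b f) g) \<and>
     integrable lborel (\<lambda>\<xi>. ((2 * pi * norm \<xi>) powr s * norm (fourier (component b f) \<xi>))\<^sup>2)}"

definition Hdot_norm :: "real \<Rightarrow> (real^3 \<Rightarrow> 'a::euclidean_space) \<Rightarrow> real" where
  "Hdot_norm s f = sqrt (\<Sum>b\<in>Basis.
     \<integral>\<xi>. ((2 * pi * norm \<xi>) powr s * norm (fourier (component b f) \<xi>))\<^sup>2 \<partial>lborel)"


section \<open>Strain matrices\<close>

definition has_distributional_deriv ::
    "3 \<Rightarrow> (real^3 \<Rightarrow> complex) \<Rightarrow> (real^3 \<Rightarrow> complex) \<Rightarrow> bool" where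
  "has_distributional_deriv i f g \<longleftrightarrow> tempered f \<and> tempered g \<and>
     (\<forall>\<phi>\<in>schwartz. (\<integral>x. f x * partial_deriv i \<phi> x \<partial>lborel) = - (\<integral>x. g x * \<phi> x \<partial>lborel))"

text \<open>Index convention: \<open>D x $ i $ j\<close> is the \<open>i\<close>-th partial derivative of \<open>u x $ j\<close>.\<close>

definition has_gradient :: "(real^3 \<Rightarrow> real^3) \<Rightarrow> (real^3 \<Rightarrow> real^3^3) \<Rightarrow> bool" where
  "has_gradient u D \<longleftrightarrow> (\<forall>i j. has_distributional_deriv i
     (\<lambda>x. complex_of_real (u x $ j)) (\<lambda>x. complex_of_real (D x $ i $ j)))"

definition L2_st :: "(real^3^3) L2 set" where
  "L2_st = {S. \<exists>u D. u \<in> Hdot 1 \<and> has_gradient u D \<and>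
     (AE x in lborel. (\<Sum>i\<in>UNIV. D x $ i $ i) = 0) \<and>
     (AE x in lborel. rep_L2 S x = (\<chi> i j. (D x $ i $ j + D x $ j $ i) / 2))}"

text \<open>
  The projection is defined on all square-integrable matrix fields. Since \<open>L2_st\<close> consists of
  symmetric fields, its restriction to symmetric fields is their orthogonal projection
  onto \<open>L2_st\<close>.
\<close>

definition P_st :: "(real^3^3) L2 \<Rightarrow> (real^3^3) L2" where
  "P_st F = (THE G. G \<in> L2_st \<and> (\<forall>H\<in>L2_st. (F - G) \<bullet> H = 0))"


section \<open>Mild solutions\<close>

definition heat_kernel :: "real^3 \<Rightarrow> real \<Rightarrow> real" where
  "heat_kernel x t = (4 * pi * t) powr (- 3 / 2) * exp (- (norm x)\<^sup>2 / (4 * t))"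

text \<open>
  Convolution with the heat kernel maps integrable and square-integrable fields to
  square-integrable fields for \<open>t > 0\<close>.
\<close>

definition heat :: "real \<Rightarrow> (real^3 \<Rightarrow> 'a::euclidean_space) \<Rightarrow> 'a L2" where
  "heat t f = abs_L2 (\<lambda>x. \<integral>y. heat_kernel (x - y) t *\<^sub>R f y \<partial>lborel)"

definition matrix_square :: "(real^3^3) L2 \<Rightarrow> real^3 \<Rightarrow> real^3^3" where
  "matrix_square S x = rep_L2 S x ** rep_L2 S x"

text \<open>
  The integrand of the Duhamel term is continuous into the space of square-integrable fields
  for \<open>0 < \<tau> \<le> t\<close> and is \<open>O(\<tau> powr (-3/4))\<close> in norm, so its Bochner integral exists and is
  the (Henstock-Kurzweil) integral used here; the value of the integrand at \<open>\<tau> = 0\<close> plays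
  no role.
\<close>

definition mild_solution :: "ereal \<Rightarrow> (real \<Rightarrow> (real^3^3) L2) \<Rightarrow> bool" where
  "mild_solution T S \<longleftrightarrow> 0 < T \<and>
     continuous_on {t. 0 \<le> t \<and> ereal t < T} S \<and>
     (\<forall>t. 0 \<le> t \<and> ereal t < T \<longrightarrow> S t \<in> L2_st) \<and>
     (\<forall>t. 0 < t \<and> ereal t < T \<longrightarrow>
        (\<lambda>\<tau>. P_st (heat \<tau> (matrix_square (S (t - \<tau>))))) integrable_on {0..t} \<and>
        S t = heat t (rep_L2 (S 0))
          - (2 / 3) *\<^sub>R integral {0..t} (\<lambda>\<tau>. P_st (heat \<tau> (matrix_square (S (t - \<tau>))))))"

definition max_existence_time :: "(real^3^3) L2 \<Rightarrow> ereal" where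
  "max_existence_time S0 = Sup {T. \<exists>S. mild_solution T S \<and> S 0 = S0}"

end

theory Submission
  imports Defs "HOL-Probability.Probability"
begin


text \<open>
  On the Fourier side the mild formulation becomes, for every single frequency \<open>\<xi>\<close>, the ordinary
  differential equation \<open>A' = - 4 \<pi>\<^sup>2 |\<xi>|\<^sup>2 A - 2/3 N\<close>, where \<open>N\<close> is the transform of \<open>S\<^sup>2\<close>, projected
  pointwise by the symbol of \<open>P_st\<close>. The transform of \<open>S\<^sup>2\<close> is bounded by the convolution of \<open>|A|\<close>
  with itself, so a submultiplicative weight \<open>(1 + |\<xi>|)\<^sup>s\<close> passes from \<open>A\<close> to \<open>N\<close>, and
  integrating the equation from a positive time gains the factor \<open>|\<xi>|\<^sup>-\<^sup>2\<close>. Three rounds with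
  exponents \<open>0, 2/5, 4/5\<close> give an integrable majorant of \<open>A\<close>, uniform on compact time
  intervals, whose product with \<open>|\<xi>|\<close> is square integrable. By dominated convergence the energy
  \<open>\<integral>|A|\<^sup>2\<close> may then be differentiated under the integral, and since \<open>A\<close> lies in the range of the
  projection, \<open>\<integral> A \<bullet> N\<close> is the transform side of \<open>\<integral> tr S\<^sup>3\<close>. For trace-free matrices
  \<open>tr S\<^sup>3 = 3 det S\<close>.
\<close>

section \<open>Integration on Euclidean space\<close>

text \<open>For a solution that is merely continuous in L2, the square lies in L1 and the cube need
  not be integrable. Neither term on the right is defined beforehand and the equation cannot be
  paired with the solution directly, so smoothing has to precede the energy identity. The heat
  factor on the starting field smooths only after a positive time, hence every round restarts later
  than the one before. A round may gain any exponent below 1/2: \<open>2 - gain\<close> must exceed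
  3/2, the threshold for square integrability of a power in dimension 3. An integrable majorant
  needs a total gain above 1, since its decay is 2 more and must exceed 3. Two rounds fall short;
  three gains of 2/5 reach 6/5. The mild formulation is an identity between classes with a
  vector-valued integral. To have an equation at every frequency, a representative of the transform
  is written down first and then shown, by testing with Gaussians, to be a transform of the
  solution. Gaussians serve here because they are Schwartz functions with explicit transforms and
  separate functions.\<close>

lemma borel_measurable_cis [measurable (raw)]:
  "f \<in> borel_measurable M \<Longrightarrow> (\<lambda>x. cis (f x)) \<in> borel_measurable M"
  by (rule measurable_compose[of f M borel cis])
     (auto intro!: borel_measurable_continuous_onI continuous_intros)

lemma lborel_distr_reflect:
  fixes c :: "'a::euclidean_space"
  shows "distr lborel borel (\<lambda>x. c - x) = lborel"
proof -
  have "lborel = density (distr lborel borel (\<lambda>x. c + (-1) *\<^sub>R x)) (\<lambda>_. \<bar>-1::real\<bar> ^ DIM('a))"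
    by (rule lborel_affine) simp
  then show ?thesis by (simp add: density_1)
qed

lemma
  fixes f :: "'a::euclidean_space \<Rightarrow> 'b::{banach, second_countable_topology}"
  assumes [measurable]: "f \<in> borel_measurable borel"
  shows integral_translate: "(\<integral>x. f (c + x) \<partial>lborel) = (\<integral>x. f x \<partial>lborel)"
    and integral_reflect_lborel: "(\<integral>x. f (c - x) \<partial>lborel) = (\<integral>x. f x \<partial>lborel)"
    and integrable_translate: "integrable lborel (\<lambda>x. f (c + x)) \<longleftrightarrow> integrable lborel f"
    and integrable_reflect: "integrable lborel (\<lambda>x. f (c - x)) \<longleftrightarrow> integrable lborel f"
  using integral_distr[of "\<lambda>x. c + x" lborel borel f] integral_distr[of "\<lambda>x. c - x" lborel borel f]
    integrable_distr_eq[of "\<lambda>x. c + x" lborel borel f] integrable_distr_eq[of "\<lambda>x. c - x" lborel borel f]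
  by (simp_all add: lborel_distr_plus lborel_distr_reflect)

lemma
  fixes f :: "'a::euclidean_space \<Rightarrow> ennreal"
  assumes [measurable]: "f \<in> borel_measurable borel"
  shows nn_integral_translate: "(\<integral>\<^sup>+x. f (c + x) \<partial>lborel) = (\<integral>\<^sup>+x. f x \<partial>lborel)"
    and nn_integral_reflect: "(\<integral>\<^sup>+x. f (c - x) \<partial>lborel) = (\<integral>\<^sup>+x. f x \<partial>lborel)"
  using nn_integral_distr[of "\<lambda>x. c + x" lborel borel f] nn_integral_distr[of "\<lambda>x. c - x" lborel borel f]
  by (simp_all add: lborel_distr_plus lborel_distr_reflect)

lemma AE_lborel_reflect:
  fixes c :: "'a::euclidean_space"
  assumes "AE x in lborel. P x" shows "AE x in lborel. P (c - x)"
proof (rule AE_distrD[of "(-) c" lborel borel P])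
  show "AE x in distr lborel borel ((-) c). P x" unfolding lborel_distr_reflect by (rule assms)
qed simp

text \<open>The form of domination behind the Fubini exchanges with a bounded oscillating factor:
  the majorant separates the variables, so its integrability is that of its factors.\<close>

lemma integrable_pair_bound:
  fixes F :: "'a::euclidean_space \<Rightarrow> 'b::euclidean_space \<Rightarrow> 'c::{banach, second_countable_topology}"
  assumes [measurable]: "case_prod F \<in> borel_measurable (lborel \<Otimes>\<^sub>M lborel)"
    and f: "integrable lborel f" and g: "integrable lborel g"
    and le: "\<And>x y. norm (F x y) \<le> f x * g y"
  shows "integrable (lborel \<Otimes>\<^sub>M lborel) (case_prod F)"
proof (rule Bochner_Integration.integrable_bound)
  have [measurable]: "f \<in> borel_measurable borel" "g \<in> borel_measurable borel" using f g by auto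
  show "integrable (lborel \<Otimes>\<^sub>M lborel) (\<lambda>(x, y). f x * g y)"
    using f g by (intro lborel_pair.Fubini_integrable) (auto simp: abs_mult)
  show "AE x in lborel \<Otimes>\<^sub>M lborel. norm (case_prod F x) \<le> norm (case x of (x, y) \<Rightarrow> f x * g y)"
    using le order_trans[OF _ abs_ge_self] by (auto intro!: AE_I2)
qed simp

text \<open>Integrating the majorant in \<open>y\<close> first leaves a constant multiple of
  \<open>f x\<close>, because reflection and translation preserve the integral of
  \<open>g\<close>.\<close>

lemma integrable_pair_bound_conv:
  fixes F :: "'a::euclidean_space \<Rightarrow> 'a \<Rightarrow> 'c::{banach, second_countable_topology}"
  assumes [measurable]: "case_prod F \<in> borel_measurable (lborel \<Otimes>\<^sub>M lborel)"
    and f: "integrable lborel f" and g: "integrable lborel g"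
    and le: "\<And>x y. norm (F x y) \<le> f x * g (x - y)"
  shows "integrable (lborel \<Otimes>\<^sub>M lborel) (case_prod F)"
proof (rule Bochner_Integration.integrable_bound)
  have [measurable]: "f \<in> borel_measurable borel" "g \<in> borel_measurable borel" using f g by auto
  show "integrable (lborel \<Otimes>\<^sub>M lborel) (\<lambda>(x, y). f x * g (x - y))"
    using f g
    by (intro lborel_pair.Fubini_integrable)
      (auto simp: abs_mult integrable_reflect integral_reflect_lborel[of "\<lambda>x. \<bar>g x\<bar>"])
  show "AE x in lborel \<Otimes>\<^sub>M lborel. norm (case_prod F x) \<le> norm (case x of (x, y) \<Rightarrow> f x * g (x - y))"
    using le order_trans[OF _ abs_ge_self] by (auto intro!: AE_I2)
qed simp

text \<open>Lebesgue measure is the image of a product measure under the coordinate map. This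
  reduces Gaussians and power weights in several variables to one real variable.\<close>

lemma
  fixes f :: "'a::euclidean_space \<Rightarrow> real \<Rightarrow> 'b::{real_normed_field, banach, second_countable_topology}"
  assumes f: "\<And>b. b \<in> Basis \<Longrightarrow> integrable lborel (f b)"
  shows integrable_lborel_prod: "integrable lborel (\<lambda>x. \<Prod>b\<in>Basis. f b (x \<bullet> b))"
    and integral_lborel_prod: "(\<integral>x. (\<Prod>b\<in>Basis. f b (x \<bullet> b)) \<partial>lborel) = (\<Prod>b\<in>Basis. \<integral>x. f b x \<partial>lborel)"
proof -
  interpret product_sigma_finite "\<lambda>_::'a. lborel :: real measure" ..
  let ?T = "\<lambda>f::'a\<Rightarrow>real. \<Sum>b\<in>Basis. f b *\<^sub>R b"
  let ?M = "\<Pi>\<^sub>M b\<in>(Basis::'a set). lborel"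
  have [measurable]: "b \<in> Basis \<Longrightarrow> f b \<in> borel_measurable borel" for b using f by auto
  have T[measurable]: "?T \<in> measurable ?M borel" by measurable
  have m: "(\<lambda>x. \<Prod>b\<in>Basis. f b (x \<bullet> b)) \<in> borel_measurable borel" by measurable
  have e: "(\<Prod>b\<in>Basis. f b (?T x \<bullet> b)) = (\<Prod>b\<in>Basis. f b (x b))" for x
    by (intro prod.cong) auto
  have i: "integrable ?M (\<lambda>x. \<Prod>b\<in>Basis. f b (x b))"
    using f by (intro product_integrable_prod) auto
  show "integrable lborel (\<lambda>x. \<Prod>b\<in>Basis. f b (x \<bullet> b))"
    by (subst lborel_eq, subst integrable_distr_eq[OF T m]) (use i in \<open>simp add: e\<close>)
  show "(\<integral>x. (\<Prod>b\<in>Basis. f b (x \<bullet> b)) \<partial>lborel) = (\<Prod>b\<in>Basis. \<integral>x. f b x \<partial>lborel)"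
    by (subst lborel_eq, subst integral_distr[OF T m])
       (simp add: e product_integral_prod[OF _ f])
qed

section \<open>Gaussians and their Fourier integrals\<close>

definition gauss :: "real \<Rightarrow> 'a::euclidean_space \<Rightarrow> 'a \<Rightarrow> complex" where
  "gauss a y x = of_real (exp (- a * (norm (x - y))\<^sup>2))"

lemma gauss_measurable [measurable]: "gauss a y \<in> borel_measurable borel"
  unfolding gauss_def[abs_def] by measurable

lemma norm_gauss: "norm (gauss a y x) = exp (- a * (norm (x - y))\<^sup>2)"
  by (simp add: gauss_def)

text \<open>This is the characteristic function of the standard normal law after scaling the
  variable by \<open>sqrt (2 * a)\<close>; the frequency becomes
  \<open>s / sqrt (2 * a)\<close>.\<close>

lemma gaussian_integral_1d:
  fixes a s :: real
  assumes a: "a > 0"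
  shows "has_bochner_integral lborel (\<lambda>t. cis (s * t) * of_real (exp (- a * t\<^sup>2)))
     (of_real (sqrt (pi / a) * exp (- s\<^sup>2 / (4 * a))))"
proof -
  let ?c = "sqrt (2 * a)"
  have c: "?c > 0" using a by simp
  let ?g = "\<lambda>t::real. std_normal_density t *\<^sub>R cis (s / ?c * t)"
  have ig: "integrable lborel ?g"
    by (rule Bochner_Integration.integrable_bound[OF integrable_normal_density[of 1 0]])
       (auto intro!: AE_I2 simp: abs_mult)
  have vg: "(\<integral>t. ?g t \<partial>lborel) = of_real (exp (- (s/?c)\<^sup>2 / 2))"
  proof -
    have "char std_normal_distribution (s/?c) = (\<integral>t. ?g t \<partial>lborel)"
      unfolding char_def
      by (subst integral_density) (auto simp: cis_conv_exp mult_ac)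
    then show ?thesis by (simp add: char_std_normal_distribution)
  qed
  have "has_bochner_integral lborel ?g (of_real (exp (- (s/?c)\<^sup>2 / 2)))"
    using ig vg by (simp add: has_bochner_integral_iff)
  then have "has_bochner_integral lborel (\<lambda>t. ?g (0 + ?c * t)) (of_real (exp (- (s/?c)\<^sup>2 / 2)) /\<^sub>R \<bar>?c\<bar>)"
    using c by (subst (asm) lborel_has_bochner_integral_real_affine_iff[of ?c _ _ 0]) auto
  then have *: "has_bochner_integral lborel (\<lambda>t. sqrt (2*pi) *\<^sub>R ?g (?c * t))
      (sqrt (2*pi) *\<^sub>R (of_real (exp (- (s/?c)\<^sup>2 / 2)) /\<^sub>R \<bar>?c\<bar>))"
    by (intro has_bochner_integral_scaleR_right) simp
  have 1: "sqrt (2*pi) *\<^sub>R ?g (?c * t) = cis (s * t) * of_real (exp (- a * t\<^sup>2))" for t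
    using a c by (simp add: std_normal_density_def scaleR_conv_of_real power_mult_distrib)
  have 2: "sqrt (2*pi) *\<^sub>R (complex_of_real (exp (- (s/?c)\<^sup>2 / 2)) /\<^sub>R \<bar>?c\<bar>)
     = of_real (sqrt (pi / a) * exp (- s\<^sup>2 / (4 * a)))"
    using a by (simp add: scaleR_conv_of_real power_divide real_sqrt_mult real_sqrt_divide field_simps)
  show ?thesis using * unfolding 1 2 .
qed

lemma exp_norm_prod: "exp (- a * (norm (x::'a::euclidean_space))\<^sup>2) = (\<Prod>b\<in>Basis. exp (- a * (x \<bullet> b)\<^sup>2))"
proof -
  have "(norm x)\<^sup>2 = (\<Sum>b\<in>Basis. (x \<bullet> b)\<^sup>2)"
    by (subst power2_norm_eq_inner, subst euclidean_inner) (simp add: power2_eq_square)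
  then show ?thesis
    by (simp add: exp_sum[symmetric] sum_negf sum_distrib_left[symmetric])
qed

text \<open>Both the character and the Gaussian are products over the coordinates, with frequency
  \<xi> \<bullet> b in the coordinate b.\<close>

lemma gaussian_integral:
  fixes \<xi> :: "'a::euclidean_space"
  assumes a: "a > 0"
  shows "has_bochner_integral lborel (\<lambda>x. cis (x \<bullet> \<xi>) * gauss a 0 x)
     (of_real (sqrt (pi / a) ^ DIM('a) * exp (- (norm \<xi>)\<^sup>2 / (4 * a))))"
proof -
  let ?f = "\<lambda>b t. cis ((\<xi> \<bullet> b) * t) * complex_of_real (exp (- a * t\<^sup>2))"
  note h = gaussian_integral_1d[OF a]
  have i: "integrable lborel (?f b)" for b using h[of "\<xi> \<bullet> b"] by (auto simp: has_bochner_integral_iff)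
  have v: "(\<integral>t. ?f b t \<partial>lborel) = of_real (sqrt (pi / a) * exp (- (\<xi> \<bullet> b)\<^sup>2 / (4 * a)))" for b
    using h[of "\<xi> \<bullet> b"] by (auto simp: has_bochner_integral_iff)
  have cs: "cis (\<Sum>b\<in>B. g b) = (\<Prod>b\<in>B. cis (g b))" if "finite B" for g :: "'a \<Rightarrow> real" and B
    using that by (induction rule: finite_induct) (auto simp: cis_mult[symmetric])
  have p: "(\<Prod>b\<in>Basis. ?f b (x \<bullet> b)) = cis (x \<bullet> \<xi>) * gauss a 0 x" for x
    unfolding prod.distrib gauss_def
    by (simp add: cs[symmetric] of_real_prod[symmetric] exp_norm_prod[symmetric, of a, simplified]
       euclidean_inner[of x \<xi>] mult.commute del: of_real_prod)
  have q: "(\<Prod>b\<in>Basis. complex_of_real (sqrt (pi / a) * exp (- (\<xi> \<bullet> b)\<^sup>2 / (4 * a))))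
     = of_real (sqrt (pi / a) ^ DIM('a) * exp (- (norm \<xi>)\<^sup>2 / (4 * a)))"
    using exp_norm_prod[of "1/(4*a)" \<xi>]
    unfolding of_real_prod[symmetric] prod.distrib by (simp add: of_real_prod[symmetric] del: of_real_prod)
  show ?thesis
    using integrable_lborel_prod[of ?f, OF i] integral_lborel_prod[of ?f, OF i]
    unfolding has_bochner_integral_iff p v q by simp
qed

lemma gauss_integrable [simp]:
  fixes y :: "'a::euclidean_space"
  assumes "a > 0" shows "integrable lborel (gauss a y)"
proof -
  have "integrable lborel (gauss a (0::'a))"
    using gaussian_integral[OF assms, of "0::'a"] by (simp add: has_bochner_integral_iff)
  then have "integrable lborel (\<lambda>x. gauss a 0 (- y + x))"
    by (subst integrable_translate) auto
  then show ?thesis by (simp add: gauss_def[abs_def])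
qed

lemma exp_norm_integrable [simp]:
  fixes y :: "'a::euclidean_space"
  assumes "a > 0" shows "integrable lborel (\<lambda>x. exp (- a * (norm (x - y))\<^sup>2))"
  using integrable_norm[OF gauss_integrable[OF assms, of y]] by (simp add: norm_gauss)


section \<open>Gaussians separate functions\<close>

lemma norm_sq_le: "(norm (a + b :: 'a::real_normed_vector))\<^sup>2 \<le> 2 * (norm a)\<^sup>2 + 2 * (norm b)\<^sup>2"
proof -
  have "(norm (a + b))\<^sup>2 \<le> (norm a + norm b)\<^sup>2"
    by (intro power_mono norm_triangle_ineq) auto
  also have "\<dots> \<le> 2 * (norm a)\<^sup>2 + 2 * (norm b)\<^sup>2"
    using sum_squares_bound[of "norm a" "norm b"] by (simp add: power2_sum)
  finally show ?thesis .
qed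

text \<open>Lebesgue differentiation: almost every value is the limit of the averages over the
  shrinking cubes \<open>cbox x (x + h *\<^sub>R One)\<close>, and all these averages
  vanish.\<close>

lemma set_integral_eq_0_imp_AE_zero:
  fixes g :: "'a::euclidean_space \<Rightarrow> 'b::euclidean_space"
  assumes int: "\<And>a b. set_integrable lborel (cbox a b) g"
    and zero: "\<And>a b. (LINT x:cbox a b|lborel. g x) = 0"
  shows "AE x in lborel. g x = 0"
proof -
  have on: "g integrable_on cbox a b" and z: "integral (cbox a b) g = 0" for a b
    using set_borel_integral_eq_integral[OF int[of a b]] zero[of a b] by auto
  from integrable_ccontinuous_explicit[of g, OF on] obtain N where N: "negligible N"
    and lim: "\<And>x e. \<lbrakk>x \<notin> N; 0 < e\<rbrakk> \<Longrightarrow> \<exists>d>0. \<forall>h. 0 < h \<and> h < d \<longrightarrow>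
        norm (integral (cbox x (x + h *\<^sub>R One)) g /\<^sub>R h ^ DIM('a) - g x) < e"
    by blast
  have "g x = 0" if xN: "x \<notin> N" for x
  proof (rule ccontr)
    assume "g x \<noteq> 0"
    then obtain d where "d > 0" and
      "\<forall>h. 0 < h \<and> h < d \<longrightarrow> norm (integral (cbox x (x + h *\<^sub>R One)) g /\<^sub>R h ^ DIM('a) - g x) < norm (g x)"
      using lim[OF xN, of "norm (g x)"] by auto
    from this(2)[rule_format, of "d/2"] this(1) show False by (simp add: z)
  qed
  moreover have "AE x in lebesgue. x \<notin> N"
    using N by (auto simp: negligible_iff_null_sets intro: AE_not_in)
  ultimately have "AE x in lebesgue. g x = 0" by (auto elim: eventually_mono)
  then show ?thesis by (simp add: AE_completion_iff)
qed

text \<open>Averaging the centres of narrow Gaussians over a box tests \<open>g\<close> against a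
  smoothed indicator of that box. As the width tends to zero the tests converge to the indicator off
  the boundary, so the integral of \<open>g\<close> over every box vanishes. The hypothesis
  \<open>int\<close>, available for arbitrarily small \<open>a\<close>, limits the growth of
  \<open>g\<close> and supplies the majorants.\<close>

lemma gauss_test_zero:
  fixes g :: "'a::euclidean_space \<Rightarrow> complex"
  assumes g[measurable]: "g \<in> borel_measurable borel"
    and int: "\<And>a. a > 0 \<Longrightarrow> integrable lborel (\<lambda>x. g x * gauss a 0 x)"
    and zero: "\<And>a y. a > 0 \<Longrightarrow> (\<integral>x. g x * gauss a y x \<partial>lborel) = 0"
  shows "AE x in lborel. g x = 0"
proof (rule set_integral_eq_0_imp_AE_zero)
  fix l u :: 'a
  define B where "B = cbox l u"
  have Bm[measurable]: "B \<in> sets borel" by (simp add: B_def)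
  obtain R where R: "\<And>x. x \<in> B \<Longrightarrow> norm x \<le> R"
    using bounded_cbox[of l u] unfolding bounded_iff B_def by auto
  \<comment> \<open>A Gaussian centred anywhere in the bounded box decays like one centred at 0, at
    the price of half the exponent and of a constant depending on \<open>R\<close>.\<close>
  have sq: "(norm x)\<^sup>2 \<le> 2 * R\<^sup>2 + 2 * (norm (x - y))\<^sup>2" if "y \<in> B" for x y
  proof -
    have "(norm x)\<^sup>2 \<le> 2 * (norm y)\<^sup>2 + 2 * (norm (x - y))\<^sup>2" using norm_sq_le[of y "x - y"] by simp
    moreover have "(norm y)\<^sup>2 \<le> R\<^sup>2" using R[OF that] by (intro power_mono) auto
    ultimately show ?thesis by simp
  qed
  have ib: "integrable lborel (\<lambda>x. indicator B x * c)" for c :: real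
    by (intro integrable_mult_left integrable_real_indicator) (auto simp: B_def emeasure_lborel_cbox_finite[unfolded infinity_ennreal_def])
  have absint: "integrable lborel (\<lambda>x. norm (g x) * exp (- a * (norm x)\<^sup>2))" if "a > 0" for a
    using integrable_norm[OF int[OF that]] by (simp add: norm_mult norm_gauss)
  show "set_integrable lborel (cbox l u) g"
    unfolding set_integrable_def B_def[symmetric]
  proof (rule Bochner_Integration.integrable_bound)
    show "integrable lborel (\<lambda>x. exp (R\<^sup>2) * (norm (g x) * exp (- 1 * (norm x)\<^sup>2)))"
      using absint[of 1] by simp
    have "norm (g x) \<le> exp (R\<^sup>2) * (norm (g x) * exp (- 1 * (norm x)\<^sup>2))" if "x \<in> B" for x
    proof -
      have "(norm x)\<^sup>2 \<le> R\<^sup>2" using R[OF that] by (intro power_mono) auto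
      then have "1 \<le> exp (R\<^sup>2) * exp (- 1 * (norm x)\<^sup>2)" by (simp add: exp_add[symmetric])
      from mult_left_mono[OF this, of "norm (g x)"] show ?thesis by (simp add: mult_ac)
    qed
    then show "AE x in lborel. norm (indicator B x *\<^sub>R g x)
        \<le> norm (exp (R\<^sup>2) * (norm (g x) * exp (- 1 * (norm x)\<^sup>2)))"
      by (intro AE_I2) (auto simp: indicator_def abs_mult)
  qed simp
  define Z where "Z = (\<integral>z. exp (- 1 * (norm z)\<^sup>2) \<partial>(lborel :: 'a measure))"
  \<comment> \<open>In the variable \<open>z = n * (y - x)\<close> this is a convolution of the
    indicator of \<open>B\<close> with a Gaussian of width of order 1/n. The Gaussian keeps the mass
    \<open>Z\<close> for every \<open>n\<close>.\<close>
  define \<Phi> where "\<Phi> n x = (\<integral>z. indicator B (x + z /\<^sub>R real n) * exp (- 1 * (norm z)\<^sup>2) \<partial>lborel)"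
    for n :: nat and x :: 'a
  have e1: "integrable lborel (\<lambda>z::'a. exp (- 1 * (norm z)\<^sup>2))"
    using exp_norm_integrable[of 1 0] by simp
  have Zpos: "Z \<noteq> 0"
  proof
    assume "Z = 0"
    then have "AE z::'a in lborel. exp (- 1 * (norm z)\<^sup>2) = 0"
      unfolding Z_def by (subst (asm) integral_nonneg_eq_0_iff_AE[OF e1]) auto
    then have "AE z::'a in lborel. False" by simp
    then show False using emeasure_lborel_UNIV[where 'a='a] by (simp add: trivial_limit_def[symmetric] ae_filter_eq_bot_iff)
  qed
  have \<Phi>_meas[measurable]: "\<Phi> n \<in> borel_measurable borel" for n
    unfolding \<Phi>_def by measurable
  have \<Phi>_scale: "\<Phi> n x = real n ^ DIM('a) * (\<integral>y. indicator B y * exp (- (real n)\<^sup>2 * (norm (x - y))\<^sup>2) \<partial>lborel)"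
    if n: "n > 0" for n x
  proof -
    let ?h = "\<lambda>z. indicator B (x + z /\<^sub>R real n) * exp (- 1 * (norm z)\<^sup>2)"
    have "\<Phi> n x = integral\<^sup>L (density (distr lborel borel (\<lambda>y. (- real n *\<^sub>R x) + real n *\<^sub>R y)) (\<lambda>_. \<bar>real n\<bar> ^ DIM('a))) ?h"
      unfolding \<Phi>_def using lborel_affine[of "real n" "- real n *\<^sub>R x"] n by simp
    also have "\<dots> = (\<integral>y. real n ^ DIM('a) * ?h ((- real n *\<^sub>R x) + real n *\<^sub>R y) \<partial>lborel)"
      by (subst integral_density) (auto simp: integral_distr)
    also have "\<dots> = (\<integral>y. real n ^ DIM('a) * (indicator B y * exp (- (real n)\<^sup>2 * (norm (x - y))\<^sup>2)) \<partial>lborel)"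
    proof (rule Bochner_Integration.integral_cong[OF refl])
      fix y
      have 1: "(- real n *\<^sub>R x) + real n *\<^sub>R y = real n *\<^sub>R (y - x)" by (simp add: scaleR_diff_right)
      show "real n ^ DIM('a) * ?h ((- real n *\<^sub>R x) + real n *\<^sub>R y)
        = real n ^ DIM('a) * (indicator B y * exp (- (real n)\<^sup>2 * (norm (x - y))\<^sup>2))"
        unfolding 1 using n by (simp add: power_mult_distrib norm_minus_commute)
    qed
    finally show ?thesis by simp
  qed
  have \<Phi>_zero: "(\<integral>x. g x * \<Phi> n x \<partial>lborel) = 0" if n: "n > 0" for n
  proof -
    let ?a = "(real n)\<^sup>2"
    have a: "?a > 0" using n by simp
    \<comment> \<open>Integration in \<open>x\<close> first meets the hypothesis
      \<open>zero\<close>; integration in \<open>y\<close> first produces \<Phi>, up to the power of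
      \<open>n\<close> from the change of variables.\<close>
    let ?F = "\<lambda>x y. g x * (of_real (indicator B y) * gauss ?a y x)"
    have gm[measurable]: "(\<lambda>(x, y). gauss ?a y x) \<in> borel_measurable (lborel \<Otimes>\<^sub>M (lborel :: 'a measure))"
      unfolding gauss_def by measurable
    have "integrable (lborel \<Otimes>\<^sub>M lborel) (case_prod ?F)"
    proof (rule integrable_pair_bound)
      show "integrable lborel (\<lambda>x. norm (g x) * exp (- (?a / 2) * (norm x)\<^sup>2))"
        using absint[of "?a/2"] a by simp
      show "integrable lborel (\<lambda>y. indicator B y * exp (?a * R\<^sup>2))" by (rule ib)
      fix x y
      have "norm (gauss ?a y x) \<le> exp (- (?a / 2) * (norm x)\<^sup>2) * exp (?a * R\<^sup>2)" if "y \<in> B"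
      proof -
        have "?a * (norm x)\<^sup>2 \<le> ?a * (2 * R\<^sup>2 + 2 * (norm (x - y))\<^sup>2)"
          using sq[OF that, of x] by (intro mult_left_mono) auto
        then show ?thesis by (simp add: norm_gauss exp_add[symmetric] algebra_simps)
      qed
      from mult_left_mono[OF this, of "norm (g x)"]
      show "norm (?F x y) \<le> (norm (g x) * exp (- (?a / 2) * (norm x)\<^sup>2)) * (indicator B y * exp (?a * R\<^sup>2))"
        by (auto simp: indicator_def norm_mult mult_ac)
    qed measurable
    from lborel_pair.Fubini_integral[OF this]
    have "(\<integral>x. (\<integral>y. ?F x y \<partial>lborel) \<partial>lborel) = (\<integral>y. (\<integral>x. ?F x y \<partial>lborel) \<partial>lborel)" by simp
    also have "\<dots> = (\<integral>y. of_real (indicator B y) * (\<integral>x. g x * gauss ?a y x \<partial>lborel) \<partial>lborel)"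
      by (intro Bochner_Integration.integral_cong refl)
         (simp add: integral_mult_right_zero[symmetric] mult_ac del: integral_mult_right_zero)
    also have "\<dots> = 0" using zero[OF a] by simp
    also have "(\<integral>x. (\<integral>y. ?F x y \<partial>lborel) \<partial>lborel) = (\<integral>x. g x * (\<Phi> n x / real n ^ DIM('a)) \<partial>lborel)"
    proof (intro Bochner_Integration.integral_cong refl)
      fix x
      have "(\<integral>y. ?F x y \<partial>lborel) = g x * of_real (\<integral>y. indicator B y * exp (- ?a * (norm (x - y))\<^sup>2) \<partial>lborel)"
        by (simp add: gauss_def integral_complex_of_real[symmetric] del: integral_complex_of_real)
      also have "(\<integral>y. indicator B y * exp (- ?a * (norm (x - y))\<^sup>2) \<partial>lborel) = \<Phi> n x / real n ^ DIM('a)"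
        using n \<Phi>_scale[OF n, of x] by simp
      finally show "(\<integral>y. ?F x y \<partial>lborel) = g x * (\<Phi> n x / real n ^ DIM('a))" by simp
    qed
    also have "\<dots> = (\<integral>x. g x * \<Phi> n x \<partial>lborel) / real n ^ DIM('a)"
      by simp
    finally show ?thesis using n by simp
  qed
  have e2: "integrable lborel (\<lambda>z::'a. exp (- (1/2) * (norm z)\<^sup>2))"
    using exp_norm_integrable[of "1/2" 0] by simp
  define K where "K = exp (R\<^sup>2/2) * (\<integral>z. exp (- (1/2) * (norm z)\<^sup>2) \<partial>(lborel :: 'a measure))"
  have \<Phi>_le: "norm (\<Phi> n x) \<le> K * exp (- (1/4) * (norm x)\<^sup>2)" if n: "n > 0" for n x
  proof -
    have "norm (\<Phi> n x) \<le> (\<integral>z. exp (R\<^sup>2/2) * exp (- (1/4) * (norm x)\<^sup>2) * exp (- (1/2) * (norm z)\<^sup>2) \<partial>(lborel :: 'a measure))"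
      unfolding \<Phi>_def
    proof (rule Bochner_Integration.integral_norm_bound_integral)
      fix z
      show "norm (indicator B (x + z /\<^sub>R real n) * exp (- 1 * (norm z)\<^sup>2))
          \<le> exp (R\<^sup>2/2) * exp (- (1/4) * (norm x)\<^sup>2) * exp (- (1/2) * (norm z)\<^sup>2)"
      proof (cases "x + z /\<^sub>R real n \<in> B")
        case True
        have "(norm x)\<^sup>2 \<le> 2 * R\<^sup>2 + 2 * (norm (z /\<^sub>R real n))\<^sup>2" using sq[OF True, of x] by simp
        moreover have "(norm (z /\<^sub>R real n))\<^sup>2 \<le> (norm z)\<^sup>2"
          using n mult_right_mono[of 1 "real n" "norm z"] by (intro power_mono) (auto simp: field_simps)
        ultimately have "(norm x)\<^sup>2 \<le> 2 * R\<^sup>2 + 2 * (norm z)\<^sup>2" by linarith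
        then show ?thesis using True by (simp add: exp_add[symmetric] algebra_simps)
      qed simp
    qed (use e1 e2 in \<open>auto intro!: Bochner_Integration.integrable_bound[OF e1] AE_I2 simp: indicator_def\<close>)
    also have "\<dots> = K * exp (- (1/4) * (norm x)\<^sup>2)"
      by (simp add: K_def)
    finally show ?thesis .
  qed
  have \<Phi>_lim: "(\<lambda>n. \<Phi> (Suc n) x) \<longlonglongrightarrow> indicator B x * Z" if x: "x \<notin> B - box l u" for x
  proof -
    have "(\<lambda>n. \<Phi> (Suc n) x) \<longlonglongrightarrow> (\<integral>z. indicator B x * exp (- 1 * (norm z)\<^sup>2) \<partial>(lborel :: 'a measure))"
      unfolding \<Phi>_def
    proof (rule integral_dominated_convergence[where w="\<lambda>z. exp (- 1 * (norm z)\<^sup>2)"])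
      show "AE z in lborel. (\<lambda>n. indicator B (x + z /\<^sub>R real (Suc n)) * exp (- 1 * (norm z)\<^sup>2))
          \<longlonglongrightarrow> indicator B x * exp (- 1 * (norm z)\<^sup>2)"
      proof (rule AE_I2, rule tendsto_mult_right)
        fix z :: 'a
        have "(\<lambda>n. inverse (real (Suc n)) *\<^sub>R z) \<longlonglongrightarrow> 0 *\<^sub>R z"
          by (rule tendsto_scaleR[OF LIMSEQ_inverse_real_of_nat tendsto_const])
        then have l: "(\<lambda>n. x + z /\<^sub>R real (Suc n)) \<longlonglongrightarrow> x"
          using tendsto_add[OF tendsto_const, of _ 0 sequentially x] by simp
        have "\<forall>\<^sub>F n in sequentially. (indicator B (x + z /\<^sub>R real (Suc n)) :: real) = indicator B x"
        proof (cases "x \<in> B")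
          case True
          then have "x \<in> box l u" using x by auto
          from topological_tendstoD[OF l open_box this] show ?thesis
            by (rule eventually_mono) (use True box_subset_cbox[of l u] in \<open>auto simp: B_def\<close>)
        next
          case False
          have "open (- B)" by (simp add: B_def closed_cbox open_Compl)
          from topological_tendstoD[OF l this] False show ?thesis
            by (auto elim!: eventually_mono)
        qed
        then show "(\<lambda>n. indicator B (x + z /\<^sub>R real (Suc n)) :: real) \<longlonglongrightarrow> indicator B x"
          by (rule tendsto_eventually)
      qed
    qed (use e1 in \<open>auto intro!: AE_I2 simp: indicator_def\<close>)
    then show ?thesis by (simp add: Z_def)
  qed
  have AEx: "AE x in lborel. x \<notin> B - box l u"
    using AE_not_in[OF null_sets_cbox_Diff_box[of l u]] unfolding B_def .
  have "(\<lambda>n. \<integral>x. g x * \<Phi> (Suc n) x \<partial>lborel) \<longlonglongrightarrow> (\<integral>x. g x * of_real (indicator B x * Z) \<partial>lborel)"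
  proof (rule integral_dominated_convergence[where w="\<lambda>x. K * (norm (g x) * exp (- (1/4) * (norm x)\<^sup>2))"])
    show "integrable lborel (\<lambda>x. K * (norm (g x) * exp (- (1/4) * (norm x)\<^sup>2)))"
      using absint[of "1/4"] by simp
    show "AE x in lborel. (\<lambda>n. g x * of_real (\<Phi> (Suc n) x)) \<longlonglongrightarrow> g x * of_real (indicator B x * Z)"
      using AEx by eventually_elim (intro tendsto_mult tendsto_const tendsto_of_real \<Phi>_lim)
    show "AE x in lborel. norm (g x * of_real (\<Phi> (Suc n) x)) \<le> K * (norm (g x) * exp (- (1/4) * (norm x)\<^sup>2))" for n
      using mult_left_mono[OF \<Phi>_le[of "Suc n"], of "norm (g _)"]
      by (intro AE_I2) (simp add: norm_mult mult_ac)
  qed measurable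
  then have "(\<integral>x. g x * of_real (indicator B x * Z) \<partial>lborel) = 0"
    by (simp add: \<Phi>_zero LIMSEQ_const_iff)
  moreover have "(\<integral>x. g x * of_real (indicator B x * Z) \<partial>lborel) = (\<integral>x. g x * of_real (indicator B x) \<partial>lborel) * Z"
    by (simp add: mult.assoc[symmetric])
  ultimately show "(LINT x:cbox l u|lborel. g x) = 0"
    using Zpos unfolding set_lebesgue_integral_def B_def[symmetric]
    by (simp add: scaleR_conv_of_real mult.commute)
qed


section \<open>Completeness of L2 and Young's inequality\<close>

lemma nn_integral_norm_sq:
  fixes f :: "'a \<Rightarrow> 'b::{banach, second_countable_topology}"
  assumes "integrable M (\<lambda>x. (norm (f x))\<^sup>2)"
  shows "(\<integral>\<^sup>+x. ennreal ((norm (f x))\<^sup>2) \<partial>M) = ennreal (\<integral>x. (norm (f x))\<^sup>2 \<partial>M)"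
  using assms by (intro nn_integral_eq_integral) auto

text \<open>Riesz-Fischer. Along a subsequence the squared steps have integrals below
  \<open>(1/4)^k\<close>. Multiplied by \<open>2^k\<close> these integrals still have a finite sum,
  and the weighted squares are large enough to make the steps themselves summable almost everywhere.
  Fatou's lemma turns the pointwise limit into a limit in L2.\<close>

lemma riesz_fischer_L2:
  fixes f :: "nat \<Rightarrow> 'a \<Rightarrow> 'b::{banach, second_countable_topology}"
  assumes [measurable]: "\<And>n. f n \<in> borel_measurable M"
    and cauchy: "\<And>e. e > 0 \<Longrightarrow> \<exists>N. \<forall>m\<ge>N. \<forall>n\<ge>N. (\<integral>\<^sup>+x. ennreal ((norm (f m x - f n x))\<^sup>2) \<partial>M) < ennreal e"
  obtains g where "g \<in> borel_measurable M"
    and "(\<lambda>n. \<integral>\<^sup>+x. ennreal ((norm (f n x - g x))\<^sup>2) \<partial>M) \<longlonglongrightarrow> 0"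
proof -
  have "\<forall>k. \<exists>N. \<forall>m\<ge>N. \<forall>n\<ge>N. (\<integral>\<^sup>+x. ennreal ((norm (f m x - f n x))\<^sup>2) \<partial>M) < ennreal ((1/4)^k)"
    by (intro allI cauchy) simp
  from choice[OF this] obtain N0 where N0: "\<And>k m n. m \<ge> N0 k \<Longrightarrow> n \<ge> N0 k \<Longrightarrow>
      (\<integral>\<^sup>+x. ennreal ((norm (f m x - f n x))\<^sup>2) \<partial>M) < ennreal ((1/4)^k)"
    by blast
  \<comment> \<open>Dominates \<open>N0 j\<close> for all \<open>j \<le> k\<close> and, through the
    summand \<open>k\<close>, tends to infinity.\<close>
  define r where "r k = k + (\<Sum>j\<le>k. N0 j)" for k
  have rN: "N0 j \<le> r k" if "j \<le> k" for j k
    using member_le_sum[of j "{..k}" N0] that by (auto simp: r_def)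
  define d where "d k x = norm (f (r (Suc k)) x - f (r k) x)" for k x
  have [measurable]: "d k \<in> borel_measurable M" for k unfolding d_def by measurable
  have dk: "(\<integral>\<^sup>+x. ennreal (2^k * (d k x)\<^sup>2) \<partial>M) \<le> ennreal ((1/2)^k)" for k
  proof -
    have "(\<integral>\<^sup>+x. ennreal (2^k * (d k x)\<^sup>2) \<partial>M) = ennreal (2^k) * (\<integral>\<^sup>+x. ennreal ((d k x)\<^sup>2) \<partial>M)"
      by (simp add: ennreal_mult nn_integral_cmult)
    also have "\<dots> \<le> ennreal (2^k) * ennreal ((1/4)^k)"
      unfolding d_def by (rule mult_left_mono[OF less_imp_le[OF N0[OF rN rN]]]) auto
    also have "\<dots> = ennreal ((1/2)^k)"
      by (simp add: ennreal_mult[symmetric] power_mult_distrib[symmetric])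
    finally show ?thesis .
  qed
  have "(\<integral>\<^sup>+x. (\<Sum>k. ennreal (2^k * (d k x)\<^sup>2)) \<partial>M) = (\<Sum>k. \<integral>\<^sup>+x. ennreal (2^k * (d k x)\<^sup>2) \<partial>M)"
    by (rule nn_integral_suminf) measurable
  also have "\<dots> \<le> (\<Sum>k. ennreal ((1/2)^k))"
    by (intro suminf_le dk) auto
  also have "\<dots> = ennreal (\<Sum>k. (1/2)^k)"
    by (rule suminf_ennreal2) (auto simp: summable_geometric)
  also have "\<dots> < \<infinity>" by simp
  finally have "AE x in M. (\<Sum>k. ennreal (2^k * (d k x)\<^sup>2)) \<noteq> \<infinity>"
    by (intro nn_integral_PInf_AE) auto
  then have conv: "AE x in M. convergent (\<lambda>k. f (r k) x)"
  proof eventually_elim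
    case (elim x)
    then have s: "summable (\<lambda>k. 2^k * (d k x)\<^sup>2)"
      by (intro summable_suminf_not_top) auto
    have "summable (\<lambda>k. d k x)"
    proof (rule summable_comparison_test')
      show "summable (\<lambda>k. (1/2)^k + 2^k * (d k x)\<^sup>2)"
        using s by (intro summable_add) (auto simp: summable_geometric)
      fix k :: nat
      \<comment> \<open>Expanding this square bounds \<open>2 * d k x\<close> by the weighted square
        plus a geometric term, both of which are summable.\<close>
      have "0 \<le> (1/2)^k * (2^k * d k x - 1)\<^sup>2" by simp
      also have "\<dots> = (1/2)^k * (2^k)\<^sup>2 * (d k x)\<^sup>2 - 2 * ((1/2)^k * 2^k) * d k x + (1/2)^k"
        by (simp add: power2_eq_square algebra_simps)
      also have "(1/2)^k * 2^k = (1::real)" by (simp add: power_mult_distrib[symmetric])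
      finally have "2 * d k x \<le> (1/2)^k * (2^k)\<^sup>2 * (d k x)\<^sup>2 + (1/2)^k" by simp
      also have "(1/2)^k * (2^k)\<^sup>2 = (2::real)^k"
        by (simp add: power2_eq_square mult.assoc[symmetric] power_mult_distrib[symmetric])
      finally have "2 * d k x \<le> 2^k * (d k x)\<^sup>2 + (1/2)^k" .
      moreover have "0 \<le> d k x" by (simp add: d_def)
      ultimately show "norm (d k x) \<le> (1/2)^k + 2^k * (d k x)\<^sup>2"
        unfolding real_norm_def by linarith
    qed
    then have "summable (\<lambda>k. f (r (Suc k)) x - f (r k) x)"
      unfolding d_def by (rule summable_norm_cancel)
    then have "convergent (\<lambda>n. \<Sum>k<n. f (r (Suc k)) x - f (r k) x)"
      by (simp add: summable_iff_convergent)
    then have "convergent (\<lambda>n. f (r n) x - f (r 0) x)"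
      by (simp add: sum_lessThan_telescope[of "\<lambda>k. f (r k) x"])
    then have "convergent (\<lambda>n. (f (r n) x - f (r 0) x) + f (r 0) x)"
      by (intro convergent_add convergent_const)
    then show ?case by simp
  qed
  define g where "g x = lim (\<lambda>k. f (r k) x)" for x
  have g[measurable]: "g \<in> borel_measurable M" unfolding g_def by measurable
  have lim: "AE x in M. (\<lambda>k. f (r k) x) \<longlonglongrightarrow> g x"
    using conv by eventually_elim (simp add: g_def convergent_LIMSEQ_iff)
  \<comment> \<open>Fatou along the subsequence: the distance to \<open>g\<close> inherits the
    Cauchy bound.\<close>
  have bound: "(\<integral>\<^sup>+x. ennreal ((norm (f n x - g x))\<^sup>2) \<partial>M) \<le> ennreal e"
    if N: "\<forall>m\<ge>N. \<forall>n\<ge>N. (\<integral>\<^sup>+x. ennreal ((norm (f m x - f n x))\<^sup>2) \<partial>M) < ennreal e" and n: "n \<ge> N" for N n e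
  proof -
    have "(\<integral>\<^sup>+x. ennreal ((norm (f n x - g x))\<^sup>2) \<partial>M)
      = (\<integral>\<^sup>+x. liminf (\<lambda>k. ennreal ((norm (f n x - f (r k) x))\<^sup>2)) \<partial>M)"
    proof (rule nn_integral_cong_AE, use lim in eventually_elim)
      case (elim x)
      then have "(\<lambda>k. ennreal ((norm (f n x - f (r k) x))\<^sup>2)) \<longlonglongrightarrow> ennreal ((norm (f n x - g x))\<^sup>2)"
        by (intro tendsto_intros)
      from lim_imp_Liminf[OF _ this] show ?case by simp
    qed
    also have "\<dots> \<le> liminf (\<lambda>k. \<integral>\<^sup>+x. ennreal ((norm (f n x - f (r k) x))\<^sup>2) \<partial>M)"
      by (rule nn_integral_liminf) measurable
    also have "\<dots> \<le> limsup (\<lambda>k. \<integral>\<^sup>+x. ennreal ((norm (f n x - f (r k) x))\<^sup>2) \<partial>M)"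
      by (rule Liminf_le_Limsup) simp
    also have "\<dots> \<le> ennreal e"
    proof (rule Limsup_bounded)
      show "\<forall>\<^sub>F k in sequentially. (\<integral>\<^sup>+x. ennreal ((norm (f n x - f (r k) x))\<^sup>2) \<partial>M) \<le> ennreal e"
        using eventually_ge_at_top[of N]
      proof eventually_elim
        case (elim k)
        then have "r k \<ge> N" by (simp add: r_def)
        with N n show ?case by (auto intro: less_imp_le)
      qed
    qed
    finally show ?thesis .
  qed
  have "(\<lambda>n. \<integral>\<^sup>+x. ennreal ((norm (f n x - g x))\<^sup>2) \<partial>M) \<longlonglongrightarrow> 0"
  proof (rule order_tendstoI)
    fix a :: ennreal assume "0 < a"
    obtain e where e: "e > 0" "ennreal e < a"
    proof (cases a)
      case (real r)
      then show ?thesis using \<open>0 < a\<close> that[of "r / 2"] by (auto simp: ennreal_less_iff)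
    next
      case top
      then show ?thesis using that[of 1] by simp
    qed
    obtain N where "\<forall>m\<ge>N. \<forall>n\<ge>N. (\<integral>\<^sup>+x. ennreal ((norm (f m x - f n x))\<^sup>2) \<partial>M) < ennreal e"
      using cauchy[OF e(1)] by auto
    from bound[OF this] show "\<forall>\<^sub>F n in sequentially. (\<integral>\<^sup>+x. ennreal ((norm (f n x - g x))\<^sup>2) \<partial>M) < a"
      using e(2) by (auto simp: eventually_sequentially intro: le_less_trans)
  qed auto
  with g show ?thesis by (rule that)
qed

text \<open>The two weightings of Cauchy--Schwarz that give Young's inequality
  \<open>L\<^sup>1 * L\<^sup>2 \<subseteq> L\<^sup>2\<close>, with the kernel respectively the field in \<open>L\<^sup>1\<close>.\<close>

lemma
  fixes k :: "'a::euclidean_space \<Rightarrow> real" and f :: "'a \<Rightarrow> 'b::{banach, second_countable_topology}"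
  assumes [measurable]: "k \<in> borel_measurable borel" "f \<in> borel_measurable borel"
    and nn: "\<And>x. 0 \<le> k x"
  shows norm_conv_sq_le_kernel: "ennreal ((norm (\<integral>y. k (x - y) *\<^sub>R f y \<partial>lborel))\<^sup>2)
      \<le> (\<integral>\<^sup>+y. ennreal (k y) \<partial>lborel) * (\<integral>\<^sup>+y. ennreal (k (x - y) * (norm (f y))\<^sup>2) \<partial>lborel)" (is ?A)
    and norm_conv_sq_le_field: "ennreal ((norm (\<integral>y. k (x - y) *\<^sub>R f y \<partial>lborel))\<^sup>2)
      \<le> (\<integral>\<^sup>+y. ennreal (norm (f y)) \<partial>lborel) * (\<integral>\<^sup>+y. ennreal ((k (x - y))\<^sup>2 * norm (f y)) \<partial>lborel)" (is ?B)
proof -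
  \<comment> \<open>A Bochner integral that does not exist is 0 by convention, so the bound also
    holds in that case.\<close>
  have 0: "ennreal (norm (\<integral>y. k (x - y) *\<^sub>R f y \<partial>lborel)) \<le> (\<integral>\<^sup>+y. ennreal (k (x - y) * norm (f y)) \<partial>lborel)"
  proof (cases "integrable lborel (\<lambda>y. k (x - y) *\<^sub>R f y)")
    case True
    from integral_norm_bound_ennreal[OF this] show ?thesis by (simp add: nn)
  qed (simp add: not_integrable_integral_eq)
  have *: "ennreal ((norm (\<integral>y. k (x - y) *\<^sub>R f y \<partial>lborel))\<^sup>2)
      \<le> (\<integral>\<^sup>+y. ennreal (u y ^ 2) \<partial>lborel) * (\<integral>\<^sup>+y. ennreal (v y ^ 2) \<partial>lborel)"
    if uv: "\<And>y. k (x - y) * norm (f y) = u y * v y" "\<And>y. 0 \<le> u y" "\<And>y. 0 \<le> v y"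
      and [measurable]: "u \<in> borel_measurable borel" "v \<in> borel_measurable borel" for u v
  proof -
    have "ennreal ((norm (\<integral>y. k (x - y) *\<^sub>R f y \<partial>lborel))\<^sup>2)
      = (ennreal (norm (\<integral>y. k (x - y) *\<^sub>R f y \<partial>lborel)))\<^sup>2" by (simp add: ennreal_power)
    also have "\<dots> \<le> (\<integral>\<^sup>+y. ennreal (k (x - y) * norm (f y)) \<partial>lborel)\<^sup>2" using 0 by (rule power_mono) simp
    also have "\<dots> = (\<integral>\<^sup>+y. ennreal (u y) * ennreal (v y) \<partial>lborel)\<^sup>2"
      using uv by (simp add: ennreal_mult)
    also have "\<dots> \<le> (\<integral>\<^sup>+y. (ennreal (u y))\<^sup>2 \<partial>lborel) * (\<integral>\<^sup>+y. (ennreal (v y))\<^sup>2 \<partial>lborel)"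
      by (rule Cauchy_Schwarz_nn_integral) measurable
    finally show ?thesis using uv by (simp add: ennreal_power)
  qed
  have "ennreal ((norm (\<integral>y. k (x - y) *\<^sub>R f y \<partial>lborel))\<^sup>2)
      \<le> (\<integral>\<^sup>+y. ennreal (k (x - y)) \<partial>lborel) * (\<integral>\<^sup>+y. ennreal (k (x - y) * (norm (f y))\<^sup>2) \<partial>lborel)"
    using *[of "\<lambda>y. sqrt (k (x - y))" "\<lambda>y. sqrt (k (x - y)) * norm (f y)"]
    by (simp add: nn power_mult_distrib mult.assoc[symmetric])
  also have "(\<integral>\<^sup>+y. ennreal (k (x - y)) \<partial>lborel) = (\<integral>\<^sup>+y. ennreal (k y) \<partial>lborel)"
    by (rule nn_integral_reflect) measurable
  finally show ?A .
  show ?B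
    using *[of "\<lambda>y. sqrt (norm (f y))" "\<lambda>y. k (x - y) * sqrt (norm (f y))"]
    by (simp add: nn power_mult_distrib mult_ac)
qed

lemma
  fixes k :: "'a::euclidean_space \<Rightarrow> real" and f :: "'a \<Rightarrow> 'b::{banach, second_countable_topology}"
  assumes [measurable]: "k \<in> borel_measurable borel" "f \<in> borel_measurable borel"
    and nn: "\<And>x. 0 \<le> k x"
  shows nn_integral_conv_sq_le_kernel: "(\<integral>\<^sup>+x. ennreal ((norm (\<integral>y. k (x - y) *\<^sub>R f y \<partial>lborel))\<^sup>2) \<partial>lborel)
      \<le> (\<integral>\<^sup>+y. ennreal (k y) \<partial>lborel)\<^sup>2 * (\<integral>\<^sup>+y. ennreal ((norm (f y))\<^sup>2) \<partial>lborel)" (is ?A)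
    and nn_integral_conv_sq_le_field: "(\<integral>\<^sup>+x. ennreal ((norm (\<integral>y. k (x - y) *\<^sub>R f y \<partial>lborel))\<^sup>2) \<partial>lborel)
      \<le> (\<integral>\<^sup>+y. ennreal (norm (f y)) \<partial>lborel)\<^sup>2 * (\<integral>\<^sup>+y. ennreal ((k y)\<^sup>2) \<partial>lborel)" (is ?B)
proof -
  have sw: "(\<integral>\<^sup>+x. (\<integral>\<^sup>+y. u (x - y) * v y \<partial>lborel) \<partial>lborel)
      = (\<integral>\<^sup>+y. u y \<partial>lborel) * (\<integral>\<^sup>+y. v y \<partial>lborel)"
    if [measurable]: "u \<in> borel_measurable borel" "v \<in> borel_measurable borel" for u v :: "'a \<Rightarrow> ennreal"
  proof -
    have "(\<integral>\<^sup>+x. (\<integral>\<^sup>+y. u (x - y) * v y \<partial>lborel) \<partial>lborel) = (\<integral>\<^sup>+y. (\<integral>\<^sup>+x. u (x - y) * v y \<partial>lborel) \<partial>lborel)"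
      by (rule lborel_pair.Fubini') measurable
    also have "\<dots> = (\<integral>\<^sup>+y. (\<integral>\<^sup>+x. u x \<partial>lborel) * v y \<partial>lborel)"
      using nn_integral_translate[of u "- _"] by (simp add: nn_integral_multc)
    finally show ?thesis by (simp add: nn_integral_cmult)
  qed
  have "(\<integral>\<^sup>+x. ennreal ((norm (\<integral>y. k (x - y) *\<^sub>R f y \<partial>lborel))\<^sup>2) \<partial>lborel)
    \<le> (\<integral>\<^sup>+x. (\<integral>\<^sup>+y. ennreal (k y) \<partial>lborel) * (\<integral>\<^sup>+y. ennreal (k (x - y) * (norm (f y))\<^sup>2) \<partial>lborel) \<partial>lborel)"
    by (intro nn_integral_mono norm_conv_sq_le_kernel nn) measurable
  also have "\<dots> = (\<integral>\<^sup>+y. ennreal (k y) \<partial>lborel) * ((\<integral>\<^sup>+y. ennreal (k y) \<partial>lborel) * (\<integral>\<^sup>+y. ennreal ((norm (f y))\<^sup>2) \<partial>lborel))"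
    by (subst nn_integral_cmult, measurable) (simp add: ennreal_mult nn sw[of "\<lambda>x. ennreal (k x)" "\<lambda>y. ennreal ((norm (f y))\<^sup>2)"])
  finally show ?A by (simp add: power2_eq_square mult_ac)
  have "(\<integral>\<^sup>+x. ennreal ((norm (\<integral>y. k (x - y) *\<^sub>R f y \<partial>lborel))\<^sup>2) \<partial>lborel)
    \<le> (\<integral>\<^sup>+x. (\<integral>\<^sup>+y. ennreal (norm (f y)) \<partial>lborel) * (\<integral>\<^sup>+y. ennreal ((k (x - y))\<^sup>2 * norm (f y)) \<partial>lborel) \<partial>lborel)"
    by (intro nn_integral_mono norm_conv_sq_le_field nn) measurable
  also have "\<dots> = (\<integral>\<^sup>+y. ennreal (norm (f y)) \<partial>lborel) * ((\<integral>\<^sup>+y. ennreal ((k y)\<^sup>2) \<partial>lborel) * (\<integral>\<^sup>+y. ennreal (norm (f y)) \<partial>lborel))"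
    by (subst nn_integral_cmult, measurable) (simp add: ennreal_mult nn sw[of "\<lambda>x. ennreal ((k x)\<^sup>2)" "\<lambda>y. ennreal (norm (f y))"])
  finally show ?B by (simp add: power2_eq_square mult_ac)
qed


section \<open>The Fourier transform of square-integrable functions\<close>

lemma square_integrable_borel [dest]: "square_integrable f \<Longrightarrow> f \<in> borel_measurable borel"
  by (simp add: square_integrable_def)

lemma borel_measurable_cnj [measurable (raw)]:
  "f \<in> borel_measurable M \<Longrightarrow> (\<lambda>x. cnj (f x)) \<in> borel_measurable M"
  by (rule measurable_compose[of f M borel cnj])
     (auto intro!: borel_measurable_continuous_onI continuous_intros)

lemma norm_fourier_integrand [simp]: "norm (cis t * z) = norm z"
  by (simp add: norm_mult)

lemma fourier_integrand_integrable:
  fixes \<phi> :: "real^3 \<Rightarrow> complex"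
  assumes "integrable lborel \<phi>" and [measurable]: "h \<in> borel_measurable borel"
  shows "integrable lborel (\<lambda>x. cis (h x) * \<phi> x)"
  using assms(1) by (rule Bochner_Integration.integrable_bound) (use assms(1) in auto)

lemma norm_fourier_integral_le:
  "norm (fourier_integral \<phi> \<xi>) \<le> (\<integral>x. norm (\<phi> x) \<partial>lborel)"
  unfolding fourier_integral_def using integral_norm_bound[of lborel "\<lambda>x. cis (- 2 * pi * (x \<bullet> \<xi>)) * \<phi> x"] by simp

lemma fourier_integral_measurable [measurable]:
  assumes [measurable]: "\<phi> \<in> borel_measurable borel"
  shows "fourier_integral \<phi> \<in> borel_measurable borel"
  unfolding fourier_integral_def[abs_def] by measurable

lemma continuous_fourier_integral:
  assumes i: "integrable lborel \<phi>"
  shows "isCont (fourier_integral \<phi>) \<xi>"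
  unfolding continuous_at_sequentially comp_def
proof (intro allI impI)
  fix X :: "nat \<Rightarrow> real^3" assume X: "X \<longlonglongrightarrow> \<xi>"
  have [measurable]: "\<phi> \<in> borel_measurable borel" using i by auto
  show "(\<lambda>n. fourier_integral \<phi> (X n)) \<longlonglongrightarrow> fourier_integral \<phi> \<xi>"
    unfolding fourier_integral_def
  proof (rule integral_dominated_convergence[where w="\<lambda>x. norm (\<phi> x)"])
    have "isCont cis t" for t
      using continuous_on_cis[OF continuous_on_id, of UNIV] by (simp add: continuous_on_eq_continuous_at)
    then show "AE x in lborel. (\<lambda>n. cis (- 2 * pi * (x \<bullet> X n)) * \<phi> x) \<longlonglongrightarrow> cis (- 2 * pi * (x \<bullet> \<xi>)) * \<phi> x"
      by (intro AE_I2 tendsto_mult tendsto_const isCont_tendsto_compose[of _ cis] tendsto_inner X)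
  qed (use i in auto)
qed

lemma fourier_integral_diff:
  assumes "integrable lborel f" "integrable lborel g"
  shows "fourier_integral (\<lambda>x. f x - g x) \<xi> = fourier_integral f \<xi> - fourier_integral g \<xi>"
  using assms by (simp add: fourier_integral_def right_diff_distrib fourier_integrand_integrable)

lemma fourier_integral_cmult:
  "fourier_integral (\<lambda>x. c * f x) \<xi> = c * fourier_integral f \<xi>"
proof -
  have "cis t * (c * z) = c * (cis t * z)" for t z by simp
  then show ?thesis by (simp only: fourier_integral_def integral_mult_right_zero)
qed

text \<open>The kernel is symmetric in its two variables, so Fubini only exchanges the roles of
  \<open>f\<close> and \<open>g\<close>. The distributional transform and \<open>L2_fourier\<close>
  below extend exactly this identity.\<close>

lemma fourier_multiplication_formula:
  assumes f: "integrable lborel f" and g: "integrable lborel g"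
  shows "(\<integral>x. f x * fourier_integral g x \<partial>lborel) = (\<integral>x. fourier_integral f x * g x \<partial>lborel)"
proof -
  have [measurable]: "f \<in> borel_measurable borel" "g \<in> borel_measurable borel" using f g by auto
  let ?F = "\<lambda>x y. f x * (cis (- 2 * pi * (y \<bullet> x)) * g y)"
  have "integrable (lborel \<Otimes>\<^sub>M lborel) (case_prod ?F)"
    by (rule integrable_pair_bound[OF _ integrable_norm[OF f] integrable_norm[OF g]])
       (auto simp: norm_mult)
  from lborel_pair.Fubini_integral[OF this]
  have "(\<integral>x. (\<integral>y. ?F x y \<partial>lborel) \<partial>lborel) = (\<integral>y. (\<integral>x. ?F x y \<partial>lborel) \<partial>lborel)" by simp
  moreover have "(\<integral>y. (\<integral>x. ?F x y \<partial>lborel) \<partial>lborel) = (\<integral>y. fourier_integral f y * g y \<partial>lborel)"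
  proof (intro Bochner_Integration.integral_cong refl)
    fix y
    have "(\<integral>x. ?F x y \<partial>lborel) = (\<integral>x. (cis (- 2 * pi * (x \<bullet> y)) * f x) * g y \<partial>lborel)"
      by (simp add: mult_ac inner_commute)
    then show "(\<integral>x. ?F x y \<partial>lborel) = fourier_integral f y * g y" by (simp add: fourier_integral_def)
  qed
  ultimately show ?thesis by (simp add: fourier_integral_def)
qed

text \<open>A norm on functions instead of classes, because on the frequency side particular
  representatives matter. For a function that is not square integrable the integral, hence also
  \<open>L2n\<close>, is 0 by convention; a bound on \<open>L2n\<close> therefore says something
  only together with \<open>square_integrable\<close>.\<close>

definition L2n :: "(real^3 \<Rightarrow> 'a::euclidean_space) \<Rightarrow> real" where
  "L2n f = sqrt (\<integral>x. (norm (f x))\<^sup>2 \<partial>lborel)"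

lemma L2n_nonneg [simp]: "0 \<le> L2n f" by (simp add: L2n_def)
lemma L2n_sq: "(L2n f)\<^sup>2 = (\<integral>x. (norm (f x))\<^sup>2 \<partial>lborel)" by (simp add: L2n_def)

lemma nn_integral_L2n:
  assumes "square_integrable f"
  shows "(\<integral>\<^sup>+x. ennreal ((norm (f x))\<^sup>2) \<partial>lborel) = ennreal ((L2n f)\<^sup>2)"
  using assms by (simp add: nn_integral_norm_sq square_integrable_def L2n_sq)

lemma square_integrableI_nn:
  assumes [measurable]: "f \<in> borel_measurable borel"
    and le: "(\<integral>\<^sup>+x. ennreal ((norm (f x))\<^sup>2) \<partial>lborel) \<le> ennreal (C\<^sup>2)" and C: "0 \<le> C"
  shows "square_integrable f" "L2n f \<le> C"
proof -
  have "integrable lborel (\<lambda>x. (norm (f x))\<^sup>2)"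
    by (rule integrableI_bounded) (use le in \<open>auto intro: le_less_trans\<close>)
  then show s: "square_integrable f" by (simp add: square_integrable_def)
  then have "(L2n f)\<^sup>2 \<le> C\<^sup>2" using le by (simp add: nn_integral_L2n)
  then show "L2n f \<le> C" using C by (rule power2_le_imp_le)
qed

lemma
  fixes f :: "real^3 \<Rightarrow> 'a::euclidean_space" and g :: "real^3 \<Rightarrow> 'b::euclidean_space"
  assumes f: "square_integrable f" and g: "square_integrable g"
  shows square_integrable_norm_mult: "integrable lborel (\<lambda>x. norm (f x) * norm (g x))"
    and L2n_Cauchy_Schwarz: "(\<integral>x. norm (f x) * norm (g x) \<partial>lborel) \<le> L2n f * L2n g"
proof -
  note [measurable] = square_integrable_borel[OF f] square_integrable_borel[OF g]
  have n: "(\<integral>\<^sup>+x. ennreal (norm (f x) * norm (g x)) \<partial>lborel)\<^sup>2 \<le> ennreal ((L2n f * L2n g)\<^sup>2)"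
    using Cauchy_Schwarz_nn_integral[of "\<lambda>x. ennreal (norm (f x))" lborel "\<lambda>x. ennreal (norm (g x))"]
    by (simp add: ennreal_power nn_integral_L2n f g ennreal_mult[symmetric] power_mult_distrib)
  then have "(\<integral>\<^sup>+x. ennreal (norm (f x) * norm (g x)) \<partial>lborel)\<^sup>2 < \<infinity>"
    by (auto intro: le_less_trans)
  then show i: "integrable lborel (\<lambda>x. norm (f x) * norm (g x))"
    by (intro integrableI_bounded) (auto simp: power_less_top_ennreal)
  from n have "(\<integral>x. norm (f x) * norm (g x) \<partial>lborel)\<^sup>2 \<le> (L2n f * L2n g)\<^sup>2"
    by (subst (asm) nn_integral_eq_integral[OF i]) (auto simp: ennreal_power)
  then show "(\<integral>x. norm (f x) * norm (g x) \<partial>lborel) \<le> L2n f * L2n g"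
    by (rule power2_le_imp_le) simp
qed

lemma
  fixes f g :: "real^3 \<Rightarrow> complex"
  assumes f: "square_integrable f" and g: "square_integrable g"
  shows square_integrable_mult: "integrable lborel (\<lambda>x. f x * g x)"
    and norm_integral_mult_le: "norm (\<integral>x. f x * g x \<partial>lborel) \<le> L2n f * L2n g"
proof -
  note [measurable] = square_integrable_borel[OF f] square_integrable_borel[OF g]
  show "integrable lborel (\<lambda>x. f x * g x)"
    by (rule Bochner_Integration.integrable_bound[OF square_integrable_norm_mult[OF f g]])
       (auto simp: norm_mult)
  show "norm (\<integral>x. f x * g x \<partial>lborel) \<le> L2n f * L2n g"
    using integral_norm_bound[of lborel "\<lambda>x. f x * g x"] L2n_Cauchy_Schwarz[OF f g] by (simp add: norm_mult)
qed

lemma square_integrable_bounded: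
  assumes i: "integrable lborel f" and b: "\<And>x. norm (f x) \<le> B"
  shows "square_integrable f"
  unfolding square_integrable_def
proof (intro conjI)
  show [measurable]: "f \<in> borel_measurable lborel" using i by auto
  show "integrable lborel (\<lambda>x. (norm (f x))\<^sup>2)"
  proof (rule Bochner_Integration.integrable_bound)
    show "integrable lborel (\<lambda>x. B * norm (f x))" using i by simp
    show "AE x in lborel. norm ((norm (f x))\<^sup>2) \<le> norm (B * norm (f x))"
      using mult_right_mono[OF b norm_ge_zero] order_trans[OF norm_ge_zero b]
      by (intro AE_I2) (auto simp: power2_eq_square abs_mult)
  qed simp
qed

lemma square_integrable_cmult: "square_integrable f \<Longrightarrow> square_integrable (\<lambda>x. c * f x :: complex)"
  by (auto simp: square_integrable_def norm_mult power_mult_distrib)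

lemma square_integrable_cis:
  "square_integrable f \<Longrightarrow> h \<in> borel_measurable borel \<Longrightarrow> square_integrable (\<lambda>x. cis (h x) * f x)"
  by (auto simp: square_integrable_def)

lemma square_integrable_diff:
  assumes "square_integrable f" "square_integrable g"
  shows "square_integrable (\<lambda>x. f x - g x)"
  using square_integrable_add[OF assms(1) square_integrable_uminus[OF assms(2)]] by simp

lemma square_integrable_gauss [simp]: "a > 0 \<Longrightarrow> square_integrable (gauss a (y::real^3))"
  by (rule square_integrable_bounded[where B=1]) (auto simp: norm_gauss)

lemma fourier_gauss:
  assumes a: "a > 0"
  shows "fourier_integral (gauss a y) \<xi>
    = of_real (sqrt (pi / a) ^ 3) * (cis (- 2 * pi * (y \<bullet> \<xi>)) * gauss (pi\<^sup>2 / a) 0 \<xi>)"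
proof -
  let ?f = "\<lambda>x. cis (- 2 * pi * (x \<bullet> \<xi>)) * gauss a y x"
  have "fourier_integral (gauss a y) \<xi> = (\<integral>x. ?f (y + x) \<partial>lborel)"
    unfolding fourier_integral_def by (rule integral_translate[symmetric]) measurable
  also have "\<dots> = (\<integral>x. cis (- 2 * pi * (y \<bullet> \<xi>)) * (cis (x \<bullet> (- 2 * pi) *\<^sub>R \<xi>) * gauss a 0 x) \<partial>lborel)"
  proof (intro Bochner_Integration.integral_cong refl)
    fix x
    have "cis (- 2 * pi * ((y + x) \<bullet> \<xi>)) = cis (- 2 * pi * (y \<bullet> \<xi>)) * cis (x \<bullet> (- 2 * pi) *\<^sub>R \<xi>)"
      by (simp add: cis_mult inner_add_left algebra_simps)
    then show "?f (y + x) = cis (- 2 * pi * (y \<bullet> \<xi>)) * (cis (x \<bullet> (- 2 * pi) *\<^sub>R \<xi>) * gauss a 0 x)"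
      by (simp add: gauss_def)
  qed
  also have "\<dots> = cis (- 2 * pi * (y \<bullet> \<xi>)) * of_real (sqrt (pi / a) ^ 3 * exp (- (norm ((- 2 * pi) *\<^sub>R \<xi>))\<^sup>2 / (4 * a)))"
    using gaussian_integral[OF a, of "(- 2 * pi) *\<^sub>R \<xi>"] by (simp add: has_bochner_integral_iff)
  also have "- (norm ((- 2 * pi) *\<^sub>R \<xi>))\<^sup>2 / (4 * a) = - (pi\<^sup>2 / a) * (norm \<xi>)\<^sup>2"
    using a by (simp add: power_mult_distrib field_simps)
  finally show ?thesis by (simp add: gauss_def[of _ 0] mult_ac)
qed

lemma fourier_modulate:
  "fourier_integral (\<lambda>x. cis (- 2 * pi * (x \<bullet> \<zeta>)) * \<phi> x) \<xi> = fourier_integral \<phi> (\<xi> + \<zeta>)"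
  unfolding fourier_integral_def
  by (simp add: mult.assoc[symmetric] cis_mult inner_add_right ring_distribs)

text \<open>With \<open>b = pi\<^sup>2 / a\<close> one has \<open>a = pi\<^sup>2 / b\<close>, and
  the constants \<open>sqrt (pi / a)\<close> and \<open>sqrt (pi / b)\<close> are inverse to each
  other. Fourier inversion on Gaussians is therefore a computation.\<close>

lemma
  assumes a: "a > 0"
  shows integrable_fourier_gauss: "integrable lborel (fourier_integral (gauss a y))"
    and square_integrable_fourier_gauss: "square_integrable (fourier_integral (gauss a y))"
    and fourier_fourier_gauss: "fourier_integral (fourier_integral (gauss a y)) x = gauss a y (- x)"
proof -
  let ?b = "pi\<^sup>2 / a"
  have b: "?b > 0" using a by simp
  have eq: "fourier_integral (gauss a y) = (\<lambda>\<xi>. of_real (sqrt (pi / a) ^ 3) * (cis (- 2 * pi * (\<xi> \<bullet> y)) * gauss ?b 0 \<xi>))"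
    using fourier_gauss[OF a, of y] by (simp add: fun_eq_iff inner_commute)
  show "integrable lborel (fourier_integral (gauss a y))" unfolding eq
    using b by (intro integrable_mult_right fourier_integrand_integrable) auto
  show "square_integrable (fourier_integral (gauss a y))" unfolding eq
    using b by (intro square_integrable_cmult square_integrable_cis) auto
  have "fourier_integral (fourier_integral (gauss a y)) x
    = of_real (sqrt (pi / a) ^ 3) * fourier_integral (\<lambda>\<xi>. cis (- 2 * pi * (\<xi> \<bullet> y)) * gauss ?b 0 \<xi>) x"
    unfolding eq fourier_integral_cmult ..
  also have "\<dots> = of_real (sqrt (pi / a) ^ 3) * fourier_integral (gauss ?b 0) (x + y)"
    unfolding fourier_modulate ..
  also have "\<dots> = of_real ((sqrt (pi / a) * sqrt (pi / ?b)) ^ 3) * gauss (pi\<^sup>2 / ?b) 0 (x + y)"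
    unfolding fourier_gauss[OF b] by (simp add: power_mult_distrib)
  also have "sqrt (pi / a) * sqrt (pi / ?b) = 1"
    using a by (simp add: real_sqrt_mult[symmetric] power2_eq_square)
  also have "pi\<^sup>2 / ?b = a" using a by simp
  also have "gauss a 0 (x + y) = gauss a y (- x)"
    using norm_minus_cancel[of "x + y"] by (simp add: gauss_def del: norm_minus_cancel)
  finally show "fourier_integral (fourier_integral (gauss a y)) x = gauss a y (- x)" by simp
qed

text \<open>The Gaussian regularisation of \<open>\<integral>|\<phi>^|\<^sup>2\<close> is paired with \<open>\<phi>\<close> through the multiplication
  formula; the transform of the regularised factor is a convolution with a probability density,
  so that Young's inequality bounds it by the norm of \<open>\<phi>\<close>.\<close>

lemma
  assumes i: "integrable lborel \<phi>" and s: "square_integrable \<phi>"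
  shows square_integrable_fourier: "square_integrable (fourier_integral \<phi>)"
    and L2n_fourier_integral_le: "L2n (fourier_integral \<phi>) \<le> L2n \<phi>"
proof -
  note [measurable] = square_integrable_borel[OF s]
  have reg: "(\<integral>\<^sup>+\<xi>. ennreal ((norm (fourier_integral \<phi> \<xi>))\<^sup>2 * exp (- a * (norm \<xi>)\<^sup>2)) \<partial>lborel) \<le> ennreal ((L2n \<phi>)\<^sup>2)"
    if a: "a > 0" for a
  proof -
    define k where "k \<xi> = gauss a 0 \<xi> * cnj (fourier_integral \<phi> \<xi>)" for \<xi>
    \<comment> \<open>The Fourier integral of \<open>gauss a 0\<close>. Its total mass is the value
      of that Gaussian at 0, namely 1.\<close>
    define K where "K z = sqrt (pi / a) ^ 3 * exp (- (pi\<^sup>2 / a) * (norm z)\<^sup>2)" for z :: "real^3"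
    have b: "pi\<^sup>2 / a > 0" using a by simp
    have [measurable]: "K \<in> borel_measurable borel" unfolding K_def by measurable
    have [simp]: "0 \<le> K z" for z using a by (simp add: K_def)
    have kint: "integrable lborel k"
    proof (rule Bochner_Integration.integrable_bound)
      show "integrable lborel (\<lambda>\<xi>. gauss a (0::real^3) \<xi> * of_real (\<integral>x. norm (\<phi> x) \<partial>lborel))"
        using a by simp
      show "AE x in lborel. norm (k x) \<le> norm (gauss a 0 x * of_real (\<integral>x. norm (\<phi> x) \<partial>lborel))"
        using mult_left_mono[OF order_trans[OF norm_fourier_integral_le abs_ge_self], of "norm (gauss a 0 _)" \<phi>]
        by (intro AE_I2) (simp add: k_def norm_mult)
    qed (simp add: k_def[abs_def])
    have Fk: "fourier_integral k x = (\<integral>y. K (x - y) *\<^sub>R cnj (\<phi> y) \<partial>lborel)" for x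
    proof -
      let ?F = "\<lambda>\<xi> y. (cis (- 2 * pi * (\<xi> \<bullet> x)) * gauss a 0 \<xi>) * (cis (2 * pi * (y \<bullet> \<xi>)) * cnj (\<phi> y))"
      have "integrable (lborel \<Otimes>\<^sub>M lborel) (case_prod ?F)"
        by (rule integrable_pair_bound[OF _ integrable_norm[OF gauss_integrable[OF a, of 0]] integrable_norm[OF i]])
           (auto simp: norm_mult)
      from lborel_pair.Fubini_integral[OF this]
      have "(\<integral>\<xi>. (\<integral>y. ?F \<xi> y \<partial>lborel) \<partial>lborel) = (\<integral>y. (\<integral>\<xi>. ?F \<xi> y \<partial>lborel) \<partial>lborel)" by simp
      also have "(\<integral>\<xi>. (\<integral>y. ?F \<xi> y \<partial>lborel) \<partial>lborel) = fourier_integral k x"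
      proof -
        have "cnj (fourier_integral \<phi> \<xi>) = (\<integral>y. cis (2 * pi * (y \<bullet> \<xi>)) * cnj (\<phi> y) \<partial>lborel)" for \<xi>
          unfolding fourier_integral_def by (subst Bochner_Integration.integral_cnj[symmetric]) (simp add: cis_cnj del: Bochner_Integration.integral_cnj)
        then show ?thesis by (simp add: fourier_integral_def[of k] k_def mult.assoc)
      qed
      also have "(\<integral>y. (\<integral>\<xi>. ?F \<xi> y \<partial>lborel) \<partial>lborel) = (\<integral>y. K (x - y) *\<^sub>R cnj (\<phi> y) \<partial>lborel)"
      proof (intro Bochner_Integration.integral_cong refl)
        fix y
        have "(\<integral>\<xi>. ?F \<xi> y \<partial>lborel) = (\<integral>\<xi>. (cis (- 2 * pi * (\<xi> \<bullet> (x - y))) * gauss a 0 \<xi>) * cnj (\<phi> y) \<partial>lborel)"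
        proof (intro Bochner_Integration.integral_cong refl)
          fix \<xi>
          have "cis (- 2 * pi * (\<xi> \<bullet> (x - y))) = cis (- 2 * pi * (\<xi> \<bullet> x)) * cis (2 * pi * (y \<bullet> \<xi>))"
            by (simp add: cis_mult inner_diff_right inner_commute algebra_simps)
          then show "?F \<xi> y = (cis (- 2 * pi * (\<xi> \<bullet> (x - y))) * gauss a 0 \<xi>) * cnj (\<phi> y)" by simp
        qed
        also have "\<dots> = fourier_integral (gauss a 0) (x - y) * cnj (\<phi> y)"
          by (simp add: fourier_integral_def)
        also have "\<dots> = K (x - y) *\<^sub>R cnj (\<phi> y)"
          by (subst fourier_gauss[OF a]) (simp add: K_def gauss_def scaleR_conv_of_real)
        finally show "(\<integral>\<xi>. ?F \<xi> y \<partial>lborel) = K (x - y) *\<^sub>R cnj (\<phi> y)" .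
      qed
      finally show ?thesis .
    qed
    have Kint: "(\<integral>\<^sup>+y. ennreal (K y) \<partial>lborel) = 1"
    proof -
      have "has_bochner_integral lborel (\<lambda>z::real^3. complex_of_real (K z)) (of_real (sqrt (pi / a) ^ 3 * sqrt (pi / (pi\<^sup>2 / a)) ^ 3))"
        using has_bochner_integral_mult_right[OF gaussian_integral[OF b, of "0::real^3"], of "of_real (sqrt (pi / a) ^ 3)"]
        by (simp add: K_def gauss_def)
      moreover have "sqrt (pi / a) ^ 3 * sqrt (pi / (pi\<^sup>2 / a)) ^ 3 = 1"
        using a by (simp add: power_mult_distrib[symmetric] real_sqrt_mult[symmetric] power2_eq_square)
      ultimately have hb: "has_bochner_integral lborel (\<lambda>z. complex_of_real (K z)) 1" by (simp only: of_real_1)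
      then have "integrable lborel K"
        by (simp only: has_bochner_integral_iff complex_of_real_integrable_eq)
      moreover have "complex_of_real (integral\<^sup>L lborel K) = 1"
        using hb by (simp only: has_bochner_integral_iff integral_complex_of_real)
      ultimately show ?thesis
        by (subst nn_integral_eq_integral) auto
    qed
    have "(\<integral>\<^sup>+x. ennreal ((norm (fourier_integral k x))\<^sup>2) \<partial>lborel) \<le> ennreal ((L2n \<phi>)\<^sup>2)"
      using nn_integral_conv_sq_le_kernel[of K "\<lambda>y. cnj (\<phi> y)"]
      by (simp add: Fk Kint nn_integral_L2n[OF s])
    from square_integrableI_nn[OF _ this]
    have Fks: "square_integrable (fourier_integral k)" and Fkn: "L2n (fourier_integral k) \<le> L2n \<phi>"
      using kint by auto
    have "complex_of_real (\<integral>\<xi>. (norm (fourier_integral \<phi> \<xi>))\<^sup>2 * exp (- a * (norm \<xi>)\<^sup>2) \<partial>lborel)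
      = (\<integral>\<xi>. fourier_integral \<phi> \<xi> * k \<xi> \<partial>lborel)"
      unfolding integral_complex_of_real[symmetric]
      by (intro Bochner_Integration.integral_cong refl)
         (simp only: k_def gauss_def of_real_mult complex_norm_square diff_zero mult_ac)
    also have "\<dots> = (\<integral>x. \<phi> x * fourier_integral k x \<partial>lborel)"
      by (rule fourier_multiplication_formula[OF i kint, symmetric])
    finally have "norm (complex_of_real (\<integral>\<xi>. (norm (fourier_integral \<phi> \<xi>))\<^sup>2 * exp (- a * (norm \<xi>)\<^sup>2) \<partial>lborel))
      = norm (\<integral>x. \<phi> x * fourier_integral k x \<partial>lborel)"
      by (rule arg_cong)
    also have "\<dots> \<le> L2n \<phi> * L2n (fourier_integral k)" by (rule norm_integral_mult_le[OF s Fks])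
    also have "\<dots> \<le> L2n \<phi> * L2n \<phi>" by (intro mult_left_mono Fkn) simp
    finally have le: "(\<integral>\<xi>. (norm (fourier_integral \<phi> \<xi>))\<^sup>2 * exp (- a * (norm \<xi>)\<^sup>2) \<partial>lborel) \<le> (L2n \<phi>)\<^sup>2"
      unfolding norm_of_real power2_eq_square[of "L2n \<phi>"] by (rule order_trans[OF abs_ge_self])
    have "integrable lborel (\<lambda>\<xi>. (norm (fourier_integral \<phi> \<xi>))\<^sup>2 * exp (- a * (norm \<xi>)\<^sup>2))"
    proof (rule Bochner_Integration.integrable_bound)
      show "integrable lborel (\<lambda>\<xi>. (\<integral>x. norm (\<phi> x) \<partial>lborel)\<^sup>2 * exp (- a * (norm (\<xi> - 0 :: real^3))\<^sup>2))"
        using a by (intro integrable_mult_right exp_norm_integrable)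
      show "AE x in lborel. norm ((norm (fourier_integral \<phi> x))\<^sup>2 * exp (- a * (norm x)\<^sup>2))
          \<le> norm ((\<integral>x. norm (\<phi> x) \<partial>lborel)\<^sup>2 * exp (- a * (norm (x - 0))\<^sup>2))"
        using norm_fourier_integral_le[of \<phi>]
        by (intro AE_I2) (auto simp: abs_mult intro!: mult_right_mono power_mono)
    qed measurable
    then show ?thesis using le by (subst nn_integral_eq_integral) auto
  qed
  \<comment> \<open>The bound \<open>reg\<close> does not depend on \<open>a\<close>, so Fatou's
    lemma along \<open>a = 1 / Suc n\<close> removes the regularisation.\<close>
  have "(\<integral>\<^sup>+\<xi>. ennreal ((norm (fourier_integral \<phi> \<xi>))\<^sup>2) \<partial>lborel)
    = (\<integral>\<^sup>+\<xi>. liminf (\<lambda>n. ennreal ((norm (fourier_integral \<phi> \<xi>))\<^sup>2 * exp (- (1 / real (Suc n)) * (norm \<xi>)\<^sup>2))) \<partial>lborel)"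
  proof (intro nn_integral_cong)
    fix \<xi> :: "real^3"
    have "(\<lambda>n. 1 / real (Suc n)) \<longlonglongrightarrow> 0"
      using LIMSEQ_inverse_real_of_nat by (simp add: inverse_eq_divide)
    then have "(\<lambda>n. ennreal ((norm (fourier_integral \<phi> \<xi>))\<^sup>2 * exp (- (1 / real (Suc n)) * (norm \<xi>)\<^sup>2)))
      \<longlonglongrightarrow> ennreal ((norm (fourier_integral \<phi> \<xi>))\<^sup>2 * exp (- 0 * (norm \<xi>)\<^sup>2))"
      by (intro tendsto_intros)
    from lim_imp_Liminf[OF _ this]
    show "ennreal ((norm (fourier_integral \<phi> \<xi>))\<^sup>2)
      = liminf (\<lambda>n. ennreal ((norm (fourier_integral \<phi> \<xi>))\<^sup>2 * exp (- (1 / real (Suc n)) * (norm \<xi>)\<^sup>2)))"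
      by simp
  qed
  also have "\<dots> \<le> liminf (\<lambda>n. \<integral>\<^sup>+\<xi>. ennreal ((norm (fourier_integral \<phi> \<xi>))\<^sup>2 * exp (- (1 / real (Suc n)) * (norm \<xi>)\<^sup>2)) \<partial>lborel)"
    by (rule nn_integral_liminf) measurable
  also have "\<dots> \<le> limsup (\<lambda>n. \<integral>\<^sup>+\<xi>. ennreal ((norm (fourier_integral \<phi> \<xi>))\<^sup>2 * exp (- (1 / real (Suc n)) * (norm \<xi>)\<^sup>2)) \<partial>lborel)"
    by (rule Liminf_le_Limsup) simp
  also have "\<dots> \<le> ennreal ((L2n \<phi>)\<^sup>2)"
    by (intro Limsup_bounded always_eventually allI reg) simp
  finally show "square_integrable (fourier_integral \<phi>)" "L2n (fourier_integral \<phi>) \<le> L2n \<phi>"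
    by (auto intro: square_integrableI_nn)
qed


text \<open>The Plancherel transform as a relation: \<open>f\<close> determines \<open>g\<close> up to null sets.\<close>

definition L2_fourier :: "(real^3 \<Rightarrow> complex) \<Rightarrow> (real^3 \<Rightarrow> complex) \<Rightarrow> bool" where
  "L2_fourier f g \<longleftrightarrow> square_integrable f \<and> square_integrable g \<and>
     (\<forall>\<phi>. integrable lborel \<phi> \<and> square_integrable \<phi> \<longrightarrow>
       (\<integral>x. f x * fourier_integral \<phi> x \<partial>lborel) = (\<integral>\<xi>. g \<xi> * \<phi> \<xi> \<partial>lborel))"

lemma L2_fourierD:
  assumes "L2_fourier f g"
  shows "square_integrable f" "square_integrable g"
    and "\<And>\<phi>. integrable lborel \<phi> \<Longrightarrow> square_integrable \<phi> \<Longrightarrow>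
       (\<integral>x. f x * fourier_integral \<phi> x \<partial>lborel) = (\<integral>\<xi>. g \<xi> * \<phi> \<xi> \<partial>lborel)"
  using assms by (auto simp: L2_fourier_def)

lemma L2_fourier_fourier_integral:
  assumes "integrable lborel f" "square_integrable f"
  shows "L2_fourier f (fourier_integral f)"
  using assms by (auto simp: L2_fourier_def square_integrable_fourier fourier_multiplication_formula)

text \<open>An L2 function cut off to a ball is also in L1, where the transform is an ordinary
  integral.\<close>

definition truncate_ball :: "nat \<Rightarrow> (real^3 \<Rightarrow> complex) \<Rightarrow> real^3 \<Rightarrow> complex" where
  "truncate_ball n f x = of_real (indicator (ball 0 (real n)) x) * f x"

lemma truncate_ball_measurable [measurable]:
  assumes [measurable]: "f \<in> borel_measurable borel"
  shows "truncate_ball n f \<in> borel_measurable borel"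
proof -
  have [measurable]: "ball (0::real^3) (real n) \<in> sets borel" by simp
  show ?thesis unfolding truncate_ball_def by measurable
qed

lemma
  assumes s: "square_integrable f"
  shows integrable_truncate_ball: "integrable lborel (truncate_ball n f)"
    and square_integrable_truncate_ball: "square_integrable (truncate_ball n f)"
    and truncate_ball_tendsto: "(\<lambda>n. \<integral>\<^sup>+x. ennreal ((norm (truncate_ball n f x - f x))\<^sup>2) \<partial>lborel) \<longlonglongrightarrow> 0"
proof -
  note [measurable] = square_integrable_borel[OF s]
  have i: "integrable lborel (\<lambda>x. (norm (f x))\<^sup>2)" using s by (simp add: square_integrable_def)
  show "integrable lborel (truncate_ball n f)"
  proof (rule Bochner_Integration.integrable_bound)
    show "integrable lborel (\<lambda>x. indicator (ball 0 (real n)) x + (norm (f x))\<^sup>2)"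
      using i emeasure_lborel_ball_finite[of "0::real^3" "real n"]
      by (intro Bochner_Integration.integrable_add integrable_real_indicator) auto
    have "norm (f x) \<le> 1 + (norm (f x))\<^sup>2" for x
      using zero_le_power2[of "norm (f x) - 1/2"] by (simp add: power2_eq_square algebra_simps)
    then show "AE x in lborel. norm (truncate_ball n f x) \<le> norm (indicator (ball 0 (real n)) x + (norm (f x))\<^sup>2)"
      by (intro AE_I2) (auto simp: truncate_ball_def indicator_def)
  qed simp
  have le: "norm (truncate_ball n f x) \<le> norm (f x)" for n x
    by (auto simp: truncate_ball_def indicator_def)
  show "square_integrable (truncate_ball n f)"
    unfolding square_integrable_def
    by (auto intro!: Bochner_Integration.integrable_bound[OF i] AE_I2 power_mono le)
  have "(\<lambda>n. \<integral>\<^sup>+x. ennreal ((norm (truncate_ball n f x - f x))\<^sup>2) \<partial>lborel) \<longlonglongrightarrow> (\<integral>\<^sup>+x. 0 \<partial>(lborel :: (real^3) measure))"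
  proof (rule nn_integral_dominated_convergence[where w="\<lambda>x. ennreal ((norm (f x))\<^sup>2)"])
    show "AE x in lborel. ennreal ((norm (truncate_ball j f x - f x))\<^sup>2) \<le> ennreal ((norm (f x))\<^sup>2)" for j
      by (auto simp: truncate_ball_def indicator_def)
    show "AE x in lborel. (\<lambda>i. ennreal ((norm (truncate_ball i f x - f x))\<^sup>2)) \<longlonglongrightarrow> 0"
    proof (rule AE_I2, rule tendsto_eventually)
      fix x :: "real^3"
      obtain N :: nat where "norm x < real N" using reals_Archimedean2 by blast
      then show "\<forall>\<^sub>F i in sequentially. ennreal ((norm (truncate_ball i f x - f x))\<^sup>2) = 0"
        by (auto simp: eventually_sequentially truncate_ball_def intro!: exI[of _ N])
    qed
    show "(\<integral>\<^sup>+ x. ennreal ((norm (f x))\<^sup>2) \<partial>lborel) < \<infinity>"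
      using nn_integral_L2n[OF s] by simp
  qed measurable
  then show "(\<lambda>n. \<integral>\<^sup>+x. ennreal ((norm (truncate_ball n f x - f x))\<^sup>2) \<partial>lborel) \<longlonglongrightarrow> 0" by simp
qed

lemma tendsto_integral_mult_L2:
  fixes g h :: "real^3 \<Rightarrow> complex"
  assumes s: "\<And>n. square_integrable (f n)" "square_integrable g" "square_integrable h"
    and lim: "(\<lambda>n. \<integral>\<^sup>+x. ennreal ((norm (f n x - g x))\<^sup>2) \<partial>lborel) \<longlonglongrightarrow> 0"
  shows "(\<lambda>n. \<integral>x. f n x * h x \<partial>lborel) \<longlonglongrightarrow> (\<integral>x. g x * h x \<partial>lborel)"
proof -
  have d: "square_integrable (\<lambda>x. f n x - g x)" for n by (intro square_integrable_diff s)
  have "(\<lambda>n. (L2n (\<lambda>x. f n x - g x))\<^sup>2) \<longlonglongrightarrow> 0"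
    using lim unfolding nn_integral_L2n[OF d] by (simp add: tendsto_ennreal_iff[of _ _ 0, simplified] ennreal_0[symmetric] del: ennreal_0)
  from tendsto_real_sqrt[OF this] have "(\<lambda>n. L2n (\<lambda>x. f n x - g x)) \<longlonglongrightarrow> 0" by simp
  from tendsto_mult_left_zero[OF this] have z: "(\<lambda>n. L2n (\<lambda>x. f n x - g x) * L2n h) \<longlonglongrightarrow> 0" .
  have "(\<lambda>n. (\<integral>x. f n x * h x \<partial>lborel) - (\<integral>x. g x * h x \<partial>lborel)) \<longlonglongrightarrow> 0"
  proof (rule Lim_null_comparison[OF _ z], rule always_eventually, rule allI)
    fix n
    show "norm ((\<integral>x. f n x * h x \<partial>lborel) - (\<integral>x. g x * h x \<partial>lborel)) \<le> L2n (\<lambda>x. f n x - g x) * L2n h"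
      using norm_integral_mult_le[OF d s(3), of n] s
      by (simp add: left_diff_distrib square_integrable_mult)
  qed
  then show ?thesis by (simp add: LIM_zero_iff)
qed

lemma L2n_diff_sq_le:
  assumes u: "square_integrable u" and v: "square_integrable v" and w: "square_integrable w"
  shows "(L2n (\<lambda>x. u x - v x))\<^sup>2 \<le> 2 * (L2n (\<lambda>x. u x - w x))\<^sup>2 + 2 * (L2n (\<lambda>x. v x - w x))\<^sup>2"
proof -
  have i: "integrable lborel (\<lambda>x. (norm (u x - v x))\<^sup>2)" "integrable lborel (\<lambda>x. (norm (u x - w x))\<^sup>2)"
    "integrable lborel (\<lambda>x. (norm (v x - w x))\<^sup>2)"
    using square_integrable_diff[OF u v] square_integrable_diff[OF u w] square_integrable_diff[OF v w]
    by (simp_all add: square_integrable_def)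
  have "(\<integral>x. (norm (u x - v x))\<^sup>2 \<partial>lborel) \<le> (\<integral>x. 2 * (norm (u x - w x))\<^sup>2 + 2 * (norm (v x - w x))\<^sup>2 \<partial>lborel)"
  proof (rule integral_mono)
    fix x
    show "(norm (u x - v x))\<^sup>2 \<le> 2 * (norm (u x - w x))\<^sup>2 + 2 * (norm (v x - w x))\<^sup>2"
      using norm_sq_le[of "u x - w x" "w x - v x"] by (simp add: norm_minus_commute[of "w x"])
  qed (use i in auto)
  then show ?thesis using i by (simp add: L2n_sq)
qed

text \<open>The truncations converge to \<open>f\<close> in L2. Since the Fourier integral does not
  increase the norm, their transforms form a Cauchy sequence; its limit inherits the defining
  identity, both sides of which are continuous in L2.\<close>

lemma L2_fourier_exists:
  assumes s: "square_integrable f"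
  obtains g where "L2_fourier f g"
proof -
  let ?f = "\<lambda>n. truncate_ball n f"
  let ?N = "\<lambda>u. \<integral>\<^sup>+x. ennreal ((norm (u x :: complex))\<^sup>2) \<partial>(lborel :: (real^3) measure)"
  note [measurable] = square_integrable_borel[OF s] square_integrable_borel[OF square_integrable_truncate_ball[OF s]]
  note ti = integrable_truncate_ball[OF s] and ts = square_integrable_truncate_ball[OF s]
  have "\<exists>N. \<forall>m\<ge>N. \<forall>n\<ge>N. ?N (\<lambda>x. fourier_integral (?f m) x - fourier_integral (?f n) x) < ennreal e" if e: "e > 0" for e
  proof -
    have ds': "square_integrable (\<lambda>x. ?f n x - f x)" for n by (intro square_integrable_diff ts s)
    have "\<forall>\<^sub>F n in sequentially. ?N (\<lambda>x. ?f n x - f x) < ennreal (e/4)"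
      using order_tendstoD(2)[OF truncate_ball_tendsto[OF s], of "ennreal (e/4)"] e by simp
    then obtain N where N: "\<And>n. n \<ge> N \<Longrightarrow> (L2n (\<lambda>x. ?f n x - f x))\<^sup>2 < e / 4"
      unfolding nn_integral_L2n[OF ds'] by (auto simp: eventually_sequentially ennreal_less_iff)
    have "?N (\<lambda>x. fourier_integral (?f m) x - fourier_integral (?f n) x) < ennreal e" if mn: "m \<ge> N" "n \<ge> N" for m n
    proof -
      have di: "integrable lborel (\<lambda>x. ?f m x - ?f n x)" and ds: "square_integrable (\<lambda>x. ?f m x - ?f n x)"
        by (intro Bochner_Integration.integrable_diff ti square_integrable_diff ts)+
      have "?N (\<lambda>x. fourier_integral (?f m) x - fourier_integral (?f n) x)
        = ?N (fourier_integral (\<lambda>x. ?f m x - ?f n x))"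
        by (simp add: fourier_integral_diff ti)
      also have "\<dots> = ennreal ((L2n (fourier_integral (\<lambda>x. ?f m x - ?f n x)))\<^sup>2)"
        by (rule nn_integral_L2n[OF square_integrable_fourier[OF di ds]])
      also have "\<dots> < ennreal e"
      proof (rule ennreal_lessI[OF e])
        have "(L2n (fourier_integral (\<lambda>x. ?f m x - ?f n x)))\<^sup>2 \<le> (L2n (\<lambda>x. ?f m x - ?f n x))\<^sup>2"
          by (intro power_mono L2n_fourier_integral_le di ds) simp
        also have "\<dots> \<le> 2 * (L2n (\<lambda>x. ?f m x - f x))\<^sup>2 + 2 * (L2n (\<lambda>x. ?f n x - f x))\<^sup>2"
          by (rule L2n_diff_sq_le[OF ts ts s])
        also have "\<dots> < e" using N[OF mn(1)] N[OF mn(2)] by linarith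
        finally show "(L2n (fourier_integral (\<lambda>x. ?f m x - ?f n x)))\<^sup>2 < e" .
      qed
      finally show ?thesis .
    qed
    then show ?thesis by blast
  qed
  then obtain g where g[measurable]: "g \<in> borel_measurable lborel"
    and lim: "(\<lambda>n. ?N (\<lambda>x. fourier_integral (?f n) x - g x)) \<longlonglongrightarrow> 0"
    by (rule riesz_fischer_L2[of "\<lambda>n. fourier_integral (?f n)" lborel, rotated]) auto
  note fs = square_integrable_fourier[OF ti ts]
  have gs: "square_integrable g"
  proof -
    obtain n where n: "?N (\<lambda>x. fourier_integral (?f n) x - g x) < 1"
      using order_tendstoD(2)[OF lim, of 1] by (auto simp: eventually_sequentially)
    have "square_integrable (\<lambda>x. fourier_integral (?f n) x - g x)"
      by (rule square_integrableI_nn[where C=1]) (use n in \<open>auto intro: less_imp_le\<close>)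
    from square_integrable_diff[OF fs this, of n] show ?thesis by simp
  qed
  have "L2_fourier f g"
    unfolding L2_fourier_def
  proof (intro conjI allI impI s gs, elim conjE)
    fix \<phi> :: "real^3 \<Rightarrow> complex" assume p: "integrable lborel \<phi>" "square_integrable \<phi>"
    have "(\<lambda>n. \<integral>x. ?f n x * fourier_integral \<phi> x \<partial>lborel) \<longlonglongrightarrow> (\<integral>x. f x * fourier_integral \<phi> x \<partial>lborel)"
      by (intro tendsto_integral_mult_L2 ts s square_integrable_fourier p truncate_ball_tendsto)
    moreover have "(\<lambda>n. \<integral>x. ?f n x * fourier_integral \<phi> x \<partial>lborel) \<longlonglongrightarrow> (\<integral>x. g x * \<phi> x \<partial>lborel)"
      unfolding fourier_multiplication_formula[OF ti p(1)]
      by (intro tendsto_integral_mult_L2 fs gs p lim)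
    ultimately show "(\<integral>x. f x * fourier_integral \<phi> x \<partial>lborel) = (\<integral>x. g x * \<phi> x \<partial>lborel)"
      by (rule LIMSEQ_unique)
  qed
  then show ?thesis by (rule that)
qed

lemma gauss_test_eq:
  fixes f g :: "real^3 \<Rightarrow> complex"
  assumes [measurable]: "f \<in> borel_measurable borel" "g \<in> borel_measurable borel"
    and int: "\<And>a y. a > 0 \<Longrightarrow> integrable lborel (\<lambda>x. f x * gauss a y x)" "\<And>a y. a > 0 \<Longrightarrow> integrable lborel (\<lambda>x. g x * gauss a y x)"
    and eq: "\<And>a y. a > 0 \<Longrightarrow> (\<integral>x. f x * gauss a y x \<partial>lborel) = (\<integral>x. g x * gauss a y x \<partial>lborel)"
  shows "AE x in lborel. f x = g x"
proof -
  have "AE x in lborel. f x - g x = 0"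
    by (rule gauss_test_zero) (use int eq in \<open>auto simp: left_diff_distrib\<close>)
  then show ?thesis by simp
qed

lemma L2_fourier_unique:
  assumes f: "L2_fourier f g" and h: "L2_fourier f h"
  shows "AE x in lborel. g x = h x"
  using f h by (intro gauss_test_eq)
    (auto dest: L2_fourierD(1,2) intro!: square_integrable_mult
      simp: L2_fourierD(3)[OF f, symmetric] L2_fourierD(3)[OF h, symmetric])

lemma L2_fourier_cong:
  assumes f: "L2_fourier f g" and eq: "AE x in lborel. f x = f' x" "AE x in lborel. g x = g' x"
    and [measurable]: "f' \<in> borel_measurable borel" "g' \<in> borel_measurable borel"
  shows "L2_fourier f' g'"
proof -
  note [measurable] = square_integrable_borel[OF L2_fourierD(1)[OF f]] square_integrable_borel[OF L2_fourierD(2)[OF f]]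
  have "integrable lborel (\<lambda>x. (norm (f x))\<^sup>2) \<longleftrightarrow> integrable lborel (\<lambda>x. (norm (f' x))\<^sup>2)"
    by (rule integrable_cong_AE) (use eq in \<open>auto elim: eventually_mono\<close>)
  moreover have "integrable lborel (\<lambda>x. (norm (g x))\<^sup>2) \<longleftrightarrow> integrable lborel (\<lambda>x. (norm (g' x))\<^sup>2)"
    by (rule integrable_cong_AE) (use eq in \<open>auto elim: eventually_mono\<close>)
  moreover have "(\<integral>x. f' x * fourier_integral \<phi> x \<partial>lborel) = (\<integral>\<xi>. g' \<xi> * \<phi> \<xi> \<partial>lborel)"
    if p: "integrable lborel \<phi>" "square_integrable \<phi>" for \<phi>
  proof -
    note [measurable] = square_integrable_borel[OF p(2)]
    have "(\<integral>x. f' x * fourier_integral \<phi> x \<partial>lborel) = (\<integral>x. f x * fourier_integral \<phi> x \<partial>lborel)"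
      by (rule integral_cong_AE) (use eq in \<open>auto elim: eventually_mono\<close>)
    also have "\<dots> = (\<integral>x. g x * \<phi> x \<partial>lborel)" by (rule L2_fourierD(3)[OF f p])
    also have "\<dots> = (\<integral>x. g' x * \<phi> x \<partial>lborel)"
      by (rule integral_cong_AE) (use eq in \<open>auto elim: eventually_mono\<close>)
    finally show ?thesis .
  qed
  ultimately show ?thesis using f by (auto simp: L2_fourier_def square_integrable_def)
qed

text \<open>By duality: test against the conjugated truncations of \<open>g\<close>.\<close>

lemma L2_fourier_le:
  assumes f: "L2_fourier f g" shows "L2n g \<le> L2n f"
proof (rule square_integrableI_nn(2))
  note s = L2_fourierD(1,2)[OF f]
  show gm[measurable]: "g \<in> borel_measurable borel" using s by auto
  have tr: "L2n (truncate_ball n g) \<le> L2n f" for n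
  proof -
    define \<phi> where "\<phi> x = cnj (truncate_ball n g x)" for x
    have nphi: "norm (\<phi> x) = norm (truncate_ball n g x)" for x by (simp add: \<phi>_def)
    have [measurable]: "\<phi> \<in> borel_measurable borel"
      unfolding \<phi>_def by measurable
    have pi: "integrable lborel \<phi>"
      using integrable_truncate_ball[OF s(2), of n] unfolding \<phi>_def by simp
    have ps: "square_integrable \<phi>"
      using square_integrable_truncate_ball[OF s(2), of n] by (simp add: square_integrable_def nphi)
    have Lp: "L2n \<phi> = L2n (truncate_ball n g)" by (simp add: L2n_def nphi)
    have "complex_of_real ((L2n (truncate_ball n g))\<^sup>2) = (\<integral>x. of_real ((norm (truncate_ball n g x))\<^sup>2) \<partial>lborel)"
      by (simp add: L2n_sq del: of_real_power)
    also have "\<dots> = (\<integral>x. g x * \<phi> x \<partial>lborel)"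
      by (intro Bochner_Integration.integral_cong refl)
         (auto simp: \<phi>_def truncate_ball_def indicator_def complex_norm_square simp del: of_real_power)
    also have "\<dots> = (\<integral>x. f x * fourier_integral \<phi> x \<partial>lborel)" by (rule L2_fourierD(3)[OF f pi ps, symmetric])
    finally have "norm (complex_of_real ((L2n (truncate_ball n g))\<^sup>2)) = norm (\<integral>x. f x * fourier_integral \<phi> x \<partial>lborel)"
      by (rule arg_cong)
    then have "(L2n (truncate_ball n g))\<^sup>2 = norm (\<integral>x. f x * fourier_integral \<phi> x \<partial>lborel)"
      by (simp only: norm_of_real abs_power2)
    also have "\<dots> \<le> L2n f * L2n (fourier_integral \<phi>)"
      by (intro norm_integral_mult_le s square_integrable_fourier pi ps)
    also have "\<dots> \<le> L2n f * L2n \<phi>"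
      by (intro mult_left_mono L2n_fourier_integral_le pi ps) simp
    finally have "L2n (truncate_ball n g) * L2n (truncate_ball n g) \<le> L2n f * L2n (truncate_ball n g)"
      by (simp add: Lp power2_eq_square)
    then show ?thesis
      using L2n_nonneg[of "truncate_ball n g"] L2n_nonneg[of f]
      by (cases "L2n (truncate_ball n g) = 0") (auto simp: mult_le_cancel_right)
  qed
  have "(\<integral>\<^sup>+x. ennreal ((norm (g x))\<^sup>2) \<partial>lborel) = (\<integral>\<^sup>+x. liminf (\<lambda>n. ennreal ((norm (truncate_ball n g x))\<^sup>2)) \<partial>lborel)"
  proof (intro nn_integral_cong)
    fix x :: "real^3"
    obtain N :: nat where "norm x < real N" using reals_Archimedean2 by blast
    then have "(\<lambda>n. ennreal ((norm (truncate_ball n g x))\<^sup>2)) \<longlonglongrightarrow> ennreal ((norm (g x))\<^sup>2)"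
      by (intro tendsto_eventually) (auto simp: eventually_sequentially truncate_ball_def intro!: exI[of _ N])
    from lim_imp_Liminf[OF _ this]
    show "ennreal ((norm (g x))\<^sup>2) = liminf (\<lambda>n. ennreal ((norm (truncate_ball n g x))\<^sup>2))" by simp
  qed
  also have "\<dots> \<le> liminf (\<lambda>n. \<integral>\<^sup>+x. ennreal ((norm (truncate_ball n g x))\<^sup>2) \<partial>lborel)"
    by (rule nn_integral_liminf) measurable
  also have "\<dots> \<le> limsup (\<lambda>n. \<integral>\<^sup>+x. ennreal ((norm (truncate_ball n g x))\<^sup>2) \<partial>lborel)"
    by (rule Liminf_le_Limsup) simp
  also have "\<dots> \<le> ennreal ((L2n f)\<^sup>2)"
    by (intro Limsup_bounded always_eventually allI)
       (simp_all add: nn_integral_L2n square_integrable_truncate_ball s tr power_mono)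
  finally show "(\<integral>\<^sup>+x. ennreal ((norm (g x))\<^sup>2) \<partial>lborel) \<le> ennreal ((L2n f)\<^sup>2)" .
qed simp

lemma square_integrable_uminus_arg:
  fixes f :: "real^3 \<Rightarrow> 'a::euclidean_space"
  assumes "square_integrable f"
  shows "square_integrable (\<lambda>x. f (- x))" "L2n (\<lambda>x. f (- x)) = L2n f"
proof -
  note [measurable] = square_integrable_borel[OF assms]
  have m: "(\<lambda>x. (norm (f x))\<^sup>2) \<in> borel_measurable borel" by measurable
  show "square_integrable (\<lambda>x. f (- x))" "L2n (\<lambda>x. f (- x)) = L2n f"
    using assms integrable_reflect[OF m, of 0] integral_reflect_lborel[OF m, of 0]
    by (simp_all add: square_integrable_def L2n_def)
qed

text \<open>Inversion is explicit for Gaussians, and Gaussians separate functions.\<close>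

lemma L2_fourier_inverse:
  assumes f: "L2_fourier f g" shows "L2_fourier g (\<lambda>x. f (- x))"
proof -
  note s = L2_fourierD(1,2)[OF f]
  note [measurable] = square_integrable_borel[OF s(1)] square_integrable_borel[OF s(2)]
  obtain h where h: "L2_fourier g h" using L2_fourier_exists[OF s(2)] .
  note [measurable] = square_integrable_borel[OF L2_fourierD(2)[OF h]]
  have "AE x in lborel. h x = f (- x)"
  proof (rule gauss_test_eq)
    fix a :: real and y :: "real^3" assume a: "a > 0"
    show "integrable lborel (\<lambda>x. h x * gauss a y x)"
      using a L2_fourierD(2)[OF h] by (intro square_integrable_mult) auto
    show "integrable lborel (\<lambda>x. f (- x) * gauss a y x)"
      using a s by (intro square_integrable_mult square_integrable_uminus_arg) auto
    have "(\<integral>x. h x * gauss a y x \<partial>lborel) = (\<integral>x. g x * fourier_integral (gauss a y) x \<partial>lborel)"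
      using a by (intro L2_fourierD(3)[OF h, symmetric]) auto
    also have "\<dots> = (\<integral>x. f x * fourier_integral (fourier_integral (gauss a y)) x \<partial>lborel)"
      using a by (intro L2_fourierD(3)[OF f, symmetric] integrable_fourier_gauss square_integrable_fourier_gauss)
    also have "\<dots> = (\<integral>x. f (- (0 - x)) * gauss a y (0 - x) \<partial>lborel)"
      by (simp add: fourier_fourier_gauss[OF a])
    also have "\<dots> = (\<integral>x. f (- x) * gauss a y x \<partial>lborel)"
      by (rule integral_reflect_lborel[where f="\<lambda>x. f (- x) * gauss a y x"]) measurable
    finally show "(\<integral>x. h x * gauss a y x \<partial>lborel) = (\<integral>x. f (- x) * gauss a y x \<partial>lborel)" .
  qed measurable
  from L2_fourier_cong[OF h _ this] show ?thesis by simp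
qed

text \<open>The transform does not increase the norm. By inversion the same applies to
  \<open>g\<close>, whose transform is the reflection of \<open>f\<close> and has the norm of
  \<open>f\<close>.\<close>

theorem plancherel:
  assumes f: "L2_fourier f g" shows "L2n g = L2n f"
  using L2_fourier_le[OF f] L2_fourier_le[OF L2_fourier_inverse[OF f]]
    square_integrable_uminus_arg(2)[OF L2_fourierD(1)[OF f]] by simp

lemma L2_fourier_reflect:
  assumes f: "L2_fourier f g" shows "L2_fourier (\<lambda>x. f (- x)) (\<lambda>\<xi>. g (- \<xi>))"
  using L2_fourier_inverse[OF L2_fourier_inverse[OF f]] .

lemma L2_fourier_add:
  assumes f: "L2_fourier f g" and h: "L2_fourier f' g'"
  shows "L2_fourier (\<lambda>x. f x + f' x) (\<lambda>x. g x + g' x)"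
  using L2_fourierD[OF f] L2_fourierD[OF h]
  by (simp add: L2_fourier_def square_integrable_add distrib_right square_integrable_mult square_integrable_fourier)

lemma L2_fourier_cmult:
  assumes f: "L2_fourier f g"
  shows "L2_fourier (\<lambda>x. c * f x) (\<lambda>x. c * g x)"
  using L2_fourierD[OF f] by (simp add: L2_fourier_def square_integrable_cmult mult.assoc)

text \<open>Polarisation of the norm identity. On complex numbers \<bullet> is the real inner
  product, so this is the real part of the usual Hermitian formula.\<close>

theorem parseval:
  assumes f: "L2_fourier f g" and h: "L2_fourier f' g'"
  shows "(\<integral>x. f x \<bullet> f' x \<partial>lborel) = (\<integral>\<xi>. g \<xi> \<bullet> g' \<xi> \<partial>lborel)"
proof -
  have *: "(L2n (\<lambda>x. u x + v x))\<^sup>2 = (L2n u)\<^sup>2 + 2 * (\<integral>x. u x \<bullet> v x \<partial>lborel) + (L2n v)\<^sup>2"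
    if u: "square_integrable u" and v: "square_integrable v" for u v :: "real^3 \<Rightarrow> complex"
  proof -
    have "(norm (u x + v x))\<^sup>2 = (norm (u x))\<^sup>2 + 2 * (u x \<bullet> v x) + (norm (v x))\<^sup>2" for x
      by (simp add: power2_norm_eq_inner inner_add_left inner_add_right inner_commute)
    moreover have "integrable lborel (\<lambda>x. (norm (u x))\<^sup>2)" "integrable lborel (\<lambda>x. (norm (v x))\<^sup>2)"
      using u v by (simp_all add: square_integrable_def)
    ultimately show ?thesis using square_integrable_inner[OF u v] by (simp add: L2n_sq)
  qed
  show ?thesis
    using *[of f f'] *[of g g'] L2_fourierD(1,2)[OF f] L2_fourierD(1,2)[OF h]
      plancherel[OF f] plancherel[OF h] plancherel[OF L2_fourier_add[OF f h]] by simp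
qed

text \<open>Makes the transform of a product at one frequency accessible as a pairing of two L2
  functions.\<close>

lemma L2_fourier_modulate:
  assumes f: "L2_fourier f g"
  shows "L2_fourier (\<lambda>x. cis (2 * pi * (x \<bullet> \<zeta>)) * f x) (\<lambda>\<xi>. g (\<xi> - \<zeta>))"
proof -
  note s = L2_fourierD(1,2)[OF f]
  note [measurable] = square_integrable_borel[OF s(1)] square_integrable_borel[OF s(2)]
  have tr: "square_integrable (\<lambda>\<xi>. u (c + \<xi>))" if u: "square_integrable u" for u :: "real^3 \<Rightarrow> complex" and c
  proof -
    note [measurable] = square_integrable_borel[OF u]
    have m: "(\<lambda>x. (norm (u x))\<^sup>2) \<in> borel_measurable borel" by measurable
    show ?thesis using u integrable_translate[OF m, of c] by (simp add: square_integrable_def)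
  qed
  have "(\<integral>x. (cis (2 * pi * (x \<bullet> \<zeta>)) * f x) * fourier_integral \<phi> x \<partial>lborel) = (\<integral>\<xi>. g (\<xi> - \<zeta>) * \<phi> \<xi> \<partial>lborel)"
    if p: "integrable lborel \<phi>" "square_integrable \<phi>" for \<phi>
  proof -
    note [measurable] = square_integrable_borel[OF p(2)]
    have e: "fourier_integral (\<lambda>\<xi>. \<phi> (\<zeta> + \<xi>)) x = cis (2 * pi * (x \<bullet> \<zeta>)) * fourier_integral \<phi> x" for x
    proof -
      have "fourier_integral \<phi> x = (\<integral>\<xi>. cis (- 2 * pi * ((\<zeta> + \<xi>) \<bullet> x)) * \<phi> (\<zeta> + \<xi>) \<partial>lborel)"
        unfolding fourier_integral_def by (rule integral_translate[symmetric]) measurable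
      also have "\<dots> = (\<integral>\<xi>. cis (- 2 * pi * (\<zeta> \<bullet> x)) * (cis (- 2 * pi * (\<xi> \<bullet> x)) * \<phi> (\<zeta> + \<xi>)) \<partial>lborel)"
        by (intro Bochner_Integration.integral_cong refl)
           (simp add: mult.assoc[symmetric] cis_mult inner_add_left ring_distribs)
      also have "\<dots> = cis (- 2 * pi * (\<zeta> \<bullet> x)) * fourier_integral (\<lambda>\<xi>. \<phi> (\<zeta> + \<xi>)) x"
        by (simp add: fourier_integral_def)
      finally show ?thesis by (simp add: mult.assoc[symmetric] cis_mult inner_commute)
    qed
    have "(\<integral>x. (cis (2 * pi * (x \<bullet> \<zeta>)) * f x) * fourier_integral \<phi> x \<partial>lborel)
      = (\<integral>x. f x * fourier_integral (\<lambda>\<xi>. \<phi> (\<zeta> + \<xi>)) x \<partial>lborel)"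
      unfolding e by (simp add: mult_ac)
    also have "\<dots> = (\<integral>\<xi>. g \<xi> * \<phi> (\<zeta> + \<xi>) \<partial>lborel)"
      using p by (intro L2_fourierD(3)[OF f] tr) (simp_all add: integrable_translate)
    also have "\<dots> = (\<integral>\<xi>. g (- \<zeta> + \<xi>) * \<phi> (\<zeta> + (- \<zeta> + \<xi>)) \<partial>lborel)"
      by (rule integral_translate[symmetric, of "\<lambda>\<xi>. g \<xi> * \<phi> (\<zeta> + \<xi>)"]) measurable
    finally show ?thesis by (simp add: add.commute[of "- \<zeta>"])
  qed
  then show ?thesis
    using s tr[OF s(2), of "- \<zeta>"] by (simp add: L2_fourier_def square_integrable_cis add.commute[of "- \<zeta>"])
qed

text \<open>\<open>parseval\<close> sees only real parts. Rotating \<open>f\<close> by the conjugate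
  sign \<open>c\<close> of the integral makes the integral real and nonnegative without increasing
  any modulus.\<close>

lemma norm_integral_mult_cnj_le:
  assumes f: "L2_fourier f g" and h: "L2_fourier f' g'"
  shows "norm (\<integral>x. f x * cnj (f' x) \<partial>lborel) \<le> (\<integral>\<xi>. norm (g \<xi>) * norm (g' \<xi>) \<partial>lborel)"
proof -
  let ?z = "\<integral>x. f x * cnj (f' x) \<partial>lborel"
  define c where "c = cnj (sgn ?z)"
  have cz: "c * ?z = of_real (norm ?z)"
    using complex_norm_square[of ?z]
    by (cases "?z = 0") (auto simp: c_def sgn_eq power2_eq_square field_simps)
  have nc: "norm c \<le> 1" by (simp add: c_def norm_sgn)
  have sc: "square_integrable (\<lambda>x. cnj (f' x))" using L2_fourierD(1)[OF h]
    by (auto simp: square_integrable_def)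
  note i = square_integrable_mult[OF L2_fourierD(1)[OF f] sc]
  have "norm ?z = Re (c * ?z)" by (simp only: cz Re_complex_of_real)
  also have "\<dots> = Re (\<integral>x. c * f x * cnj (f' x) \<partial>lborel)" by (simp add: mult.assoc)
  also have "\<dots> = (\<integral>x. Re (c * f x * cnj (f' x)) \<partial>lborel)"
    using i by (intro integral_Re[symmetric]) (simp add: mult.assoc)
  also have "\<dots> = (\<integral>x. (c * f x) \<bullet> f' x \<partial>lborel)" by (simp add: inner_complex_def)
  also have "\<dots> = (\<integral>\<xi>. (c * g \<xi>) \<bullet> g' \<xi> \<partial>lborel)" by (rule parseval[OF L2_fourier_cmult[OF f] h])
  also have "\<dots> \<le> (\<integral>\<xi>. norm (g \<xi>) * norm (g' \<xi>) \<partial>lborel)"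
  proof (rule integral_mono)
    show "integrable lborel (\<lambda>\<xi>. (c * g \<xi>) \<bullet> g' \<xi>)"
      using L2_fourierD(2)[OF f] L2_fourierD(2)[OF h] by (intro square_integrable_inner square_integrable_cmult)
    show "integrable lborel (\<lambda>\<xi>. norm (g \<xi>) * norm (g' \<xi>))"
      using L2_fourierD(2)[OF f] L2_fourierD(2)[OF h] by (rule square_integrable_norm_mult)
    fix \<xi> :: "real^3"
    have "(c * g \<xi>) \<bullet> g' \<xi> \<le> norm (c * g \<xi>) * norm (g' \<xi>)" by (rule norm_cauchy_schwarz)
    also have "\<dots> \<le> norm (g \<xi>) * norm (g' \<xi>)"
      using nc by (intro mult_right_mono) (auto simp: norm_mult mult_left_le_one_le)
    finally show "(c * g \<xi>) \<bullet> g' \<xi> \<le> norm (g \<xi>) * norm (g' \<xi>)" .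
  qed
  finally show ?thesis .
qed

text \<open>As \<open>g\<close> is real, the transform of the product at \<xi> is the Hermitian
  pairing of \<open>f\<close> with \<open>g\<close> modulated by \<xi>. This is the convolution
  theorem in the form of an inequality between moduli.\<close>

lemma norm_fourier_integral_mult_le:
  assumes f: "L2_fourier (\<lambda>x. of_real (f x)) f'" and g: "L2_fourier (\<lambda>x. of_real (g x)) g'"
  shows "norm (fourier_integral (\<lambda>x. of_real (f x * g x)) \<xi>) \<le> (\<integral>\<eta>. norm (f' \<eta>) * norm (g' (\<eta> - \<xi>)) \<partial>lborel)"
  using norm_integral_mult_cnj_le[OF f L2_fourier_modulate[OF g, of \<xi>]]
  by (simp add: fourier_integral_def cis_cnj mult_ac)

text \<open>When the transform is integrable, inversion becomes an actual integral almost
  everywhere. In this way the L1 norm of a transform bounds the function itself.\<close>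

lemma L2_fourier_inversion_L1:
  assumes f: "L2_fourier f g" and i: "integrable lborel g"
  shows "AE x in lborel. f x = fourier_integral g (- x)"
proof -
  have "AE x in lborel. f (- x) = fourier_integral g x"
    by (rule L2_fourier_unique[OF L2_fourier_inverse[OF f] L2_fourier_fourier_integral[OF i L2_fourierD(2)[OF f]]])
  from AE_lborel_reflect[OF this, of 0] show ?thesis by simp
qed


section \<open>Differentiation under the integral sign\<close>

lemma has_vector_derivative_iff_tendsto:
  "(f has_vector_derivative D) (at x) \<longleftrightarrow> ((\<lambda>y. (f y - f x) /\<^sub>R (y - x)) \<longlongrightarrow> D) (at x)"
proof -
  have e: "norm (f y - f x - (y - x) *\<^sub>R D) / norm (y - x) = norm ((f y - f x) /\<^sub>R (y - x) - D)" if "y \<noteq> x" for y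
  proof -
    have "(f y - f x) /\<^sub>R (y - x) - D = (f y - f x - (y - x) *\<^sub>R D) /\<^sub>R (y - x)"
      using that by (simp add: scaleR_diff_right)
    then show ?thesis by (simp add: divide_inverse mult.commute)
  qed
  have "(f has_vector_derivative D) (at x) \<longleftrightarrow> ((\<lambda>y. norm (f y - f x - (y - x) *\<^sub>R D) / norm (y - x)) \<longlongrightarrow> 0) (at x)"
    unfolding has_vector_derivative_def has_derivative_iff_norm by (simp add: bounded_linear_scaleR_left)
  also have "\<dots> \<longleftrightarrow> ((\<lambda>y. norm ((f y - f x) /\<^sub>R (y - x) - D)) \<longlongrightarrow> 0) (at x)"
    by (rule tendsto_cong, unfold eventually_at_filter, rule always_eventually) (use e in blast)
  finally show ?thesis by (simp add: tendsto_norm_zero_iff LIM_zero_iff)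
qed

text \<open>By the mean value inequality the difference quotients inherit the majorant
  \<open>w\<close> of the derivative; dominated convergence along sequences does the rest.\<close>

lemma has_vector_derivative_lborel_integral:
  fixes f :: "real \<Rightarrow> 'a \<Rightarrow> 'b::euclidean_space"
  assumes t0: "a < t0" "t0 < b"
    and der: "\<And>t x. a < t \<Longrightarrow> t < b \<Longrightarrow> ((\<lambda>s. f s x) has_vector_derivative f' t x) (at t)"
    and int: "\<And>t. a < t \<Longrightarrow> t < b \<Longrightarrow> integrable M (f t)"
    and meas: "f' t0 \<in> borel_measurable M"
    and w: "integrable M w" and le: "\<And>t x. a < t \<Longrightarrow> t < b \<Longrightarrow> norm (f' t x) \<le> w x"
  shows "((\<lambda>t. \<integral>x. f t x \<partial>M) has_vector_derivative (\<integral>x. f' t0 x \<partial>M)) (at t0)"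
proof -
  let ?q = "\<lambda>t x. (f t x - f t0 x) /\<^sub>R (t - t0)"
  have bd: "norm (?q t x) \<le> w x" if t: "a < t" "t < b" "t \<noteq> t0" for t x
  proof -
    have "norm (f t x - f t0 x) \<le> w x * norm (t - t0)"
    proof (rule differentiable_bound[of "{a<..<b}" "\<lambda>s. f s x" "\<lambda>s h. h *\<^sub>R f' s x"])
      fix s assume s: "s \<in> {a<..<b}"
      show "((\<lambda>s. f s x) has_derivative (\<lambda>h. h *\<^sub>R f' s x)) (at s within {a<..<b})"
        using der[of s x] s by (auto simp: has_vector_derivative_def intro: has_derivative_at_withinI)
      show "onorm (\<lambda>h. h *\<^sub>R f' s x) \<le> w x"
        using le[of s x] s by (intro onorm_le) (auto simp: mult.commute[of "w x"] intro!: mult_left_mono)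
    qed (use t t0 in auto)
    then show ?thesis using t by (simp add: divide_simps mult.commute)
  qed
  have "((\<lambda>t. \<integral>x. ?q t x \<partial>M) \<longlongrightarrow> (\<integral>x. f' t0 x \<partial>M)) (at t0)"
    unfolding tendsto_at_iff_sequentially comp_def
  proof (intro allI impI)
    fix X assume X: "\<forall>i. X i \<in> UNIV - {t0}" and lim: "X \<longlonglongrightarrow> t0"
    from order_tendstoD[OF lim] t0 have "\<forall>\<^sub>F n in sequentially. a < X n \<and> X n < b"
      by (auto intro: eventually_conj)
    then obtain N where N: "\<And>n. n \<ge> N \<Longrightarrow> a < X n \<and> X n < b" by (auto simp: eventually_sequentially)
    show "(\<lambda>n. \<integral>x. ?q (X n) x \<partial>M) \<longlonglongrightarrow> (\<integral>x. f' t0 x \<partial>M)"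
    \<comment> \<open>The first \<open>N\<close> terms of the sequence may lie outside the interval
      on which \<open>f\<close> is known to be integrable.\<close>
    proof (rule LIMSEQ_offset[of _ N], rule integral_dominated_convergence[OF meas _ w])
      show "(\<lambda>x. ?q (X (n + N)) x) \<in> borel_measurable M" for n
        using int[of "X (n + N)"] int[of t0] N[of "n + N"] t0 by auto
      show "AE x in M. norm (?q (X (n + N)) x) \<le> w x" for n
        using bd[of "X (n + N)"] N[of "n + N"] X by (intro AE_I2) auto
      show "AE x in M. (\<lambda>n. ?q (X (n + N)) x) \<longlonglongrightarrow> f' t0 x"
      proof (rule AE_I2)
        fix x
        have "((\<lambda>t. ?q t x) \<longlongrightarrow> f' t0 x) (at t0)"
          using der[OF t0, of x] by (simp only: has_vector_derivative_iff_tendsto)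
        then have "(\<lambda>n. ?q (X n) x) \<longlonglongrightarrow> f' t0 x"
          using X lim unfolding tendsto_at_iff_sequentially comp_def by auto
        then show "(\<lambda>n. ?q (X (n + N)) x) \<longlonglongrightarrow> f' t0 x" by (rule LIMSEQ_ignore_initial_segment)
      qed
    qed
  qed
  moreover have "\<forall>\<^sub>F t in at t0. (\<integral>x. ?q t x \<partial>M) = ((\<integral>x. f t x \<partial>M) - (\<integral>x. f t0 x \<partial>M)) /\<^sub>R (t - t0)"
  proof -
    have "\<forall>\<^sub>F t in at t0. a < t \<and> t < b"
      using order_tendstoD[OF tendsto_ident_at[of t0 UNIV]] t0 by (auto intro: eventually_conj)
    then show ?thesis
      by eventually_elim (use int t0 in \<open>simp add: Bochner_Integration.integral_diff\<close>)
  qed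
  ultimately have "((\<lambda>t. ((\<integral>x. f t x \<partial>M) - (\<integral>x. f t0 x \<partial>M)) /\<^sub>R (t - t0)) \<longlongrightarrow> (\<integral>x. f' t0 x \<partial>M)) (at t0)"
    by (rule Lim_transform_eventually)
  then show ?thesis by (simp only: has_vector_derivative_iff_tendsto)
qed

section \<open>Integrability of power weights\<close>

lemma nn_integral_real_even:
  fixes f :: "real \<Rightarrow> ennreal"
  assumes [measurable]: "f \<in> borel_measurable borel" and even: "\<And>x. f (- x) = f x"
  shows "(\<integral>\<^sup>+x. f x \<partial>lborel) \<le> 2 * (\<integral>\<^sup>+x. f x * indicator {0..} x \<partial>lborel)"
proof -
  have "(\<integral>\<^sup>+x. f x \<partial>lborel) \<le> (\<integral>\<^sup>+x. f x * indicator {0..} x + f (0 - x) * indicator {0..} (0 - x) \<partial>lborel)"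
    by (intro nn_integral_mono) (auto simp: even indicator_def)
  also have "\<dots> = (\<integral>\<^sup>+x. f x * indicator {0..} x \<partial>lborel) + (\<integral>\<^sup>+x. f (0 - x) * indicator {0..} (0 - x) \<partial>lborel)"
    by (rule nn_integral_add) measurable
  also have "(\<integral>\<^sup>+x. f (0 - x) * indicator {0..} (0 - x) \<partial>lborel) = (\<integral>\<^sup>+x. f x * indicator {0..} x \<partial>lborel)"
    by (rule nn_integral_reflect[where f="\<lambda>x. f x * indicator {0..} x"]) measurable
  finally show ?thesis by (simp add: mult_2)
qed

lemma integrable_one_plus_abs_powr:
  assumes q: "q > 1"
  shows "integrable lborel (\<lambda>t::real. (1 + \<bar>t\<bar>) powr (- q))"
proof (rule integrableI_bounded)
  have "(\<integral>\<^sup>+x. ennreal ((1 + \<bar>x\<bar>) powr (- q)) * indicator {0..} x \<partial>lborel)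
    = (\<integral>\<^sup>+x. ennreal ((1 + x) powr (- q)) * indicator {0..} x \<partial>lborel)"
    by (intro nn_integral_cong) (auto simp: indicator_def)
  also have "\<dots> = ennreal (0 - (1 + 0) powr (1 - q) / (1 - q))"
  proof (rule nn_integral_FTC_atLeast)
    show "(\<lambda>x. (1 + x) powr (- q)) \<in> borel_measurable borel" by measurable
    show "DERIV (\<lambda>x. (1 + x) powr (1 - q) / (1 - q)) x :> (1 + x) powr (- q)" if "0 \<le> x" for x
    proof -
      have "1 - q - 1 = - q" by simp
      then show ?thesis using that q by (auto intro!: derivative_eq_intros)
    qed
    have "((\<lambda>x. (1 + x) powr (1 - q)) \<longlongrightarrow> 0) at_top"
      by (rule tendsto_neg_powr) (use q in \<open>auto intro: filterlim_tendsto_add_at_top[OF tendsto_const filterlim_ident]\<close>)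
    from tendsto_divide[OF this tendsto_const, of "1 - q"] q
    show "((\<lambda>x. (1 + x) powr (1 - q) / (1 - q)) \<longlongrightarrow> 0) at_top" by simp
  qed auto
  also have "\<dots> < \<infinity>" by simp
  finally have "2 * (\<integral>\<^sup>+x. ennreal ((1 + \<bar>x\<bar>) powr (- q)) * indicator {0..} x \<partial>lborel) < \<infinity>"
    by (simp add: ennreal_mult_less_top)
  moreover have "(\<integral>\<^sup>+x. ennreal ((1 + \<bar>x\<bar>) powr (- q)) \<partial>lborel)
      \<le> 2 * (\<integral>\<^sup>+x. ennreal ((1 + \<bar>x\<bar>) powr (- q)) * indicator {0..} x \<partial>lborel)"
    by (rule nn_integral_real_even) auto
  ultimately show "(\<integral>\<^sup>+x. ennreal (norm ((1 + \<bar>x\<bar>) powr (- q))) \<partial>lborel) < \<infinity>"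
    by (auto intro: le_less_trans)
qed measurable

text \<open>The exponent is split evenly over the three coordinates: each
  \<open>\<bar>x \<bullet> b\<bar>\<close> is at most the norm, so the weight lies below a product
  of one-dimensional weights with exponent \<open>p / 3 > 1\<close>.\<close>

lemma integrable_one_plus_norm_powr:
  assumes p: "p > 3"
  shows "integrable lborel (\<lambda>x::real^3. (1 + norm x) powr (- p))"
proof (rule Bochner_Integration.integrable_bound)
  let ?f = "\<lambda>(b::real^3) t. (1 + \<bar>t\<bar>) powr (- (p / 3))"
  show "integrable lborel (\<lambda>x::real^3. \<Prod>b\<in>Basis. ?f b (x \<bullet> b))"
    by (rule integrable_lborel_prod, rule integrable_one_plus_abs_powr) (use p in simp)
  have "(1 + norm x) powr (- p) \<le> (\<Prod>b\<in>Basis. ?f b (x \<bullet> b))" for x :: "real^3"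
  proof -
    have "(\<Prod>b\<in>(Basis::(real^3) set). (1 + norm x) powr (- (p / 3))) \<le> (\<Prod>b\<in>Basis. ?f b (x \<bullet> b))"
      using p by (intro prod_mono conjI powr_mono2') (auto intro: Basis_le_norm)
    moreover have "(\<Prod>b\<in>(Basis::(real^3) set). (1 + norm x) powr (- (p / 3))) = (1 + norm x) powr (- p)"
      by (simp add: powr_powr[symmetric] powr_realpow[symmetric] power3_eq_cube powr_add[symmetric] add_pos_nonneg)
    ultimately show ?thesis by simp
  qed
  moreover have "0 \<le> (\<Prod>b\<in>Basis. ?f b (x \<bullet> b))" for x :: "real^3" by (intro prod_nonneg) simp
  ultimately show "AE x in lborel. norm ((1 + norm x) powr (- p)) \<le> norm (\<Prod>b\<in>Basis. ?f b (x \<bullet> b))" by simp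
qed measurable

text \<open>Near 0 the exponent above -1 suffices, away from 0 the Gaussian does.\<close>

lemma integrable_abs_powr_gauss_1d:
  assumes a: "a > 0" and q: "0 < q" "q < 1"
  shows "integrable lborel (\<lambda>t::real. \<bar>t\<bar> powr (- q) * exp (- a * t\<^sup>2))"
proof (rule Bochner_Integration.integrable_bound)
  have 1: "integrable lborel (\<lambda>t::real. \<bar>t\<bar> powr (- q) * indicator {-1..1} t)"
  proof (rule integrableI_bounded)
    have "(\<integral>\<^sup>+x. ennreal (\<bar>x\<bar> powr (- q) * indicator {-1..1} x) * indicator {0..} x \<partial>lborel)
      = (\<integral>\<^sup>+x. ennreal (x powr (- q)) * indicator {0..1} x \<partial>lborel)"
      by (intro nn_integral_cong) (auto simp: indicator_def)
    also have "\<dots> < \<infinity>"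
    proof -
      have "((\<lambda>x. x powr (- q)) has_integral 1 powr (- q + 1) / (- q + 1)) {0..1}"
        using q by (intro has_integral_powr_from_0) auto
      moreover have eq: "(\<lambda>x. x powr (- q) * indicator {0..1} x) = (\<lambda>x. if x \<in> {0..1} then x powr (- q) else 0)"
        by (auto simp: fun_eq_iff indicator_def)
      ultimately have "((\<lambda>x. x powr (- q) * indicator {0..1} x) has_integral 1 powr (- q + 1) / (- q + 1)) UNIV"
        by (simp only: has_integral_restrict_UNIV)
      then have "(\<integral>\<^sup>+x. ennreal (x powr (- q) * indicator {0..1} x) \<partial>lborel) = ennreal (1 powr (- q + 1) / (- q + 1))"
        by (intro nn_integral_has_integral_lborel) auto
      then show ?thesis by (simp add: ennreal_mult' ennreal_indicator[symmetric] del: ennreal_indicator)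
    qed
    finally have "2 * (\<integral>\<^sup>+x. ennreal (\<bar>x\<bar> powr (- q) * indicator {-1..1} x) * indicator {0..} x \<partial>lborel) < \<infinity>"
      by (simp add: ennreal_mult_less_top)
    moreover have "(\<integral>\<^sup>+x. ennreal (\<bar>x\<bar> powr (- q) * indicator {-1..1} x) \<partial>lborel)
      \<le> 2 * (\<integral>\<^sup>+x. ennreal (\<bar>x\<bar> powr (- q) * indicator {-1..1} x) * indicator {0..} x \<partial>lborel)"
      by (rule nn_integral_real_even) (auto simp: indicator_def)
    ultimately show "(\<integral>\<^sup>+x. ennreal (norm (\<bar>x\<bar> powr (- q) * indicator {-1..1} x)) \<partial>lborel) < \<infinity>"
      by (auto intro: le_less_trans)
  qed measurable
  show "integrable lborel (\<lambda>t::real. \<bar>t\<bar> powr (- q) * indicator {-1..1} t + exp (- a * (norm (t - 0))\<^sup>2))"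
    using 1 exp_norm_integrable[OF a, of "0::real"] by (rule Bochner_Integration.integrable_add)
  show "AE t in lborel. norm (\<bar>t\<bar> powr (- q) * exp (- a * t\<^sup>2)) \<le> norm (\<bar>t\<bar> powr (- q) * indicator {-1..1} t + exp (- a * (norm (t - 0))\<^sup>2))"
  proof (rule AE_I2)
    fix t :: real
    show "norm (\<bar>t\<bar> powr (- q) * exp (- a * t\<^sup>2)) \<le> norm (\<bar>t\<bar> powr (- q) * indicator {-1..1} t + exp (- a * (norm (t - 0))\<^sup>2))"
    proof (cases "\<bar>t\<bar> \<le> 1")
      case True
      have "\<bar>t\<bar> powr (- q) * exp (- a * t\<^sup>2) \<le> \<bar>t\<bar> powr (- q) * 1"
        using a by (intro mult_left_mono) auto
      then show ?thesis using True by (auto simp: indicator_def abs_le_iff intro: add_increasing2)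
    next
      case False
      then have "t \<noteq> 0" by auto
      have "\<bar>t\<bar> powr (- q) \<le> \<bar>t\<bar> powr 0" using q False by (intro powr_mono) auto
      then have "\<bar>t\<bar> powr (- q) \<le> 1" using \<open>t \<noteq> 0\<close> by simp
      then have "\<bar>t\<bar> powr (- q) * exp (- a * t\<^sup>2) \<le> 1 * exp (- a * t\<^sup>2)"
        by (intro mult_right_mono) auto
      then show ?thesis using False by (auto simp: indicator_def)
    qed
  qed
qed measurable

lemma AE_inner_Basis_nonzero:
  fixes b :: "'a::euclidean_space"
  assumes "b \<in> Basis" shows "AE x in lborel. x \<bullet> b \<noteq> 0"
proof -
  have "negligible {x. b \<bullet> x = 0}" using assms by (intro negligible_hyperplane) auto
  then have "AE x in lebesgue. x \<notin> {x. b \<bullet> x = 0}"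
    by (intro AE_not_in) (simp add: negligible_iff_null_sets)
  then show ?thesis by (simp add: AE_completion_iff inner_commute)
qed

text \<open>Same splitting as for the decaying weight: the inverse square of the norm is at most the
  product of the coordinates to the power -2/3, and 2/3 is below 1. It controls the singularity of
  order -1 at the origin, both in L1 and in L2, that appears in the velocity of a projected
  field.\<close>

lemma integrable_inverse_norm_sq_gauss:
  assumes a: "a > 0"
  shows "integrable lborel (\<lambda>x::real^3. exp (- a * (norm x)\<^sup>2) / (norm x)\<^sup>2)"
proof (rule Bochner_Integration.integrable_bound)
  let ?f = "\<lambda>(b::real^3) t. \<bar>t\<bar> powr (- (2/3)) * exp (- a * t\<^sup>2)"
  show "integrable lborel (\<lambda>x::real^3. \<Prod>b\<in>Basis. ?f b (x \<bullet> b))"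
    by (rule integrable_lborel_prod, rule integrable_abs_powr_gauss_1d) (use a in auto)
  \<comment> \<open>Coordinate hyperplanes must be left out, because \<open>0 powr (- (2/3))\<close>
    is 0 and the product would vanish there.\<close>
  have "AE x in lborel. \<forall>b\<in>(Basis::(real^3) set). x \<bullet> b \<noteq> 0"
    by (intro AE_finite_allI AE_inner_Basis_nonzero) auto
  then show "AE x::real^3 in lborel. norm (exp (- a * (norm x)\<^sup>2) / (norm x)\<^sup>2) \<le> norm (\<Prod>b\<in>Basis. ?f b (x \<bullet> b))"
  proof eventually_elim
    case (elim x)
    then have nz: "norm x > 0" by auto
    have "(\<Prod>b\<in>(Basis::(real^3) set). norm x powr (- (2/3))) \<le> (\<Prod>b\<in>Basis. \<bar>x \<bullet> b\<bar> powr (- (2/3)))"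
      using elim by (intro prod_mono conjI powr_mono2') (auto intro: Basis_le_norm)
    moreover have "(\<Prod>b\<in>(Basis::(real^3) set). norm x powr (- (2/3))) = 1 / (norm x)\<^sup>2"
    proof -
      have "(\<Prod>b\<in>(Basis::(real^3) set). norm x powr (- (2/3))) = norm x powr (- 2)"
        using nz by (simp add: power3_eq_cube powr_add[symmetric])
      also have "\<dots> = 1 / (norm x)\<^sup>2" using nz by (simp add: powr_minus_divide)
      finally show ?thesis .
    qed
    ultimately have "1 / (norm x)\<^sup>2 * exp (- a * (norm x)\<^sup>2) \<le> (\<Prod>b\<in>Basis. \<bar>x \<bullet> b\<bar> powr (- (2/3))) * exp (- a * (norm x)\<^sup>2)"
      by (intro mult_right_mono) auto
    then show ?case by (simp add: prod.distrib exp_norm_prod[of a x, simplified] abs_mult prod_nonneg abs_prod)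
  qed
qed measurable


section \<open>Schwartz functions\<close>

lemma schwartz_differentiable: "\<phi> \<in> schwartz \<Longrightarrow> \<phi> differentiable at x"
  unfolding schwartz_def by (auto dest: spec[of _ "[]"])

lemma schwartz_decay:
  assumes "\<phi> \<in> schwartz"
  shows "\<exists>C. \<forall>x. norm (\<phi> x) \<le> C * (1 + norm x) powr (- real k)"
proof -
  obtain C where C: "\<And>x. (1 + norm x) ^ k * norm (\<phi> x) \<le> C"
  proof -
    have "\<exists>C. \<forall>x. (1 + norm x) ^ k * norm (foldr partial_deriv [] \<phi> x) \<le> C"
      using assms unfolding schwartz_def by blast
    then show ?thesis using that by auto
  qed
  have "norm (\<phi> x) \<le> C * (1 + norm x) powr (- real k)" for x
  proof -
    have "1 + norm x > 0" by (simp add: add_pos_nonneg)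
    then show ?thesis using C[of x] by (simp add: powr_minus powr_realpow divide_simps mult.commute)
  qed
  then show ?thesis by blast
qed

lemma schwartz_partial_deriv:
  assumes "\<phi> \<in> schwartz" shows "partial_deriv i \<phi> \<in> schwartz"
  unfolding schwartz_def
proof (intro CollectI allI)
  fix js
  have "foldr partial_deriv js (partial_deriv i \<phi>) = foldr partial_deriv (js @ [i]) \<phi>" by simp
  then show "(\<forall>x. foldr partial_deriv js (partial_deriv i \<phi>) differentiable at x) \<and>
     (\<forall>k::nat. \<exists>C. \<forall>x. (1 + norm x) ^ k * norm (foldr partial_deriv js (partial_deriv i \<phi>) x) \<le> C)"
    using assms unfolding schwartz_def mem_Collect_eq by presburger
qed

lemma schwartz_measurable: "\<phi> \<in> schwartz \<Longrightarrow> \<phi> \<in> borel_measurable borel"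
  by (intro borel_measurable_continuous_onI continuous_at_imp_continuous_on ballI
      differentiable_imp_continuous_within schwartz_differentiable)

lemma
  assumes s: "\<phi> \<in> schwartz"
  shows schwartz_integrable: "integrable lborel \<phi>"
    and schwartz_square_integrable: "square_integrable \<phi>"
proof -
  obtain C where C: "\<And>x. norm (\<phi> x) \<le> C * (1 + norm x) powr (- real 4)" using schwartz_decay[OF s, of 4] by blast
  obtain B where B: "\<And>x. norm (\<phi> x) \<le> B * (1 + norm x) powr (- real 0)" using schwartz_decay[OF s, of 0] by blast
  show "integrable lborel \<phi>"
  proof (rule Bochner_Integration.integrable_bound)
    show "integrable lborel (\<lambda>x::real^3. C * (1 + norm x) powr (- 4))"
      by (intro integrable_mult_right integrable_one_plus_norm_powr) simp
    show "AE x in lborel. norm (\<phi> x) \<le> norm (C * (1 + norm x) powr (- 4))"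
      using order_trans[OF C abs_ge_self] by (intro AE_I2) simp
  qed (use schwartz_measurable[OF s] in simp)
  moreover have "norm (\<phi> x) \<le> B" for x
    using B[of x] add_pos_nonneg[of 1 "norm x"] by simp
  ultimately show "square_integrable \<phi>" by (rule square_integrable_bounded)
qed

lemma partial_derivI:
  "(f has_derivative D) (at x) \<Longrightarrow> partial_deriv i f x = D (axis i 1)"
  using frechet_derivative_at[of f D x] by (simp add: partial_deriv_def)

lemma partial_deriv_line:
  assumes "f differentiable at x"
  shows "((\<lambda>t. f (x + t *\<^sub>R axis i 1)) has_vector_derivative partial_deriv i f x) (at 0)"
proof -
  let ?D = "frechet_derivative f (at x)"
  have D: "(f has_derivative ?D) (at x)" using assms by (simp add: frechet_derivative_works)
  have "(f has_derivative ?D) (at (x + 0 *\<^sub>R axis i 1))" using D by simp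
  then have "((\<lambda>t. f (x + t *\<^sub>R axis i 1)) has_derivative (\<lambda>t. ?D (t *\<^sub>R axis i 1))) (at 0)"
    by (rule has_derivative_compose[rotated]) (auto intro!: derivative_eq_intros)
  then show ?thesis
    using linear_cmul[OF has_derivative_linear[OF D]] by (simp add: has_vector_derivative_def partial_deriv_def)
qed

section \<open>Polynomials times Gaussians are Schwartz functions\<close>

inductive_set polys :: "(real^3 \<Rightarrow> complex) set" where
  poly_const: "(\<lambda>x. c) \<in> polys"
| poly_coord: "(\<lambda>x. of_real (x $ i)) \<in> polys"
| poly_add: "p \<in> polys \<Longrightarrow> q \<in> polys \<Longrightarrow> (\<lambda>x. p x + q x) \<in> polys"
| poly_mult: "p \<in> polys \<Longrightarrow> q \<in> polys \<Longrightarrow> (\<lambda>x. p x * q x) \<in> polys"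

lemma polys_derivative:
  assumes "p \<in> polys"
  shows "\<exists>D. (\<forall>x. (p has_derivative D x) (at x)) \<and> (\<forall>i. (\<lambda>x. D x (axis i 1)) \<in> polys)"
  using assms
proof induction
  case (poly_const c)
  show ?case by (rule exI[of _ "\<lambda>x h. 0"]) (auto intro!: polys.poly_const)
next
  case (poly_coord j)
  have "((\<lambda>x. complex_of_real (x $ j)) has_derivative (\<lambda>h. of_real (h $ j))) (at x)" for x
    by (rule bounded_linear_imp_has_derivative)
       (intro bounded_linear_compose[OF bounded_linear_of_real] bounded_linear_vec_nth)
  then show ?case
    by (intro exI[of _ "\<lambda>x h. of_real (h $ j)"]) (auto intro: polys.poly_const)
next
  case (poly_add p q)
  then obtain D E where D: "\<forall>x. (p has_derivative D x) (at x)" "\<forall>i. (\<lambda>x. D x (axis i 1)) \<in> polys"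
    and E: "\<forall>x. (q has_derivative E x) (at x)" "\<forall>i. (\<lambda>x. E x (axis i 1)) \<in> polys" by blast
  show ?case
    by (rule exI[of _ "\<lambda>x h. D x h + E x h"]) (use D E in \<open>auto intro!: has_derivative_add polys.poly_add\<close>)
next
  case (poly_mult p q)
  then obtain D E where D: "\<forall>x. (p has_derivative D x) (at x)" "\<forall>i. (\<lambda>x. D x (axis i 1)) \<in> polys"
    and E: "\<forall>x. (q has_derivative E x) (at x)" "\<forall>i. (\<lambda>x. E x (axis i 1)) \<in> polys" by blast
  show ?case
    by (rule exI[of _ "\<lambda>x h. p x * E x h + D x h * q x"])
       (use D E poly_mult in \<open>auto intro!: has_derivative_mult polys.poly_add polys.poly_mult\<close>)
qed

lemma polys_growth:
  assumes "p \<in> polys" shows "\<exists>C k. 0 \<le> C \<and> (\<forall>x. norm (p x) \<le> C * (1 + norm x) ^ k)"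
  using assms
proof induction
  case (poly_const c)
  show ?case by (rule exI[of _ "norm c"], rule exI[of _ 0]) simp
next
  case (poly_coord i)
  have "\<bar>x $ i\<bar> \<le> 1 + norm x" for x :: "real^3" using component_le_norm_cart[of x i] by simp
  then show ?case by (intro exI[of _ 1]) (auto intro!: exI[of _ "1::nat"])
next
  case (poly_add p q)
  then obtain C k D l where p: "0 \<le> C" "\<forall>x. norm (p x) \<le> C * (1 + norm x) ^ k"
    and q: "0 \<le> D" "\<forall>x. norm (q x) \<le> D * (1 + norm x) ^ l" by blast
  have "norm (p x + q x) \<le> (C + D) * (1 + norm x) ^ (k + l)" for x
  proof -
    have "norm (p x) \<le> C * (1 + norm x) ^ (k + l)"
      using p by (intro order_trans[OF p(2)[rule_format]] mult_left_mono power_increasing) auto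
    moreover have "norm (q x) \<le> D * (1 + norm x) ^ (k + l)"
      using q by (intro order_trans[OF q(2)[rule_format]] mult_left_mono power_increasing) auto
    ultimately show ?thesis using norm_triangle_ineq[of "p x" "q x"] by (simp add: distrib_right)
  qed
  then show ?case using p(1) q(1) by (intro exI[of _ "C + D"] exI[of _ "k + l"]) auto
next
  case (poly_mult p q)
  then obtain C k D l where p: "0 \<le> C" "\<forall>x. norm (p x) \<le> C * (1 + norm x) ^ k"
    and q: "0 \<le> D" "\<forall>x. norm (q x) \<le> D * (1 + norm x) ^ l" by blast
  have "norm (p x * q x) \<le> (C * D) * (1 + norm x) ^ (k + l)" for x
    using mult_mono[OF p(2)[rule_format, of x] q(2)[rule_format, of x]] p(1)
    by (simp add: norm_mult power_add mult_ac)
  then show ?case using p(1) q(1) by (intro exI[of _ "C * D"] exI[of _ "k + l"]) auto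
qed

text \<open>The real linear term accounts for translations and the imaginary one for characters, so
  this single family contains, up to constants, the Gaussians \<open>gauss a y\<close> and their
  Fourier integrals.\<close>

definition gauss_exp :: "real \<Rightarrow> real^3 \<Rightarrow> real^3 \<Rightarrow> real^3 \<Rightarrow> complex" where
  "gauss_exp b u w x = exp (of_real (- b * (x \<bullet> x) + x \<bullet> u) + \<i> * of_real (x \<bullet> w))"

lemma gauss_exp_derivative:
  "(gauss_exp b u w has_derivative
     (\<lambda>h. gauss_exp b u w x * (of_real (- b * (2 * (x \<bullet> h)) + h \<bullet> u) + \<i> * of_real (h \<bullet> w)))) (at x)"
proof -
  have "((\<lambda>x. of_real (- b * (x \<bullet> x) + x \<bullet> u) + \<i> * of_real (x \<bullet> w)) has_derivative
     (\<lambda>h. complex_of_real (- b * (2 * (x \<bullet> h)) + h \<bullet> u) + \<i> * of_real (h \<bullet> w))) (at x)"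
    by (auto intro!: derivative_eq_intros simp: inner_commute algebra_simps)
  from has_derivative_compose[OF this DERIV_exp[unfolded has_field_derivative_def]] show ?thesis
    unfolding gauss_exp_def .
qed

lemma gauss_exp_eq: "gauss_exp b u w x = of_real (exp (- b * (x \<bullet> x) + x \<bullet> u)) * cis (x \<bullet> w)"
  by (simp only: gauss_exp_def exp_add exp_of_real cis_conv_exp)

lemma power_le_fact_mult_exp:
  assumes "0 \<le> (x::real)" shows "x ^ m \<le> fact m * exp x"
proof -
  have s: "(\<lambda>n. x ^ n /\<^sub>R fact n) sums exp x" by (rule exp_converges)
  have "(\<Sum>n\<in>{m}. x ^ n /\<^sub>R fact n) \<le> (\<Sum>n. x ^ n /\<^sub>R fact n)"
    by (rule sum_le_suminf) (use s assms in \<open>auto simp: sums_iff\<close>)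
  also have "\<dots> = exp x" using s by (simp add: sums_iff)
  finally show ?thesis by (simp add: divide_simps mult.commute)
qed

lemma gauss_exp_decay:
  assumes b: "b > 0"
  shows "\<exists>C. \<forall>x. (1 + norm x) ^ k * norm (gauss_exp b u w x) \<le> C"
proof -
  \<comment> \<open>\<open>?v\<close> is the total linear growth rate: \<open>norm u\<close> from
    the exponent and 1 from bounding the power of \<open>1 + norm x\<close> by an exponential.
    Completing the square against \<open>b\<close> then gives the constant.\<close>
  let ?v = "norm u + 1"
  have "(1 + norm x) ^ k * norm (gauss_exp b u w x) \<le> fact k * exp (1 + ?v\<^sup>2 / (4 * b))" for x
  proof -
    have n: "norm (gauss_exp b u w x) = exp (- b * (x \<bullet> x) + x \<bullet> u)"
      by (simp add: gauss_exp_eq norm_mult)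
    have "(1 + norm x) ^ k * norm (gauss_exp b u w x) \<le> fact k * exp (1 + norm x) * exp (- b * (x \<bullet> x) + x \<bullet> u)"
      unfolding n by (intro mult_right_mono power_le_fact_mult_exp) auto
    also have "\<dots> = fact k * exp (1 + norm x + (- b * (x \<bullet> x) + x \<bullet> u))" by (simp only: exp_add mult.assoc)
    also have "\<dots> \<le> fact k * exp (1 + ?v\<^sup>2 / (4 * b))"
    proof -
      have "x \<bullet> u \<le> norm x * norm u" by (rule norm_cauchy_schwarz)
      moreover have "?v * norm x - b * (norm x)\<^sup>2 \<le> ?v\<^sup>2 / (4 * b)"
      proof -
        have "0 \<le> (2 * b * norm x - ?v)\<^sup>2" by simp
        then show ?thesis using b by (simp add: field_simps power2_eq_square)
      qed
      ultimately have "1 + norm x + (- b * (x \<bullet> x) + x \<bullet> u) \<le> 1 + ?v\<^sup>2 / (4 * b)"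
        unfolding power2_norm_eq_inner[symmetric] by (simp add: algebra_simps)
      then show ?thesis by simp
    qed
    finally show ?thesis .
  qed
  then show ?thesis by blast
qed

text \<open>Partial derivatives map the class of polynomials times a fixed \<open>gauss_exp\<close>
  into itself, so one decay estimate for this class covers derivatives of every order.\<close>

lemma poly_gauss_exp_schwartz:
  assumes p: "p \<in> polys" and b: "b > 0"
  shows "(\<lambda>x. p x * gauss_exp b u w x) \<in> schwartz"
proof -
  let ?E = "gauss_exp b u w"
  let ?X = "{\<lambda>x. p x * ?E x | p. p \<in> polys}"
  have step: "(\<forall>x. f differentiable at x) \<and> partial_deriv i f \<in> ?X" if "f \<in> ?X" for f i
  proof -
    from that obtain p where f: "f = (\<lambda>x. p x * ?E x)" and p: "p \<in> polys" by blast
    obtain D where D: "\<And>x. (p has_derivative D x) (at x)" and Dp: "\<And>i. (\<lambda>x. D x (axis i 1)) \<in> polys"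
      using polys_derivative[OF p] by blast
    let ?q = "\<lambda>x. p x * (of_real (- b * 2) * of_real (x $ i) + (of_real (u $ i) + \<i> * of_real (w $ i))) + D x (axis i 1)"
    have der: "(f has_derivative (\<lambda>h. p x * (?E x * (of_real (- b * (2 * (x \<bullet> h)) + h \<bullet> u) + \<i> * of_real (h \<bullet> w)))
        + D x h * ?E x)) (at x)" for x
      unfolding f by (rule has_derivative_mult[OF D gauss_exp_derivative])
    have "partial_deriv i f = (\<lambda>x. ?q x * ?E x)"
      by (rule ext, subst partial_derivI[OF der]) (simp add: inner_axis inner_axis' algebra_simps)
    moreover have "?q \<in> polys"
      by (intro polys.intros p Dp)
    ultimately have "partial_deriv i f \<in> ?X"
      unfolding mem_Collect_eq by (intro exI[of _ ?q] conjI)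
    then show ?thesis using der by (auto simp: differentiable_def)
  qed
  have foldr: "foldr partial_deriv js (\<lambda>x. p x * ?E x) \<in> ?X" for js
    by (induction js) (use p step in auto)
  have bnd: "\<exists>C. \<forall>x. (1 + norm x) ^ k * norm (f x) \<le> C" if "f \<in> ?X" for f k
  proof -
    from that obtain p where f: "f = (\<lambda>x. p x * ?E x)" and p: "p \<in> polys" by blast
    obtain C l where C: "0 \<le> C" "\<And>x. norm (p x) \<le> C * (1 + norm x) ^ l" using polys_growth[OF p] by blast
    obtain B where B: "\<And>x. (1 + norm x) ^ (k + l) * norm (?E x) \<le> B" using gauss_exp_decay[OF b] by blast
    have "(1 + norm x) ^ k * norm (f x) \<le> C * B" for x
    proof -
      have "(1 + norm x) ^ k * norm (f x) \<le> (1 + norm x) ^ k * (C * (1 + norm x) ^ l * norm (?E x))"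
        unfolding f norm_mult by (intro mult_left_mono mult_right_mono C) auto
      also have "\<dots> = C * ((1 + norm x) ^ (k + l) * norm (?E x))" by (simp add: power_add mult_ac)
      also have "\<dots> \<le> C * B" by (intro mult_left_mono B C)
      finally show ?thesis .
    qed
    then show ?thesis by blast
  qed
  show ?thesis
    unfolding schwartz_def using step[OF foldr] bnd[OF foldr] by blast
qed

lemma gauss_eq_gauss_exp: "gauss a y x = of_real (exp (- a * (y \<bullet> y))) * gauss_exp a ((2 * a) *\<^sub>R y) 0 x"
proof -
  have "- a * (norm (x - y))\<^sup>2 = - a * (y \<bullet> y) + (- a * (x \<bullet> x) + x \<bullet> ((2 * a) *\<^sub>R y))"
    by (simp add: power2_norm_eq_inner inner_diff_left inner_diff_right inner_commute algebra_simps)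
  then show ?thesis
    by (simp only: gauss_def gauss_exp_eq exp_add of_real_mult inner_zero_right cis_zero mult_1_right)
qed

lemma poly_gauss_schwartz:
  assumes "a > 0" "p \<in> polys" shows "(\<lambda>x. p x * gauss a y x) \<in> schwartz"
proof -
  have "(\<lambda>x. (of_real (exp (- a * (y \<bullet> y))) * p x) * gauss_exp a ((2 * a) *\<^sub>R y) 0 x) \<in> schwartz"
    by (intro poly_gauss_exp_schwartz polys.intros assms)
  then show ?thesis by (simp add: gauss_eq_gauss_exp mult_ac)
qed

lemma gauss_schwartz: "a > 0 \<Longrightarrow> gauss a y \<in> schwartz"
  using poly_gauss_schwartz[of a "\<lambda>x. 1" y] by (simp add: polys.poly_const)

text \<open>Allows transforms of Gaussians as test functions in
  \<open>has_distributional_deriv\<close>.\<close>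

lemma fourier_gauss_schwartz:
  assumes a: "a > 0" shows "fourier_integral (gauss a y) \<in> schwartz"
proof -
  have "(\<lambda>\<xi>. of_real (sqrt (pi / a) ^ 3) * gauss_exp (pi\<^sup>2 / a) 0 ((- 2 * pi) *\<^sub>R y) \<xi>) \<in> schwartz"
    using a by (intro poly_gauss_exp_schwartz polys.intros) auto
  moreover have "fourier_integral (gauss a y) = (\<lambda>\<xi>. of_real (sqrt (pi / a) ^ 3) * gauss_exp (pi\<^sup>2 / a) 0 ((- 2 * pi) *\<^sub>R y) \<xi>)"
    unfolding fun_eq_iff fourier_gauss[OF a] gauss_def gauss_exp_eq
    by (simp add: power2_norm_eq_inner inner_commute mult_ac)
  ultimately show ?thesis by (simp only:)
qed

section \<open>Derivatives and the Fourier integral\<close>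

lemma has_vector_derivative_cis:
  "((\<lambda>t. cis (c + t * d)) has_vector_derivative (\<i> * of_real d * cis (c + t * d))) (at t)"
proof -
  have "((\<lambda>t. \<i> * complex_of_real (c + t * d)) has_vector_derivative \<i> * of_real d) (at t)"
    by (intro has_vector_derivative_mult_right has_vector_derivative_of_real) (auto intro!: derivative_eq_intros)
  from field_vector_diff_chain_at[OF this DERIV_exp]
  show ?thesis by (simp add: comp_def cis_conv_exp)
qed

text \<open>Differentiation under the integral. The point is that the result is again the Fourier
  integral of a Schwartz function, to which the definition of a distributional transform
  applies.\<close>

lemma partial_deriv_fourier_gauss:
  assumes a: "a > 0"
  shows "partial_deriv i (fourier_integral (gauss a y)) \<xi>
    = fourier_integral (\<lambda>x. - 2 * pi * \<i> * of_real (x $ i) * gauss a y x) \<xi>"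
proof -
  let ?f = "\<lambda>t x. cis (- 2 * pi * (x \<bullet> (\<xi> + t *\<^sub>R axis i 1))) * gauss a y x"
  let ?f' = "\<lambda>t x. (\<i> * of_real (- 2 * pi * x $ i) * cis (- 2 * pi * (x \<bullet> (\<xi> + t *\<^sub>R axis i 1)))) * gauss a y x"
  have "((\<lambda>t. \<integral>x. ?f t x \<partial>lborel) has_vector_derivative (\<integral>x. ?f' 0 x \<partial>lborel)) (at 0)"
  proof (rule has_vector_derivative_lborel_integral[where a="-1" and b=1 and w="\<lambda>x. norm (of_real (- 2 * pi) * of_real (x $ i) * gauss a y x)"])
    fix t :: real and x :: "real^3"
    have e: "- 2 * pi * (x \<bullet> (\<xi> + t *\<^sub>R axis i 1)) = - 2 * pi * (x \<bullet> \<xi>) + t * (- 2 * pi * x $ i)" for t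
      by (simp add: inner_add_right inner_axis algebra_simps)
    show "((\<lambda>s. ?f s x) has_vector_derivative ?f' t x) (at t)"
      unfolding e by (intro has_vector_derivative_mult_left has_vector_derivative_cis)
    show "integrable lborel (?f t)"
      using a by (intro fourier_integrand_integrable gauss_integrable) auto
    show "norm (?f' t x) \<le> norm (of_real (- 2 * pi) * of_real (x $ i) * gauss a y x)" by (simp add: norm_mult)
  next
    have "(\<lambda>x. (of_real (- 2 * pi) * of_real (x $ i)) * gauss a y x) \<in> schwartz"
      by (rule poly_gauss_schwartz[OF a]) (intro polys.intros)
    from integrable_norm[OF schwartz_integrable[OF this]]
    show "integrable lborel (\<lambda>x. norm (of_real (- 2 * pi) * of_real (x $ i) * gauss a y x))" .
  qed auto
  moreover have "((\<lambda>t. \<integral>x. ?f t x \<partial>lborel) has_vector_derivative partial_deriv i (fourier_integral (gauss a y)) \<xi>) (at 0)"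
    using partial_deriv_line[OF schwartz_differentiable[OF fourier_gauss_schwartz[OF a, of y]], of \<xi> i]
    by (simp add: fourier_integral_def)
  ultimately have "partial_deriv i (fourier_integral (gauss a y)) \<xi> = (\<integral>x. ?f' 0 x \<partial>lborel)"
    by (rule vector_derivative_unique_at[rotated])
  also have "\<dots> = fourier_integral (\<lambda>x. - 2 * pi * \<i> * of_real (x $ i) * gauss a y x) \<xi>"
    unfolding fourier_integral_def by (intro Bochner_Integration.integral_cong refl) simp
  finally show ?thesis .
qed

text \<open>Integration by parts through translation invariance: the integral of
  \<open>?g (x + t *\<^sub>R ?e)\<close> does not depend on \<open>t\<close>, so the integral of its
  derivative at 0 vanishes, and the product rule splits that derivative.\<close>

lemma fourier_integral_partial_deriv:
  assumes s: "\<phi> \<in> schwartz"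
  shows "fourier_integral (partial_deriv i \<phi>) \<xi> = 2 * pi * \<i> * of_real (\<xi> $ i) * fourier_integral \<phi> \<xi>"
proof -
  let ?e = "axis i 1 :: real^3"
  let ?g = "\<lambda>x. cis (- 2 * pi * (x \<bullet> \<xi>)) * \<phi> x"
  let ?g' = "\<lambda>x. \<i> * of_real (- 2 * pi * \<xi> $ i) * cis (- 2 * pi * (x \<bullet> \<xi>)) * \<phi> x + cis (- 2 * pi * (x \<bullet> \<xi>)) * partial_deriv i \<phi> x"
  note s' = schwartz_partial_deriv[OF s, of i]
  note [measurable] = schwartz_measurable[OF s] schwartz_measurable[OF s']
  have g_int: "integrable lborel ?g" by (intro fourier_integrand_integrable schwartz_integrable s) auto
  obtain B where B: "\<And>x. norm (\<phi> x) \<le> B * (1 + norm x) powr (- real 4)" using schwartz_decay[OF s, of 4] by blast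
  obtain C where C: "\<And>x. norm (partial_deriv i \<phi> x) \<le> C * (1 + norm x) powr (- real 4)" using schwartz_decay[OF s', of 4] by blast
  define K where "K = 2 * pi * \<bar>\<xi> $ i\<bar> * B + C"
  have Bnn: "0 \<le> B" using order_trans[OF norm_ge_zero B[of 0]] by simp
  have Cnn: "0 \<le> C" using order_trans[OF norm_ge_zero C[of 0]] by simp
  have Knn: "0 \<le> K" using Bnn Cnn by (simp add: K_def)
  have g'_le: "norm (?g' x) \<le> K * (1 + norm x) powr (- 4)" for x
  proof -
    have "norm (?g' x) \<le> 2 * pi * \<bar>\<xi> $ i\<bar> * norm (\<phi> x) + norm (partial_deriv i \<phi> x)"
      by (rule order_trans[OF norm_triangle_ineq]) (simp add: norm_mult abs_mult)
    also have "\<dots> \<le> 2 * pi * \<bar>\<xi> $ i\<bar> * (B * (1 + norm x) powr (- real 4)) + C * (1 + norm x) powr (- real 4)"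
      by (intro add_mono mult_left_mono B C) auto
    finally show ?thesis by (simp add: K_def algebra_simps)
  qed
  have der: "((\<lambda>s. ?g (x + s *\<^sub>R ?e)) has_vector_derivative ?g' (x + t *\<^sub>R ?e)) (at t)" for x t
  proof -
    let ?z = "x + t *\<^sub>R ?e"
    have e: "- 2 * pi * ((?z + s *\<^sub>R ?e) \<bullet> \<xi>) = - 2 * pi * (?z \<bullet> \<xi>) + s * (- 2 * pi * \<xi> $ i)" for s
      by (simp add: inner_add_left inner_axis' algebra_simps)
    have "((\<lambda>s. ?g (?z + s *\<^sub>R ?e)) has_vector_derivative
        (cis (- 2 * pi * ((?z + 0 *\<^sub>R ?e) \<bullet> \<xi>)) * partial_deriv i \<phi> ?z
         + \<i> * of_real (- 2 * pi * \<xi> $ i) * cis (- 2 * pi * ((?z + 0 *\<^sub>R ?e) \<bullet> \<xi>)) * \<phi> (?z + 0 *\<^sub>R ?e))) (at 0)"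
      unfolding e
      by (rule has_vector_derivative_mult[OF has_vector_derivative_cis])
         (rule partial_deriv_line[OF schwartz_differentiable[OF s]])
    then have h: "((\<lambda>s. ?g (?z + s *\<^sub>R ?e)) has_vector_derivative ?g' ?z) (at (t - t))" by (simp add: add.commute)
    have "((\<lambda>s. s - t) has_vector_derivative 1) (at t)" by (auto intro!: derivative_eq_intros)
    from vector_diff_chain_at[OF this h]
    have "((\<lambda>s. ?g (?z + (s - t) *\<^sub>R ?e)) has_vector_derivative ?g' ?z) (at t)" by (simp add: comp_def)
    moreover have "?z + (s - t) *\<^sub>R ?e = x + s *\<^sub>R ?e" for s by (simp add: scaleR_diff_left)
    ultimately show ?thesis by simp
  qed
  have "((\<lambda>t. \<integral>x. ?g (x + t *\<^sub>R ?e) \<partial>lborel) has_vector_derivative (\<integral>x. ?g' (x + 0 *\<^sub>R ?e) \<partial>lborel)) (at 0)"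
  proof (rule has_vector_derivative_lborel_integral[where a="-1" and b=1 and w="\<lambda>x. K * 2 powr 4 * (1 + norm x) powr (- 4)"])
    fix t x assume t: "-1 < t" "t < (1::real)"
    show "((\<lambda>s. ?g (x + s *\<^sub>R ?e)) has_vector_derivative ?g' (x + t *\<^sub>R ?e)) (at t)" by (rule der)
    show "norm (?g' (x + t *\<^sub>R ?e)) \<le> K * 2 powr 4 * (1 + norm x) powr (- 4)"
    proof -
      \<comment> \<open>A shift by less than 1 changes \<open>1 + norm x\<close> by at most a factor
        2; this is the origin of \<open>2 powr 4\<close> in the majorant.\<close>
      have aux: "1 + n \<le> 2 * (1 + m)" if "n \<le> m + \<bar>t\<bar>" "\<bar>t\<bar> < 1" "0 \<le> m" for n m t :: real
      proof -
        have "n < m + 1" using le_less_trans[OF that(1) add_strict_left_mono[OF that(2), of m]] .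
        then show ?thesis using that(3) by (smt (verit))
      qed
      have "norm x \<le> norm (x + t *\<^sub>R ?e) + norm (t *\<^sub>R ?e)"
        using norm_triangle_ineq4[of "x + t *\<^sub>R ?e" "t *\<^sub>R ?e"] by simp
      then have "norm x \<le> norm (x + t *\<^sub>R ?e) + \<bar>t\<bar>" by simp
      moreover have "\<bar>t\<bar> < 1" using t by auto
      ultimately have "1 + norm x \<le> 2 * (1 + norm (x + t *\<^sub>R ?e))"
        by (rule aux[OF _ _ norm_ge_zero])
      then have "(2 * (1 + norm (x + t *\<^sub>R ?e))) powr (- 4) \<le> (1 + norm x) powr (- 4)"
        by (intro powr_mono2') (auto simp: add_pos_nonneg)
      then have "2 powr (- 4) * (1 + norm (x + t *\<^sub>R ?e)) powr (- 4) \<le> (1 + norm x) powr (- 4)"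
        by (simp only: powr_mult)
      then have "(1 + norm (x + t *\<^sub>R ?e)) powr (- 4) \<le> 2 powr 4 * (1 + norm x) powr (- 4)"
        by (simp add: powr_minus field_simps)
      from mult_left_mono[OF this Knn] show ?thesis using g'_le[of "x + t *\<^sub>R ?e"] by (simp add: mult_ac)
    qed
  next
    fix t :: real
    show "integrable lborel (\<lambda>x. ?g (x + t *\<^sub>R ?e))"
      using g_int integrable_translate[of ?g "t *\<^sub>R ?e"] by (simp add: add.commute)
  next
    show "integrable lborel (\<lambda>x::real^3. K * 2 powr 4 * (1 + norm x) powr (- 4))"
      by (intro integrable_mult_right integrable_one_plus_norm_powr) simp
  qed auto
  moreover have "(\<integral>x. ?g (x + t *\<^sub>R ?e) \<partial>lborel) = fourier_integral \<phi> \<xi>" for t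
    using integral_translate[of ?g "t *\<^sub>R ?e"] by (simp add: add.commute fourier_integral_def)
  ultimately have "((\<lambda>t. fourier_integral \<phi> \<xi>) has_vector_derivative (\<integral>x. ?g' x \<partial>lborel)) (at (0::real))" by simp
  from vector_derivative_unique_at[OF this has_vector_derivative_const]
  have "0 = (\<integral>x. ?g' x \<partial>lborel)" by simp
  also have "\<dots> = (\<integral>x. (\<i> * of_real (- 2 * pi * \<xi> $ i)) * ?g x + cis (- 2 * pi * (x \<bullet> \<xi>)) * partial_deriv i \<phi> x \<partial>lborel)"
    by (simp only: mult.assoc)
  also have "\<dots> = (\<integral>x. (\<i> * of_real (- 2 * pi * \<xi> $ i)) * ?g x \<partial>lborel) + fourier_integral (partial_deriv i \<phi>) \<xi>"
    unfolding fourier_integral_def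
    by (intro Bochner_Integration.integral_add integrable_mult_right g_int fourier_integrand_integrable
        schwartz_integrable[OF s']) measurable
  also have "(\<integral>x. (\<i> * of_real (- 2 * pi * \<xi> $ i)) * ?g x \<partial>lborel) = (\<i> * of_real (- 2 * pi * \<xi> $ i)) * fourier_integral \<phi> \<xi>"
    unfolding fourier_integral_def by (rule integral_mult_right_zero)
  finally show ?thesis by (simp add: algebra_simps eq_neg_iff_add_eq_0)
qed

section \<open>Distributional Fourier transforms\<close>

lemma tempered_square_integrable:
  assumes "square_integrable f" shows "tempered f"
  using assms by (auto simp: tempered_def intro!: square_integrable_mult schwartz_square_integrable)

lemma L2_fourier_has_fourier_transform:
  assumes f: "L2_fourier f g" shows "has_fourier_transform f g"
  unfolding has_fourier_transform_def
  using L2_fourierD[OF f] by (auto intro!: tempered_square_integrable schwartz_integrable schwartz_square_integrable)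

lemma has_fourier_transform_unique:
  assumes g: "has_fourier_transform f g" and h: "has_fourier_transform f h"
  shows "AE \<xi> in lborel. g \<xi> = h \<xi>"
proof (rule gauss_test_eq)
  show "g \<in> borel_measurable borel" "h \<in> borel_measurable borel"
    using g h by (auto simp: has_fourier_transform_def tempered_def)
  fix a :: real and y assume a: "a > 0"
  note s = gauss_schwartz[OF a, of y]
  show "integrable lborel (\<lambda>x. g x * gauss a y x)" "integrable lborel (\<lambda>x. h x * gauss a y x)"
    using g h s by (auto simp: has_fourier_transform_def tempered_def)
  show "(\<integral>x. g x * gauss a y x \<partial>lborel) = (\<integral>x. h x * gauss a y x \<partial>lborel)"
    using g h s by (auto simp: has_fourier_transform_def)
qed

lemma has_fourier_transform_fourier:
  "has_fourier_transform f g \<Longrightarrow> has_fourier_transform f (fourier f)"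
  unfolding fourier_def by (rule someI[of "has_fourier_transform f" g])

text \<open>\<open>fourier\<close> is an arbitrary choice among transforms that agree almost
  everywhere, so inside integrals any transform at hand may replace it.\<close>

lemma fourier_AE_eq:
  assumes "has_fourier_transform f g" shows "AE \<xi> in lborel. fourier f \<xi> = g \<xi>"
  by (rule has_fourier_transform_unique[OF has_fourier_transform_fourier[OF assms] assms])


section \<open>Matrix fields and the heat semigroup\<close>

lemma square_integrable_rep_L2: "square_integrable (rep_L2 F)"
  using Quotient3_rep_reflp[OF Quotient3_L2, of F] by (simp add: L2_rel_def)

lemma rep_abs_L2_AE:
  assumes "square_integrable f" shows "AE x in lborel. rep_L2 (abs_L2 f) x = f x"
  using Quotient3_rep_abs[OF Quotient3_L2, of f] assms by (simp add: L2_rel_def)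

lemma inner_L2_rep: "F \<bullet> G = (\<integral>x. rep_L2 F x \<bullet> rep_L2 G x \<partial>lborel)"
  by (simp add: inner_L2_def)

section \<open>Matrix fields entry by entry\<close>

definition entry :: "(real^3 \<Rightarrow> real^3^3) \<Rightarrow> 3 \<Rightarrow> 3 \<Rightarrow> real^3 \<Rightarrow> complex" where
  "entry f i j x = of_real (f x $ i $ j)"

lemma entry_measurable [measurable]:
  assumes "f \<in> borel_measurable borel" shows "entry f i j \<in> borel_measurable borel"
proof -
  have "(\<lambda>y::real^3^3. complex_of_real (y $ i $ j)) \<in> borel_measurable borel"
    by (intro borel_measurable_continuous_onI continuous_intros)
  from measurable_compose[OF assms this] show ?thesis by (simp add: entry_def[abs_def])
qed

lemma inner_matrix: "(M :: real^3^3) \<bullet> N = (\<Sum>i\<in>UNIV. \<Sum>j\<in>UNIV. M $ i $ j * N $ i $ j)"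
  by (simp add: inner_vec_def)

lemma norm_matrix_sq: "(norm (M :: real^3^3))\<^sup>2 = (\<Sum>i\<in>UNIV. \<Sum>j\<in>UNIV. (M $ i $ j)\<^sup>2)"
  unfolding power2_norm_eq_inner inner_matrix by (simp only: power2_eq_square)

lemma abs_entry_le: "\<bar>(M :: real^3^3) $ i $ j\<bar> \<le> norm M"
  using component_le_norm_cart[of "M $ i" j] Finite_Cartesian_Product.norm_nth_le[of M i] by simp

lemma norm_matrix_le: "norm (M :: real^3^3) \<le> (\<Sum>i\<in>UNIV. \<Sum>j\<in>UNIV. \<bar>M $ i $ j\<bar>)"
proof -
  have "norm M \<le> (\<Sum>i\<in>UNIV. norm (M $ i))" by (simp add: norm_vec_def[of M] L2_set_le_sum)
  also have "\<dots> \<le> (\<Sum>i\<in>UNIV. \<Sum>j\<in>UNIV. \<bar>M $ i $ j\<bar>)" by (intro sum_mono norm_le_l1_cart)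
  finally show ?thesis .
qed

lemma square_integrable_entry:
  assumes "square_integrable f" shows "square_integrable (entry f i j)"
proof -
  note [measurable] = square_integrable_borel[OF assms]
  have "integrable lborel (\<lambda>x. (norm (f x))\<^sup>2)" using assms by (simp add: square_integrable_def)
  then have "integrable lborel (\<lambda>x. (norm (entry f i j x))\<^sup>2)"
  proof (rule Bochner_Integration.integrable_bound)
    show "AE x in lborel. norm ((norm (entry f i j x))\<^sup>2) \<le> norm ((norm (f x))\<^sup>2)"
      using power_mono[OF abs_entry_le abs_ge_zero, of "f _" i j 2] by (intro AE_I2) (simp add: entry_def)
  qed simp
  then show ?thesis by (simp add: square_integrable_def)
qed

lemma square_integrable_matrixI:
  assumes [measurable]: "f \<in> borel_measurable borel" and "\<And>i j. square_integrable (entry f i j)"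
  shows "square_integrable f"
proof -
  have "integrable lborel (\<lambda>x. \<Sum>i\<in>UNIV. \<Sum>j\<in>UNIV. (norm (entry f i j x))\<^sup>2)"
    using assms by (intro Bochner_Integration.integrable_sum) (simp add: square_integrable_def)
  moreover have "(\<Sum>i\<in>UNIV. \<Sum>j\<in>UNIV. (norm (entry f i j x))\<^sup>2) = (norm (f x))\<^sup>2" for x
    by (simp add: norm_matrix_sq entry_def)
  ultimately show ?thesis by (simp add: square_integrable_def)
qed

lemma integrable_entry:
  assumes "integrable lborel f" shows "integrable lborel (entry f i j)"
proof (rule Bochner_Integration.integrable_bound[OF assms])
  have [measurable]: "f \<in> borel_measurable borel" using assms by auto
  show "entry f i j \<in> borel_measurable lborel" by simp
  show "AE x in lborel. norm (entry f i j x) \<le> norm (f x)"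
    by (simp add: entry_def abs_entry_le)
qed

lemma inner_L2_entry:
  "F \<bullet> G = (\<Sum>i\<in>UNIV. \<Sum>j\<in>UNIV. \<integral>x. entry (rep_L2 F) i j x \<bullet> entry (rep_L2 G) i j x \<partial>lborel)"
proof -
  have i: "integrable lborel (\<lambda>x. entry (rep_L2 F) i j x \<bullet> entry (rep_L2 G) i j x)" for i j
    by (intro square_integrable_inner square_integrable_entry square_integrable_rep_L2)
  have "F \<bullet> G = (\<integral>x. (\<Sum>i\<in>UNIV. \<Sum>j\<in>UNIV. entry (rep_L2 F) i j x \<bullet> entry (rep_L2 G) i j x) \<partial>lborel)"
    unfolding inner_L2_rep by (simp add: inner_matrix entry_def inner_complex_def)
  also have "\<dots> = (\<Sum>i\<in>UNIV. \<Sum>j\<in>UNIV. \<integral>x. entry (rep_L2 F) i j x \<bullet> entry (rep_L2 G) i j x \<partial>lborel)"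
    using i by (simp add: Bochner_Integration.integral_sum)
  finally show ?thesis .
qed

text \<open>A relation and not a function, so that \<open>A\<close> may be any representative. Later
  this admits the particular one that satisfies an equation at every frequency.\<close>

definition matrix_fourier :: "(real^3^3) L2 \<Rightarrow> (3 \<Rightarrow> 3 \<Rightarrow> real^3 \<Rightarrow> complex) \<Rightarrow> bool" where
  "matrix_fourier F A \<longleftrightarrow> (\<forall>i j. L2_fourier (entry (rep_L2 F) i j) (A i j))"

lemma matrix_fourierD: "matrix_fourier F A \<Longrightarrow> L2_fourier (entry (rep_L2 F) i j) (A i j)"
  by (simp add: matrix_fourier_def)

lemma matrix_fourier_exists: "\<exists>A. matrix_fourier F A"
proof -
  have "\<exists>g. L2_fourier (entry (rep_L2 F) i j) g" for i j
    using L2_fourier_exists[OF square_integrable_entry[OF square_integrable_rep_L2]] by blast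
  then show ?thesis unfolding matrix_fourier_def by metis
qed

lemma inner_matrix_fourier:
  assumes A: "matrix_fourier F A" and B: "matrix_fourier G B"
  shows "F \<bullet> G = (\<Sum>i\<in>UNIV. \<Sum>j\<in>UNIV. \<integral>\<xi>. A i j \<xi> \<bullet> B i j \<xi> \<partial>lborel)"
  unfolding inner_L2_entry parseval[OF matrix_fourierD[OF A] matrix_fourierD[OF B]] ..

lemma norm_matrix_fourier:
  assumes A: "matrix_fourier F A"
  shows "(norm F)\<^sup>2 = (\<Sum>i\<in>UNIV. \<Sum>j\<in>UNIV. \<integral>\<xi>. (norm (A i j \<xi>))\<^sup>2 \<partial>lborel)"
  unfolding power2_norm_eq_inner inner_matrix_fourier[OF A A] ..

text \<open>The Fourier multiplier of the heat semigroup. Negative times are meaningful as well and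
  serve as integrating factors.\<close>

definition heat_symbol :: "real \<Rightarrow> real^3 \<Rightarrow> real" where
  "heat_symbol t \<xi> = exp (- (4 * pi\<^sup>2 * t) * (norm \<xi>)\<^sup>2)"

lemma heat_symbol_measurable [measurable]: "heat_symbol t \<in> borel_measurable borel"
  unfolding heat_symbol_def[abs_def] by measurable

lemma heat_symbol_bounds: "0 < heat_symbol t \<xi>" "0 \<le> t \<Longrightarrow> heat_symbol t \<xi> \<le> 1"
  by (auto simp: heat_symbol_def)

lemma integrable_heat_symbol: "t > 0 \<Longrightarrow> integrable lborel (heat_symbol t)"
  unfolding heat_symbol_def[abs_def] using exp_norm_integrable[of "4 * pi\<^sup>2 * t" "0::real^3"] by simp

lemma heat_kernel_gauss:
  assumes "t > 0"
  shows "complex_of_real (heat_kernel (x - y) t) = of_real ((4 * pi * t) powr (- 3 / 2)) * gauss (1 / (4 * t)) y x"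
  by (simp add: heat_kernel_def gauss_def)

lemma fourier_heat_kernel:
  assumes t: "t > 0"
  shows "fourier_integral (\<lambda>x. of_real (heat_kernel (x - y) t)) \<xi> = cis (- 2 * pi * (y \<bullet> \<xi>)) * of_real (heat_symbol t \<xi>)"
proof -
  have p: "4 * pi * t > 0" using t by simp
  have "(4 * pi * t) powr (- 3 / 2) * sqrt (4 * pi * t) ^ 3 = 1"
  proof -
    have "sqrt (4 * pi * t) ^ 3 = (4 * pi * t) powr (3 / 2)"
    proof -
      have "(4 * pi * t) powr (3 / 2) = ((4 * pi * t) powr (1 / 2)) powr 3" by (simp add: powr_powr)
      then show ?thesis using p by (simp add: powr_numeral powr_half_sqrt)
    qed
    then show ?thesis using t by (simp add: powr_add[symmetric])
  qed
  then have c: "complex_of_real ((4 * pi * t) powr (- 3 / 2)) * of_real (sqrt (4 * pi * t) ^ 3) = 1"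
    by (metis of_real_mult of_real_1)
  have "fourier_integral (\<lambda>x. of_real (heat_kernel (x - y) t)) \<xi>
    = of_real ((4 * pi * t) powr (- 3 / 2)) * (of_real (sqrt (4 * pi * t) ^ 3) *
        (cis (- 2 * pi * (y \<bullet> \<xi>)) * gauss (4 * pi\<^sup>2 * t) 0 \<xi>))"
    unfolding heat_kernel_gauss[OF t] fourier_integral_cmult
    using fourier_gauss[of "1 / (4 * t)" y \<xi>] t by (simp add: mult_ac)
  also have "\<dots> = cis (- 2 * pi * (y \<bullet> \<xi>)) * gauss (4 * pi\<^sup>2 * t) 0 \<xi>"
    using c by (simp only: mult.assoc[symmetric] mult_1)
  finally show ?thesis by (simp add: gauss_def heat_symbol_def)
qed

lemma heat_kernel_measurable [measurable]: "(\<lambda>x. heat_kernel x t) \<in> borel_measurable borel"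
  unfolding heat_kernel_def by measurable

lemma heat_kernel_nonneg [simp]: "0 \<le> heat_kernel x t"
  by (simp add: heat_kernel_def)

lemma heat_kernel_le:
  assumes "t > 0" shows "heat_kernel x t \<le> (4 * pi * t) powr (- 3 / 2)"
proof -
  have "exp (- (norm x)\<^sup>2 / (4 * t)) \<le> 1" using assms by simp
  from mult_left_mono[OF this, of "(4 * pi * t) powr (- 3 / 2)"] show ?thesis by (simp add: heat_kernel_def)
qed

lemma integrable_heat_kernel:
  assumes "t > 0" shows "integrable lborel (\<lambda>x. heat_kernel x t)"
  unfolding heat_kernel_def using exp_norm_integrable[of "1 / (4 * t)" "0::real^3"] assms by simp

lemma square_integrable_heat_kernel:
  assumes "t > 0" shows "square_integrable (\<lambda>x. heat_kernel x t)"
  using integrable_heat_kernel[OF assms] heat_kernel_le[OF assms]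
  by (intro square_integrable_bounded) auto

lemma integrable_pair_bound_conv':
  fixes F :: "'a::euclidean_space \<Rightarrow> 'a \<Rightarrow> 'c::{banach, second_countable_topology}"
  assumes [measurable]: "case_prod F \<in> borel_measurable (lborel \<Otimes>\<^sub>M lborel)"
    and f: "integrable lborel f" and g: "integrable lborel g"
    and le: "\<And>x y. norm (F x y) \<le> f y * g (x - y)"
  shows "integrable (lborel \<Otimes>\<^sub>M lborel) (case_prod F)"
proof -
  have [measurable]: "g \<in> borel_measurable borel" using g by auto
  have g': "integrable lborel (\<lambda>x. g (- x))" using g integrable_reflect[of g 0] by simp
  have "integrable (lborel \<Otimes>\<^sub>M lborel) (case_prod (\<lambda>x y. F y x))"
    by (rule integrable_pair_bound_conv[OF _ f g']) (use le in auto)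
  from lborel_pair.integrable_product_swap[OF this] show ?thesis by (simp add: case_prod_beta')
qed

definition heat_conv :: "real \<Rightarrow> (real^3 \<Rightarrow> complex) \<Rightarrow> real^3 \<Rightarrow> complex" where
  "heat_conv t f x = (\<integral>y. heat_kernel (x - y) t *\<^sub>R f y \<partial>lborel)"

lemma heat_conv_measurable [measurable]:
  assumes [measurable]: "f \<in> borel_measurable borel"
  shows "heat_conv t f \<in> borel_measurable borel"
  unfolding heat_conv_def[abs_def] by measurable

text \<open>By the multiplication formula, convolving \<open>\<phi>^\<close> with the heat kernel multiplies \<open>\<phi>\<close> by
  the heat symbol; Fubini moves the convolution from \<open>f\<close> to \<open>\<phi>^\<close>.\<close>

lemma heat_conv_fourier_test:
  assumes t: "t > 0" and p: "integrable lborel \<phi>" and [measurable]: "f \<in> borel_measurable borel"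
    and int: "integrable (lborel \<Otimes>\<^sub>M lborel) (\<lambda>(x, y). (heat_kernel (x - y) t *\<^sub>R f y) * fourier_integral \<phi> x)"
  shows "(\<integral>x. heat_conv t f x * fourier_integral \<phi> x \<partial>lborel)
    = (\<integral>y. f y * fourier_integral (\<lambda>\<xi>. of_real (heat_symbol t \<xi>) * \<phi> \<xi>) y \<partial>lborel)"
proof -
  have [measurable]: "\<phi> \<in> borel_measurable borel" using p by auto
  have e: "(\<integral>x. of_real (heat_kernel (x - y) t) * fourier_integral \<phi> x \<partial>lborel)
    = fourier_integral (\<lambda>\<xi>. of_real (heat_symbol t \<xi>) * \<phi> \<xi>) y" for y
  proof -
    have k: "integrable lborel (\<lambda>x. complex_of_real (heat_kernel (x - y) t))"
      unfolding heat_kernel_gauss[OF t] using t by simp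
    have "(\<integral>x. of_real (heat_kernel (x - y) t) * fourier_integral \<phi> x \<partial>lborel)
      = (\<integral>\<xi>. (cis (- 2 * pi * (y \<bullet> \<xi>)) * of_real (heat_symbol t \<xi>)) * \<phi> \<xi> \<partial>lborel)"
      unfolding fourier_multiplication_formula[OF k p] fourier_heat_kernel[OF t] ..
    also have "\<dots> = fourier_integral (\<lambda>\<xi>. of_real (heat_symbol t \<xi>) * \<phi> \<xi>) y"
      by (simp add: fourier_integral_def mult.assoc inner_commute)
    finally show ?thesis .
  qed
  have "(\<integral>x. heat_conv t f x * fourier_integral \<phi> x \<partial>lborel)
    = (\<integral>x. (\<integral>y. (heat_kernel (x - y) t *\<^sub>R f y) * fourier_integral \<phi> x \<partial>lborel) \<partial>lborel)"
    unfolding heat_conv_def by (simp only: integral_mult_left_zero)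
  also have "\<dots> = (\<integral>y. (\<integral>x. (heat_kernel (x - y) t *\<^sub>R f y) * fourier_integral \<phi> x \<partial>lborel) \<partial>lborel)"
    by (rule lborel_pair.Fubini_integral[OF int, symmetric])
  also have "\<dots> = (\<integral>y. f y * (\<integral>x. of_real (heat_kernel (x - y) t) * fourier_integral \<phi> x \<partial>lborel) \<partial>lborel)"
  proof (intro Bochner_Integration.integral_cong refl)
    fix y
    have "(heat_kernel (x - y) t *\<^sub>R f y) * fourier_integral \<phi> x = f y * (of_real (heat_kernel (x - y) t) * fourier_integral \<phi> x)" for x
      by (simp add: scaleR_conv_of_real)
    then show "(\<integral>x. (heat_kernel (x - y) t *\<^sub>R f y) * fourier_integral \<phi> x \<partial>lborel)
      = f y * (\<integral>x. of_real (heat_kernel (x - y) t) * fourier_integral \<phi> x \<partial>lborel)"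
      by (simp only: integral_mult_right_zero)
  qed
  finally show ?thesis by (simp only: e)
qed

lemma heat_symbol_mult:
  fixes \<phi> :: "real^3 \<Rightarrow> complex"
  assumes "0 \<le> t"
  shows "integrable lborel \<phi> \<Longrightarrow> integrable lborel (\<lambda>\<xi>. of_real (heat_symbol t \<xi>) * \<phi> \<xi>)"
    and "square_integrable \<phi> \<Longrightarrow> square_integrable (\<lambda>\<xi>. of_real (heat_symbol t \<xi>) * \<phi> \<xi>)"
proof -
  have le: "norm (of_real (heat_symbol t \<xi>) * \<phi> \<xi>) \<le> norm (\<phi> \<xi>)" for \<xi>
    using heat_symbol_bounds[of t \<xi>] assms
    by (simp add: norm_mult mult_left_le_one_le)
  show "integrable lborel (\<lambda>\<xi>. of_real (heat_symbol t \<xi>) * \<phi> \<xi>)" if i: "integrable lborel \<phi>"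
  proof (rule Bochner_Integration.integrable_bound[OF i])
    have [measurable]: "\<phi> \<in> borel_measurable borel" using i by auto
    show "(\<lambda>\<xi>. of_real (heat_symbol t \<xi>) * \<phi> \<xi>) \<in> borel_measurable lborel" by measurable
    show "AE \<xi> in lborel. norm (of_real (heat_symbol t \<xi>) * \<phi> \<xi>) \<le> norm (\<phi> \<xi>)"
      by (rule AE_I2) (rule le)
  qed
  show "square_integrable (\<lambda>\<xi>. of_real (heat_symbol t \<xi>) * \<phi> \<xi>)" if s: "square_integrable \<phi>"
    unfolding square_integrable_def
  proof
    note [measurable] = square_integrable_borel[OF s]
    show m: "(\<lambda>\<xi>. of_real (heat_symbol t \<xi>) * \<phi> \<xi>) \<in> borel_measurable lborel" by measurable
    have i: "integrable lborel (\<lambda>x. (norm (\<phi> x))\<^sup>2)" using s by (simp add: square_integrable_def)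
    show "integrable lborel (\<lambda>\<xi>. (norm (of_real (heat_symbol t \<xi>) * \<phi> \<xi>))\<^sup>2)"
    proof (rule Bochner_Integration.integrable_bound[OF i])
      show "AE \<xi> in lborel. norm ((norm (of_real (heat_symbol t \<xi>) * \<phi> \<xi>))\<^sup>2) \<le> norm ((norm (\<phi> \<xi>))\<^sup>2)"
        unfolding real_norm_def abs_power2 by (rule AE_I2) (rule power_mono[OF le norm_ge_zero])
    qed measurable
  qed
qed

lemma square_integrable_heat_symbol_bounded:
  fixes g :: "real^3 \<Rightarrow> complex"
  assumes t: "t > 0" and [measurable]: "g \<in> borel_measurable borel" and g: "\<And>\<xi>. norm (g \<xi>) \<le> B"
  shows "integrable lborel (\<lambda>\<xi>. of_real (heat_symbol t \<xi>) * g \<xi>)"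
    and "square_integrable (\<lambda>\<xi>. of_real (heat_symbol t \<xi>) * g \<xi>)"
proof -
  have B: "0 \<le> B" using order_trans[OF norm_ge_zero g] .
  have le: "norm (of_real (heat_symbol t \<xi>) * g \<xi>) \<le> heat_symbol t \<xi> * B" for \<xi>
    using heat_symbol_bounds(1)[of t \<xi>] g[of \<xi>] by (simp add: norm_mult)
  show i: "integrable lborel (\<lambda>\<xi>. of_real (heat_symbol t \<xi>) * g \<xi>)"
  proof (rule Bochner_Integration.integrable_bound)
    show "integrable lborel (\<lambda>\<xi>. heat_symbol t \<xi> * B)" using integrable_heat_symbol[OF t] by simp
    show "AE x in lborel. norm (of_real (heat_symbol t x) * g x) \<le> norm (heat_symbol t x * B)"
      using order_trans[OF le abs_ge_self] by (intro AE_I2) simp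
  qed measurable
  have "norm (of_real (heat_symbol t \<xi>) * g \<xi>) \<le> B" for \<xi>
    using le[of \<xi>] mult_right_mono[OF heat_symbol_bounds(2)[of t \<xi>] B] t by simp
  with i show "square_integrable (\<lambda>\<xi>. of_real (heat_symbol t \<xi>) * g \<xi>)"
    by (rule square_integrable_bounded)
qed

text \<open>The case of the squared field, which is only known to be in L1. Young's inequality puts
  the kernel in L2. In the exchange of integrals the transform of \<phi> is bounded by the L1 norm
  of \<phi>.\<close>

lemma heat_conv_L1:
  assumes t: "t > 0" and f: "integrable lborel f"
  shows "L2_fourier (heat_conv t f) (\<lambda>\<xi>. of_real (heat_symbol t \<xi>) * fourier_integral f \<xi>)"
proof -
  have [measurable]: "f \<in> borel_measurable borel" using f by auto
  have "square_integrable (heat_conv t f)"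
  proof (rule square_integrableI_nn(1))
    let ?I = "\<integral>x. norm (f x) \<partial>lborel" and ?k = "L2n (\<lambda>x. heat_kernel x t)"
    have "(\<integral>\<^sup>+x. ennreal ((norm (heat_conv t f x))\<^sup>2) \<partial>lborel)
      \<le> (\<integral>\<^sup>+y. ennreal (norm (f y)) \<partial>lborel)\<^sup>2 * (\<integral>\<^sup>+y. ennreal ((heat_kernel y t)\<^sup>2) \<partial>lborel)"
      unfolding heat_conv_def by (rule nn_integral_conv_sq_le_field) auto
    also have "(\<integral>\<^sup>+y. ennreal (norm (f y)) \<partial>lborel) = ennreal ?I"
      using f by (intro nn_integral_eq_integral) auto
    also have "(\<integral>\<^sup>+y. ennreal ((heat_kernel y t)\<^sup>2) \<partial>lborel) = ennreal (?k\<^sup>2)"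
      using nn_integral_L2n[OF square_integrable_heat_kernel[OF t]] by simp
    also have "(ennreal ?I)\<^sup>2 * ennreal (?k\<^sup>2) = ennreal ((?I * ?k)\<^sup>2)"
      by (simp add: ennreal_power ennreal_mult[symmetric] power_mult_distrib)
    finally show "(\<integral>\<^sup>+x. ennreal ((norm (heat_conv t f x))\<^sup>2) \<partial>lborel) \<le> ennreal ((?I * ?k)\<^sup>2)" .
  qed auto
  moreover have "square_integrable (\<lambda>\<xi>. of_real (heat_symbol t \<xi>) * fourier_integral f \<xi>)"
    by (rule square_integrable_heat_symbol_bounded[OF t _ norm_fourier_integral_le]) measurable
  moreover have "(\<integral>x. heat_conv t f x * fourier_integral \<phi> x \<partial>lborel)
      = (\<integral>\<xi>. of_real (heat_symbol t \<xi>) * fourier_integral f \<xi> * \<phi> \<xi> \<partial>lborel)"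
    if p: "integrable lborel \<phi>" "square_integrable \<phi>" for \<phi>
  proof -
    have [measurable]: "\<phi> \<in> borel_measurable borel" using p by auto
    have "integrable (lborel \<Otimes>\<^sub>M lborel) (\<lambda>(x, y). (heat_kernel (x - y) t *\<^sub>R f y) * fourier_integral \<phi> x)"
    proof (rule integrable_pair_bound_conv')
      show "integrable lborel (\<lambda>y. norm (f y) * (\<integral>x. norm (\<phi> x) \<partial>lborel))" using f by simp
      fix x y
      show "norm ((heat_kernel (x - y) t *\<^sub>R f y) * fourier_integral \<phi> x)
        \<le> norm (f y) * (\<integral>x. norm (\<phi> x) \<partial>lborel) * heat_kernel (x - y) t"
        using mult_left_mono[OF norm_fourier_integral_le[of \<phi> x], of "heat_kernel (x - y) t * norm (f y)"]
        by (simp add: norm_mult mult_ac)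
    qed (use integrable_heat_kernel[OF t] in measurable)
    from heat_conv_fourier_test[OF t p(1) _ this]
    have "(\<integral>x. heat_conv t f x * fourier_integral \<phi> x \<partial>lborel)
      = (\<integral>y. f y * fourier_integral (\<lambda>\<xi>. of_real (heat_symbol t \<xi>) * \<phi> \<xi>) y \<partial>lborel)" by simp
    also have "\<dots> = (\<integral>\<xi>. fourier_integral f \<xi> * (of_real (heat_symbol t \<xi>) * \<phi> \<xi>) \<partial>lborel)"
      using t by (intro fourier_multiplication_formula f heat_symbol_mult p) simp
    finally show ?thesis by (simp add: mult_ac)
  qed
  ultimately show ?thesis unfolding L2_fourier_def by blast
qed

text \<open>The case of the initial field, with the kernel in L1. For the exchange of integrals the
  product of the two L2 factors is bounded by the sum of their squares, each of which is integrable
  against the kernel.\<close>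

lemma heat_conv_L2:
  assumes t: "t > 0" and f: "L2_fourier f g"
  shows "L2_fourier (heat_conv t f) (\<lambda>\<xi>. of_real (heat_symbol t \<xi>) * g \<xi>)"
proof -
  note s = L2_fourierD(1,2)[OF f]
  note [measurable] = square_integrable_borel[OF s(1)] square_integrable_borel[OF s(2)]
  have "square_integrable (heat_conv t f)"
  proof (rule square_integrableI_nn(1))
    let ?k = "\<integral>x. heat_kernel x t \<partial>lborel"
    have "(\<integral>\<^sup>+x. ennreal ((norm (heat_conv t f x))\<^sup>2) \<partial>lborel)
      \<le> (\<integral>\<^sup>+y. ennreal (heat_kernel y t) \<partial>lborel)\<^sup>2 * (\<integral>\<^sup>+y. ennreal ((norm (f y))\<^sup>2) \<partial>lborel)"
      unfolding heat_conv_def by (rule nn_integral_conv_sq_le_kernel) auto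
    also have "(\<integral>\<^sup>+y. ennreal (heat_kernel y t) \<partial>lborel) = ennreal ?k"
      using integrable_heat_kernel[OF t] by (intro nn_integral_eq_integral) auto
    also have "(\<integral>\<^sup>+y. ennreal ((norm (f y))\<^sup>2) \<partial>lborel) = ennreal ((L2n f)\<^sup>2)"
      by (rule nn_integral_L2n[OF s(1)])
    also have "(ennreal ?k)\<^sup>2 * ennreal ((L2n f)\<^sup>2) = ennreal ((?k * L2n f)\<^sup>2)"
      by (simp add: ennreal_power ennreal_mult[symmetric] power_mult_distrib)
    finally show "(\<integral>\<^sup>+x. ennreal ((norm (heat_conv t f x))\<^sup>2) \<partial>lborel) \<le> ennreal ((?k * L2n f)\<^sup>2)" .
  qed auto
  moreover have "square_integrable (\<lambda>\<xi>. of_real (heat_symbol t \<xi>) * g \<xi>)"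
    using t s by (intro heat_symbol_mult) auto
  moreover have "(\<integral>x. heat_conv t f x * fourier_integral \<phi> x \<partial>lborel)
      = (\<integral>\<xi>. of_real (heat_symbol t \<xi>) * g \<xi> * \<phi> \<xi> \<partial>lborel)"
    if p: "integrable lborel \<phi>" "square_integrable \<phi>" for \<phi>
  proof -
    have [measurable]: "\<phi> \<in> borel_measurable borel" using p by auto
    have F2: "integrable lborel (\<lambda>x. (norm (fourier_integral \<phi> x))\<^sup>2)"
      using square_integrable_fourier[OF p] by (simp add: square_integrable_def)
    have f2: "integrable lborel (\<lambda>x. (norm (f x))\<^sup>2)" using s by (simp add: square_integrable_def)
    have i1: "integrable (lborel \<Otimes>\<^sub>M lborel) (\<lambda>(x, y). (norm (f y))\<^sup>2 * heat_kernel (x - y) t)"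
      by (rule integrable_pair_bound_conv'[OF _ f2 integrable_heat_kernel[OF t]]) auto
    have i2: "integrable (lborel \<Otimes>\<^sub>M lborel) (\<lambda>(x, y). (norm (fourier_integral \<phi> x))\<^sup>2 * heat_kernel (x - y) t)"
      by (rule integrable_pair_bound_conv[OF _ F2 integrable_heat_kernel[OF t]]) auto
    have "integrable (lborel \<Otimes>\<^sub>M lborel) (\<lambda>(x, y). (heat_kernel (x - y) t *\<^sub>R f y) * fourier_integral \<phi> x)"
    proof (rule Bochner_Integration.integrable_bound[OF Bochner_Integration.integrable_add[OF i1 i2]])
      have "norm ((heat_kernel (x - y) t *\<^sub>R f y) * fourier_integral \<phi> x)
        \<le> norm ((norm (f y))\<^sup>2 * heat_kernel (x - y) t + (norm (fourier_integral \<phi> x))\<^sup>2 * heat_kernel (x - y) t)" for x y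
      proof -
        have "norm (f y) * norm (fourier_integral \<phi> x) \<le> (norm (f y))\<^sup>2 + (norm (fourier_integral \<phi> x))\<^sup>2"
        proof -
          have "0 \<le> norm (f y) * norm (fourier_integral \<phi> x)" by simp
          then show ?thesis
            using sum_squares_bound[of "norm (f y)" "norm (fourier_integral \<phi> x)"] by linarith
        qed
        from mult_left_mono[OF this, of "heat_kernel (x - y) t"] show ?thesis
          by (simp add: norm_mult algebra_simps abs_of_nonneg add_nonneg_nonneg)
      qed
      then show "AE z in lborel \<Otimes>\<^sub>M lborel. norm (case z of (x, y) \<Rightarrow> (heat_kernel (x - y) t *\<^sub>R f y) * fourier_integral \<phi> x)
        \<le> norm ((case z of (x, y) \<Rightarrow> (norm (f y))\<^sup>2 * heat_kernel (x - y) t) + (case z of (x, y) \<Rightarrow> (norm (fourier_integral \<phi> x))\<^sup>2 * heat_kernel (x - y) t))"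
        by (intro AE_I2) (simp add: case_prod_beta')
    qed measurable
    from heat_conv_fourier_test[OF t p(1) _ this]
    have "(\<integral>x. heat_conv t f x * fourier_integral \<phi> x \<partial>lborel)
      = (\<integral>y. f y * fourier_integral (\<lambda>\<xi>. of_real (heat_symbol t \<xi>) * \<phi> \<xi>) y \<partial>lborel)" by simp
    also have "\<dots> = (\<integral>\<xi>. g \<xi> * (of_real (heat_symbol t \<xi>) * \<phi> \<xi>) \<partial>lborel)"
      using t by (intro L2_fourierD(3)[OF f] heat_symbol_mult p) simp_all
    finally show ?thesis by (simp add: mult_ac)
  qed
  ultimately show ?thesis unfolding L2_fourier_def by blast
qed

text \<open>\<open>heat\<close> convolves matrices, whereas the Fourier relations concern scalars.
  Taking an entry commutes with the matrix-valued integral where that integral exists; the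
  hypothesis \<open>int\<close> provides this at every point.\<close>

lemma
  fixes f :: "real^3 \<Rightarrow> real^3^3"
  assumes t: "t > 0" and [measurable]: "f \<in> borel_measurable borel"
    and int: "\<And>x. integrable lborel (\<lambda>y. heat_kernel (x - y) t *\<^sub>R f y)"
    and L: "\<And>i j. L2_fourier (heat_conv t (entry f i j)) (A i j)"
  shows matrix_fourier_heat: "matrix_fourier (heat t f) A"
proof -
  let ?h = "\<lambda>x. \<integral>y. heat_kernel (x - y) t *\<^sub>R f y \<partial>lborel"
  have bl: "bounded_linear (\<lambda>M::real^3^3. complex_of_real (M $ i $ j))" for i j
    by (intro bounded_linear_compose[OF bounded_linear_of_real]
      bounded_linear_compose[OF bounded_linear_vec_nth bounded_linear_vec_nth])
  have e: "entry ?h i j = heat_conv t (entry f i j)" for i j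
  proof
    fix x
    show "entry ?h i j x = heat_conv t (entry f i j) x"
      unfolding entry_def heat_conv_def
      by (subst integral_bounded_linear[OF bl int, symmetric]) (simp add: scaleR_conv_of_real[where 'a=complex])
  qed
  have hm: "?h \<in> borel_measurable borel" by measurable
  have "square_integrable ?h"
    by (rule square_integrable_matrixI[OF hm]) (simp add: e L2_fourierD(1)[OF L])
  from rep_abs_L2_AE[OF this] have ae: "AE x in lborel. rep_L2 (heat t f) x = ?h x" by (simp add: heat_def)
  show ?thesis
    unfolding matrix_fourier_def
  proof (intro allI)
    fix i j
    have "AE x in lborel. heat_conv t (entry f i j) x = entry (rep_L2 (heat t f)) i j x"
      using ae by eventually_elim (simp add: e[symmetric] entry_def)
    then show "L2_fourier (entry (rep_L2 (heat t f)) i j) (A i j)"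
      by (rule L2_fourier_cong[OF L])
         (auto intro!: entry_measurable square_integrable_borel[OF square_integrable_rep_L2]
            square_integrable_borel[OF L2_fourierD(2)[OF L]])
  qed
qed

lemma matrix_fourier_heat_L1:
  assumes t: "t > 0" and f: "integrable lborel f"
  shows "matrix_fourier (heat t f) (\<lambda>i j \<xi>. of_real (heat_symbol t \<xi>) * fourier_integral (entry f i j) \<xi>)"
proof (rule matrix_fourier_heat[OF t])
  show [measurable]: "f \<in> borel_measurable borel" using f by auto
  fix x :: "real^3"
  show "integrable lborel (\<lambda>y. heat_kernel (x - y) t *\<^sub>R f y)"
  proof (rule Bochner_Integration.integrable_bound)
    show "integrable lborel (\<lambda>y. (4 * pi * t) powr (- 3 / 2) *\<^sub>R f y)" using f by simp
    show "AE y in lborel. norm (heat_kernel (x - y) t *\<^sub>R f y) \<le> norm ((4 * pi * t) powr (- 3 / 2) *\<^sub>R f y)"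
      using mult_right_mono[OF heat_kernel_le[OF t]] by (intro AE_I2) auto
  qed measurable
qed (rule heat_conv_L1[OF t integrable_entry[OF f]])

lemma matrix_fourier_heat_L2:
  assumes t: "t > 0" and A: "matrix_fourier F A"
  shows "matrix_fourier (heat t (rep_L2 F)) (\<lambda>i j \<xi>. of_real (heat_symbol t \<xi>) * A i j \<xi>)"
proof (rule matrix_fourier_heat[OF t])
  note s = square_integrable_rep_L2[of F]
  show [measurable]: "rep_L2 F \<in> borel_measurable borel" by (rule square_integrable_borel[OF s])
  fix x :: "real^3"
  have k: "square_integrable (\<lambda>y. heat_kernel (x - y) t)"
  proof -
    have m: "(\<lambda>x. (heat_kernel x t)\<^sup>2) \<in> borel_measurable borel" by measurable
    show ?thesis
      using square_integrable_heat_kernel[OF t] integrable_reflect[OF m, of x]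
      by (simp add: square_integrable_def)
  qed
  show "integrable lborel (\<lambda>y. heat_kernel (x - y) t *\<^sub>R rep_L2 F y)"
    by (rule Bochner_Integration.integrable_bound[OF square_integrable_norm_mult[OF k s]]) auto
qed (rule heat_conv_L2[OF t matrix_fourierD[OF A]])


section \<open>The strain space on the Fourier side\<close>

lemma vec_nth_measurable [measurable]: "(\<lambda>x::real^3. x $ i) \<in> borel_measurable borel"
  by (intro borel_measurable_continuous_onI continuous_intros)

lemma has_fourier_transformD:
  assumes "has_fourier_transform f g"
  shows "f \<in> borel_measurable borel" "g \<in> borel_measurable borel"
    and "\<And>\<phi>. \<phi> \<in> schwartz \<Longrightarrow> integrable lborel (\<lambda>x. f x * \<phi> x)"
    and "\<And>\<phi>. \<phi> \<in> schwartz \<Longrightarrow> integrable lborel (\<lambda>x. g x * \<phi> x)"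
    and "\<And>\<phi>. \<phi> \<in> schwartz \<Longrightarrow> (\<integral>x. f x * fourier_integral \<phi> x \<partial>lborel) = (\<integral>\<xi>. g \<xi> * \<phi> \<xi> \<partial>lborel)"
  using assms by (auto simp: has_fourier_transform_def tempered_def)

text \<open>No transform of the derivative \<open>g\<close> is presupposed. It is tested against
  transforms of Gaussians, and moving the derivative onto the test function gives the transform of a
  polynomial times a Gaussian, where \<open>v\<close> takes over.\<close>

lemma distributional_deriv_fourier_gauss:
  assumes v: "has_fourier_transform f v" and D: "has_distributional_deriv i f g" and a: "a > 0"
  shows "(\<integral>x. g x * fourier_integral (gauss a y) x \<partial>lborel)
    = (\<integral>\<xi>. 2 * pi * \<i> * (of_real (\<xi> $ i) * v \<xi>) * gauss a y \<xi> \<partial>lborel)"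
proof -
  let ?\<chi> = "\<lambda>x. - 2 * pi * \<i> * of_real (x $ i) * gauss a y x"
  have \<chi>: "?\<chi> \<in> schwartz" by (rule poly_gauss_schwartz[OF a]) (intro polys.intros)
  have "- (\<integral>x. g x * fourier_integral (gauss a y) x \<partial>lborel)
    = (\<integral>x. f x * partial_deriv i (fourier_integral (gauss a y)) x \<partial>lborel)"
    using D fourier_gauss_schwartz[OF a, of y] by (simp add: has_distributional_deriv_def)
  also have "\<dots> = (\<integral>x. f x * fourier_integral ?\<chi> x \<partial>lborel)"
    by (simp only: partial_deriv_fourier_gauss[OF a])
  also have "\<dots> = (\<integral>\<xi>. v \<xi> * ?\<chi> \<xi> \<partial>lborel)" by (rule has_fourier_transformD(5)[OF v \<chi>])
  also have "\<dots> = (\<integral>\<xi>. - (2 * pi * \<i> * (of_real (\<xi> $ i) * v \<xi>) * gauss a y \<xi>) \<partial>lborel)"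
    by (intro Bochner_Integration.integral_cong refl) simp
  finally show ?thesis by simp
qed

text \<open>The vector is the transform of the velocity \<open>u\<close>: the symmetric part of
  \<xi> \<otimes> v carries the factor 2 pi i / 2. The transform of \<open>S\<close> is an L2
  function and that of \<open>u\<close> only a tempered one; Gaussian tests are legitimate for both
  and identify the two sides.\<close>

lemma L2_st_symbol:
  assumes S: "S \<in> L2_st" and A: "matrix_fourier S A"
  shows "AE \<xi> in lborel. \<exists>v::3 \<Rightarrow> complex. (\<forall>i j. A i j \<xi> = pi * \<i> * (of_real (\<xi> $ i) * v j + of_real (\<xi> $ j) * v i)) \<and>
    (\<Sum>i\<in>UNIV. of_real (\<xi> $ i) * v i) = 0"
proof -
  obtain u D where u: "u \<in> Hdot 1" and D: "has_gradient u D"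
    and tr: "AE x in lborel. (\<Sum>i\<in>UNIV. D x $ i $ i) = 0"
    and SD: "AE x in lborel. rep_L2 S x = (\<chi> i j. (D x $ i $ j + D x $ j $ i) / 2)"
    using S unfolding L2_st_def by blast
  have "\<exists>g. has_fourier_transform (\<lambda>x. of_real (u x $ j)) g" for j
  proof -
    have "axis j 1 \<in> (Basis :: (real^3) set)" by (simp add: axis_in_Basis_iff)
    then have "\<exists>g. has_fourier_transform (component (axis j 1) u) g" using u by (auto simp: Hdot_def)
    then show ?thesis by (simp add: component_def[abs_def] inner_axis)
  qed
  then obtain v where v: "\<And>j. has_fourier_transform (\<lambda>x. of_real (u x $ j)) (v j)" by metis
  have d: "has_distributional_deriv i (\<lambda>x. of_real (u x $ j)) (\<lambda>x. of_real (D x $ i $ j))" for i j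
    using D by (simp add: has_gradient_def)
  note [measurable] = has_fourier_transformD(2)[OF v]
  have Dm[measurable]: "(\<lambda>x. complex_of_real (D x $ i $ j)) \<in> borel_measurable borel" for i j
    using d[of i j] by (simp add: has_distributional_deriv_def tempered_def)
  have Di: "integrable lborel (\<lambda>x. complex_of_real (D x $ i $ j) * fourier_integral (gauss a y) x)" if "a > 0" for a y i j
    using d[of i j] fourier_gauss_schwartz[OF that, of y] by (simp add: has_distributional_deriv_def tempered_def)
  have vi: "integrable lborel (\<lambda>\<xi>. c * (of_real (\<xi> $ i) * v j \<xi>) * gauss a y \<xi>)" if "a > 0" for a y i j c
  proof -
    have "(\<lambda>x. (c * of_real (x $ i)) * gauss a y x) \<in> schwartz"
      by (rule poly_gauss_schwartz[OF that]) (intro polys.intros)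
    from has_fourier_transformD(4)[OF v this, of j] show ?thesis by (simp add: mult_ac)
  qed
  note key = distributional_deriv_fourier_gauss[OF v d]
  have 1: "AE \<xi> in lborel. A i j \<xi> = pi * \<i> * (of_real (\<xi> $ i) * v j \<xi> + of_real (\<xi> $ j) * v i \<xi>)" for i j
  proof (rule gauss_test_eq)
    note s = L2_fourierD(1,2)[OF matrix_fourierD[OF A, of i j]]
    show "A i j \<in> borel_measurable borel" by (rule square_integrable_borel[OF s(2)])
    fix a :: real and y assume a: "a > 0"
    show "integrable lborel (\<lambda>x. A i j x * gauss a y x)" using a s by (intro square_integrable_mult) auto
    show "integrable lborel (\<lambda>\<xi>. pi * \<i> * (of_real (\<xi> $ i) * v j \<xi> + of_real (\<xi> $ j) * v i \<xi>) * gauss a y \<xi>)"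
      unfolding distrib_left distrib_right by (intro Bochner_Integration.integrable_add vi a)
    have [measurable]: "entry (rep_L2 S) i j \<in> borel_measurable borel" by (rule square_integrable_borel[OF s(1)])
    have "(\<integral>x. A i j x * gauss a y x \<partial>lborel) = (\<integral>x. entry (rep_L2 S) i j x * fourier_integral (gauss a y) x \<partial>lborel)"
      using a by (intro L2_fourierD(3)[OF matrix_fourierD[OF A], symmetric]) auto
    also have "\<dots> = (\<integral>x. (of_real (D x $ i $ j) * fourier_integral (gauss a y) x + of_real (D x $ j $ i) * fourier_integral (gauss a y) x) / 2 \<partial>lborel)"
    proof (rule integral_cong_AE)
      show "AE x in lborel. entry (rep_L2 S) i j x * fourier_integral (gauss a y) x
        = (of_real (D x $ i $ j) * fourier_integral (gauss a y) x + of_real (D x $ j $ i) * fourier_integral (gauss a y) x) / 2"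
        using SD by eventually_elim (simp add: entry_def field_simps)
    qed measurable
    also have "\<dots> = ((\<integral>x. of_real (D x $ i $ j) * fourier_integral (gauss a y) x \<partial>lborel) + (\<integral>x. of_real (D x $ j $ i) * fourier_integral (gauss a y) x \<partial>lborel)) / 2"
      using Di[OF a] by simp
    also have "\<dots> = ((\<integral>\<xi>. 2 * pi * \<i> * (of_real (\<xi> $ i) * v j \<xi>) * gauss a y \<xi> \<partial>lborel) + (\<integral>\<xi>. 2 * pi * \<i> * (of_real (\<xi> $ j) * v i \<xi>) * gauss a y \<xi> \<partial>lborel)) / 2"
      by (simp only: key[OF a])
    also have "\<dots> = (\<integral>\<xi>. (2 * pi * \<i> * (of_real (\<xi> $ i) * v j \<xi>) * gauss a y \<xi> + 2 * pi * \<i> * (of_real (\<xi> $ j) * v i \<xi>) * gauss a y \<xi>) / 2 \<partial>lborel)"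
      by (simp only: Bochner_Integration.integral_add[OF vi[OF a] vi[OF a]] integral_divide_zero)
    also have "\<dots> = (\<integral>\<xi>. pi * \<i> * (of_real (\<xi> $ i) * v j \<xi> + of_real (\<xi> $ j) * v i \<xi>) * gauss a y \<xi> \<partial>lborel)"
      by (intro Bochner_Integration.integral_cong refl) (simp add: algebra_simps)
    finally show "(\<integral>x. A i j x * gauss a y x \<partial>lborel)
      = (\<integral>\<xi>. pi * \<i> * (of_real (\<xi> $ i) * v j \<xi> + of_real (\<xi> $ j) * v i \<xi>) * gauss a y \<xi> \<partial>lborel)" .
  qed measurable
  have 2: "AE \<xi> in lborel. (\<Sum>i\<in>UNIV. 2 * pi * \<i> * (of_real (\<xi> $ i) * v i \<xi>)) = 0"
  proof (rule gauss_test_zero)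
    show "(\<lambda>\<xi>. \<Sum>i\<in>UNIV. 2 * pi * \<i> * (of_real (\<xi> $ i) * v i \<xi>)) \<in> borel_measurable borel" by measurable
    fix a :: real assume a: "a > 0"
    show "integrable lborel (\<lambda>\<xi>. (\<Sum>i\<in>UNIV. 2 * pi * \<i> * (of_real (\<xi> $ i) * v i \<xi>)) * gauss a 0 \<xi>)"
      unfolding sum_distrib_right by (intro Bochner_Integration.integrable_sum vi a)
    fix y
    have "(\<integral>\<xi>. (\<Sum>i\<in>UNIV. 2 * pi * \<i> * (of_real (\<xi> $ i) * v i \<xi>)) * gauss a y \<xi> \<partial>lborel)
      = (\<Sum>i\<in>UNIV. \<integral>x. of_real (D x $ i $ i) * fourier_integral (gauss a y) x \<partial>lborel)"
      unfolding sum_distrib_right by (subst Bochner_Integration.integral_sum) (simp_all only: vi[OF a] key[OF a])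
    also have "\<dots> = (\<integral>x. (\<Sum>i\<in>UNIV. of_real (D x $ i $ i) * fourier_integral (gauss a y) x) \<partial>lborel)"
      by (rule Bochner_Integration.integral_sum[symmetric]) (rule Di[OF a])
    also have "\<dots> = (\<integral>x. 0 \<partial>(lborel :: (real^3) measure))"
    proof (rule integral_cong_AE)
      show "AE x in lborel. (\<Sum>i\<in>UNIV. of_real (D x $ i $ i) * fourier_integral (gauss a y) x) = 0"
        using tr by eventually_elim (simp add: sum_distrib_right[symmetric] of_real_sum[symmetric] del: of_real_sum)
    qed measurable
    finally show "(\<integral>\<xi>. (\<Sum>i\<in>UNIV. 2 * pi * \<i> * (of_real (\<xi> $ i) * v i \<xi>)) * gauss a y \<xi> \<partial>lborel) = 0" by simp
  qed
  have "AE \<xi> in lborel. \<forall>i\<in>UNIV. \<forall>j\<in>UNIV. A i j \<xi> = pi * \<i> * (of_real (\<xi> $ i) * v j \<xi> + of_real (\<xi> $ j) * v i \<xi>)"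
    by (intro AE_finite_allI 1) auto
  with 2 show ?thesis
  proof eventually_elim
    case (elim \<xi>)
    then have "(\<Sum>i\<in>UNIV. of_real (\<xi> $ i) * v i \<xi>) = 0" by (simp add: sum_distrib_left[symmetric])
    with elim(2) show ?case by (intro exI[of _ "\<lambda>i. v i \<xi>"]) simp
  qed
qed

lemma L2_st_symmetric_trace_free:
  assumes "S \<in> L2_st"
  shows "AE x in lborel. (\<forall>i j. rep_L2 S x $ i $ j = rep_L2 S x $ j $ i) \<and> (\<Sum>i\<in>UNIV. rep_L2 S x $ i $ i) = 0"
proof -
  obtain D where tr: "AE x in lborel. (\<Sum>i\<in>UNIV. D x $ i $ i) = 0"
    and SD: "AE x in lborel. rep_L2 S x = (\<chi> i j. (D x $ i $ j + D x $ j $ i) / 2)"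
    using assms unfolding L2_st_def by blast
  from tr SD show ?thesis
    by eventually_elim (simp add: add.commute)
qed

lemma fourier_integral_reflect:
  assumes [measurable]: "g \<in> borel_measurable borel"
  shows "fourier_integral g (- x) = fourier_integral (\<lambda>\<xi>. g (- \<xi>)) x"
proof -
  have "fourier_integral g (- x) = (\<integral>\<xi>. cis (- 2 * pi * ((0 - \<xi>) \<bullet> (- x))) * g (0 - \<xi>) \<partial>lborel)"
    unfolding fourier_integral_def by (rule integral_reflect_lborel[symmetric]) measurable
  then show ?thesis by (simp add: fourier_integral_def)
qed

lemma fourier_integral_cnj:
  "cnj (fourier_integral g x) = fourier_integral (\<lambda>\<xi>. cnj (g \<xi>)) (- x)"
  unfolding fourier_integral_def
  by (subst Bochner_Integration.integral_cnj[symmetric]) (simp add: cis_cnj del: Bochner_Integration.integral_cnj)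

lemma fourier_integral_hermitian_real:
  assumes [measurable]: "g \<in> borel_measurable borel" and h: "\<And>\<xi>. g (- \<xi>) = cnj (g \<xi>)"
  shows "of_real (Re (fourier_integral g x)) = fourier_integral g x"
proof -
  have "cnj (fourier_integral g x) = fourier_integral (\<lambda>\<xi>. g (- \<xi>)) (- x)"
    unfolding fourier_integral_cnj h ..
  also have "\<dots> = fourier_integral g x" by (subst fourier_integral_reflect) simp_all
  finally show ?thesis by (simp add: complex_eq_iff)
qed

lemma matrix_measurableI:
  fixes f :: "'a \<Rightarrow> real^3^3"
  assumes "\<And>i j. (\<lambda>x. f x $ i $ j) \<in> borel_measurable M"
  shows "f \<in> borel_measurable M"
proof (subst borel_measurable_euclidean_space, rule ballI)
  fix b :: "real^3^3" assume "b \<in> Basis"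
  then obtain i j where "b = axis i (axis j 1)" by (auto simp: Basis_vec_def)
  then show "(\<lambda>x. f x \<bullet> b) \<in> borel_measurable M" using assms by (simp add: inner_axis)
qed

text \<open>The converse of \<open>L2_st_symbol\<close> for regular data. With \<open>v\<close> and
  its products with coordinates both in L1 and in L2, velocity and gradient are ordinary inverse
  Fourier integrals; the Hermitian symmetry makes them real.\<close>

lemma L2_stI:
  fixes v :: "3 \<Rightarrow> real^3 \<Rightarrow> complex"
  assumes v: "\<And>j. integrable lborel (v j)" "\<And>j. square_integrable (v j)"
    and w: "\<And>i j. integrable lborel (\<lambda>\<xi>. of_real (\<xi> $ i) * v j \<xi>)" "\<And>i j. square_integrable (\<lambda>\<xi>. of_real (\<xi> $ i) * v j \<xi>)"
    and herm: "\<And>j \<xi>. v j (- \<xi>) = cnj (v j \<xi>)"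
    and div: "\<And>\<xi>. (\<Sum>j\<in>UNIV. of_real (\<xi> $ j) * v j \<xi>) = 0"
  shows "\<exists>S\<in>L2_st. matrix_fourier S (\<lambda>i j \<xi>. pi * \<i> * (of_real (\<xi> $ i) * v j \<xi> + of_real (\<xi> $ j) * v i \<xi>))"
proof -
  \<comment> \<open>The transform of the \<open>i\<close>-th derivative of the \<open>j\<close>-th
    velocity component.\<close>
  define W where "W i j \<xi> = 2 * pi * \<i> * (of_real (\<xi> $ i) * v j \<xi>)" for i j \<xi>
  have Wi: "integrable lborel (W i j)" and Ws: "square_integrable (W i j)" for i j
    using integrable_mult_right[OF w(1), of "2 * pi * \<i>" i j] square_integrable_cmult[OF w(2), of "2 * pi * \<i>" i j]
    by (simp_all add: W_def[abs_def])
  have Wh: "W i j (- \<xi>) = cnj (W i j \<xi>)" for i j \<xi> by (simp add: W_def herm)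
  note [measurable] = square_integrable_borel[OF v(2)] square_integrable_borel[OF Ws]
  define u where "u x = (\<chi> j. Re (fourier_integral (v j) (- x)))" for x
  define D where "D x = (\<chi> i j. Re (fourier_integral (W i j) (- x)))" for x
  have u: "complex_of_real (u x $ j) = fourier_integral (v j) (- x)" for x j
    by (simp add: u_def fourier_integral_hermitian_real herm)
  have D: "complex_of_real (D x $ i $ j) = fourier_integral (W i j) (- x)" for x i j
    by (simp add: D_def fourier_integral_hermitian_real Wh)
  have inv: "L2_fourier (\<lambda>x. fourier_integral g (- x)) g"
    if "integrable lborel g" "square_integrable g" for g
    using L2_fourier_reflect[OF L2_fourier_inverse[OF L2_fourier_fourier_integral[OF that]]] by simp
  have uv: "L2_fourier (\<lambda>x. of_real (u x $ j)) (v j)" for j unfolding u by (intro inv v)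
  have DW: "L2_fourier (\<lambda>x. of_real (D x $ i $ j)) (W i j)" for i j unfolding D by (intro inv Wi Ws)
  have "has_distributional_deriv i (\<lambda>x. of_real (u x $ j)) (\<lambda>x. of_real (D x $ i $ j))" for i j
    unfolding has_distributional_deriv_def
  proof (intro conjI ballI tempered_square_integrable)
    show "square_integrable (\<lambda>x. complex_of_real (u x $ j))" by (rule L2_fourierD(1)[OF uv])
    show "square_integrable (\<lambda>x. complex_of_real (D x $ i $ j))" by (rule L2_fourierD(1)[OF DW])
    fix \<phi> assume \<phi>: "\<phi> \<in> schwartz"
    have r: "integrable lborel (\<lambda>\<xi>. g (- \<xi>))" if "integrable lborel g" for g :: "real^3 \<Rightarrow> complex"
      using that integrable_reflect[of g 0] by auto
    have "(\<integral>x. of_real (u x $ j) * partial_deriv i \<phi> x \<partial>lborel) = (\<integral>x. fourier_integral (\<lambda>\<xi>. v j (- \<xi>)) x * partial_deriv i \<phi> x \<partial>lborel)"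
      by (simp add: u fourier_integral_reflect)
    also have "\<dots> = (\<integral>\<xi>. v j (- \<xi>) * fourier_integral (partial_deriv i \<phi>) \<xi> \<partial>lborel)"
      by (intro fourier_multiplication_formula[symmetric] r v schwartz_integrable schwartz_partial_deriv \<phi>)
    also have "\<dots> = (\<integral>\<xi>. - (W i j (- \<xi>) * fourier_integral \<phi> \<xi>) \<partial>lborel)"
      unfolding fourier_integral_partial_deriv[OF \<phi>]
      by (intro Bochner_Integration.integral_cong refl) (simp add: W_def)
    also have "\<dots> = - (\<integral>\<xi>. W i j (- \<xi>) * fourier_integral \<phi> \<xi> \<partial>lborel)" by simp
    also have "(\<integral>\<xi>. W i j (- \<xi>) * fourier_integral \<phi> \<xi> \<partial>lborel) = (\<integral>x. fourier_integral (\<lambda>\<xi>. W i j (- \<xi>)) x * \<phi> x \<partial>lborel)"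
      by (intro fourier_multiplication_formula r Wi schwartz_integrable \<phi>)
    also have "\<dots> = (\<integral>x. of_real (D x $ i $ j) * \<phi> x \<partial>lborel)"
      by (simp add: D fourier_integral_reflect)
    finally show "(\<integral>x. of_real (u x $ j) * partial_deriv i \<phi> x \<partial>lborel) = - (\<integral>x. of_real (D x $ i $ j) * \<phi> x \<partial>lborel)" .
  qed
  then have grad: "has_gradient u D" by (simp add: has_gradient_def)
  have "u \<in> Hdot 1"
    unfolding Hdot_def
  proof (intro CollectI ballI)
    fix b :: "real^3" assume "b \<in> Basis"
    then obtain j where b: "b = axis j 1" by (auto simp: Basis_vec_def)
    have c: "component b u = (\<lambda>x. of_real (u x $ j))" by (simp add: component_def[abs_def] b inner_axis)
    have h: "has_fourier_transform (component b u) (v j)"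
      unfolding c by (rule L2_fourier_has_fourier_transform[OF uv])
    have [measurable]: "fourier (component b u) \<in> borel_measurable borel"
      by (rule has_fourier_transformD(2)[OF has_fourier_transform_fourier[OF h]])
    have i: "integrable lborel (\<lambda>\<xi>. (2 * pi)\<^sup>2 * (\<Sum>i\<in>UNIV. (norm (of_real (\<xi> $ i) * v j \<xi>))\<^sup>2))"
      using w(2) by (intro integrable_mult_right Bochner_Integration.integrable_sum) (simp add: square_integrable_def)
    have "integrable lborel (\<lambda>\<xi>. ((2 * pi * norm \<xi>) powr 1 * norm (fourier (component b u) \<xi>))\<^sup>2)
      \<longleftrightarrow> integrable lborel (\<lambda>\<xi>. (2 * pi)\<^sup>2 * (\<Sum>i\<in>UNIV. (norm (of_real (\<xi> $ i) * v j \<xi>))\<^sup>2))"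
    proof (rule integrable_cong_AE)
      show "AE \<xi> in lborel. ((2 * pi * norm \<xi>) powr 1 * norm (fourier (component b u) \<xi>))\<^sup>2
          = (2 * pi)\<^sup>2 * (\<Sum>i\<in>UNIV. (norm (of_real (\<xi> $ i) * v j \<xi>))\<^sup>2)"
        using fourier_AE_eq[OF h]
      proof eventually_elim
        case (elim \<xi>)
        have "(\<Sum>i\<in>UNIV. (norm (of_real (\<xi> $ i) * v j \<xi>))\<^sup>2) = (norm \<xi>)\<^sup>2 * (norm (v j \<xi>))\<^sup>2"
          by (simp add: norm_mult power_mult_distrib sum_distrib_right[symmetric] power2_norm_eq_inner[of \<xi>] inner_vec_def power2_eq_square[symmetric])
        then show ?case by (simp add: elim power_mult_distrib)
      qed
    qed measurable
    with i h show "(\<exists>g. has_fourier_transform (component b u) g) \<and>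
       integrable lborel (\<lambda>\<xi>. ((2 * pi * norm \<xi>) powr 1 * norm (fourier (component b u) \<xi>))\<^sup>2)" by blast
  qed
  have tr: "(\<Sum>i\<in>UNIV. D x $ i $ i) = 0" for x
  proof -
    have "complex_of_real (\<Sum>i\<in>UNIV. D x $ i $ i) = (\<Sum>i\<in>UNIV. fourier_integral (W i i) (- x))" by (simp add: D)
    also have "\<dots> = (\<integral>\<xi>. (\<Sum>i\<in>UNIV. cis (- 2 * pi * (\<xi> \<bullet> - x)) * W i i \<xi>) \<partial>lborel)"
      unfolding fourier_integral_def
      by (rule Bochner_Integration.integral_sum[symmetric]) (intro fourier_integrand_integrable Wi, measurable)
    also have "\<dots> = (\<integral>\<xi>. 0 \<partial>(lborel :: (real^3) measure))"
      using div by (intro Bochner_Integration.integral_cong refl) (simp add: W_def sum_distrib_left[symmetric])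
    finally have "complex_of_real (\<Sum>i\<in>UNIV. D x $ i $ i) = 0" by simp
    then show ?thesis by (simp only: of_real_eq_0_iff)
  qed
  define s where "s x = ((\<chi> i j. (D x $ i $ j + D x $ j $ i) / 2) :: real^3^3)" for x
  have es: "entry s i j = (\<lambda>x. (1/2) * (of_real (D x $ i $ j) + of_real (D x $ j $ i)))" for i j
    by (simp add: entry_def[abs_def] s_def)
  have Ls: "L2_fourier (entry s i j) (\<lambda>\<xi>. pi * \<i> * (of_real (\<xi> $ i) * v j \<xi> + of_real (\<xi> $ j) * v i \<xi>))" for i j
  proof -
    have "L2_fourier (entry s i j) (\<lambda>\<xi>. (1/2) * (W i j \<xi> + W j i \<xi>))"
      unfolding es by (intro L2_fourier_cmult L2_fourier_add DW)
    then show ?thesis by (simp add: W_def distrib_left mult.assoc)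
  qed
  have [measurable]: "s \<in> borel_measurable borel"
  proof (rule matrix_measurableI)
    fix i j
    have [measurable]: "(\<lambda>x. D x $ i $ j) \<in> borel_measurable borel" for i j
      unfolding D_def by simp
    show "(\<lambda>x. s x $ i $ j) \<in> borel_measurable borel" unfolding s_def by simp
  qed
  have "square_integrable s" by (rule square_integrable_matrixI) (auto intro: L2_fourierD(1)[OF Ls])
  from rep_abs_L2_AE[OF this] have ae: "AE x in lborel. rep_L2 (abs_L2 s) x = s x" .
  have "abs_L2 s \<in> L2_st"
    unfolding L2_st_def using \<open>u \<in> Hdot 1\<close> grad tr ae
    by (intro CollectI exI[of _ u] exI[of _ D] conjI) (simp_all add: s_def)
  moreover have "matrix_fourier (abs_L2 s) (\<lambda>i j \<xi>. pi * \<i> * (of_real (\<xi> $ i) * v j \<xi> + of_real (\<xi> $ j) * v i \<xi>))"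
    unfolding matrix_fourier_def
  proof (intro allI)
    fix i j
    have "AE x in lborel. entry s i j x = entry (rep_L2 (abs_L2 s)) i j x"
      using ae by eventually_elim (simp add: entry_def)
    then show "L2_fourier (entry (rep_L2 (abs_L2 s)) i j) (\<lambda>\<xi>. pi * \<i> * (of_real (\<xi> $ i) * v j \<xi> + of_real (\<xi> $ j) * v i \<xi>))"
      by (rule L2_fourier_cong[OF Ls])
         (auto intro!: entry_measurable square_integrable_borel[OF square_integrable_rep_L2]
           square_integrable_borel[OF L2_fourierD(2)[OF Ls]])
  qed
  ultimately show ?thesis by blast
qed

text \<open>For symmetric \<open>B\<close> and \<open>\<xi> \<noteq> 0\<close>, \<open>st_proj \<xi> B\<close> is the orthogonal projection of \<open>B\<close> onto the
  matrices \<open>\<xi> \<otimes> w + w \<otimes> \<xi>\<close> with \<open>w\<close> orthogonal to \<open>\<xi>\<close>; at \<open>\<xi> = 0\<close> division by zero makes it vanish.\<close>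

definition st_vec :: "real^3 \<Rightarrow> (3 \<Rightarrow> 3 \<Rightarrow> complex) \<Rightarrow> 3 \<Rightarrow> complex" where
  "st_vec \<xi> B j = (\<Sum>k\<in>UNIV. B j k * of_real (\<xi> $ k)) / of_real ((norm \<xi>)\<^sup>2)
     - of_real (\<xi> $ j) * (\<Sum>k\<in>UNIV. \<Sum>l\<in>UNIV. B k l * of_real (\<xi> $ k) * of_real (\<xi> $ l)) / of_real ((norm \<xi>) ^ 4)"

definition st_proj :: "real^3 \<Rightarrow> (3 \<Rightarrow> 3 \<Rightarrow> complex) \<Rightarrow> 3 \<Rightarrow> 3 \<Rightarrow> complex" where
  "st_proj \<xi> B i j = of_real (\<xi> $ i) * st_vec \<xi> B j + of_real (\<xi> $ j) * st_vec \<xi> B i"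

lemma norm_vec3_sq: "(norm (\<xi>::real^3))\<^sup>2 = (\<Sum>i\<in>UNIV. (\<xi> $ i)\<^sup>2)"
  unfolding power2_norm_eq_inner inner_vec_def by (simp add: power2_eq_square)

text \<open>The second term of \<open>st_vec\<close> is the component of the first along \<xi>,
  which is subtracted.\<close>

lemma st_vec_orthogonal: "(\<Sum>j\<in>UNIV. of_real (\<xi> $ j) * st_vec \<xi> B j) = 0"
proof (cases "\<xi> = 0")
  case False
  let ?r = "complex_of_real ((norm \<xi>)\<^sup>2)"
  let ?q = "\<Sum>k\<in>UNIV. \<Sum>l\<in>UNIV. B k l * of_real (\<xi> $ k) * of_real (\<xi> $ l)"
  have r: "?r \<noteq> 0" using False by simp
  have r4: "complex_of_real ((norm \<xi>) ^ 4) = ?r * ?r" by (simp add: power4_eq_xxxx power2_eq_square)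
  have s: "(\<Sum>j\<in>UNIV. complex_of_real (\<xi> $ j) * of_real (\<xi> $ j)) = ?r"
    unfolding norm_vec3_sq by (simp add: power2_eq_square)
  have q: "(\<Sum>j\<in>UNIV. of_real (\<xi> $ j) * (\<Sum>k\<in>UNIV. B j k * of_real (\<xi> $ k))) = ?q"
    by (simp add: sum_distrib_left mult_ac)
  have lin: "(\<Sum>j\<in>(UNIV :: 3 set). x j * (\<beta> j / r - x j * q / (r * r))) = (\<Sum>j\<in>UNIV. x j * \<beta> j) / r - (\<Sum>j\<in>UNIV. x j * x j) * q / (r * r)"
    for x \<beta> :: "3 \<Rightarrow> complex" and r q
    unfolding sum_3 by (simp add: algebra_simps add_divide_distrib)
  have "(\<Sum>j\<in>UNIV. of_real (\<xi> $ j) * st_vec \<xi> B j) = ?q / ?r - ?r * ?q / (?r * ?r)"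
    unfolding st_vec_def r4 lin q s ..
  also have "\<dots> = 0" by (simp only: mult_divide_mult_cancel_left[OF r] diff_self)
  finally show ?thesis .
qed (simp add: st_vec_def)

text \<open>Conjugating \<open>v\<close> turns the real inner product into the real part of a
  bilinear expression, and \<open>c\<close> can be pulled out of it. What remains is a polynomial
  identity in \<open>x\<close>, \<open>y\<close>, \<open>W\<close> and the entries of
  \<open>B\<close>.\<close>

lemma st_proj_orthogonal:
  assumes sym: "\<And>k l. B k l = B l k" and v: "(\<Sum>i\<in>UNIV. of_real (\<xi> $ i) * v i) = 0"
  shows "(\<Sum>i\<in>UNIV. \<Sum>j\<in>UNIV. (B i j - st_proj \<xi> B i j) \<bullet> (c * (of_real (\<xi> $ i) * v j + of_real (\<xi> $ j) * v i))) = 0"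
proof -
  define x where "x i = complex_of_real (\<xi> $ i)" for i
  define y where "y i = cnj (v i)" for i
  define W where "W = st_vec \<xi> B"
  have xy: "(\<Sum>i\<in>UNIV. x i * y i) = 0"
    using arg_cong[OF v, of cnj] by (simp add: x_def y_def)
  have xW: "(\<Sum>i\<in>UNIV. x i * W i) = 0" using st_vec_orthogonal[of \<xi> B] by (simp add: x_def W_def)
  have inner: "z \<bullet> (c * (of_real (\<xi> $ i) * v j + of_real (\<xi> $ j) * v i)) = Re (cnj c * (z * (x i * y j + x j * y i)))" for z i j
    by (simp add: inner_complex_def x_def y_def algebra_simps)
  \<comment> \<open>Against a vector orthogonal to \<xi>, \<open>st_vec\<close> acts like B \<xi>
    divided by the squared norm. Multiplied out, the claim also covers \<xi> = 0, where both sides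
    vanish.\<close>
  have Wy: "of_real ((norm \<xi>)\<^sup>2) * (\<Sum>j\<in>UNIV. W j * y j) = (\<Sum>j\<in>UNIV. \<Sum>k\<in>UNIV. B j k * x k * y j)"
  proof (cases "\<xi> = 0")
    case False
    let ?r = "complex_of_real ((norm \<xi>)\<^sup>2)"
    let ?q = "\<Sum>k\<in>UNIV. \<Sum>l\<in>UNIV. B k l * of_real (\<xi> $ k) * of_real (\<xi> $ l)"
    have r: "?r \<noteq> 0" using False by simp
    have r4: "complex_of_real ((norm \<xi>) ^ 4) = ?r * ?r" by (simp add: power4_eq_xxxx power2_eq_square)
    have lin: "(\<Sum>j\<in>(UNIV :: 3 set). (a j - x j * p) * y j) = (\<Sum>j\<in>UNIV. a j * y j) - p * (\<Sum>j\<in>UNIV. x j * y j)"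
      for a x y :: "3 \<Rightarrow> complex" and p
      unfolding sum_3 by (simp add: algebra_simps)
    have "?r * W j = (\<Sum>k\<in>UNIV. B j k * x k) - x j * (?q / ?r)" for j
      unfolding W_def st_vec_def r4 x_def using r by (simp add: field_simps)
    then have "?r * (\<Sum>j\<in>UNIV. W j * y j) = (\<Sum>j\<in>UNIV. ((\<Sum>k\<in>UNIV. B j k * x k) - x j * (?q / ?r)) * y j)"
      by (simp add: sum_distrib_left mult.assoc[symmetric])
    also have "\<dots> = (\<Sum>j\<in>UNIV. (\<Sum>k\<in>UNIV. B j k * x k) * y j) - (?q / ?r) * (\<Sum>j\<in>UNIV. x j * y j)"
      by (rule lin)
    also have "(\<Sum>j\<in>UNIV. (\<Sum>k\<in>UNIV. B j k * x k) * y j) = (\<Sum>j\<in>UNIV. \<Sum>k\<in>UNIV. B j k * x k * y j)"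
      by (simp only: sum_distrib_right)
    finally show ?thesis by (simp add: xy)
  qed (simp add: x_def)
  have nr: "complex_of_real ((norm \<xi>)\<^sup>2) = (\<Sum>i\<in>UNIV. x i * x i)"
    unfolding norm_vec3_sq by (simp add: x_def power2_eq_square)
  have B: "B 2 1 = B 1 2" "B 3 1 = B 1 3" "B 3 2 = B 2 3" by (rule sym)+
  \<comment> \<open>Symmetry of \<open>B\<close> doubles the first term. The two symmetrised
    products contract to the second and third, and the third vanishes because both \<open>y\<close>
    and \<open>W\<close> are orthogonal to \<open>x\<close>.\<close>
  have "(\<Sum>i\<in>UNIV. \<Sum>j\<in>UNIV. (B i j - (x i * W j + x j * W i)) * (x i * y j + x j * y i))
    = 2 * (\<Sum>j\<in>UNIV. \<Sum>k\<in>UNIV. B j k * x k * y j) - 2 * ((\<Sum>i\<in>UNIV. x i * x i) * (\<Sum>j\<in>UNIV. W j * y j))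
      - 2 * ((\<Sum>i\<in>UNIV. x i * y i) * (\<Sum>i\<in>UNIV. x i * W i))"
    unfolding sum_3 B by algebra
  also have "\<dots> = 0" unfolding nr[symmetric] Wy xy by simp
  finally have z: "(\<Sum>i\<in>UNIV. \<Sum>j\<in>UNIV. (B i j - (x i * W j + x j * W i)) * (x i * y j + x j * y i)) = 0" .
  have "(\<Sum>i\<in>UNIV. \<Sum>j\<in>UNIV. (B i j - st_proj \<xi> B i j) \<bullet> (c * (of_real (\<xi> $ i) * v j + of_real (\<xi> $ j) * v i)))
    = Re (cnj c * (\<Sum>i\<in>UNIV. \<Sum>j\<in>UNIV. (B i j - (x i * W j + x j * W i)) * (x i * y j + x j * y i)))"
    unfolding inner st_proj_def sum_distrib_left Re_sum by (simp only: x_def W_def)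
  then show ?thesis by (simp add: z)
qed

text \<open>Each of the two terms of \<open>st_vec\<close> contributes the sum of the entries over
  \<open>norm \<xi>\<close>. The inequality survives at \<xi> = 0, since both sides are 0 by
  division by zero.\<close>

lemma norm_st_vec_le: "norm (st_vec \<xi> B j) \<le> 2 * (\<Sum>k\<in>UNIV. \<Sum>l\<in>UNIV. norm (B k l)) / norm \<xi>"
proof (cases "\<xi> = 0")
  case False
  let ?b = "\<Sum>k\<in>UNIV. \<Sum>l\<in>UNIV. norm (B k l)"
  let ?n = "norm \<xi>"
  have n: "?n > 0" using False by simp
  have c: "norm (complex_of_real (\<xi> $ k)) \<le> ?n" for k using component_le_norm_cart[of \<xi> k] by simp
  have "norm (\<Sum>k\<in>UNIV. B j k * of_real (\<xi> $ k)) \<le> (\<Sum>k\<in>UNIV. norm (B j k) * ?n)"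
    by (intro sum_norm_le) (simp only: norm_mult, intro mult_left_mono c norm_ge_zero)
  also have "\<dots> = (\<Sum>k\<in>UNIV. norm (B j k)) * ?n" by (rule sum_distrib_right[symmetric])
  also have "\<dots> \<le> ?b * ?n"
    by (intro mult_right_mono member_le_sum[of j UNIV "\<lambda>k. \<Sum>l\<in>UNIV. norm (B k l)"]) (auto intro: sum_nonneg)
  finally have 1: "norm (\<Sum>k\<in>UNIV. B j k * of_real (\<xi> $ k)) \<le> ?b * ?n" .
  have "norm (\<Sum>k\<in>UNIV. \<Sum>l\<in>UNIV. B k l * of_real (\<xi> $ k) * of_real (\<xi> $ l)) \<le> (\<Sum>k\<in>UNIV. \<Sum>l\<in>UNIV. norm (B k l) * ?n * ?n)"
    by (intro sum_norm_le) (simp only: norm_mult, intro mult_mono c norm_ge_zero mult_nonneg_nonneg order_refl)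
  also have "\<dots> = ?b * ?n * ?n" by (simp add: sum_distrib_right)
  finally have 2: "norm (\<Sum>k\<in>UNIV. \<Sum>l\<in>UNIV. B k l * of_real (\<xi> $ k) * of_real (\<xi> $ l)) \<le> ?b * ?n * ?n" .
  have "norm (st_vec \<xi> B j) \<le> norm (\<Sum>k\<in>UNIV. B j k * of_real (\<xi> $ k)) / ?n\<^sup>2
    + norm (complex_of_real (\<xi> $ j)) * norm (\<Sum>k\<in>UNIV. \<Sum>l\<in>UNIV. B k l * of_real (\<xi> $ k) * of_real (\<xi> $ l)) / ?n ^ 4"
    unfolding st_vec_def by (rule order_trans[OF norm_triangle_ineq4]) (simp add: norm_divide norm_mult norm_power)
  also have "\<dots> \<le> (?b * ?n) / ?n\<^sup>2 + ?n * (?b * ?n * ?n) / ?n ^ 4"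
    by (intro add_mono divide_right_mono mult_mono 1 2 c) auto
  also have "\<dots> = 2 * ?b / ?n" using n by (simp add: field_simps power2_eq_square power4_eq_xxxx)
  finally show ?thesis .
qed (simp add: st_vec_def)

lemma norm_coord_st_vec_le:
  "norm (of_real (\<xi> $ i) * st_vec \<xi> B j) \<le> 2 * (\<Sum>k\<in>UNIV. \<Sum>l\<in>UNIV. norm (B k l))"
proof -
  have b: "0 \<le> (\<Sum>k\<in>UNIV. \<Sum>l\<in>UNIV. norm (B k l))" by (intro sum_nonneg) auto
  have "norm (of_real (\<xi> $ i) * st_vec \<xi> B j) \<le> norm \<xi> * (2 * (\<Sum>k\<in>UNIV. \<Sum>l\<in>UNIV. norm (B k l)) / norm \<xi>)"
    unfolding norm_mult using component_le_norm_cart[of \<xi> i] by (intro mult_mono norm_st_vec_le) auto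
  also have "\<dots> \<le> 2 * (\<Sum>k\<in>UNIV. \<Sum>l\<in>UNIV. norm (B k l))" using b by simp
  finally show ?thesis .
qed

lemma norm_st_proj_le: "norm (st_proj \<xi> B i j) \<le> 4 * (\<Sum>k\<in>UNIV. \<Sum>l\<in>UNIV. norm (B k l))"
  unfolding st_proj_def
  using norm_triangle_ineq[of "of_real (\<xi> $ i) * st_vec \<xi> B j" "of_real (\<xi> $ j) * st_vec \<xi> B i"]
    norm_coord_st_vec_le[of \<xi> i B j] norm_coord_st_vec_le[of \<xi> j B i] by linarith

text \<open>\<open>P_st\<close> is a definite description, so a candidate has to be exhibited. Two
  candidates differ by a vector orthogonal to both of them, hence to itself.\<close>

lemma P_st_eqI:
  assumes G: "G \<in> L2_st" and orth: "\<And>H. H \<in> L2_st \<Longrightarrow> (F - G) \<bullet> H = 0"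
  shows "P_st F = G"
  unfolding P_st_def
proof (rule the_equality)
  fix G' assume G': "G' \<in> L2_st \<and> (\<forall>H\<in>L2_st. (F - G') \<bullet> H = 0)"
  have "(G' - G) \<bullet> H = 0" if "H \<in> L2_st" for H
    using orth[OF that] G' that by (simp add: inner_diff_left)
  then have "(G' - G) \<bullet> (G' - G) = 0" using G G' by (simp add: inner_diff_right)
  then show "G' = G" by simp
qed (use G orth in blast)

text \<open>After the heat flow the projection can be written down. The velocity has a singularity
  of order -1 at the origin, which is integrable and square integrable in dimension 3, and the heat
  factor decays at infinity; so \<open>L2_stI\<close> yields an element of \<open>L2_st\<close>.
  Orthogonality is \<open>st_proj_orthogonal\<close> at almost every frequency.\<close>

lemma P_st_heat:
  assumes t: "t > 0" and f: "integrable lborel f"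
    and sym: "AE x in lborel. \<forall>i j. f x $ i $ j = f x $ j $ i"
  shows "P_st (heat t f) \<in> L2_st \<and> matrix_fourier (P_st (heat t f))
    (\<lambda>i j \<xi>. of_real (heat_symbol t \<xi>) * st_proj \<xi> (\<lambda>k l. fourier_integral (entry f k l) \<xi>) i j)"
proof -
  define B where "B \<xi> k l = fourier_integral (entry f k l) \<xi>" for \<xi> k l
  define b where "b = (\<Sum>k\<in>UNIV. \<Sum>l\<in>UNIV. \<integral>x. norm (entry f k l x) \<partial>lborel)"
  have [measurable]: "f \<in> borel_measurable borel" using f by auto
  have Bm[measurable]: "(\<lambda>\<xi>. B \<xi> k l) \<in> borel_measurable borel" for k l unfolding B_def by measurable
  have Bsym: "B \<xi> k l = B \<xi> l k" for \<xi> k l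
    unfolding B_def fourier_integral_def
  proof (rule integral_cong_AE)
    show "AE x in lborel. cis (- 2 * pi * (x \<bullet> \<xi>)) * entry f k l x = cis (- 2 * pi * (x \<bullet> \<xi>)) * entry f l k x"
      using sym by eventually_elim (simp add: entry_def)
  qed measurable
  have Bherm: "B (- \<xi>) k l = cnj (B \<xi> k l)" for \<xi> k l
    unfolding B_def fourier_integral_cnj by (simp add: entry_def[abs_def])
  have Bb: "(\<Sum>k\<in>UNIV. \<Sum>l\<in>UNIV. norm (B \<xi> k l)) \<le> b" for \<xi>
    unfolding B_def b_def by (intro sum_mono norm_fourier_integral_le)
  have b0: "0 \<le> b" unfolding b_def by (intro sum_nonneg) auto
  \<comment> \<open>Division by \<open>pi * \<i>\<close> cancels the factor that
    \<open>L2_stI\<close> puts in front of the symmetrised product.\<close>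
  define v where "v j \<xi> = of_real (heat_symbol t \<xi>) * (st_vec \<xi> (B \<xi>) j / (pi * \<i>))" for j \<xi>
  have stm[measurable]: "(\<lambda>\<xi>. st_vec \<xi> (B \<xi>) j) \<in> borel_measurable borel" for j
    unfolding st_vec_def by measurable
  have vm[measurable]: "v j \<in> borel_measurable borel" for j unfolding v_def[abs_def] by measurable
  have e: "0 < heat_symbol t \<xi>" "heat_symbol t \<xi> \<le> 1" for \<xi> using heat_symbol_bounds[of t \<xi>] t by auto
  have vle: "norm (v j \<xi>) \<le> b * (heat_symbol t \<xi> / norm \<xi>)" for j \<xi>
  proof -
    have "norm (st_vec \<xi> (B \<xi>) j / (pi * \<i>)) = norm (st_vec \<xi> (B \<xi>) j) / pi" by (simp add: norm_divide norm_mult)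
    also have "\<dots> \<le> norm (st_vec \<xi> (B \<xi>) j) / 2" using pi_ge_two by (intro divide_left_mono) auto
    also have "\<dots> \<le> (2 * b / norm \<xi>) / 2"
      by (intro divide_right_mono order_trans[OF norm_st_vec_le] mult_left_mono Bb) auto
    finally have "norm (st_vec \<xi> (B \<xi>) j / (pi * \<i>)) \<le> b / norm \<xi>" by simp
    then have "norm (v j \<xi>) \<le> heat_symbol t \<xi> * (b / norm \<xi>)"
      unfolding v_def norm_mult using e(1)[of \<xi>] by (intro mult_mono) auto
    then show ?thesis by (simp add: mult_ac)
  qed
  have eh: "integrable lborel (\<lambda>\<xi>. heat_symbol t \<xi> / (norm \<xi>)\<^sup>2)"
    unfolding heat_symbol_def using t by (intro integrable_inverse_norm_sq_gauss) simp
  have v1: "integrable lborel (v j)" for j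
  proof (rule Bochner_Integration.integrable_bound)
    show "integrable lborel (\<lambda>\<xi>. b * (heat_symbol t \<xi> + heat_symbol t \<xi> / (norm \<xi>)\<^sup>2))"
      using eh integrable_heat_symbol[OF t] by (intro integrable_mult_right Bochner_Integration.integrable_add)
    have vn: "norm (v j \<xi>) \<le> b * (heat_symbol t \<xi> + heat_symbol t \<xi> / (norm \<xi>)\<^sup>2)" for \<xi>
    proof -
      \<comment> \<open>Interpolates the singularity of order -1 between the heat symbol alone and
        the heat symbol over the squared norm, both integrable.\<close>
      have "1 / norm \<xi> \<le> 1 + 1 / (norm \<xi>)\<^sup>2"
        using zero_le_power2[of "1 / norm \<xi> - 1/2"] by (simp add: power2_eq_square algebra_simps)
      from mult_left_mono[OF this, of "heat_symbol t \<xi>"] e(1)[of \<xi>]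
      have "heat_symbol t \<xi> / norm \<xi> \<le> heat_symbol t \<xi> + heat_symbol t \<xi> / (norm \<xi>)\<^sup>2"
        by (simp add: distrib_left)
      from mult_left_mono[OF this b0] vle[of j \<xi>] show ?thesis by linarith
    qed
    show "AE \<xi> in lborel. norm (v j \<xi>) \<le> norm (b * (heat_symbol t \<xi> + heat_symbol t \<xi> / (norm \<xi>)\<^sup>2))"
      unfolding real_norm_def by (intro AE_I2 order_trans[OF vn abs_ge_self])
  qed measurable
  have v2: "square_integrable (v j)" for j
    unfolding square_integrable_def
  proof
    show "integrable lborel (\<lambda>\<xi>. (norm (v j \<xi>))\<^sup>2)"
    proof (rule Bochner_Integration.integrable_bound)
      show "integrable lborel (\<lambda>\<xi>. b\<^sup>2 * (heat_symbol t \<xi> / (norm \<xi>)\<^sup>2))" by (rule integrable_mult_right[OF eh])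
      have vn: "(norm (v j \<xi>))\<^sup>2 \<le> b\<^sup>2 * (heat_symbol t \<xi> / (norm \<xi>)\<^sup>2)" for \<xi>
      proof -
        have "(norm (v j \<xi>))\<^sup>2 \<le> (b * (heat_symbol t \<xi> / norm \<xi>))\<^sup>2" by (intro power_mono vle) simp
        also have "\<dots> = b\<^sup>2 * (heat_symbol t \<xi> * heat_symbol t \<xi> / (norm \<xi>)\<^sup>2)"
          by (simp add: power_mult_distrib power_divide power2_eq_square)
        also have "\<dots> \<le> b\<^sup>2 * (heat_symbol t \<xi> / (norm \<xi>)\<^sup>2)"
          using e[of \<xi>] by (intro mult_left_mono divide_right_mono) (auto simp: mult_left_le_one_le)
        finally show ?thesis .
      qed
      show "AE \<xi> in lborel. norm ((norm (v j \<xi>))\<^sup>2) \<le> norm (b\<^sup>2 * (heat_symbol t \<xi> / (norm \<xi>)\<^sup>2))"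
        unfolding real_norm_def abs_power2 by (intro AE_I2 order_trans[OF vn abs_ge_self])
    qed measurable
  qed simp
  have wv: "of_real (\<xi> $ i) * v j \<xi> = of_real (heat_symbol t \<xi>) * (of_real (\<xi> $ i) * st_vec \<xi> (B \<xi>) j / (pi * \<i>))" for \<xi> i j
    by (simp add: v_def)
  have wb: "norm (of_real (\<xi> $ i) * st_vec \<xi> (B \<xi>) j / (pi * \<i>)) \<le> b" for \<xi> i j
  proof -
    have "norm (of_real (\<xi> $ i) * st_vec \<xi> (B \<xi>) j / (pi * \<i>)) = norm (of_real (\<xi> $ i) * st_vec \<xi> (B \<xi>) j) / pi"
      by (simp add: norm_divide norm_mult)
    also have "\<dots> \<le> norm (of_real (\<xi> $ i) * st_vec \<xi> (B \<xi>) j) / 2" using pi_ge_two by (intro divide_left_mono) auto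
    also have "\<dots> \<le> (2 * b) / 2"
      by (intro divide_right_mono order_trans[OF norm_coord_st_vec_le] mult_left_mono Bb) auto
    finally show ?thesis by simp
  qed
  have w: "integrable lborel (\<lambda>\<xi>. of_real (\<xi> $ i) * v j \<xi>)" "square_integrable (\<lambda>\<xi>. of_real (\<xi> $ i) * v j \<xi>)" for i j
    unfolding wv by (rule square_integrable_heat_symbol_bounded[OF t _ wb], measurable)+
  have herm: "v j (- \<xi>) = cnj (v j \<xi>)" for j \<xi>
    by (simp add: v_def st_vec_def heat_symbol_def Bherm sum_negf field_simps)
  have div: "(\<Sum>j\<in>UNIV. of_real (\<xi> $ j) * v j \<xi>) = 0" for \<xi>
  proof -
    have "(\<Sum>j\<in>UNIV. of_real (\<xi> $ j) * v j \<xi>) = of_real (heat_symbol t \<xi>) / (pi * \<i>) * (\<Sum>j\<in>UNIV. of_real (\<xi> $ j) * st_vec \<xi> (B \<xi>) j)"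
      by (simp add: v_def sum_distrib_left mult_ac)
    then show ?thesis by (simp add: st_vec_orthogonal)
  qed
  obtain G where G: "G \<in> L2_st"
    and GA: "matrix_fourier G (\<lambda>i j \<xi>. pi * \<i> * (of_real (\<xi> $ i) * v j \<xi> + of_real (\<xi> $ j) * v i \<xi>))"
    using L2_stI[OF v1 v2 w herm div] by blast
  have "pi * \<i> * (of_real (\<xi> $ i) * v j \<xi> + of_real (\<xi> $ j) * v i \<xi>) = of_real (heat_symbol t \<xi>) * st_proj \<xi> (B \<xi>) i j" for i j \<xi>
    by (simp add: v_def st_proj_def field_simps)
  with GA have GA: "matrix_fourier G (\<lambda>i j \<xi>. of_real (heat_symbol t \<xi>) * st_proj \<xi> (B \<xi>) i j)" by simp
  have HA: "matrix_fourier (heat t f) (\<lambda>i j \<xi>. of_real (heat_symbol t \<xi>) * B \<xi> i j)"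
    unfolding B_def by (rule matrix_fourier_heat_L1[OF t f])
  have "P_st (heat t f) = G"
  proof (rule P_st_eqI[OF G])
    fix H assume H: "H \<in> L2_st"
    obtain C where C: "matrix_fourier H C" using matrix_fourier_exists by blast
    let ?P = "\<lambda>i j \<xi>. (complex_of_real (heat_symbol t \<xi>) * B \<xi> i j) \<bullet> C i j \<xi>"
    let ?Q = "\<lambda>i j \<xi>. (complex_of_real (heat_symbol t \<xi>) * st_proj \<xi> (B \<xi>) i j) \<bullet> C i j \<xi>"
    have iP: "integrable lborel (?P i j)" for i j
      by (rule square_integrable_inner[OF L2_fourierD(2)[OF matrix_fourierD[OF HA]] L2_fourierD(2)[OF matrix_fourierD[OF C]]])
    have iQ: "integrable lborel (?Q i j)" for i j
      by (rule square_integrable_inner[OF L2_fourierD(2)[OF matrix_fourierD[OF GA]] L2_fourierD(2)[OF matrix_fourierD[OF C]]])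
    have "(heat t f - G) \<bullet> H = (\<Sum>i\<in>UNIV. \<Sum>j\<in>UNIV. (\<integral>\<xi>. ?P i j \<xi> \<partial>lborel) - (\<integral>\<xi>. ?Q i j \<xi> \<partial>lborel))"
      unfolding inner_diff_left inner_matrix_fourier[OF HA C] inner_matrix_fourier[OF GA C] by (simp add: sum_subtractf)
    also have "\<dots> = (\<integral>\<xi>. (\<Sum>i\<in>UNIV. \<Sum>j\<in>UNIV. ?P i j \<xi> - ?Q i j \<xi>) \<partial>lborel)"
      using iP iQ by (simp add: Bochner_Integration.integral_sum Bochner_Integration.integrable_sum Bochner_Integration.integral_diff)
    also have "\<dots> = 0"
    proof (rule integral_eq_zero_AE, use L2_st_symbol[OF H C] in eventually_elim)
      case (elim \<xi>)
      then obtain y where y: "\<And>i j. C i j \<xi> = pi * \<i> * (of_real (\<xi> $ i) * y j + of_real (\<xi> $ j) * y i)"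
        and y0: "(\<Sum>i\<in>UNIV. of_real (\<xi> $ i) * y i) = 0" by blast
      have "(\<Sum>i\<in>UNIV. \<Sum>j\<in>UNIV. ?P i j \<xi> - ?Q i j \<xi>)
        = heat_symbol t \<xi> * (\<Sum>i\<in>UNIV. \<Sum>j\<in>UNIV. (B \<xi> i j - st_proj \<xi> (B \<xi>) i j) \<bullet> C i j \<xi>)"
        by (simp add: scaleR_conv_of_real[symmetric] inner_diff_left sum_distrib_left right_diff_distrib)
      also have "\<dots> = 0" unfolding y by (simp add: st_proj_orthogonal[OF Bsym y0])
      finally show ?case .
    qed
    finally show "(heat t f - G) \<bullet> H = 0" .
  qed
  then show ?thesis using G GA by (simp add: B_def[abs_def])
qed


section \<open>The Duhamel formula on the Fourier side\<close>

lemma norm_L2_entry: "(norm F)\<^sup>2 = (\<Sum>i\<in>UNIV. \<Sum>j\<in>UNIV. (L2n (entry (rep_L2 F) i j))\<^sup>2)"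
  unfolding power2_norm_eq_inner[of F] inner_L2_entry by (simp add: L2n_sq power2_norm_eq_inner)

lemma L2n_entry_le: "L2n (entry (rep_L2 F) i j) \<le> norm F"
proof (rule power2_le_imp_le)
  have "(L2n (entry (rep_L2 F) i j))\<^sup>2 \<le> (\<Sum>j\<in>UNIV. (L2n (entry (rep_L2 F) i j))\<^sup>2)"
    by (rule member_le_sum) auto
  also have "\<dots> \<le> (\<Sum>i\<in>UNIV. \<Sum>j\<in>UNIV. (L2n (entry (rep_L2 F) i j))\<^sup>2)"
    by (rule member_le_sum[of i UNIV "\<lambda>i. \<Sum>j\<in>UNIV. (L2n (entry (rep_L2 F) i j))\<^sup>2"]) (auto intro: sum_nonneg)
  finally show "(L2n (entry (rep_L2 F) i j))\<^sup>2 \<le> (norm F)\<^sup>2" by (simp add: norm_L2_entry)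
qed simp

lemma rep_L2_add: "AE x in lborel. rep_L2 (F + G) x = rep_L2 F x + rep_L2 G x"
proof -
  have "F + G = abs_L2 (\<lambda>x. rep_L2 F x + rep_L2 G x)" by (simp add: plus_L2_def)
  then show ?thesis
    using rep_abs_L2_AE[OF square_integrable_add[OF square_integrable_rep_L2[of F] square_integrable_rep_L2[of G]]] by simp
qed

lemma rep_L2_scaleR: "AE x in lborel. rep_L2 (c *\<^sub>R F) x = c *\<^sub>R rep_L2 F x"
proof -
  have "c *\<^sub>R F = abs_L2 (\<lambda>x. c *\<^sub>R rep_L2 F x)" by (simp add: scaleR_L2_def)
  then show ?thesis
    using rep_abs_L2_AE[OF square_integrable_scaleR[OF square_integrable_rep_L2[of F]]] by simp
qed

lemma rep_L2_diff: "AE x in lborel. rep_L2 (F - G) x = rep_L2 F x - rep_L2 G x"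
proof -
  have eq: "F - G = F + (- 1) *\<^sub>R G" by simp
  show ?thesis
    unfolding eq using rep_L2_add[of F "(- 1) *\<^sub>R G"] rep_L2_scaleR[of "- 1" G]
    by eventually_elim simp
qed

lemma entry_rep_measurable [measurable]: "entry (rep_L2 F) i j \<in> borel_measurable borel"
  by (rule entry_measurable[OF square_integrable_borel[OF square_integrable_rep_L2]])

lemma square_integrable_entry_rep: "square_integrable (entry (rep_L2 F) i j)"
  by (rule square_integrable_entry[OF square_integrable_rep_L2])

text \<open>Testing an entry is a bounded functional on classes, so it commutes with the
  vector-valued integral of the mild formulation.\<close>

lemma bounded_linear_entry_integral:
  assumes h: "square_integrable h"
  shows "bounded_linear (\<lambda>F. \<integral>x. entry (rep_L2 F) i j x * h x \<partial>lborel)"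
proof (rule bounded_linear_intro[where K="L2n h"])
  note [measurable] = square_integrable_borel[OF h]
  have i: "integrable lborel (\<lambda>x. entry (rep_L2 F) i j x * h x)" for F
    by (intro square_integrable_mult square_integrable_entry_rep h)
  show "(\<integral>x. entry (rep_L2 (F + G)) i j x * h x \<partial>lborel)
      = (\<integral>x. entry (rep_L2 F) i j x * h x \<partial>lborel) + (\<integral>x. entry (rep_L2 G) i j x * h x \<partial>lborel)" for F G
  proof -
    have "(\<integral>x. entry (rep_L2 (F + G)) i j x * h x \<partial>lborel)
      = (\<integral>x. entry (rep_L2 F) i j x * h x + entry (rep_L2 G) i j x * h x \<partial>lborel)"
    proof (rule integral_cong_AE)
      show "AE x in lborel. entry (rep_L2 (F + G)) i j x * h x
        = entry (rep_L2 F) i j x * h x + entry (rep_L2 G) i j x * h x"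
        using rep_L2_add[of F G] by eventually_elim (simp add: entry_def distrib_right)
    qed measurable
    then show ?thesis using i by simp
  qed
  show "(\<integral>x. entry (rep_L2 (r *\<^sub>R F)) i j x * h x \<partial>lborel) = r *\<^sub>R (\<integral>x. entry (rep_L2 F) i j x * h x \<partial>lborel)" for r F
  proof -
    have "(\<integral>x. entry (rep_L2 (r *\<^sub>R F)) i j x * h x \<partial>lborel) = (\<integral>x. r *\<^sub>R (entry (rep_L2 F) i j x * h x) \<partial>lborel)"
    proof (rule integral_cong_AE)
      show "AE x in lborel. entry (rep_L2 (r *\<^sub>R F)) i j x * h x = r *\<^sub>R (entry (rep_L2 F) i j x * h x)"
        using rep_L2_scaleR[of r F] by eventually_elim (simp add: entry_def scaleR_conv_of_real[where 'a=complex])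
    qed measurable
    then show ?thesis by simp
  qed
  show "norm (\<integral>x. entry (rep_L2 F) i j x * h x \<partial>lborel) \<le> norm F * L2n h" for F
    by (rule order_trans[OF norm_integral_mult_le[OF square_integrable_entry_rep h] mult_right_mono[OF L2n_entry_le]]) simp
qed

text \<open>An integral with a definite value at every frequency, because the squared field is in
  L1.\<close>

definition square_fourier :: "(real^3^3) L2 \<Rightarrow> 3 \<Rightarrow> 3 \<Rightarrow> real^3 \<Rightarrow> complex" where
  "square_fourier F k l = fourier_integral (entry (matrix_square F) k l)"

lemma entry_matrix_square:
  "entry (matrix_square F) k l x = (\<Sum>m\<in>UNIV. entry (rep_L2 F) k m x * entry (rep_L2 F) m l x)"
  by (simp add: entry_def matrix_square_def matrix_matrix_mult_def)

lemma matrix_square_measurable [measurable]: "matrix_square F \<in> borel_measurable borel"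
proof (rule matrix_measurableI)
  fix i j
  have "(\<lambda>x. Re (entry (matrix_square F) i j x)) \<in> borel_measurable borel"
    unfolding entry_matrix_square by measurable
  then show "(\<lambda>x. matrix_square F x $ i $ j) \<in> borel_measurable borel" by (simp add: entry_def)
qed

lemma integrable_entry_matrix_square: "integrable lborel (entry (matrix_square F) k l)"
  unfolding entry_matrix_square[abs_def]
  by (intro Bochner_Integration.integrable_sum square_integrable_mult square_integrable_entry_rep)

lemma integrable_matrix_square: "integrable lborel (matrix_square F)"
proof (rule Bochner_Integration.integrable_bound)
  show "integrable lborel (\<lambda>x. \<Sum>i\<in>UNIV. \<Sum>j\<in>UNIV. norm (entry (matrix_square F) i j x))"
    by (intro Bochner_Integration.integrable_sum integrable_norm integrable_entry_matrix_square)
  show "AE x in lborel. norm (matrix_square F x) \<le> norm (\<Sum>i\<in>UNIV. \<Sum>j\<in>UNIV. norm (entry (matrix_square F) i j x))"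
    using order_trans[OF norm_matrix_le abs_ge_self] by (intro AE_I2) (simp add: entry_def)
qed simp

lemma matrix_square_symmetric:
  assumes "S \<in> L2_st" shows "AE x in lborel. \<forall>i j. matrix_square S x $ i $ j = matrix_square S x $ j $ i"
  using L2_st_symmetric_trace_free[OF assms]
proof eventually_elim
  case (elim x)
  then have s: "rep_L2 S x $ i $ j = rep_L2 S x $ j $ i" for i j by blast
  show ?case
  proof (intro allI)
    fix i j
    have "matrix_square S x $ i $ j = (\<Sum>k\<in>UNIV. rep_L2 S x $ k $ i * rep_L2 S x $ j $ k)"
      unfolding matrix_square_def matrix_matrix_mult_def by (simp add: s[of i] s[of _ j])
    then show "matrix_square S x $ i $ j = matrix_square S x $ j $ i"
      by (simp add: matrix_square_def matrix_matrix_mult_def mult.commute)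
  qed
qed

lemma square_fourier_symmetric:
  assumes "S \<in> L2_st" shows "square_fourier S k l \<xi> = square_fourier S l k \<xi>"
  unfolding square_fourier_def fourier_integral_def
proof (rule integral_cong_AE)
  show "AE x in lborel. cis (- 2 * pi * (x \<bullet> \<xi>)) * entry (matrix_square S) k l x = cis (- 2 * pi * (x \<bullet> \<xi>)) * entry (matrix_square S) l k x"
    using matrix_square_symmetric[OF assms] by eventually_elim (simp add: entry_def)
qed measurable

lemma square_fourier_sum:
  "square_fourier F k l \<xi> = (\<Sum>m\<in>UNIV. fourier_integral (\<lambda>x. entry (rep_L2 F) k m x * entry (rep_L2 F) m l x) \<xi>)"
  unfolding square_fourier_def fourier_integral_def entry_matrix_square sum_distrib_left
  by (rule Bochner_Integration.integral_sum)
     (intro fourier_integrand_integrable square_integrable_mult square_integrable_entry_rep, measurable)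

text \<open>Writes \<open>a * b - c * d\<close> as \<open>a * (b - d) + (a - c) * d\<close> and
  applies Cauchy-Schwarz to each part; the estimate is uniform in the frequency.\<close>

lemma norm_fourier_mult_diff_le:
  assumes s: "square_integrable a" "square_integrable b" "square_integrable c" "square_integrable d"
  shows "norm (fourier_integral (\<lambda>x. a x * b x) \<xi> - fourier_integral (\<lambda>x. c x * d x) \<xi>)
    \<le> L2n a * L2n (\<lambda>x. b x - d x) + L2n (\<lambda>x. a x - c x) * L2n d"
proof -
  note ds = square_integrable_diff[OF s(2) s(4)] square_integrable_diff[OF s(1) s(3)]
  note i = square_integrable_norm_mult[OF s(1) ds(1)] square_integrable_norm_mult[OF ds(2) s(4)]
  have "fourier_integral (\<lambda>x. a x * b x) \<xi> - fourier_integral (\<lambda>x. c x * d x) \<xi>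
    = fourier_integral (\<lambda>x. a x * b x - c x * d x) \<xi>"
    by (intro fourier_integral_diff[symmetric] square_integrable_mult s)
  also have "norm \<dots> \<le> (\<integral>x. norm (a x * b x - c x * d x) \<partial>lborel)" by (rule norm_fourier_integral_le)
  also have "\<dots> \<le> (\<integral>x. norm (a x) * norm (b x - d x) + norm (a x - c x) * norm (d x) \<partial>lborel)"
  proof (rule integral_mono)
    show "integrable lborel (\<lambda>x. norm (a x * b x - c x * d x))"
      by (intro integrable_norm Bochner_Integration.integrable_diff square_integrable_mult s)
    show "integrable lborel (\<lambda>x. norm (a x) * norm (b x - d x) + norm (a x - c x) * norm (d x))"
      by (intro Bochner_Integration.integrable_add i)
    fix x
    have "a x * b x - c x * d x = a x * (b x - d x) + (a x - c x) * d x" by (simp add: algebra_simps)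
    then show "norm (a x * b x - c x * d x) \<le> norm (a x) * norm (b x - d x) + norm (a x - c x) * norm (d x)"
      using norm_triangle_ineq[of "a x * (b x - d x)" "(a x - c x) * d x"] by (simp add: norm_mult)
  qed
  also have "\<dots> = (\<integral>x. norm (a x) * norm (b x - d x) \<partial>lborel) + (\<integral>x. norm (a x - c x) * norm (d x) \<partial>lborel)"
    by (rule Bochner_Integration.integral_add[OF i])
  also have "\<dots> \<le> L2n a * L2n (\<lambda>x. b x - d x) + L2n (\<lambda>x. a x - c x) * L2n d"
    by (intro add_mono L2n_Cauchy_Schwarz s ds)
  finally show ?thesis .
qed

text \<open>The quadratic term is Lipschitz on bounded sets, uniformly in \<xi>; this transfers the
  continuity in time of the solution. The factor 3 counts the summands of a matrix product.\<close>

lemma square_fourier_diff_le: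
  "norm (square_fourier F k l \<xi> - square_fourier G k l \<xi>) \<le> 3 * (norm F + norm G) * norm (F - G)"
proof -
  have d: "L2n (\<lambda>x. entry (rep_L2 F) i j x - entry (rep_L2 G) i j x) \<le> norm (F - G)" for i j
  proof -
    have "L2n (\<lambda>x. entry (rep_L2 F) i j x - entry (rep_L2 G) i j x) = L2n (entry (rep_L2 (F - G)) i j)"
      unfolding L2n_def
    proof (intro arg_cong[where f=sqrt] integral_cong_AE)
      show "AE x in lborel. (norm (entry (rep_L2 F) i j x - entry (rep_L2 G) i j x))\<^sup>2 = (norm (entry (rep_L2 (F - G)) i j x))\<^sup>2"
        using rep_L2_diff[of F G] by eventually_elim (simp add: entry_def of_real_diff[symmetric] del: of_real_diff)
    qed measurable
    then show ?thesis by (simp add: L2n_entry_le)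
  qed
  have "norm (square_fourier F k l \<xi> - square_fourier G k l \<xi>)
    \<le> (\<Sum>m\<in>(UNIV :: 3 set). norm F * norm (F - G) + norm (F - G) * norm G)"
    unfolding square_fourier_sum sum_subtractf[symmetric]
    by (intro sum_norm_le order_trans[OF norm_fourier_mult_diff_le] add_mono mult_mono d L2n_entry_le
        square_integrable_entry_rep) auto
  also have "\<dots> = 3 * (norm F + norm G) * norm (F - G)" by (simp add: algebra_simps)
  finally show ?thesis .
qed

lemma norm_square_fourier_le: "norm (square_fourier F k l \<xi>) \<le> 3 * (norm F)\<^sup>2"
proof -
  have z: "square_fourier 0 k l \<xi> = 0"
  proof -
    have "AE x in lborel. rep_L2 (0 :: (real^3^3) L2) x = 0"
      using rep_L2_scaleR[of 0 "0 :: (real^3^3) L2"] by simp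
    then have "AE x in lborel. cis (- 2 * pi * (x \<bullet> \<xi>)) * entry (matrix_square 0) k l x = 0"
    proof eventually_elim
      case (elim x)
      then show ?case unfolding entry_matrix_square by (simp add: entry_def)
    qed
    then show ?thesis unfolding square_fourier_def fourier_integral_def by (rule integral_eq_zero_AE)
  qed
  show ?thesis using square_fourier_diff_le[of F k l \<xi> 0] by (simp add: z power2_eq_square)
qed

lemma continuous_square_fourier: "isCont (square_fourier F k l) \<xi>"
  unfolding square_fourier_def by (rule continuous_fourier_integral[OF integrable_entry_matrix_square])

text \<open>The setting on a compact time interval. \<open>R\<close> stands for the solution on
  \<open>[0, b]\<close>, extended by its end values, so that continuity, the bound \<open>K\<close>
  and membership in \<open>L2_st\<close> hold at all real times, while the mild equation is demanded
  only up to \<open>b\<close>.\<close>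

locale mild_flow =
  fixes R :: "real \<Rightarrow> (real^3^3) L2" and b K :: real and A0 :: "3 \<Rightarrow> 3 \<Rightarrow> real^3 \<Rightarrow> complex"
  assumes b: "0 < b" and cont: "continuous_on UNIV R" and st: "\<And>r. R r \<in> L2_st" and K: "\<And>r. norm (R r) \<le> K"
    and duhamel_integrable: "\<And>t. 0 < t \<Longrightarrow> t \<le> b \<Longrightarrow>
      (\<lambda>\<tau>. P_st (heat \<tau> (matrix_square (R (t - \<tau>))))) integrable_on {0..t}"
    and duhamel: "\<And>t. 0 < t \<Longrightarrow> t \<le> b \<Longrightarrow> R t = heat t (rep_L2 (R 0))
      - (2 / 3) *\<^sub>R integral {0..t} (\<lambda>\<tau>. P_st (heat \<tau> (matrix_square (R (t - \<tau>)))))"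
    and A0: "matrix_fourier (R 0) A0"
begin

definition N :: "3 \<Rightarrow> 3 \<Rightarrow> real \<Rightarrow> real^3 \<Rightarrow> complex" where
  "N i j r \<xi> = st_proj \<xi> (\<lambda>k l. square_fourier (R r) k l \<xi>) i j"

text \<open>Defined for every \<open>\<xi>\<close>, not only up to null sets, so that \<open>A i j\<close> solves a differential
  equation in time at each frequency.\<close>

definition A :: "3 \<Rightarrow> 3 \<Rightarrow> real \<Rightarrow> real^3 \<Rightarrow> complex" where
  "A i j t \<xi> = heat_symbol t \<xi> *\<^sub>R (A0 i j \<xi> - (2 / 3) *\<^sub>R
     (LINT r:{0..t}|lborel. heat_symbol (- r) \<xi> *\<^sub>R N i j r \<xi>))"

text \<open>Lipschitz dependence on the field, uniform in \<xi>, combined with continuity in \<xi>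
  for a fixed field. Joint continuity is the source of the joint measurability that Fubini
  requires.\<close>

lemma square_fourier_joint_continuous: "isCont (\<lambda>(r, \<xi>). square_fourier (R r) k l \<xi>) (r0, \<xi>0)"
proof -
  have "isCont R r0" using cont by (simp add: continuous_on_eq_continuous_at)
  from isCont_tendsto_compose[OF this, of fst "at (r0, \<xi>0)"] tendsto_fst[OF tendsto_ident_at[of "(r0, \<xi>0)" UNIV]]
  have R: "((\<lambda>z. R (fst z)) \<longlongrightarrow> R r0) (at (r0, \<xi>0))" by simp
  have "((\<lambda>z. 3 * (K + K) * norm (R (fst z) - R r0)) \<longlongrightarrow> 3 * (K + K) * norm (R r0 - R r0)) (at (r0, \<xi>0))"
    by (intro tendsto_mult tendsto_const tendsto_norm tendsto_diff R)
  then have 1: "((\<lambda>z. 3 * (K + K) * norm (R (fst z) - R r0)) \<longlongrightarrow> 0) (at (r0, \<xi>0))" by simp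
  have "((\<lambda>z. square_fourier (R (fst z)) k l (snd z) - square_fourier (R r0) k l (snd z)) \<longlongrightarrow> 0) (at (r0, \<xi>0))"
  proof (rule Lim_null_comparison[OF _ 1], rule always_eventually, rule allI)
    fix z :: "real \<times> (real^3)"
    show "norm (square_fourier (R (fst z)) k l (snd z) - square_fourier (R r0) k l (snd z))
      \<le> 3 * (K + K) * norm (R (fst z) - R r0)"
      by (rule order_trans[OF square_fourier_diff_le]) (intro mult_right_mono mult_left_mono add_mono K, auto)
  qed
  moreover have "((\<lambda>z. square_fourier (R r0) k l (snd z)) \<longlongrightarrow> square_fourier (R r0) k l \<xi>0) (at (r0, \<xi>0))"
    using isCont_tendsto_compose[OF continuous_square_fourier, of snd \<xi>0 "at (r0, \<xi>0)" "R r0" k l]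
      tendsto_snd[OF tendsto_ident_at[of "(r0, \<xi>0)" UNIV]] by simp
  ultimately have "((\<lambda>z. (square_fourier (R (fst z)) k l (snd z) - square_fourier (R r0) k l (snd z)) + square_fourier (R r0) k l (snd z))
      \<longlongrightarrow> 0 + square_fourier (R r0) k l \<xi>0) (at (r0, \<xi>0))"
    by (rule tendsto_add)
  then show ?thesis by (simp add: isCont_def case_prod_beta')
qed

lemma square_fourier_joint_measurable [measurable]:
  "(\<lambda>(r, \<xi>). square_fourier (R r) k l \<xi>) \<in> borel_measurable (borel \<Otimes>\<^sub>M borel)"
proof -
  have "continuous_on UNIV (\<lambda>(r, \<xi>). square_fourier (R r) k l \<xi>)"
    by (intro continuous_at_imp_continuous_on) (auto intro: square_fourier_joint_continuous)
  from borel_measurable_continuous_onI[OF this] show ?thesis by (simp add: borel_prod)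
qed

lemma N_joint_measurable [measurable]: "(\<lambda>(r, \<xi>). N i j r \<xi>) \<in> borel_measurable (borel \<Otimes>\<^sub>M borel)"
  unfolding N_def st_proj_def st_vec_def by measurable

lemma heat_symbol_joint_measurable [measurable]: "(\<lambda>(t, \<xi>). heat_symbol t \<xi>) \<in> borel_measurable (borel \<Otimes>\<^sub>M borel)"
  unfolding heat_symbol_def by measurable

text \<open>Continuity in time only: the symbol of the projection has in general no limit at \<xi> =
  0.\<close>

lemma N_continuous: "continuous_on UNIV (\<lambda>r. N i j r \<xi>)"
proof -
  have "isCont (\<lambda>r. square_fourier (R r) k l \<xi>) r" for k l r
  proof -
    have "isCont (\<lambda>r. (r, \<xi>)) r" by (intro continuous_intros)
    from isCont_o2[OF this square_fourier_joint_continuous] show ?thesis by simp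
  qed
  then have "continuous_on UNIV (\<lambda>r. square_fourier (R r) k l \<xi>)" for k l
    by (simp add: continuous_at_imp_continuous_on)
  then show ?thesis unfolding N_def st_proj_def st_vec_def
    by (intro continuous_on_add continuous_on_mult continuous_on_const continuous_on_diff continuous_on_sum)
       (auto simp: divide_inverse intro!: continuous_intros)
qed

text \<open>The constant is 4 * 9 * 3: the factor of \<open>norm_st_proj_le\<close>, the nine
  entries, and the factor of \<open>norm_square_fourier_le\<close>.\<close>

definition CN :: real where "CN = 108 * K\<^sup>2"

lemma N_bound: "norm (N i j r \<xi>) \<le> CN"
proof -
  have "(norm (R r))\<^sup>2 \<le> K\<^sup>2" by (intro power_mono K) simp
  then have "norm (square_fourier (R r) k l \<xi>) \<le> 3 * K\<^sup>2" for k l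
    using norm_square_fourier_le[of "R r" k l \<xi>] by linarith
  then have "(\<Sum>k\<in>UNIV. \<Sum>l\<in>UNIV. norm (square_fourier (R r) k l \<xi>)) \<le> (\<Sum>k\<in>(UNIV :: 3 set). \<Sum>l\<in>(UNIV :: 3 set). 3 * K\<^sup>2)"
    by (intro sum_mono)
  then show ?thesis
    using norm_st_proj_le[of \<xi> "\<lambda>k l. square_fourier (R r) k l \<xi>" i j] unfolding N_def CN_def by simp
qed

lemma A0_measurable [measurable]: "A0 i j \<in> borel_measurable borel"
  by (rule square_integrable_borel[OF L2_fourierD(2)[OF matrix_fourierD[OF A0]]])

lemma A_measurable [measurable]: "A i j t \<in> borel_measurable borel"
  unfolding A_def[abs_def] set_lebesgue_integral_def by measurable

lemma duhamel_set_integrable: "set_integrable lborel {a..c} (\<lambda>r. heat_symbol (u * r) \<xi> *\<^sub>R N i j r \<xi>)"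
proof (rule borel_integrable_atLeastAtMost')
  show "continuous_on {a..c} (\<lambda>r. heat_symbol (u * r) \<xi> *\<^sub>R N i j r \<xi>)"
    unfolding heat_symbol_def
    by (intro continuous_intros continuous_on_subset[OF N_continuous]) auto
qed

lemma heat_symbol_add: "heat_symbol (s + t) \<xi> = heat_symbol s \<xi> * heat_symbol t \<xi>"
  by (simp add: heat_symbol_def exp_add[symmetric] algebra_simps)

text \<open>The substitution of \<open>t - \<tau>\<close> for the time variable brings
  \<open>A\<close> into the shape of the Duhamel term in \<open>mild_solution\<close>.\<close>

lemma A_convolution:
  assumes "0 \<le> t"
  shows "A i j t \<xi> = heat_symbol t \<xi> *\<^sub>R A0 i j \<xi>
    - (2 / 3) *\<^sub>R (\<integral>\<tau>. indicator {0..t} \<tau> *\<^sub>R (heat_symbol \<tau> \<xi> *\<^sub>R N i j (t - \<tau>) \<xi>) \<partial>lborel)"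
proof -
  have m[measurable]: "(\<lambda>r. N i j r \<xi>) \<in> borel_measurable borel"
    by (rule borel_measurable_continuous_onI[OF N_continuous])
  have m2[measurable]: "(\<lambda>r. heat_symbol r \<xi>) \<in> borel_measurable borel"
    unfolding heat_symbol_def by measurable
  let ?H = "\<lambda>r. indicator {0..t} r *\<^sub>R (heat_symbol (t - r) \<xi> *\<^sub>R N i j r \<xi>)"
  have "heat_symbol t \<xi> *\<^sub>R (LINT r:{0..t}|lborel. heat_symbol (- r) \<xi> *\<^sub>R N i j r \<xi>) = (\<integral>r. ?H r \<partial>lborel)"
    unfolding set_lebesgue_integral_def integral_scaleR_right[symmetric]
    using heat_symbol_add[of t "- _" \<xi>] by (intro Bochner_Integration.integral_cong refl) (simp add: mult_ac)
  also have "\<dots> = (\<integral>\<tau>. ?H (t - \<tau>) \<partial>lborel)" by (rule integral_reflect_lborel[symmetric]) measurable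
  also have "\<dots> = (\<integral>\<tau>. indicator {0..t} \<tau> *\<^sub>R (heat_symbol \<tau> \<xi> *\<^sub>R N i j (t - \<tau>) \<xi>) \<partial>lborel)"
    by (intro Bochner_Integration.integral_cong refl) (auto simp: indicator_def)
  finally have e: "heat_symbol t \<xi> *\<^sub>R (LINT r:{0..t}|lborel. heat_symbol (- r) \<xi> *\<^sub>R N i j r \<xi>)
    = (\<integral>\<tau>. indicator {0..t} \<tau> *\<^sub>R (heat_symbol \<tau> \<xi> *\<^sub>R N i j (t - \<tau>) \<xi>) \<partial>lborel)" .
  show ?thesis
    unfolding A_def scaleR_diff_right scaleR_left_commute[of "heat_symbol t \<xi>" "2 / 3"] e ..
qed

text \<open>Links the explicit \<open>A\<close> to the solution. Any transform \<open>B\<close> of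
  \<open>R t\<close> and the function \<open>A\<close> have the same integrals against Gaussians:
  the test functional passes through the Duhamel integral, \<open>P_st_heat\<close> evaluates it at
  each time, and Fubini restores the integral over time inside.\<close>

lemma A_fourier:
  assumes t: "0 < t" "t \<le> b"
  shows "matrix_fourier (R t) (\<lambda>i j. A i j t)"
  unfolding matrix_fourier_def
proof (intro allI)
  fix i j
  obtain B where B: "matrix_fourier (R t) B" using matrix_fourier_exists by blast
  note Bs = L2_fourierD(2)[OF matrix_fourierD[OF B, of i j]]
  note A0s = L2_fourierD(2)[OF matrix_fourierD[OF A0, of i j]]
  define D where "D \<xi> = (\<integral>\<tau>. indicator {0..t} \<tau> *\<^sub>R (heat_symbol \<tau> \<xi> *\<^sub>R N i j (t - \<tau>) \<xi>) \<partial>lborel)" for \<xi>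
  have [measurable]: "D \<in> borel_measurable borel" unfolding D_def by measurable
  have AD: "A i j t \<xi> = of_real (heat_symbol t \<xi>) * A0 i j \<xi> - (2 / 3) * D \<xi>" for \<xi>
    using A_convolution[of t i j \<xi>] t by (simp add: D_def scaleR_conv_of_real)
  have "AE \<xi> in lborel. B i j \<xi> = A i j t \<xi>"
  proof (rule gauss_test_eq)
    show "B i j \<in> borel_measurable borel" by (rule square_integrable_borel[OF Bs])
    fix a :: real and y :: "real^3" assume a: "a > 0"
    let ?\<psi> = "gauss a y"
    \<comment> \<open>By \<open>lF\<close> this functional of the field computes the Gaussian test
      of whichever transform is used.\<close>
    define l where "l F = (\<integral>x. entry (rep_L2 F) i j x * fourier_integral ?\<psi> x \<partial>lborel)" for F
    have l: "bounded_linear l"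
      unfolding l_def by (rule bounded_linear_entry_integral[OF square_integrable_fourier_gauss[OF a]])
    have lF: "l F = (\<integral>\<xi>. C i j \<xi> * ?\<psi> \<xi> \<partial>lborel)" if "matrix_fourier F C" for F C
      unfolding l_def using a by (intro L2_fourierD(3)[OF matrix_fourierD[OF that]]) auto
    show "integrable lborel (\<lambda>\<xi>. B i j \<xi> * ?\<psi> \<xi>)" using a Bs by (intro square_integrable_mult) auto
    let ?F = "\<lambda>\<tau> \<xi>. (indicator {0..t} \<tau> *\<^sub>R (heat_symbol \<tau> \<xi> *\<^sub>R N i j (t - \<tau>) \<xi>)) * ?\<psi> \<xi>"
    have F: "integrable (lborel \<Otimes>\<^sub>M lborel) (case_prod ?F)"
    proof (rule integrable_pair_bound)
      show "integrable lborel (\<lambda>\<tau>::real. indicator {0..t} \<tau> * CN)"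
        using t by (intro integrable_mult_left integrable_real_indicator) auto
      show "integrable lborel (\<lambda>\<xi>. norm (?\<psi> \<xi>))" using a by simp
      fix \<tau> :: real and \<xi> :: "real^3"
      have "heat_symbol \<tau> \<xi> * norm (N i j (t - \<tau>) \<xi>) \<le> 1 * CN" if "0 \<le> \<tau>"
        using heat_symbol_bounds[of \<tau> \<xi>] that by (intro mult_mono N_bound) auto
      then have "indicator {0..t} \<tau> * (heat_symbol \<tau> \<xi> * norm (N i j (t - \<tau>) \<xi>)) \<le> indicator {0..t} \<tau> * CN"
        by (auto simp: indicator_def)
      from mult_right_mono[OF this norm_ge_zero[of "?\<psi> \<xi>"]]
      show "norm (?F \<tau> \<xi>) \<le> indicator {0..t} \<tau> * CN * norm (?\<psi> \<xi>)"
        using heat_symbol_bounds(1)[of \<tau> \<xi>] by (simp add: norm_mult mult_ac)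
    qed measurable
    have FE: "(\<integral>\<xi>. ?F \<tau> \<xi> \<partial>lborel) = indicator {0..t} \<tau> *\<^sub>R (\<integral>\<xi>. (heat_symbol \<tau> \<xi> *\<^sub>R N i j (t - \<tau>) \<xi>) * ?\<psi> \<xi> \<partial>lborel)" for \<tau>
      by (simp only: mult_scaleR_left integral_scaleR_right)
    have Dint: "integrable lborel (\<lambda>\<xi>. D \<xi> * ?\<psi> \<xi>)"
      using lborel_pair.integrable_snd[OF F] unfolding D_def by (simp only: integral_mult_left_zero)
    have HA: "integrable lborel (\<lambda>\<xi>. (of_real (heat_symbol t \<xi>) * A0 i j \<xi>) * ?\<psi> \<xi>)"
      using t a A0s by (intro square_integrable_mult heat_symbol_mult) auto
    show "integrable lborel (\<lambda>\<xi>. A i j t \<xi> * ?\<psi> \<xi>)"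
      unfolding AD left_diff_distrib mult.assoc[of "2/3"]
      by (intro Bochner_Integration.integrable_diff HA integrable_mult_right Dint)
    let ?P = "\<lambda>\<tau>. P_st (heat \<tau> (matrix_square (R (t - \<tau>))))"
    have lP: "l (?P \<tau>) = (\<integral>\<xi>. (heat_symbol \<tau> \<xi> *\<^sub>R N i j (t - \<tau>) \<xi>) * ?\<psi> \<xi> \<partial>lborel)" if "\<tau> > 0" for \<tau>
      using lF[OF conjunct2[OF P_st_heat[OF that integrable_matrix_square matrix_square_symmetric[OF st]]]]
      by (simp add: N_def square_fourier_def scaleR_conv_of_real)
    have "l (integral {0..t} ?P) = integral {0..t} (\<lambda>\<tau>. l (?P \<tau>))"
      using integral_linear[OF duhamel_integrable[OF t] l] by (simp add: comp_def)
    \<comment> \<open>The formula \<open>lP\<close> is available for positive times only, so the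
      single point 0 is discarded.\<close>
    also have "\<dots> = integral {0..t} (\<lambda>\<tau>. \<integral>\<xi>. (heat_symbol \<tau> \<xi> *\<^sub>R N i j (t - \<tau>) \<xi>) * ?\<psi> \<xi> \<partial>lborel)"
      by (rule integral_spike[of "{0}"]) (auto simp: lP)
    also have "\<dots> = (LINT \<tau>:{0..t}|lborel. \<integral>\<xi>. (heat_symbol \<tau> \<xi> *\<^sub>R N i j (t - \<tau>) \<xi>) * ?\<psi> \<xi> \<partial>lborel)"
    proof (rule set_borel_integral_eq_integral(2)[symmetric])
      show "set_integrable lborel {0..t} (\<lambda>\<tau>. \<integral>\<xi>. (heat_symbol \<tau> \<xi> *\<^sub>R N i j (t - \<tau>) \<xi>) * ?\<psi> \<xi> \<partial>lborel)"
        using lborel_pair.integrable_fst[OF F] unfolding set_integrable_def FE .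
    qed
    also have "\<dots> = (\<integral>\<tau>. (\<integral>\<xi>. ?F \<tau> \<xi> \<partial>lborel) \<partial>lborel)"
      unfolding set_lebesgue_integral_def FE ..
    also have "\<dots> = (\<integral>\<xi>. (\<integral>\<tau>. ?F \<tau> \<xi> \<partial>lborel) \<partial>lborel)"
      by (rule lborel_pair.Fubini_integral[OF F, symmetric])
    also have "\<dots> = (\<integral>\<xi>. D \<xi> * ?\<psi> \<xi> \<partial>lborel)" by (simp only: D_def integral_mult_left_zero)
    finally have lD: "l (integral {0..t} ?P) = (\<integral>\<xi>. D \<xi> * ?\<psi> \<xi> \<partial>lborel)" .
    have "(\<integral>\<xi>. B i j \<xi> * ?\<psi> \<xi> \<partial>lborel) = l (R t)" by (rule lF[OF B, symmetric])
    also have "\<dots> = l (heat t (rep_L2 (R 0))) - (2 / 3) *\<^sub>R l (integral {0..t} ?P)"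
      by (subst duhamel[OF t]) (simp only: linear_diff[OF bounded_linear.linear[OF l]] linear_cmul[OF bounded_linear.linear[OF l]])
    also have "l (heat t (rep_L2 (R 0))) = (\<integral>\<xi>. (of_real (heat_symbol t \<xi>) * A0 i j \<xi>) * ?\<psi> \<xi> \<partial>lborel)"
      by (rule lF[OF matrix_fourier_heat_L2[OF t(1) A0]])
    also have "\<dots> - (2 / 3) *\<^sub>R l (integral {0..t} ?P) = (\<integral>\<xi>. A i j t \<xi> * ?\<psi> \<xi> \<partial>lborel)"
      unfolding lD AD left_diff_distrib mult.assoc[of "2/3"]
      using HA Dint by (simp add: scaleR_conv_of_real)
    finally show "(\<integral>\<xi>. B i j \<xi> * ?\<psi> \<xi> \<partial>lborel) = (\<integral>\<xi>. A i j t \<xi> * ?\<psi> \<xi> \<partial>lborel)" .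
  qed measurable
  from L2_fourier_cong[OF matrix_fourierD[OF B] _ this] show "L2_fourier (entry (rep_L2 (R t)) i j) (A i j t)" by simp
qed

text \<open>At a fixed frequency the integrand of \<open>A\<close> is continuous in time, so the
  fundamental theorem of calculus and the product rule with the integrating factor apply.\<close>

lemma A_derivative:
  assumes t: "0 < t"
  shows "((\<lambda>t. A i j t \<xi>) has_vector_derivative
    (- (4 * pi\<^sup>2 * (norm \<xi>)\<^sup>2) *\<^sub>R A i j t \<xi> - (2 / 3) *\<^sub>R N i j t \<xi>)) (at t)"
proof -
  let ?g = "\<lambda>r. heat_symbol (- r) \<xi> *\<^sub>R N i j r \<xi>"
  let ?c = "4 * pi\<^sup>2 * (norm \<xi>)\<^sup>2"
  have gc: "continuous_on UNIV ?g"
    unfolding heat_symbol_def by (intro continuous_intros N_continuous)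
  have I: "(LINT r:{0..s}|lborel. ?g r) = integral {0..s} ?g" for s
    using duhamel_set_integrable[of 0 s "- 1" \<xi> i j] by (intro set_borel_integral_eq_integral) simp
  \<comment> \<open>The interval ends at \<open>t + 1\<close> so that \<open>t\<close> is interior
    and the derivative becomes two-sided.\<close>
  have "((\<lambda>s. integral {0..s} ?g) has_vector_derivative ?g t) (at t within {0..t + 1})"
    using t by (intro integral_has_vector_derivative continuous_on_subset[OF gc]) auto
  then have Id: "((\<lambda>s. integral {0..s} ?g) has_vector_derivative ?g t) (at t)"
    using t by (simp add: at_within_Icc_at)
  have ed: "((\<lambda>s. heat_symbol s \<xi>) has_real_derivative (- ?c * heat_symbol t \<xi>)) (at t)"
    unfolding heat_symbol_def by (auto intro!: derivative_eq_intros)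
  have eq: "(\<lambda>t. A i j t \<xi>) = (\<lambda>s. heat_symbol s \<xi> *\<^sub>R (A0 i j \<xi> - (2 / 3) *\<^sub>R integral {0..s} ?g))"
    unfolding A_def I ..
  have "((\<lambda>s. A0 i j \<xi> - (2 / 3) *\<^sub>R integral {0..s} ?g) has_vector_derivative (0 - (2 / 3) *\<^sub>R ?g t)) (at t)"
    by (intro has_vector_derivative_diff has_vector_derivative_const bounded_linear.has_vector_derivative[OF bounded_linear_scaleR_right Id])
  from has_vector_derivative_scaleR[OF ed this]
  have der: "((\<lambda>t. A i j t \<xi>) has_vector_derivative (heat_symbol t \<xi> *\<^sub>R (0 - (2 / 3) *\<^sub>R ?g t)
     + (- ?c * heat_symbol t \<xi>) *\<^sub>R (A0 i j \<xi> - (2 / 3) *\<^sub>R integral {0..t} ?g))) (at t)"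
    unfolding eq .
  have e1: "heat_symbol t \<xi> *\<^sub>R (0 - (2 / 3) *\<^sub>R ?g t) = - (2 / 3) *\<^sub>R N i j t \<xi>"
  proof -
    have "heat_symbol t \<xi> * heat_symbol (- t) \<xi> = 1" using heat_symbol_add[of t "- t" \<xi>] by (simp add: heat_symbol_def)
    then show ?thesis by (simp add: mult.left_commute[of "heat_symbol t \<xi>"] mult.commute)
  qed
  have e2: "(- ?c * heat_symbol t \<xi>) *\<^sub>R (A0 i j \<xi> - (2 / 3) *\<^sub>R integral {0..t} ?g) = - ?c *\<^sub>R A i j t \<xi>"
    using fun_cong[OF eq, of t] by simp
  show ?thesis
    by (rule has_vector_derivative_eq_rhs[OF der]) (unfold e1 e2, simp)
qed

end


section \<open>Smoothing\<close>

text \<open>The summand 1 keeps the weight finite and positive at the origin also for negative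
  \<open>s\<close>, and makes it submultiplicative for nonnegative \<open>s\<close>, as the
  convolution estimate requires.\<close>

definition wt :: "real \<Rightarrow> real^3 \<Rightarrow> real" where
  "wt s \<xi> = (1 + norm \<xi>) powr s"

lemma one_plus_norm_pos: "0 < 1 + norm (\<xi>::real^3)"
  by (simp add: add_pos_nonneg)

lemma wt_measurable [measurable]: "wt s \<in> borel_measurable borel"
  unfolding wt_def[abs_def] by measurable

lemma wt_pos [simp]: "0 < wt s \<xi>"
  using one_plus_norm_pos[of \<xi>] by (auto simp: wt_def)

lemma wt_nonneg [simp]: "0 \<le> wt s \<xi>"
  using wt_pos[of s \<xi>] by linarith

lemma wt_add: "wt (s + t) \<xi> = wt s \<xi> * wt t \<xi>"
  by (simp add: wt_def powr_add)

lemma wt_minus: "wt (- s) \<xi> * wt s \<xi> = 1"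
  using wt_add[of "- s" s \<xi>] one_plus_norm_pos[of \<xi>] by (simp add: wt_def)

lemma wt_submult:
  assumes "0 \<le> s" shows "wt s \<xi> \<le> wt s \<eta> * wt s (\<eta> - \<xi>)"
proof -
  have "norm \<xi> \<le> norm \<eta> + norm (\<eta> - \<xi>)"
    using norm_triangle_ineq4[of \<eta> "\<eta> - \<xi>"] by simp
  then have "1 + norm \<xi> \<le> (1 + norm \<eta>) * (1 + norm (\<eta> - \<xi>))"
  proof -
    have "(1 + norm \<eta>) * (1 + norm (\<eta> - \<xi>)) = 1 + norm \<eta> + norm (\<eta> - \<xi>) + norm \<eta> * norm (\<eta> - \<xi>)"
      by (simp add: algebra_simps)
    moreover have "0 \<le> norm \<eta> * norm (\<eta> - \<xi>)" by simp
    ultimately show ?thesis using \<open>norm \<xi> \<le> norm \<eta> + norm (\<eta> - \<xi>)\<close> by linarith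
  qed
  then have "wt s \<xi> \<le> ((1 + norm \<eta>) * (1 + norm (\<eta> - \<xi>))) powr s"
    unfolding wt_def using assms by (intro powr_mono2) auto
  then show ?thesis by (simp add: wt_def powr_mult)
qed

lemma wt_integrable: "3 < p \<Longrightarrow> integrable lborel (wt (- p))"
  unfolding wt_def[abs_def] by (rule integrable_one_plus_norm_powr)

lemma wt_square_integrable:
  assumes "3 / 2 < p" shows "square_integrable (wt (- p))"
proof -
  have "(wt (- p) \<xi>)\<^sup>2 = wt (- (2 * p)) \<xi>" for \<xi>
    using wt_add[of "- p" "- p" \<xi>] by (simp add: power2_eq_square)
  then show ?thesis
    unfolding square_integrable_def using wt_integrable[of "2 * p"] assms by simp
qed

lemma wt_gauss_bounded:
  assumes \<mu>: "0 < \<mu>" and "0 \<le> s"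
  shows "\<exists>C. \<forall>\<xi>. wt s \<xi> * exp (- \<mu> * (norm \<xi>)\<^sup>2) \<le> C"
proof -
  obtain n :: nat where n: "s \<le> real n" using real_arch_simple by blast
  obtain C where C: "\<And>x. (1 + norm x) ^ n * norm (gauss_exp \<mu> 0 0 x) \<le> C" using gauss_exp_decay[OF \<mu>] by blast
  have "wt s \<xi> * exp (- \<mu> * (norm \<xi>)\<^sup>2) \<le> C" for \<xi>
  proof -
    have "wt s \<xi> \<le> (1 + norm \<xi>) powr real n" unfolding wt_def using n by (intro powr_mono) auto
    then have "wt s \<xi> \<le> (1 + norm \<xi>) ^ n" using one_plus_norm_pos[of \<xi>] by (simp add: powr_realpow)
    then have "wt s \<xi> * exp (- \<mu> * (norm \<xi>)\<^sup>2) \<le> (1 + norm \<xi>) ^ n * exp (- \<mu> * (norm \<xi>)\<^sup>2)"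
      by (intro mult_right_mono) auto
    also have "\<dots> \<le> C" using C[of \<xi>] by (simp add: gauss_exp_eq norm_mult power2_norm_eq_inner)
    finally show ?thesis .
  qed
  then show ?thesis by blast
qed

lemma square_integrable_le:
  fixes f :: "real^3 \<Rightarrow> 'a::euclidean_space" and g :: "real^3 \<Rightarrow> 'b::euclidean_space"
  assumes g: "square_integrable g" and [measurable]: "f \<in> borel_measurable borel"
    and le: "AE x in lborel. norm (f x) \<le> norm (g x)"
  shows "square_integrable f" "L2n f \<le> L2n g"
proof -
  have le2: "AE x in lborel. (norm (f x))\<^sup>2 \<le> (norm (g x))\<^sup>2"
    using le by eventually_elim (rule power_mono, auto)
  have gi: "integrable lborel (\<lambda>x. (norm (g x))\<^sup>2)" using g by (simp add: square_integrable_def)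
  have fi: "integrable lborel (\<lambda>x. (norm (f x))\<^sup>2)"
    by (rule Bochner_Integration.integrable_bound[OF gi]) (use le2 in auto)
  then show "square_integrable f" by (simp add: square_integrable_def)
  show "L2n f \<le> L2n g"
    unfolding L2n_def by (intro real_sqrt_le_mono integral_mono_AE fi gi le2)
qed

lemma L2n_shift:
  fixes f :: "real^3 \<Rightarrow> 'a::euclidean_space"
  assumes f: "square_integrable f"
  shows "square_integrable (\<lambda>x. f (x - c))" "L2n (\<lambda>x. f (x - c)) = L2n f"
proof -
  note [measurable] = square_integrable_borel[OF f]
  have m: "(\<lambda>x. (norm (f x))\<^sup>2) \<in> borel_measurable borel" by measurable
  have e: "f (x - c) = f (- c + x)" for x by simp
  show "square_integrable (\<lambda>x. f (x - c))" "L2n (\<lambda>x. f (x - c)) = L2n f"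
    unfolding e using f integrable_translate[OF m, of "- c"] integral_translate[OF m, of "- c"]
    by (simp_all add: square_integrable_def L2n_def)
qed

context mild_flow
begin

text \<open>A bound on the Sobolev norm of order \<open>s\<close> of every entry, uniform for times
  in \<open>[a, b]\<close>.\<close>

definition weighted_bound :: "real \<Rightarrow> real \<Rightarrow> real \<Rightarrow> bool" where
  "weighted_bound s a M \<longleftrightarrow> (\<forall>t. a \<le> t \<and> t \<le> b \<longrightarrow> (\<forall>i j.
     square_integrable (\<lambda>\<xi>. wt s \<xi> *\<^sub>R A i j t \<xi>) \<and> L2n (\<lambda>\<xi>. wt s \<xi> *\<^sub>R A i j t \<xi>) \<le> M))"

lemma weighted_bound_0:
  assumes a: "0 < a" shows "weighted_bound 0 a K"
  unfolding weighted_bound_def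
proof (intro allI impI)
  fix t i j assume t: "a \<le> t \<and> t \<le> b"
  have F: "L2_fourier (entry (rep_L2 (R t)) i j) (A i j t)"
    by (rule matrix_fourierD[OF A_fourier]) (use t a in auto)
  have w: "(\<lambda>\<xi>. wt 0 \<xi> *\<^sub>R A i j t \<xi>) = A i j t"
  proof
    fix \<xi> :: "real^3"
    have "1 + norm \<xi> \<noteq> 0" using one_plus_norm_pos[of \<xi>] by linarith
    then show "wt 0 \<xi> *\<^sub>R A i j t \<xi> = A i j t \<xi>" by (simp add: wt_def)
  qed
  show "square_integrable (\<lambda>\<xi>. wt 0 \<xi> *\<^sub>R A i j t \<xi>) \<and> L2n (\<lambda>\<xi>. wt 0 \<xi> *\<^sub>R A i j t \<xi>) \<le> K"
    unfolding w plancherel[OF F] using L2_fourierD(2)[OF F] L2n_entry_le[of "R t" i j] K[of t] by auto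
qed

text \<open>Submultiplicativity distributes the weight over the two factors of the convolution, and
  Cauchy-Schwarz bounds the result at each frequency. Square-integrable control of \<open>A\<close>
  thus becomes pointwise decay of the quadratic term; the factor 3 counts the summands of the matrix
  product.\<close>

lemma square_fourier_weighted:
  assumes M: "weighted_bound s a M" and s: "0 \<le> s" and a: "0 < a" and t: "a \<le> t" "t \<le> b"
  shows "norm (square_fourier (R t) k l \<xi>) \<le> 3 * M\<^sup>2 * wt (- s) \<xi>"
proof -
  have F: "L2_fourier (\<lambda>x. of_real (rep_L2 (R t) x $ i $ j)) (A i j t)" for i j
    using matrix_fourierD[OF A_fourier, of t i j] t a by (simp add: entry_def[abs_def])
  have w: "square_integrable (\<lambda>\<xi>. wt s \<xi> *\<^sub>R A i j t \<xi>)" "L2n (\<lambda>\<xi>. wt s \<xi> *\<^sub>R A i j t \<xi>) \<le> M" for i j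
    using M t by (auto simp: weighted_bound_def)
  have 1: "wt s \<xi> * norm (fourier_integral (\<lambda>x. entry (rep_L2 (R t)) k m x * entry (rep_L2 (R t)) m l x) \<xi>) \<le> M * M" for m
  proof -
    have "norm (fourier_integral (\<lambda>x. entry (rep_L2 (R t)) k m x * entry (rep_L2 (R t)) m l x) \<xi>)
      \<le> (\<integral>\<eta>. norm (A k m t \<eta>) * norm (A m l t (\<eta> - \<xi>)) \<partial>lborel)"
      using norm_fourier_integral_mult_le[OF F F, of k m m l \<xi>] by (simp add: entry_def)
    then have "wt s \<xi> * norm (fourier_integral (\<lambda>x. entry (rep_L2 (R t)) k m x * entry (rep_L2 (R t)) m l x) \<xi>)
      \<le> (\<integral>\<eta>. wt s \<xi> * (norm (A k m t \<eta>) * norm (A m l t (\<eta> - \<xi>))) \<partial>lborel)"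
      using mult_left_mono[OF _ wt_nonneg] by simp
    also have "\<dots> \<le> (\<integral>\<eta>. norm (wt s \<eta> *\<^sub>R A k m t \<eta>) * norm (wt s (\<eta> - \<xi>) *\<^sub>R A m l t (\<eta> - \<xi>)) \<partial>lborel)"
    proof (rule integral_mono)
      show "integrable lborel (\<lambda>\<eta>. wt s \<xi> * (norm (A k m t \<eta>) * norm (A m l t (\<eta> - \<xi>))))"
        by (intro integrable_mult_right square_integrable_norm_mult L2n_shift L2_fourierD(2)[OF F])
      show "integrable lborel (\<lambda>\<eta>. norm (wt s \<eta> *\<^sub>R A k m t \<eta>) * norm (wt s (\<eta> - \<xi>) *\<^sub>R A m l t (\<eta> - \<xi>)))"
        by (intro square_integrable_norm_mult w(1) L2n_shift(1)[OF w(1)])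
      fix \<eta>
      show "wt s \<xi> * (norm (A k m t \<eta>) * norm (A m l t (\<eta> - \<xi>)))
        \<le> norm (wt s \<eta> *\<^sub>R A k m t \<eta>) * norm (wt s (\<eta> - \<xi>) *\<^sub>R A m l t (\<eta> - \<xi>))"
        using mult_right_mono[OF wt_submult[OF s, of \<xi> \<eta>], of "norm (A k m t \<eta>) * norm (A m l t (\<eta> - \<xi>))"]
        by (simp add: mult_ac)
    qed
    also have "\<dots> \<le> L2n (\<lambda>\<eta>. wt s \<eta> *\<^sub>R A k m t \<eta>) * L2n (\<lambda>\<eta>. wt s (\<eta> - \<xi>) *\<^sub>R A m l t (\<eta> - \<xi>))"
      by (intro L2n_Cauchy_Schwarz w(1) L2n_shift(1)[OF w(1)])
    also have "\<dots> \<le> M * M"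
      unfolding L2n_shift(2)[OF w(1)] using order_trans[OF L2n_nonneg w(2)] by (intro mult_mono w(2)) auto
    finally show ?thesis .
  qed
  have "wt s \<xi> * norm (square_fourier (R t) k l \<xi>)
    \<le> wt s \<xi> * (\<Sum>m\<in>UNIV. norm (fourier_integral (\<lambda>x. entry (rep_L2 (R t)) k m x * entry (rep_L2 (R t)) m l x) \<xi>))"
    unfolding square_fourier_sum by (intro mult_left_mono norm_sum) auto
  also have "\<dots> \<le> (\<Sum>m\<in>(UNIV :: 3 set). M * M)"
    unfolding sum_distrib_left by (intro sum_mono 1)
  finally have "wt s \<xi> * norm (square_fourier (R t) k l \<xi>) \<le> 3 * M\<^sup>2" by (simp add: power2_eq_square)
  from mult_left_mono[OF this, of "wt (- s) \<xi>"]
  show ?thesis by (simp add: mult.assoc[symmetric] wt_minus) (simp add: mult_ac)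
qed

lemma N_weighted:
  assumes M: "weighted_bound s a M" and s: "0 \<le> s" and a: "0 < a" and t: "a \<le> t" "t \<le> b"
  shows "norm (N i j t \<xi>) \<le> 108 * M\<^sup>2 * wt (- s) \<xi>"
proof -
  have "(\<Sum>k\<in>UNIV. \<Sum>l\<in>UNIV. norm (square_fourier (R t) k l \<xi>)) \<le> (\<Sum>k\<in>(UNIV :: 3 set). \<Sum>l\<in>(UNIV :: 3 set). 3 * M\<^sup>2 * wt (- s) \<xi>)"
    by (intro sum_mono square_fourier_weighted[OF assms])
  then show ?thesis
    using norm_st_proj_le[of \<xi> "\<lambda>k l. square_fourier (R t) k l \<xi>" i j] unfolding N_def by simp
qed

text \<open>The equation is integrated from \<open>a\<close> instead of 0, since the weighted bounds
  on the nonlinearity hold only from a positive time on.\<close>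

lemma A_restart:
  assumes "0 \<le> a" "a \<le> t"
  shows "A i j t \<xi> = heat_symbol (t - a) \<xi> *\<^sub>R A i j a \<xi>
    - (2 / 3) *\<^sub>R (heat_symbol t \<xi> *\<^sub>R integral {a..t} (\<lambda>r. heat_symbol (- r) \<xi> *\<^sub>R N i j r \<xi>))"
proof -
  let ?g = "\<lambda>r. heat_symbol (- r) \<xi> *\<^sub>R N i j r \<xi>"
  have gc: "continuous_on UNIV ?g"
    unfolding heat_symbol_def by (intro continuous_intros N_continuous)
  have I: "(LINT r:{0..s}|lborel. ?g r) = integral {0..s} ?g" for s
    using duhamel_set_integrable[of 0 s "- 1" \<xi> i j] by (intro set_borel_integral_eq_integral) simp
  have "integral {0..a} ?g + integral {a..t} ?g = integral {0..t} ?g"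
    using assms by (intro Henstock_Kurzweil_Integration.integral_combine integrable_continuous_interval continuous_on_subset[OF gc]) auto
  moreover have "heat_symbol t \<xi> = heat_symbol (t - a) \<xi> * heat_symbol a \<xi>"
    using heat_symbol_add[of "t - a" a \<xi>] by simp
  ultimately show ?thesis
    unfolding A_def I by (simp add: algebra_simps scaleR_add_right[symmetric] del: scaleR_add_right)
qed

text \<open>The left side is the integral of exp (- c (t - r)) with c = 4 pi^2 |\<xi>|^2, hence at
  most the length of the interval and at most 1/c. The first is used for |\<xi>| up to 1, the second
  beyond. In the two ranges (1 + |\<xi>|)^2 is at most 4 and at most 4 |\<xi>|^2 respectively, which
  explains the constant.\<close>

lemma heat_symbol_integral_le:
  assumes at: "0 < a" "a \<le> t" "t \<le> b"
  shows "heat_symbol t \<xi> * integral {a..t} (\<lambda>r. heat_symbol (- r) \<xi>) \<le> 4 * (b + 1) * wt (- 2) \<xi>"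
proof -
  let ?c = "4 * pi\<^sup>2 * (norm \<xi>)\<^sup>2"
  let ?J = "heat_symbol t \<xi> * integral {a..t} (\<lambda>r. heat_symbol (- r) \<xi>)"
  have hc: "continuous_on S (\<lambda>r. heat_symbol (- r) \<xi>)" for S unfolding heat_symbol_def by (intro continuous_intros)
  have w2: "wt (- 2) \<xi> = 1 / (1 + norm \<xi>)\<^sup>2"
    using one_plus_norm_pos[of \<xi>] by (simp add: wt_def powr_minus_divide powr_numeral)
  show ?thesis
  proof (cases "norm \<xi> \<le> 1")
    case True
    have "integral {a..t} (\<lambda>r. heat_symbol (- r) \<xi>) \<le> integral {a..t} (\<lambda>r. heat_symbol (- t) \<xi>)"
    proof (rule integral_le)
      fix r assume "r \<in> {a..t}"
      then show "heat_symbol (- r) \<xi> \<le> heat_symbol (- t) \<xi>"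
        unfolding heat_symbol_def by (auto intro!: mult_right_mono)
    qed (auto intro!: integrable_continuous_interval hc)
    then have "?J \<le> heat_symbol t \<xi> * ((t - a) * heat_symbol (- t) \<xi>)"
      using heat_symbol_bounds(1)[of t \<xi>] at by (intro mult_left_mono) auto
    also have "\<dots> = t - a" using heat_symbol_add[of t "- t" \<xi>] by (simp add: heat_symbol_def)
    also have "\<dots> \<le> b" using at by simp
    also have "\<dots> \<le> 4 * (b + 1) * wt (- 2) \<xi>"
    proof -
      have "(1 + norm \<xi>)\<^sup>2 \<le> 2\<^sup>2" using True by (intro power_mono) auto
      then have "1 / 4 \<le> wt (- 2) \<xi>" unfolding w2 using one_plus_norm_pos[of \<xi>]
        by (simp add: divide_simps)
      then have "4 * (b + 1) * (1 / 4) \<le> 4 * (b + 1) * wt (- 2) \<xi>" using b by (intro mult_left_mono) auto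
      moreover have "b \<le> 4 * (b + 1) * (1 / 4)" by simp
      ultimately show ?thesis by linarith
    qed
    finally show ?thesis .
  next
    case False
    then have n1: "1 < norm \<xi>" by simp
    then have "\<xi> \<noteq> 0" by auto
    then have l: "0 < ?c" by (simp add: zero_less_mult_iff)
    have "((\<lambda>r. heat_symbol (- r) \<xi>) has_integral (heat_symbol (- t) \<xi> / ?c - heat_symbol (- a) \<xi> / ?c)) {a..t}"
    proof (rule fundamental_theorem_of_calculus[OF at(2)])
      fix r assume "r \<in> {a..t}"
      have "((\<lambda>r. heat_symbol (- r) \<xi> / ?c) has_real_derivative (?c * heat_symbol (- r) \<xi> / ?c)) (at r within {a..t})"
        unfolding heat_symbol_def by (auto intro!: derivative_eq_intros)
      then show "((\<lambda>r. heat_symbol (- r) \<xi> / ?c) has_vector_derivative heat_symbol (- r) \<xi>) (at r within {a..t})"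
        using l \<open>\<xi> \<noteq> 0\<close> by (simp add: has_real_derivative_iff_has_vector_derivative)
    qed
    then have "integral {a..t} (\<lambda>r. heat_symbol (- r) \<xi>) = heat_symbol (- t) \<xi> / ?c - heat_symbol (- a) \<xi> / ?c"
      by (rule integral_unique)
    also have "\<dots> \<le> heat_symbol (- t) \<xi> / ?c" using heat_symbol_bounds(1)[of "- a" \<xi>] l by simp
    finally have "?J \<le> heat_symbol t \<xi> * (heat_symbol (- t) \<xi> / ?c)"
      using heat_symbol_bounds(1)[of t \<xi>] by (intro mult_left_mono) auto
    also have "\<dots> = 1 / ?c" using heat_symbol_add[of t "- t" \<xi>] by (simp add: heat_symbol_def)
    also have "\<dots> \<le> 1 / (norm \<xi>)\<^sup>2"
    proof -
      have "2\<^sup>2 \<le> pi\<^sup>2" using pi_ge_two by (intro power_mono) auto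
      then have "1 * (norm \<xi>)\<^sup>2 \<le> ?c" by (intro mult_right_mono) auto
      then have "(norm \<xi>)\<^sup>2 \<le> ?c" by (simp only: mult_1)
      then show ?thesis by (rule divide_left_mono) (use l \<open>\<xi> \<noteq> 0\<close> in \<open>auto simp: zero_less_mult_iff\<close>)
    qed
    also have "\<dots> \<le> 4 * wt (- 2) \<xi>"
    proof -
      have "(1 + norm \<xi>)\<^sup>2 \<le> (2 * norm \<xi>)\<^sup>2" using n1 by (intro power_mono) auto
      then show ?thesis unfolding w2 using n1 by (simp add: divide_simps power_mult_distrib)
    qed
    also have "\<dots> \<le> 4 * (b + 1) * wt (- 2) \<xi>" using b by (intro mult_right_mono) auto
    finally show ?thesis .
  qed
qed

text \<open>Restarting at \<open>a / 2\<close> leaves the linear part at least the time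
  \<open>a / 2\<close> to smooth, which gives the exponent \<open>2 * pi\<^sup>2 * a\<close>. In the
  nonlinear part the decay \<open>s\<close> of \<open>N\<close> gains 2 from the time integral, and
  288 is (2/3) * 108 * 4.\<close>

lemma majorant:
  assumes M: "weighted_bound s (a / 2) M" and s: "0 \<le> s" and a: "0 < a"
    and t: "a \<le> t" "t \<le> b"
  shows "norm (A i j t \<xi>) \<le> exp (- (2 * pi\<^sup>2 * a) * (norm \<xi>)\<^sup>2) * norm (A i j (a / 2) \<xi>)
    + 288 * M\<^sup>2 * (b + 1) * wt (- (s + 2)) \<xi>"
proof -
  let ?h = "\<lambda>r. heat_symbol (- r) \<xi>"
  let ?c = "108 * M\<^sup>2 * wt (- s) \<xi>"
  have c0: "0 \<le> ?c" by simp
  have hc: "continuous_on S (\<lambda>r. heat_symbol (- r) \<xi>)" for S unfolding heat_symbol_def by (intro continuous_intros)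
  have "norm (integral {a/2..t} (\<lambda>r. ?h r *\<^sub>R N i j r \<xi>)) \<le> integral {a/2..t} (\<lambda>r. ?c * ?h r)"
  proof (rule Henstock_Kurzweil_Integration.integral_norm_bound_integral)
    show "(\<lambda>r. ?h r *\<^sub>R N i j r \<xi>) integrable_on {a/2..t}"
      by (intro integrable_continuous_interval continuous_on_scaleR hc continuous_on_subset[OF N_continuous]) auto
    show "(\<lambda>r. ?c * ?h r) integrable_on {a/2..t}"
      by (intro integrable_continuous_interval continuous_on_mult continuous_on_const hc)
    fix r assume "r \<in> {a/2..t}"
    then have "norm (N i j r \<xi>) \<le> ?c" using a t by (intro N_weighted[OF M s]) auto
    from mult_left_mono[OF this, of "?h r"] show "norm (?h r *\<^sub>R N i j r \<xi>) \<le> ?c * ?h r"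
      using heat_symbol_bounds(1)[of "- r" \<xi>] by (simp add: mult.commute)
  qed
  also have "\<dots> = ?c * integral {a/2..t} ?h" by simp
  finally have "heat_symbol t \<xi> * norm (integral {a/2..t} (\<lambda>r. ?h r *\<^sub>R N i j r \<xi>))
    \<le> heat_symbol t \<xi> * (?c * integral {a/2..t} ?h)"
    using heat_symbol_bounds(1)[of t \<xi>] by (intro mult_left_mono) auto
  also have "\<dots> = ?c * (heat_symbol t \<xi> * integral {a/2..t} ?h)" by (rule mult.left_commute)
  also have "\<dots> \<le> ?c * (4 * (b + 1) * wt (- 2) \<xi>)"
    using a t by (intro mult_left_mono[OF heat_symbol_integral_le c0]) auto
  also have "\<dots> = 432 * M\<^sup>2 * (b + 1) * wt (- (s + 2)) \<xi>"
    using wt_add[of "- s" "- 2" \<xi>] by simp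
  finally have 1: "heat_symbol t \<xi> * norm (integral {a/2..t} (\<lambda>r. ?h r *\<^sub>R N i j r \<xi>)) \<le> 432 * M\<^sup>2 * (b + 1) * wt (- (s + 2)) \<xi>" .
  have 2: "heat_symbol (t - a/2) \<xi> \<le> exp (- (2 * pi\<^sup>2 * a) * (norm \<xi>)\<^sup>2)"
  proof -
    have "2 * pi\<^sup>2 * a \<le> 4 * pi\<^sup>2 * (t - a/2)" using t by simp
    then have "2 * pi\<^sup>2 * a * (norm \<xi>)\<^sup>2 \<le> 4 * pi\<^sup>2 * (t - a/2) * (norm \<xi>)\<^sup>2" by (intro mult_right_mono) auto
    then show ?thesis by (simp add: heat_symbol_def)
  qed
  have "norm (A i j t \<xi>) \<le> heat_symbol (t - a/2) \<xi> * norm (A i j (a/2) \<xi>)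
    + (2/3) * (heat_symbol t \<xi> * norm (integral {a/2..t} (\<lambda>r. ?h r *\<^sub>R N i j r \<xi>)))"
    using a t heat_symbol_bounds(1)[of t \<xi>] heat_symbol_bounds(1)[of "t - a/2" \<xi>]
    by (subst A_restart[of "a/2"]) (auto intro: order_trans[OF norm_triangle_ineq4])
  also have "\<dots> \<le> exp (- (2 * pi\<^sup>2 * a) * (norm \<xi>)\<^sup>2) * norm (A i j (a/2) \<xi>) + (2/3) * (432 * M\<^sup>2 * (b + 1) * wt (- (s + 2)) \<xi>)"
    by (intro add_mono mult_right_mono mult_left_mono 1 2) auto
  also have "(2/3) * (432 * M\<^sup>2 * (b + 1) * wt (- (s + 2)) \<xi>) = 288 * M\<^sup>2 * (b + 1) * wt (- (s + 2)) \<xi>" by simp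
  finally show ?thesis .
qed

lemma square_integrable_A: "0 < t \<Longrightarrow> t \<le> b \<Longrightarrow> square_integrable (A i j t)"
  using L2_fourierD(2)[OF matrix_fourierD[OF A_fourier]] by blast

text \<open>Any gain below \<open>1/2\<close> would do: the majorant decays by \<open>|\<xi>|\<^sup>-\<^sup>2\<close> more than the nonlinearity, and
  \<open>|\<xi>| powr (- p)\<close> is square integrable at infinity for \<open>p > 3/2\<close>.\<close>

lemma weighted_bound_step:
  assumes M: "weighted_bound s (a / 2) M" and s: "0 \<le> s" and a: "0 < a" "a \<le> b"
  shows "\<exists>M'. weighted_bound (s + 2/5) a M'"
proof -
  let ?m = "2 * pi\<^sup>2 * a"
  have "0 < ?m" using a by simp
  then obtain C where C: "\<And>\<xi>. wt (s + 2/5) \<xi> * exp (- ?m * (norm \<xi>)\<^sup>2) \<le> C"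
    using wt_gauss_bounded[of ?m "s + 2/5"] s by auto
  have C0: "0 \<le> C" using order_trans[OF _ C[of 0]] by simp
  define c where "c = 288 * M\<^sup>2 * (b + 1)"
  have c0: "0 \<le> c" using b by (simp add: c_def)
  \<comment> \<open>The exponent 8/5 is (s + 2) - (s + 2/5); it exceeds 3/2, so this weight is
    square integrable.\<close>
  define H where "H i j \<xi> = C * norm (A i j (a/2) \<xi>) + c * wt (- (8/5)) \<xi>" for i j \<xi>
  have H: "square_integrable (H i j)" for i j
  proof -
    have "square_integrable (\<lambda>\<xi>. C *\<^sub>R norm (A i j (a/2) \<xi>) + c *\<^sub>R wt (- (8/5)) \<xi>)"
      using a square_integrable_A[of "a/2" i j]
      by (intro square_integrable_add square_integrable_scaleR wt_square_integrable)
         (auto simp: square_integrable_def)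
    then show ?thesis by (simp add: H_def[abs_def])
  qed
  have le: "norm (wt (s + 2/5) \<xi> *\<^sub>R A i j t \<xi>) \<le> norm (H i j \<xi>)" if t: "a \<le> t" "t \<le> b" for t i j \<xi>
  proof -
    have "norm (wt (s + 2/5) \<xi> *\<^sub>R A i j t \<xi>) = wt (s + 2/5) \<xi> * norm (A i j t \<xi>)" by simp
    also have "\<dots> \<le> wt (s + 2/5) \<xi> * (exp (- ?m * (norm \<xi>)\<^sup>2) * norm (A i j (a / 2) \<xi>) + c * wt (- (s + 2)) \<xi>)"
      unfolding c_def by (intro mult_left_mono majorant[OF M s a(1) t] wt_nonneg)
    also have "\<dots> = (wt (s + 2/5) \<xi> * exp (- ?m * (norm \<xi>)\<^sup>2)) * norm (A i j (a / 2) \<xi>) + c * (wt (s + 2/5) \<xi> * wt (- (s + 2)) \<xi>)"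
      by (simp add: algebra_simps)
    also have "wt (s + 2/5) \<xi> * wt (- (s + 2)) \<xi> = wt (- (8/5)) \<xi>"
      unfolding wt_add[symmetric] by simp
    also have "(wt (s + 2/5) \<xi> * exp (- ?m * (norm \<xi>)\<^sup>2)) * norm (A i j (a / 2) \<xi>) \<le> C * norm (A i j (a/2) \<xi>)"
      by (intro mult_right_mono C) simp
    finally show ?thesis using C0 c0 by (simp add: H_def)
  qed
  define M' where "M' = (\<Sum>i\<in>UNIV. \<Sum>j\<in>UNIV. L2n (H i j))"
  have HM: "L2n (H i j) \<le> M'" for i j
  proof -
    have "L2n (H i j) \<le> (\<Sum>j\<in>UNIV. L2n (H i j))" by (rule member_le_sum) auto
    also have "\<dots> \<le> M'" unfolding M'_def
      by (rule member_le_sum[of i UNIV "\<lambda>i. \<Sum>j\<in>UNIV. L2n (H i j)"]) (auto intro: sum_nonneg)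
    finally show ?thesis .
  qed
  have "weighted_bound (s + 2/5) a M'"
    unfolding weighted_bound_def
  proof (intro allI impI)
    fix t i j assume t: "a \<le> t \<and> t \<le> b"
    have "AE \<xi> in lborel. norm (wt (s + 2/5) \<xi> *\<^sub>R A i j t \<xi>) \<le> norm (H i j \<xi>)"
      using t by (intro AE_I2 le) auto
    from square_integrable_le[OF H _ this] HM[of i j]
    show "square_integrable (\<lambda>\<xi>. wt (s + 2/5) \<xi> *\<^sub>R A i j t \<xi>) \<and> L2n (\<lambda>\<xi>. wt (s + 2/5) \<xi> *\<^sub>R A i j t \<xi>) \<le> M'"
      by auto
  qed
  then show ?thesis by blast
qed

text \<open>A round that ends at \<open>a\<close> takes its input from \<open>a / 2\<close>, so the
  intermediate bounds are claimed for every starting time.\<close>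

lemma weighted_bound_6_5:
  assumes "0 < a" "a \<le> b" shows "\<exists>M. weighted_bound (6/5) a M"
proof -
  have 2: "\<exists>M. weighted_bound (2/5) a M" if "0 < a" "a \<le> b" for a
    using weighted_bound_step[OF weighted_bound_0, of a] that by simp
  have 4: "\<exists>M. weighted_bound (4/5) a M" if a: "0 < a" "a \<le> b" for a
  proof -
    obtain M where "weighted_bound (2/5) (a/2) M" using 2[of "a/2"] a by auto
    from weighted_bound_step[OF this _ a] show ?thesis by simp
  qed
  obtain M where "weighted_bound (4/5) (a/2) M" using 4[of "a/2"] assms by auto
  from weighted_bound_step[OF this _ assms] show ?thesis by simp
qed

text \<open>From weight 6/5 the nonlinear part decays like the power -16/5, integrable since 16/5 >
  3; multiplied by \<open>norm \<xi>\<close> it decays like -11/5, square integrable since 11/5 >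
  3/2. The Gaussian handles the linear part in both cases.\<close>

lemma uniform_majorant:
  assumes a: "0 < a" "a \<le> b"
  obtains h where "integrable lborel h" "square_integrable (\<lambda>\<xi>. norm \<xi> * h \<xi>)"
    "\<And>t i j \<xi>. a \<le> t \<Longrightarrow> t \<le> b \<Longrightarrow> norm (A i j t \<xi>) \<le> h \<xi>"
proof -
  obtain M where M: "weighted_bound (6/5) (a/2) M" using weighted_bound_6_5[of "a/2"] a by auto
  let ?m = "2 * pi\<^sup>2 * a"
  have \<mu>: "0 < ?m" using a by simp
  define c where "c = 288 * M\<^sup>2 * (b + 1)"
  have c0: "0 \<le> c" using b by (simp add: c_def)
  define g where "g \<xi> = (\<Sum>i\<in>UNIV. \<Sum>j\<in>UNIV. norm (A i j (a/2) \<xi>))" for \<xi>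
  define e where "e \<xi> = exp (- ?m * (norm \<xi>)\<^sup>2)" for \<xi> :: "real^3"
  define h where "h \<xi> = e \<xi> * g \<xi> + c * wt (- (16/5)) \<xi>" for \<xi>
  have g0: "0 \<le> g \<xi>" for \<xi> unfolding g_def by (intro sum_nonneg) auto
  have As: "square_integrable (\<lambda>\<xi>. norm (A i j (a/2) \<xi>))" for i j
    using square_integrable_A[of "a/2" i j] a by (auto simp: square_integrable_def)
  have gs: "square_integrable g"
  proof -
    have "square_integrable (\<lambda>\<xi>. \<Sum>i\<in>I. f i \<xi>)" if "finite I" "\<And>i. square_integrable (f i)"
      for I :: "3 set" and f :: "3 \<Rightarrow> real^3 \<Rightarrow> real"
      using that by (induction I) (auto intro: square_integrable_zero square_integrable_add)
    then show ?thesis unfolding g_def[abs_def] by (simp add: As)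
  qed
  note [measurable] = square_integrable_borel[OF gs]
  have es: "square_integrable e"
    unfolding e_def[abs_def] using exp_norm_integrable[OF \<mu>, of "0::real^3"] \<mu>
    by (intro square_integrable_bounded[where B=1]) auto
  note [measurable] = square_integrable_borel[OF es]
  have "integrable lborel (\<lambda>\<xi>. e \<xi> * g \<xi>)"
    using square_integrable_norm_mult[OF es gs] g0 by (simp add: e_def)
  then have h1: "integrable lborel h"
    unfolding h_def[abs_def] by (intro Bochner_Integration.integrable_add integrable_mult_right wt_integrable) simp_all
  obtain C where C: "\<And>\<xi>. wt 1 \<xi> * e \<xi> \<le> C"
    using wt_gauss_bounded[OF \<mu>, of 1] by (auto simp: e_def)
  have C0: "0 \<le> C" using order_trans[OF _ C[of 0]] by (simp add: e_def)
  have "square_integrable (\<lambda>\<xi>. C *\<^sub>R g \<xi> + c *\<^sub>R wt (- (11/5)) \<xi>)"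
    by (intro square_integrable_add square_integrable_scaleR gs wt_square_integrable) simp
  then have h2: "square_integrable (\<lambda>\<xi>. norm \<xi> * h \<xi>)"
  proof (rule square_integrable_le(1))
    show "(\<lambda>\<xi>. norm \<xi> * h \<xi>) \<in> borel_measurable borel" unfolding h_def by measurable
    show "AE \<xi> in lborel. norm (norm \<xi> * h \<xi>) \<le> norm (C *\<^sub>R g \<xi> + c *\<^sub>R wt (- (11/5)) \<xi>)"
    proof (rule AE_I2)
      fix \<xi> :: "real^3"
      have h0: "0 \<le> h \<xi>" using g0 c0 by (simp add: h_def e_def)
      have "norm \<xi> \<le> wt 1 \<xi>" using one_plus_norm_pos[of \<xi>] by (simp add: wt_def)
      then have "norm \<xi> * h \<xi> \<le> wt 1 \<xi> * h \<xi>" using h0 by (rule mult_right_mono)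
      also have "\<dots> = (wt 1 \<xi> * e \<xi>) * g \<xi> + c * (wt 1 \<xi> * wt (- (16/5)) \<xi>)"
        by (simp add: h_def algebra_simps)
      also have "wt 1 \<xi> * wt (- (16/5)) \<xi> = wt (- (11/5)) \<xi>" unfolding wt_add[symmetric] by simp
      also have "(wt 1 \<xi> * e \<xi>) * g \<xi> \<le> C * g \<xi>" by (intro mult_right_mono C g0)
      finally show "norm (norm \<xi> * h \<xi>) \<le> norm (C *\<^sub>R g \<xi> + c *\<^sub>R wt (- (11/5)) \<xi>)"
        using h0 by simp
    qed
  qed
  have "norm (A i j t \<xi>) \<le> h \<xi>" if t: "a \<le> t" "t \<le> b" for t i j \<xi>
  proof -
    have "norm (A i j (a/2) \<xi>) \<le> (\<Sum>j\<in>UNIV. norm (A i j (a/2) \<xi>))" by (rule member_le_sum) auto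
    also have "\<dots> \<le> g \<xi>" unfolding g_def
      by (rule member_le_sum[of i UNIV "\<lambda>i. \<Sum>j\<in>UNIV. norm (A i j (a/2) \<xi>)"]) (auto intro: sum_nonneg)
    finally have eg: "e \<xi> * norm (A i j (a/2) \<xi>) \<le> e \<xi> * g \<xi>" by (intro mult_left_mono) (auto simp: e_def)
    have "norm (A i j t \<xi>) \<le> e \<xi> * norm (A i j (a/2) \<xi>) + c * wt (- (6/5 + 2)) \<xi>"
      unfolding e_def c_def by (rule majorant[OF M _ a(1) t]) simp
    also have "wt (- (6/5 + 2)) \<xi> = wt (- (16/5)) \<xi>" by simp
    finally show ?thesis unfolding h_def using add_right_mono[OF eg] by (rule order_trans)
  qed
  with h1 h2 show ?thesis by (rule that)
qed

end


section \<open>The energy identity\<close>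

text \<open>Matches the sum over \<open>Basis\<close> in \<open>Hdot_norm\<close> with sums over
  matrix entries.\<close>

lemma sum_Basis_matrix:
  "(\<Sum>b\<in>(Basis :: (real^3^3) set). f b) = (\<Sum>i\<in>UNIV. \<Sum>j\<in>UNIV. f (axis i (axis j 1)))"
proof -
  have "(\<Sum>b\<in>(Basis :: (real^3^3) set). f b) = (\<Sum>(i, j)\<in>UNIV \<times> UNIV. f (axis i (axis j 1)))"
  proof (rule sum.reindex_bij_betw[symmetric, of "\<lambda>(i, j). axis i (axis j 1)" "UNIV \<times> UNIV" Basis f, simplified case_prod_beta', THEN trans])
    show "bij_betw (\<lambda>p. axis (fst p) (axis (snd p) 1)) (UNIV \<times> UNIV) (Basis :: (real^3^3) set)"
      by (auto simp: bij_betw_def inj_on_def axis_eq_axis Basis_vec_def image_iff)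
  qed (simp add: case_prod_beta')
  then show ?thesis by (simp add: sum.cartesian_product)
qed

lemma
  fixes f :: "real^3 \<Rightarrow> real^3^3"
  assumes A: "\<And>i j. L2_fourier (entry f i j) (A i j)"
    and w: "\<And>i j. square_integrable (\<lambda>\<xi>. norm \<xi> *\<^sub>R A i j \<xi>)"
  shows Hdot_entryI: "f \<in> Hdot 1"
    and Hdot_norm_entry: "(Hdot_norm 1 f)\<^sup>2 = (\<Sum>i\<in>UNIV. \<Sum>j\<in>UNIV. \<integral>\<xi>. 4 * pi\<^sup>2 * (norm \<xi>)\<^sup>2 * (norm (A i j \<xi>))\<^sup>2 \<partial>lborel)"
proof -
  have c: "component (axis i (axis j 1)) f = entry f i j" for i j
    by (simp add: fun_eq_iff component_def entry_def inner_axis)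
  have h: "has_fourier_transform (entry f i j) (A i j)" for i j
    by (rule L2_fourier_has_fourier_transform[OF A])
  note [measurable] = has_fourier_transformD(2)[OF h] has_fourier_transformD(2)[OF has_fourier_transform_fourier[OF h]]
  have ae: "AE \<xi> in lborel. ((2 * pi * norm \<xi>) powr 1 * norm (fourier (entry f i j) \<xi>))\<^sup>2
      = 4 * pi\<^sup>2 * (norm \<xi>)\<^sup>2 * (norm (A i j \<xi>))\<^sup>2" for i j
    using fourier_AE_eq[OF h, of i j] by eventually_elim (simp add: power_mult_distrib)
  have wi: "integrable lborel (\<lambda>\<xi>. 4 * pi\<^sup>2 * (norm \<xi>)\<^sup>2 * (norm (A i j \<xi>))\<^sup>2)" for i j
  proof -
    have "integrable lborel (\<lambda>\<xi>. 4 * pi\<^sup>2 * (norm (norm \<xi> *\<^sub>R A i j \<xi>))\<^sup>2)"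
      using w[of i j] by (intro integrable_mult_right) (simp add: square_integrable_def)
    then show ?thesis by (simp add: power_mult_distrib mult.assoc)
  qed
  have i: "integrable lborel (\<lambda>\<xi>. ((2 * pi * norm \<xi>) powr 1 * norm (fourier (entry f i j) \<xi>))\<^sup>2)" for i j
    by (subst integrable_cong_AE[OF _ _ ae]) (use wi in auto)
  show "f \<in> Hdot 1"
    unfolding Hdot_def
  proof (intro CollectI ballI)
    fix b :: "real^3^3" assume "b \<in> Basis"
    then obtain i j where b: "b = axis i (axis j 1)" by (auto simp: Basis_vec_def)
    show "(\<exists>g. has_fourier_transform (component b f) g) \<and>
      integrable lborel (\<lambda>\<xi>. ((2 * pi * norm \<xi>) powr 1 * norm (fourier (component b f) \<xi>))\<^sup>2)"
      unfolding b c using h[of i j] i[of i j] by blast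
  qed
  have "(Hdot_norm 1 f)\<^sup>2 = (\<Sum>b\<in>Basis. \<integral>\<xi>. ((2 * pi * norm \<xi>) powr 1 * norm (fourier (component b f) \<xi>))\<^sup>2 \<partial>lborel)"
    unfolding Hdot_norm_def by (intro real_sqrt_pow2 sum_nonneg) simp
  also have "\<dots> = (\<Sum>i\<in>UNIV. \<Sum>j\<in>UNIV. \<integral>\<xi>. ((2 * pi * norm \<xi>) powr 1 * norm (fourier (entry f i j) \<xi>))\<^sup>2 \<partial>lborel)"
    unfolding sum_Basis_matrix c ..
  also have "\<dots> = (\<Sum>i\<in>UNIV. \<Sum>j\<in>UNIV. \<integral>\<xi>. 4 * pi\<^sup>2 * (norm \<xi>)\<^sup>2 * (norm (A i j \<xi>))\<^sup>2 \<partial>lborel)"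
    by (intro sum.cong refl integral_cong_AE ae) measurable
  finally show "(Hdot_norm 1 f)\<^sup>2 = (\<Sum>i\<in>UNIV. \<Sum>j\<in>UNIV. \<integral>\<xi>. 4 * pi\<^sup>2 * (norm \<xi>)\<^sup>2 * (norm (A i j \<xi>))\<^sup>2 \<partial>lborel)" .
qed

lemma rep_L2_nth_measurable [measurable]:
  fixes F :: "(real^3^3) L2" shows "(\<lambda>x. rep_L2 F x $ i $ j) \<in> borel_measurable borel"
proof -
  have "(\<lambda>x. Re (entry (rep_L2 F) i j x)) \<in> borel_measurable borel" by measurable
  then show ?thesis by (simp add: entry_def)
qed

lemma trace_cube_measurable [measurable]:
  fixes F :: "(real^3^3) L2"
  shows "(\<lambda>x. trace (rep_L2 F x ** rep_L2 F x ** rep_L2 F x)) \<in> borel_measurable borel"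
  unfolding trace_def matrix_matrix_mult_def vec_lambda_beta by measurable

lemma det_measurable [measurable]:
  fixes F :: "(real^3^3) L2" shows "(\<lambda>x. det (rep_L2 F x)) \<in> borel_measurable borel"
  unfolding det_3 by measurable

lemma trace_cube_symmetric:
  fixes M :: "real^3^3"
  assumes "\<And>i j. M $ i $ j = M $ j $ i"
  shows "trace (M ** M ** M) = (\<Sum>i\<in>UNIV. \<Sum>j\<in>UNIV. M $ i $ j * (M ** M) $ i $ j)"
proof -
  have "trace (M ** M ** M) = (\<Sum>i\<in>UNIV. \<Sum>j\<in>UNIV. (M ** M) $ i $ j * M $ j $ i)"
    unfolding trace_def by (subst (2) matrix_matrix_mult_def) simp
  also have "\<dots> = (\<Sum>i\<in>UNIV. \<Sum>j\<in>UNIV. M $ i $ j * (M ** M) $ i $ j)"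
    by (intro sum.cong refl) (subst assms, rule mult.commute)
  finally show ?thesis .
qed

lemma trace_cube_eq_det:
  fixes M :: "real^3^3"
  assumes "(\<Sum>i\<in>UNIV. M $ i $ i) = 0"
  shows "trace (M ** M ** M) = 3 * det M"
proof -
  \<comment> \<open>Eliminating one diagonal entry leaves a polynomial identity in the other
    eight.\<close>
  have "M $ 1 $ 1 + M $ 2 $ 2 + M $ 3 $ 3 = 0" using assms by (simp add: sum_3)
  then have "M $ 3 $ 3 = - M $ 1 $ 1 - M $ 2 $ 2" by simp
  then show ?thesis
    unfolding trace_def matrix_matrix_mult_def vec_lambda_beta det_3 sum_3 by algebra
qed

context mild_flow
begin

lemma sum_sum_const: "(\<Sum>i\<in>(UNIV :: 3 set). \<Sum>j\<in>(UNIV :: 3 set). c :: real) = 9 * c"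
  by simp

text \<open>The coefficients are those of 2 A \<bullet> A': twice the heat term, and 2 * (2/3) = 4/3
  for the nonlinear one.\<close>

lemma energy_derivative:
  assumes t0: "0 < t0" "t0 < b"
  shows "((\<lambda>t. (norm (R t))\<^sup>2) has_vector_derivative
    (\<integral>\<xi>. (\<Sum>i\<in>UNIV. \<Sum>j\<in>UNIV. - 2 * (4 * pi\<^sup>2 * (norm \<xi>)\<^sup>2 * (norm (A i j t0 \<xi>))\<^sup>2) - 4 / 3 * (A i j t0 \<xi> \<bullet> N i j t0 \<xi>)) \<partial>lborel)) (at t0)"
proof -
  define e where "e t \<xi> = (\<Sum>i\<in>UNIV. \<Sum>j\<in>UNIV. (norm (A i j t \<xi>))\<^sup>2)" for t \<xi>
  define e' where "e' t \<xi> = (\<Sum>i\<in>UNIV. \<Sum>j\<in>UNIV. - 2 * (4 * pi\<^sup>2 * (norm \<xi>)\<^sup>2 * (norm (A i j t \<xi>))\<^sup>2) - 4 / 3 * (A i j t \<xi> \<bullet> N i j t \<xi>))" for t \<xi>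
  \<comment> \<open>The domination has to be uniform near \<open>t0\<close>; starting the time
    interval at \<open>t0 / 2\<close> keeps it away from time 0, where there is no majorant.\<close>
  have a: "0 < t0 / 2" "t0 / 2 \<le> b" using t0 by auto
  obtain h where h1: "integrable lborel h" and h2: "square_integrable (\<lambda>\<xi>. norm \<xi> * h \<xi>)"
    and hA: "\<And>t i j \<xi>. t0 / 2 \<le> t \<Longrightarrow> t \<le> b \<Longrightarrow> norm (A i j t \<xi>) \<le> h \<xi>"
    using uniform_majorant[OF a] by blast
  \<comment> \<open>One summand for each of the nine entries. The dissipation is controlled by the
    square integrability of \<open>norm \<xi> * h \<xi>\<close>, the nonlinear term by the
    integrability of \<open>h\<close> and the bound \<open>CN\<close>.\<close>
  define w where "w \<xi> = 9 * (2 * 4 * pi\<^sup>2 * (norm \<xi> * h \<xi>)\<^sup>2 + 4 / 3 * (CN * h \<xi>))" for \<xi>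
  have Ai: "integrable lborel (\<lambda>\<xi>. (norm (A i j t \<xi>))\<^sup>2)" if "0 < t" "t \<le> b" for i j t
    using square_integrable_A[OF that, of i j] by (simp add: square_integrable_def)
  have norm_eq: "(norm (R t))\<^sup>2 = (\<integral>\<xi>. e t \<xi> \<partial>lborel)" if t: "0 < t" "t \<le> b" for t
    unfolding norm_matrix_fourier[OF A_fourier[OF t]] e_def using Ai[OF t]
    by (simp add: Bochner_Integration.integral_sum Bochner_Integration.integrable_sum)
  have N_measurable[measurable]: "N i j t \<in> borel_measurable borel" for i j t
    using measurable_compose[OF _ N_joint_measurable, of "\<lambda>\<xi>. (t, \<xi>)" borel i j] by simp
  have "((\<lambda>t. \<integral>\<xi>. e t \<xi> \<partial>lborel) has_vector_derivative (\<integral>\<xi>. e' t0 \<xi> \<partial>lborel)) (at t0)"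
  proof (rule has_vector_derivative_lborel_integral[where a="t0 / 2" and b=b and w=w])
    fix t \<xi> assume t: "t0 / 2 < t" "t < b"
    have tp: "0 < t" using t t0 by simp
    let ?A' = "\<lambda>i j. - (4 * pi\<^sup>2 * (norm \<xi>)\<^sup>2) *\<^sub>R A i j t \<xi> - (2 / 3) *\<^sub>R N i j t \<xi>"
    have "((\<lambda>s. A i j s \<xi> \<bullet> A i j s \<xi>) has_vector_derivative (A i j t \<xi> \<bullet> ?A' i j + ?A' i j \<bullet> A i j t \<xi>)) (at t)" for i j
      by (rule bounded_bilinear.has_vector_derivative[OF bounded_bilinear_inner A_derivative[OF tp] A_derivative[OF tp]])
    moreover have "A i j t \<xi> \<bullet> ?A' i j + ?A' i j \<bullet> A i j t \<xi>
      = - 2 * (4 * pi\<^sup>2 * (norm \<xi>)\<^sup>2 * (norm (A i j t \<xi>))\<^sup>2) - 4 / 3 * (A i j t \<xi> \<bullet> N i j t \<xi>)" for i j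
      unfolding power2_norm_eq_inner[of "A i j t \<xi>"]
      by (simp add: inner_diff_left inner_diff_right inner_commute[of "N i j t \<xi>"])
    ultimately show "((\<lambda>s. e s \<xi>) has_vector_derivative e' t \<xi>) (at t)"
      unfolding e_def e'_def power2_norm_eq_inner[of "A _ _ _ \<xi>"] by (intro has_vector_derivative_sum) simp
    have Ah: "norm (A i j t \<xi>) \<le> h \<xi>" for i j using t by (intro hA) auto
    have h0: "0 \<le> h \<xi>" using order_trans[OF norm_ge_zero Ah] .
    have "norm (e' t \<xi>) \<le> (\<Sum>i\<in>(UNIV :: 3 set). \<Sum>j\<in>(UNIV :: 3 set). 2 * 4 * pi\<^sup>2 * (norm \<xi> * h \<xi>)\<^sup>2 + 4 / 3 * (CN * h \<xi>))"
      unfolding e'_def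
    proof (intro sum_norm_le)
      fix i j
      have "norm (- 2 * (4 * pi\<^sup>2 * (norm \<xi>)\<^sup>2 * (norm (A i j t \<xi>))\<^sup>2) - 4 / 3 * (A i j t \<xi> \<bullet> N i j t \<xi>))
        \<le> 2 * 4 * pi\<^sup>2 * (norm \<xi> * norm (A i j t \<xi>))\<^sup>2 + 4 / 3 * \<bar>A i j t \<xi> \<bullet> N i j t \<xi>\<bar>"
        using abs_triangle_ineq4[of "- 2 * (4 * pi\<^sup>2 * (norm \<xi>)\<^sup>2 * (norm (A i j t \<xi>))\<^sup>2)" "4 / 3 * (A i j t \<xi> \<bullet> N i j t \<xi>)"]
        by (simp add: abs_mult power_mult_distrib)
      also have "\<dots> \<le> 2 * 4 * pi\<^sup>2 * (norm \<xi> * h \<xi>)\<^sup>2 + 4 / 3 * (CN * h \<xi>)"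
      proof (intro add_mono mult_left_mono power_mono Ah)
        have "\<bar>A i j t \<xi> \<bullet> N i j t \<xi>\<bar> \<le> norm (A i j t \<xi>) * norm (N i j t \<xi>)" by (rule Cauchy_Schwarz_ineq2)
        also have "\<dots> \<le> h \<xi> * CN" by (intro mult_mono Ah N_bound h0) simp
        finally show "\<bar>A i j t \<xi> \<bullet> N i j t \<xi>\<bar> \<le> CN * h \<xi>" by (simp add: mult.commute)
      qed auto
      finally show "norm (- 2 * (4 * pi\<^sup>2 * (norm \<xi>)\<^sup>2 * (norm (A i j t \<xi>))\<^sup>2) - 4 / 3 * (A i j t \<xi> \<bullet> N i j t \<xi>))
        \<le> 2 * 4 * pi\<^sup>2 * (norm \<xi> * h \<xi>)\<^sup>2 + 4 / 3 * (CN * h \<xi>)" .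
    qed
    then show "norm (e' t \<xi>) \<le> w \<xi>" unfolding w_def sum_sum_const .
  next
    fix t assume t: "t0 / 2 < t" "t < b"
    show "integrable lborel (e t)"
      unfolding e_def[abs_def] using t t0 by (intro Bochner_Integration.integrable_sum Ai) auto
  next
    show "integrable lborel w"
      unfolding w_def[abs_def] using h1 h2
      by (intro integrable_mult_right Bochner_Integration.integrable_add) (auto simp: square_integrable_def)
    show "e' t0 \<in> borel_measurable lborel" unfolding e'_def[abs_def] by measurable
  qed (use t0 in auto)
  then show ?thesis
    unfolding e'_def
  proof (rule has_vector_derivative_transform_within_open[of _ _ _ "{0<..<b}"])
    show "(\<integral>\<xi>. e t \<xi> \<partial>lborel) = (norm (R t))\<^sup>2" if "t \<in> {0<..<b}" for t
      using norm_eq[of t] that by simp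
  qed (use t0 in auto)
qed

text \<open>The integrable majorant bounds the field through the inversion integral. Boundedness
  puts the squared field into L2, as Parseval requires, and makes the cube integrable.\<close>

lemma R_bounded:
  assumes t: "0 < t" "t \<le> b"
  shows "\<exists>B. AE x in lborel. \<forall>i j. norm (entry (rep_L2 (R t)) i j x) \<le> B"
proof -
  obtain h where h1: "integrable lborel h" and "square_integrable (\<lambda>\<xi>. norm \<xi> * h \<xi>)"
    and hA: "\<And>s i j \<xi>. t \<le> s \<Longrightarrow> s \<le> b \<Longrightarrow> norm (A i j s \<xi>) \<le> h \<xi>"
    using uniform_majorant[OF t] by blast
  have hA': "norm (A i j t \<xi>) \<le> h \<xi>" for i j \<xi> using t by (intro hA) auto
  have Ai: "integrable lborel (A i j t)" for i j
    by (rule Bochner_Integration.integrable_bound[OF h1])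
       (auto intro!: AE_I2 order_trans[OF hA' abs_ge_self])
  have "AE x in lborel. norm (entry (rep_L2 (R t)) i j x) \<le> integral\<^sup>L lborel h" for i j
    using L2_fourier_inversion_L1[OF matrix_fourierD[OF A_fourier[OF t], of i j] Ai]
  proof eventually_elim
    case (elim x)
    have "norm (entry (rep_L2 (R t)) i j x) \<le> (\<integral>\<xi>. norm (A i j t \<xi>) \<partial>lborel)"
      unfolding elim by (rule norm_fourier_integral_le)
    also have "\<dots> \<le> integral\<^sup>L lborel h" by (intro integral_mono integrable_norm Ai h1 hA')
    finally show ?case .
  qed
  then have "AE x in lborel. \<forall>i\<in>UNIV. \<forall>j\<in>UNIV. norm (entry (rep_L2 (R t)) i j x) \<le> integral\<^sup>L lborel h"
    by (intro AE_finite_allI) auto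
  then show ?thesis by auto
qed

lemma square_fourier_L2:
  assumes t: "0 < t" "t \<le> b"
  shows "L2_fourier (entry (matrix_square (R t)) i j) (square_fourier (R t) i j)"
  unfolding square_fourier_def
proof (rule L2_fourier_fourier_integral[OF integrable_entry_matrix_square])
  obtain B where B: "AE x in lborel. \<forall>i j. norm (entry (rep_L2 (R t)) i j x) \<le> B" using R_bounded[OF t] by blast
  have "square_integrable (\<lambda>x. B * norm (entry (rep_L2 (R t)) m j x))" for m
    using square_integrable_entry_rep[of "R t" m j] by (auto simp: square_integrable_def power_mult_distrib)
  then have "square_integrable (\<lambda>x. entry (rep_L2 (R t)) i m x * entry (rep_L2 (R t)) m j x)" for m
  proof (rule square_integrable_le(1))
    show "AE x in lborel. norm (entry (rep_L2 (R t)) i m x * entry (rep_L2 (R t)) m j x) \<le> norm (B * norm (entry (rep_L2 (R t)) m j x))"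
      using B
    proof eventually_elim
      case (elim x)
      have "norm (entry (rep_L2 (R t)) i m x) \<le> \<bar>B\<bar>" using elim order_trans[OF _ abs_ge_self] by blast
      from mult_right_mono[OF this norm_ge_zero[of "entry (rep_L2 (R t)) m j x"]]
      show ?case by (simp add: norm_mult abs_mult)
    qed
  qed measurable
  then have s: "square_integrable (\<lambda>x. entry (rep_L2 (R t)) i m x * entry (rep_L2 (R t)) m j x)" for m .
  have "entry (matrix_square (R t)) i j = (\<lambda>x. (entry (rep_L2 (R t)) i 1 x * entry (rep_L2 (R t)) 1 j x
      + entry (rep_L2 (R t)) i 2 x * entry (rep_L2 (R t)) 2 j x) + entry (rep_L2 (R t)) i 3 x * entry (rep_L2 (R t)) 3 j x)"
    by (rule ext) (simp only: entry_matrix_square sum_3)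
  then show "square_integrable (entry (matrix_square (R t)) i j)" by (simp only:) (intro square_integrable_add s)
qed

lemma trace_cube_AE:
  "AE x in lborel. trace (rep_L2 (R t) x ** rep_L2 (R t) x ** rep_L2 (R t) x)
    = (\<Sum>i\<in>UNIV. \<Sum>j\<in>UNIV. entry (rep_L2 (R t)) i j x \<bullet> entry (matrix_square (R t)) i j x)"
  using L2_st_symmetric_trace_free[OF st[of t]]
proof eventually_elim
  case (elim x)
  then show ?case by (subst trace_cube_symmetric) (auto simp: entry_def inner_complex_def matrix_square_def)
qed

text \<open>Symmetry turns the trace of the cube into the inner product of the field with its
  square; both are in L2, so Parseval moves it to the frequency side.\<close>

lemma
  assumes t: "0 < t" "t \<le> b"
  shows trace_cube_integrable: "integrable lborel (\<lambda>x. trace (rep_L2 (R t) x ** rep_L2 (R t) x ** rep_L2 (R t) x))"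
    and trace_cube_integral: "(\<integral>x. trace (rep_L2 (R t) x ** rep_L2 (R t) x ** rep_L2 (R t) x) \<partial>lborel)
      = (\<Sum>i\<in>UNIV. \<Sum>j\<in>UNIV. \<integral>\<xi>. A i j t \<xi> \<bullet> square_fourier (R t) i j \<xi> \<partial>lborel)"
proof -
  have i: "integrable lborel (\<lambda>x. entry (rep_L2 (R t)) i j x \<bullet> entry (matrix_square (R t)) i j x)" for i j
    by (intro square_integrable_inner square_integrable_entry_rep L2_fourierD(1)[OF square_fourier_L2[OF t]])
  have [measurable]: "entry (matrix_square (R t)) i j \<in> borel_measurable borel" for i j
    by (rule entry_measurable) measurable
  show "integrable lborel (\<lambda>x. trace (rep_L2 (R t) x ** rep_L2 (R t) x ** rep_L2 (R t) x))"
    by (subst integrable_cong_AE[OF _ _ trace_cube_AE])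
       (auto intro!: Bochner_Integration.integrable_sum i)
  have "(\<integral>x. trace (rep_L2 (R t) x ** rep_L2 (R t) x ** rep_L2 (R t) x) \<partial>lborel)
    = (\<integral>x. (\<Sum>i\<in>UNIV. \<Sum>j\<in>UNIV. entry (rep_L2 (R t)) i j x \<bullet> entry (matrix_square (R t)) i j x) \<partial>lborel)"
    by (rule integral_cong_AE[OF _ _ trace_cube_AE]) measurable
  also have "\<dots> = (\<Sum>i\<in>UNIV. \<Sum>j\<in>UNIV. \<integral>x. entry (rep_L2 (R t)) i j x \<bullet> entry (matrix_square (R t)) i j x \<partial>lborel)"
    using i by (simp add: Bochner_Integration.integral_sum Bochner_Integration.integrable_sum)
  also have "\<dots> = (\<Sum>i\<in>UNIV. \<Sum>j\<in>UNIV. \<integral>\<xi>. A i j t \<xi> \<bullet> square_fourier (R t) i j \<xi> \<partial>lborel)"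
    by (intro sum.cong refl parseval[OF matrix_fourierD[OF A_fourier[OF t]] square_fourier_L2[OF t]])
  finally show "(\<integral>x. trace (rep_L2 (R t) x ** rep_L2 (R t) x ** rep_L2 (R t) x) \<partial>lborel)
      = (\<Sum>i\<in>UNIV. \<Sum>j\<in>UNIV. \<integral>\<xi>. A i j t \<xi> \<bullet> square_fourier (R t) i j \<xi> \<partial>lborel)" .
qed

lemma weighted_A_square_integrable:
  assumes t: "0 < t" "t \<le> b" shows "square_integrable (\<lambda>\<xi>. norm \<xi> *\<^sub>R A i j t \<xi>)"
proof -
  obtain h where "integrable lborel h" and h2: "square_integrable (\<lambda>\<xi>. norm \<xi> * h \<xi>)"
    and hA: "\<And>s i j \<xi>. t \<le> s \<Longrightarrow> s \<le> b \<Longrightarrow> norm (A i j s \<xi>) \<le> h \<xi>"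
    using uniform_majorant[OF t] by blast
  show ?thesis
  proof (rule square_integrable_le(1)[OF h2])
    have "norm (norm \<xi> *\<^sub>R A i j t \<xi>) \<le> norm (norm \<xi> * h \<xi>)" for \<xi>
      using mult_left_mono[OF order_trans[OF hA abs_ge_self], of t "norm \<xi>" i j \<xi>] t by (simp add: abs_mult)
    then show "AE \<xi> in lborel. norm (norm \<xi> *\<^sub>R A i j t \<xi>) \<le> norm (norm \<xi> * h \<xi>)" by simp
  qed measurable
qed

theorem energy_identity:
  assumes t: "0 < t" "t < b"
  shows "rep_L2 (R t) \<in> Hdot 1"
    and "integrable lborel (\<lambda>x. trace (rep_L2 (R t) x ** rep_L2 (R t) x ** rep_L2 (R t) x))"
    and "((\<lambda>s. (norm (R s))\<^sup>2) has_real_derivative - 2 * (Hdot_norm 1 (rep_L2 (R t)))\<^sup>2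
       - 4 / 3 * (\<integral>x. trace (rep_L2 (R t) x ** rep_L2 (R t) x ** rep_L2 (R t) x) \<partial>lborel)) (at t)"
proof -
  have t': "0 < t" "t \<le> b" using t by auto
  note F = matrix_fourierD[OF A_fourier[OF t']] and W = weighted_A_square_integrable[OF t']
  show "rep_L2 (R t) \<in> Hdot 1" by (rule Hdot_entryI[OF F W])
  show "integrable lborel (\<lambda>x. trace (rep_L2 (R t) x ** rep_L2 (R t) x ** rep_L2 (R t) x))"
    by (rule trace_cube_integrable[OF t'])
  let ?H = "\<lambda>i j \<xi>. 4 * pi\<^sup>2 * (norm \<xi>)\<^sup>2 * (norm (A i j t \<xi>))\<^sup>2"
  let ?Q = "\<lambda>i j \<xi>. A i j t \<xi> \<bullet> square_fourier (R t) i j \<xi>"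
  have Hi: "integrable lborel (?H i j)" for i j
  proof -
    have "integrable lborel (\<lambda>\<xi>. 4 * pi\<^sup>2 * (norm (norm \<xi> *\<^sub>R A i j t \<xi>))\<^sup>2)"
      using W[of i j] by (intro integrable_mult_right) (simp add: square_integrable_def)
    then show ?thesis by (simp add: power_mult_distrib mult.assoc)
  qed
  have Qi: "integrable lborel (?Q i j)" for i j
    by (intro square_integrable_inner L2_fourierD(2)[OF F] L2_fourierD(2)[OF square_fourier_L2[OF t']])
  have [measurable]: "square_fourier (R t) i j \<in> borel_measurable borel" for i j
    by (rule square_integrable_borel[OF L2_fourierD(2)[OF square_fourier_L2[OF t']]])
  have [measurable]: "N i j t \<in> borel_measurable borel" for i j
    using measurable_compose[OF _ N_joint_measurable, of "\<lambda>\<xi>. (t, \<xi>)" borel i j] by simp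
  have "(\<integral>\<xi>. (\<Sum>i\<in>UNIV. \<Sum>j\<in>UNIV. - 2 * ?H i j \<xi> - 4 / 3 * (A i j t \<xi> \<bullet> N i j t \<xi>)) \<partial>lborel)
    = (\<integral>\<xi>. (\<Sum>i\<in>UNIV. \<Sum>j\<in>UNIV. - 2 * ?H i j \<xi> - 4 / 3 * ?Q i j \<xi>) \<partial>lborel)"
  proof (rule integral_cong_AE)
    show "AE \<xi> in lborel. (\<Sum>i\<in>UNIV. \<Sum>j\<in>UNIV. - 2 * ?H i j \<xi> - 4 / 3 * (A i j t \<xi> \<bullet> N i j t \<xi>))
      = (\<Sum>i\<in>UNIV. \<Sum>j\<in>UNIV. - 2 * ?H i j \<xi> - 4 / 3 * ?Q i j \<xi>)"
      using L2_st_symbol[OF st A_fourier[OF t']]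
    proof eventually_elim
      case (elim \<xi>)
      then obtain v where v: "\<And>i j. A i j t \<xi> = pi * \<i> * (of_real (\<xi> $ i) * v j + of_real (\<xi> $ j) * v i)"
        and v0: "(\<Sum>i\<in>UNIV. of_real (\<xi> $ i) * v i) = 0" by blast
      \<comment> \<open>The factor \<open>pi * \<i>\<close> of the symbol is the free constant
        \<open>c\<close> of \<open>st_proj_orthogonal\<close>.\<close>
      have "(\<Sum>i\<in>UNIV. \<Sum>j\<in>UNIV. (square_fourier (R t) i j \<xi> - N i j t \<xi>) \<bullet> A i j t \<xi>) = 0"
        unfolding N_def v by (rule st_proj_orthogonal[OF square_fourier_symmetric[OF st] v0])
      then have "(\<Sum>i\<in>UNIV. \<Sum>j\<in>UNIV. A i j t \<xi> \<bullet> N i j t \<xi>) = (\<Sum>i\<in>UNIV. \<Sum>j\<in>UNIV. ?Q i j \<xi>)"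
        by (simp add: inner_diff_left sum_subtractf inner_commute[of "A i j t \<xi>" for i j])
      then show ?case by (simp only: sum_subtractf sum_distrib_left[symmetric])
    qed
  qed measurable
  also have "\<dots> = (\<Sum>i\<in>UNIV. \<Sum>j\<in>UNIV. \<integral>\<xi>. - 2 * ?H i j \<xi> - 4 / 3 * ?Q i j \<xi> \<partial>lborel)"
    using Hi Qi by (subst Bochner_Integration.integral_sum,
      fastforce intro!: Bochner_Integration.integrable_sum Bochner_Integration.integrable_diff integrable_mult_right)
      (intro sum.cong refl Bochner_Integration.integral_sum Bochner_Integration.integrable_diff integrable_mult_right)
  also have "\<dots> = (\<Sum>i\<in>UNIV. \<Sum>j\<in>UNIV. - 2 * (\<integral>\<xi>. ?H i j \<xi> \<partial>lborel) - 4 / 3 * (\<integral>\<xi>. ?Q i j \<xi> \<partial>lborel))"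
    by (intro sum.cong refl)
       (simp only: Bochner_Integration.integral_diff[OF integrable_mult_right[OF Hi] integrable_mult_right[OF Qi]] integral_mult_right_zero)
  also have "\<dots> = - 2 * (Hdot_norm 1 (rep_L2 (R t)))\<^sup>2
       - 4 / 3 * (\<integral>x. trace (rep_L2 (R t) x ** rep_L2 (R t) x ** rep_L2 (R t) x) \<partial>lborel)"
    unfolding Hdot_norm_entry[OF F W] trace_cube_integral[OF t'] by (simp only: sum_subtractf sum_distrib_left)
  finally show "((\<lambda>s. (norm (R s))\<^sup>2) has_real_derivative - 2 * (Hdot_norm 1 (rep_L2 (R t)))\<^sup>2
       - 4 / 3 * (\<integral>x. trace (rep_L2 (R t) x ** rep_L2 (R t) x ** rep_L2 (R t) x) \<partial>lborel)) (at t)"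
    using energy_derivative[OF t] by (simp only: has_real_derivative_iff_has_vector_derivative)
qed

end

theorem proposition4p3:
  fixes S :: "real \<Rightarrow> (real^3^3) L2" and Tmax :: ereal
  assumes "mild_solution Tmax S"
    and "Tmax = max_existence_time (S 0)"
  shows "\<forall>t. 0 < t \<and> ereal t < Tmax \<longrightarrow>
    rep_L2 (S t) \<in> Hdot 1 \<and>
    integrable lborel (\<lambda>x. trace (rep_L2 (S t) x ** rep_L2 (S t) x ** rep_L2 (S t) x)) \<and>
    integrable lborel (\<lambda>x. det (rep_L2 (S t) x)) \<and>
    ((\<lambda>s. (norm (S s))\<^sup>2) has_real_derivative
       - 2 * (Hdot_norm 1 (rep_L2 (S t)))\<^sup>2
       - 4 / 3 * (\<integral>x. trace (rep_L2 (S t) x ** rep_L2 (S t) x ** rep_L2 (S t) x) \<partial>lborel)) (at t) \<and>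
    - 2 * (Hdot_norm 1 (rep_L2 (S t)))\<^sup>2
       - 4 / 3 * (\<integral>x. trace (rep_L2 (S t) x ** rep_L2 (S t) x ** rep_L2 (S t) x) \<partial>lborel)
    = - 2 * (Hdot_norm 1 (rep_L2 (S t)))\<^sup>2 - 4 * (\<integral>x. det (rep_L2 (S t) x) \<partial>lborel)"
proof (intro allI impI)
  fix t assume t: "0 < t \<and> ereal t < Tmax"
  \<comment> \<open>A time strictly between \<open>t\<close> and \<open>Tmax\<close> makes
    \<open>t\<close> interior to a compact interval, on which the continuous \<open>S\<close> is
    bounded.\<close>
  then obtain b' where b': "ereal t < b'" "b' < Tmax" using dense[of "ereal t" Tmax] by auto
  then obtain b where b: "t < b" "ereal b < Tmax" by (cases b') auto
  have b0: "0 < b" using b t by simp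
  \<comment> \<open>Clamping the time to \<open>[0, b]\<close> extends \<open>S\<close> by constants
    and provides the global hypotheses of \<open>mild_flow\<close>.\<close>
  define R where "R r = S (max 0 (min b r))" for r
  have RS: "R r = S r" if "0 \<le> r" "r \<le> b" for r using that by (simp add: R_def)
  have below: "ereal r < Tmax" if "r \<le> b" for r
    using that b(2) by (meson ereal_less_eq(3) le_less_trans)
  have S_cont: "continuous_on {0..b} S"
    using assms(1) unfolding mild_solution_def
    by (auto elim!: continuous_on_subset intro: below)
  have cont: "continuous_on UNIV R"
    unfolding R_def using b0
    by (intro continuous_on_compose2[OF S_cont] continuous_intros) auto
  have "bounded (S ` {0..b})"
    by (intro compact_imp_bounded compact_continuous_image S_cont) simp
  then obtain K where "\<forall>F\<in>S ` {0..b}. norm F \<le> K" unfolding bounded_iff by blast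
  then have K: "norm (S s) \<le> K" if "s \<in> {0..b}" for s using that by blast
  obtain A0 where A0: "matrix_fourier (R 0) A0" using matrix_fourier_exists by blast
  have st: "R r \<in> L2_st" for r
    using assms(1) b0 below[of "max 0 (min b r)"] by (auto simp: mild_solution_def R_def)
  have duhamel: "(\<lambda>\<tau>. P_st (heat \<tau> (matrix_square (R (u - \<tau>))))) integrable_on {0..u} \<and>
      R u = heat u (rep_L2 (R 0)) - (2 / 3) *\<^sub>R integral {0..u} (\<lambda>\<tau>. P_st (heat \<tau> (matrix_square (R (u - \<tau>)))))"
    if u: "0 < u" "u \<le> b" for u
  proof -
    \<comment> \<open>The Duhamel integrand looks only at times \<open>u - \<tau>\<close> inside
      \<open>[0, b]\<close>, where \<open>R\<close> and \<open>S\<close> agree.\<close>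
    have eq: "P_st (heat \<tau> (matrix_square (S (u - \<tau>)))) = P_st (heat \<tau> (matrix_square (R (u - \<tau>))))"
      if "\<tau> \<in> {0..u}" for \<tau>
      using that u by (simp add: RS)
    have "(\<lambda>\<tau>. P_st (heat \<tau> (matrix_square (S (u - \<tau>))))) integrable_on {0..u} \<and>
        S u = heat u (rep_L2 (S 0)) - (2 / 3) *\<^sub>R integral {0..u} (\<lambda>\<tau>. P_st (heat \<tau> (matrix_square (S (u - \<tau>)))))"
      using assms(1) u below[OF u(2)] unfolding mild_solution_def by blast
    moreover have "(\<lambda>\<tau>. P_st (heat \<tau> (matrix_square (S (u - \<tau>))))) integrable_on {0..u}
        \<longleftrightarrow> (\<lambda>\<tau>. P_st (heat \<tau> (matrix_square (R (u - \<tau>))))) integrable_on {0..u}"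
      by (rule integrable_cong) (rule eq)
    moreover have "integral {0..u} (\<lambda>\<tau>. P_st (heat \<tau> (matrix_square (S (u - \<tau>)))))
        = integral {0..u} (\<lambda>\<tau>. P_st (heat \<tau> (matrix_square (R (u - \<tau>)))))"
      by (rule Henstock_Kurzweil_Integration.integral_cong) (rule eq)
    ultimately show ?thesis using u b0 by (simp add: RS)
  qed
  have tb: "0 < t" "t < b" using t b by auto
  interpret mild_flow R b K A0
    using b0 cont st duhamel A0 K by unfold_locales (auto simp: R_def)
  note E = energy_identity[OF tb]
  have Rt: "R t = S t" using tb by (simp add: RS)
  let ?T = "\<lambda>x. trace (rep_L2 (S t) x ** rep_L2 (S t) x ** rep_L2 (S t) x)"
  let ?D = "\<lambda>x. det (rep_L2 (S t) x)"
  have ae: "AE x in lborel. ?D x = ?T x / 3"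
    using L2_st_symmetric_trace_free[OF st[of t]] unfolding Rt
    by eventually_elim (simp add: trace_cube_eq_det)
  have Ti: "integrable lborel ?T" using E(2) by (simp add: Rt)
  have Di: "integrable lborel ?D"
    by (subst integrable_cong_AE[OF _ _ ae]) (use Ti in simp_all)
  have "(\<integral>x. ?D x \<partial>lborel) = (\<integral>x. ?T x / 3 \<partial>lborel)"
    by (rule integral_cong_AE[OF _ _ ae]) simp_all
  then have TD: "4 / 3 * (\<integral>x. ?T x \<partial>lborel) = 4 * (\<integral>x. ?D x \<partial>lborel)" by simp
  have "((\<lambda>s. (norm (S s))\<^sup>2) has_real_derivative
      - 2 * (Hdot_norm 1 (rep_L2 (S t)))\<^sup>2 - 4 / 3 * (\<integral>x. ?T x \<partial>lborel)) (at t)"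
    using E(3) unfolding Rt
    by (rule has_field_derivative_transform_within_open[of _ _ _ "{0<..<b}"]) (use tb in \<open>auto simp: RS\<close>)
  then show "rep_L2 (S t) \<in> Hdot 1 \<and> integrable lborel ?T \<and> integrable lborel ?D \<and>
    ((\<lambda>s. (norm (S s))\<^sup>2) has_real_derivative
       - 2 * (Hdot_norm 1 (rep_L2 (S t)))\<^sup>2 - 4 / 3 * (\<integral>x. ?T x \<partial>lborel)) (at t) \<and>
    - 2 * (Hdot_norm 1 (rep_L2 (S t)))\<^sup>2 - 4 / 3 * (\<integral>x. ?T x \<partial>lborel)
    = - 2 * (Hdot_norm 1 (rep_L2 (S t)))\<^sup>2 - 4 * (\<integral>x. ?D x \<partial>lborel)"
    using E(1) Ti Di TD by (simp only: Rt)
qed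

end
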